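(* Let $R$ be a commutative Noetherian ring, $M$ an $R$-module and $I$ an ideal of $R$ with $IM\neq M$ and $\operatorname{grade}(I,M)=c$. Let $C^\cdot_M(I)$ be the truncation complex of $M$ with respect to $I$. Then for any $R$-module $N$: (i) There are natural homomorphisms $H^i_I(N,H^c_I(M))\to H^{i+c}_I(N, M)$ for all $i\in\mathbb{Z}$. Moreover these are isomorphisms for all $i\in\mathbb{Z}$ if and only if $H^i_I(N,C^{\cdot}_M(I))= 0$ for all $i\in\mathbb{Z}$. (ii) Suppose that $R$ is local. Then there are natural homomorphisms $H^i_{I}(N,D(M))\to H^{i+c}_{I}(N,D(H^c_I(M)))$ for all $i\in\mathbb{Z}$. Moreover these are isomorphisms (for all $i\in\mathbb{Z}$) if and only if $H^i_{I}(N,D(C^{\cdot}_M(I)))=0$ for all $i\in\mathbb{Z}$.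
   Context: - $H^i_I(X)$ is ordinary local cohomology. For an $R$-module or complex of $R$-modules $X$, $H^i_I(N,X)=\varinjlim_s\operatorname{Ext}^i_R(N/I^sN,X)$, where for a complex $X$, $\operatorname{Ext}^i_R(N/I^sN,X)=H^i(\operatorname{Hom}_R(F_\cdot(N/I^sN),X))$ with $F_\cdot(N/I^sN)$ a free resolution of $N/I^sN$ (hyper-Ext). - For $IM\ne M$, $\operatorname{grade}(I,M)=\inf\{i\in\mathbb{Z}: H^i_I(M)\neq 0\}$. - If $R$ is local with residue field $k$, $D(\cdot)=\operatorname{Hom}_R(\cdot,E_R(k))$ is the Matlis dual functor. - Truncation complex: let $E^\cdot$ be a minimal injective resolution of $M$. Since $\Gamma_I(E^\cdot)^i=0$ for $i<c$, there is an embedding of complexes $H^c_I(M)[-c]\to\Gamma_I(E^\cdot)$ ($H^c_I(M)$ in cohomological degree $c$), and $C^\cdot_M(I)$ is its cokernel. Meaning of "natural homomorphisms". The map in (i) is the direct limit over $s$ of $\operatorname{Ext}^{i}_R(N/I^sN,H^c_I(M))\to \operatorname{Ext}^{i+c}_R(N/I^sN,\Gamma_I(E^\cdot))\cong\operatorname{Ext}^{i+c}_R(N/I^sN,M)$, induced by the embedding and by the inclusion $\Gamma_I(E^\cdot)\subseteq E^\cdot$. The map in (ii) is the direct limit over $s$ of $\operatorname{Ext}^i_R(N/I^sN,D(M))\cong\operatorname{Ext}^i_R(N/I^sN,D(\Gamma_I(E^\cdot)))\to\operatorname{Ext}^{i+c}_R(N/I^sN,D(H^c_I(M)))$, where the isomorphism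 is induced by $M\to E^\cdot\leftarrow\Gamma_I(E^\cdot)$ and the second map by the Matlis dual $D(\Gamma_I(E^\cdot))\to D(H^c_I(M))[c]$ of the embedding. *)

theory Defs
  imports
    "HOL-Algebra.Module"
    "HOL-Algebra.QuotRing"
    "HOL-Algebra.Ideal_Product"
    "HOL-Algebra.Ring_Divisibility"
    "HOL-Library.Extended_Real"
begin

section \<open>Modules\<close>

text \<open>The \<open>mult\<close> and \<open>one\<close> fields of a module record play no role.\<close>

definition mk_module ::
    "'a set \<Rightarrow> 'a \<Rightarrow> ('a \<Rightarrow> 'a \<Rightarrow> 'a) \<Rightarrow> ('r \<Rightarrow> 'a \<Rightarrow> 'a) \<Rightarrow> ('r, 'a) module" where
  "mk_module C z a s =
     \<lparr>carrier = C, monoid.mult = undefined, one = undefined, zero = z, add = a, smult = s\<rparr>"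

lemma mk_module_simps [simp]:
  "carrier (mk_module C z a s) = C"
  "\<zero>\<^bsub>mk_module C z a s\<^esub> = z"
  "x \<oplus>\<^bsub>mk_module C z a s\<^esub> y = a x y"
  "r \<odot>\<^bsub>mk_module C z a s\<^esub> x = s r x"
  by (simp_all add: mk_module_def)

definition ring_module :: "('r, 'q) ring_scheme \<Rightarrow> ('r, 'r) module" where
  "ring_module R = mk_module (carrier R) \<zero>\<^bsub>R\<^esub> (\<lambda>x y. x \<oplus>\<^bsub>R\<^esub> y) (\<lambda>x y. x \<otimes>\<^bsub>R\<^esub> y)"

definition sub_module :: "('r, 'a) module \<Rightarrow> 'a set \<Rightarrow> ('r, 'a) module" where
  "sub_module A K = A\<lparr>carrier := K\<rparr>"

text \<open>For \<open>r\<close> in the ring and a coset \<open>S = K + x\<close>, the union below is the single coset \<open>K + rx\<close>;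
  it avoids choosing a representative.  The same device is used for all maps out of quotients
  and direct limits.\<close>

definition quot_module :: "('r, 'a) module \<Rightarrow> 'a set \<Rightarrow> ('r, 'a set) module" where
  "quot_module A K =
     mk_module (a_rcosets\<^bsub>A\<^esub> K) K (\<lambda>S T. S <+>\<^bsub>A\<^esub> T) (\<lambda>r S. \<Union>x\<in>S. K +>\<^bsub>A\<^esub> (r \<odot>\<^bsub>A\<^esub> x))"

definition zero_module :: "('r, 'a) module \<Rightarrow> bool" where
  "zero_module A \<longleftrightarrow> carrier A = {\<zero>\<^bsub>A\<^esub>}"

definition mod_hom ::
    "('r, 'q) ring_scheme \<Rightarrow> ('r, 'a) module \<Rightarrow> ('r, 'b) module \<Rightarrow> ('a \<Rightarrow> 'b) set" where
  "mod_hom R A B = {f \<in> carrier A \<rightarrow> carrier B.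
     (\<forall>x\<in>carrier A. \<forall>y\<in>carrier A. f (x \<oplus>\<^bsub>A\<^esub> y) = f x \<oplus>\<^bsub>B\<^esub> f y) \<and>
     (\<forall>r\<in>carrier R. \<forall>x\<in>carrier A. f (r \<odot>\<^bsub>A\<^esub> x) = r \<odot>\<^bsub>B\<^esub> f x)}"

definition mod_iso ::
    "('r, 'q) ring_scheme \<Rightarrow> ('r, 'a) module \<Rightarrow> ('r, 'b) module \<Rightarrow> ('a \<Rightarrow> 'b) set" where
  "mod_iso R A B = {f \<in> mod_hom R A B. bij_betw f (carrier A) (carrier B)}"

text \<open>Homomorphisms are made extensional, so that equality in the module \<open>Hom R A B\<close> is equality
  on the carrier of \<open>A\<close>.\<close>

definition Hom ::
    "('r, 'q) ring_scheme \<Rightarrow> ('r, 'a) module \<Rightarrow> ('r, 'b) module \<Rightarrow> ('r, 'a \<Rightarrow> 'b) module" where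
  "Hom R A B = mk_module
     (mod_hom R A B \<inter> extensional (carrier A))
     (\<lambda>x\<in>carrier A. \<zero>\<^bsub>B\<^esub>)
     (\<lambda>f g. \<lambda>x\<in>carrier A. f x \<oplus>\<^bsub>B\<^esub> g x)
     (\<lambda>r f. \<lambda>x\<in>carrier A. r \<odot>\<^bsub>B\<^esub> f x)"

definition ideal_smult ::
    "('r, 'q) ring_scheme \<Rightarrow> 'r set \<Rightarrow> ('r, 'a) module \<Rightarrow> 'a set" where
  "ideal_smult R J A =
     \<Inter>{K. submodule K R A \<and> (\<forall>a\<in>J. \<forall>x\<in>carrier A. a \<odot>\<^bsub>A\<^esub> x \<in> K)}"

abbreviation ideal_power :: "('r, 'q) ring_scheme \<Rightarrow> 'r set \<Rightarrow> nat \<Rightarrow> 'r set" where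
  "ideal_power R I s \<equiv> I [^]\<^bsub>ideals_set R\<^esub> s"

definition essential :: "('r, 'q) ring_scheme \<Rightarrow> 'a set \<Rightarrow> ('r, 'a) module \<Rightarrow> bool" where
  "essential R K A \<longleftrightarrow> submodule K R A \<and>
     (\<forall>L. submodule L R A \<and> L \<noteq> {\<zero>\<^bsub>A\<^esub>} \<longrightarrow> L \<inter> K \<noteq> {\<zero>\<^bsub>A\<^esub>})"

text \<open>Types cannot be quantified inside a definition, so the test modules \<open>B\<close> range over the modules
  whose elements have the type of the ring elements.  Since these include the ring itself, this is
  no restriction: lemma \<open>injective_module_extend\<close> below gives the extension
  property for test modules over every type.\<close>

definition injective_module :: "('r, 'q) ring_scheme \<Rightarrow> ('r, 'a) module \<Rightarrow> bool" where
  "injective_module R A \<longleftrightarrow> module R A \<and>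
     (\<forall>(B :: ('r, 'r) module) K f.
        module R B \<and> submodule K R B \<and> f \<in> mod_hom R (sub_module B K) A \<longrightarrow>
        (\<exists>g \<in> mod_hom R B A. \<forall>x\<in>K. g x = f x))"

definition injective_hull ::
    "('r, 'q) ring_scheme \<Rightarrow> ('r, 'b) module \<Rightarrow> ('b \<Rightarrow> 'a) \<Rightarrow> ('r, 'a) module \<Rightarrow> bool" where
  "injective_hull R B j A \<longleftrightarrow>
     injective_module R A \<and> j \<in> mod_hom R B A \<and> inj_on j (carrier B) \<and>
     essential R (j ` carrier B) A"

definition local_ring :: "('r, 'q) ring_scheme \<Rightarrow> bool" where
  "local_ring R \<longleftrightarrow> cring R \<and> (\<exists>!\<mm>. maximalideal \<mm> R)"

definition residue_field :: "('r, 'q) ring_scheme \<Rightarrow> ('r, 'r set) module" where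
  "residue_field R = quot_module (ring_module R) (THE \<mm>. maximalideal \<mm> R)"


section \<open>Cochain complexes\<close>

record ('r, 'a) cpx =
  obj :: "int \<Rightarrow> ('r, 'a) module"
  dif :: "int \<Rightarrow> 'a \<Rightarrow> 'a"

definition cochain_complex :: "('r, 'q) ring_scheme \<Rightarrow> ('r, 'a) cpx \<Rightarrow> bool" where
  "cochain_complex R X \<longleftrightarrow> (\<forall>j. module R (obj X j)) \<and>
     (\<forall>j. dif X j \<in> mod_hom R (obj X j) (obj X (j + 1))) \<and>
     (\<forall>j. \<forall>x\<in>carrier (obj X j). dif X (j + 1) (dif X j x) = \<zero>\<^bsub>obj X (j + 2)\<^esub>)"

definition cocycles :: "('r, 'a) cpx \<Rightarrow> int \<Rightarrow> 'a set" where
  "cocycles X j = {x \<in> carrier (obj X j). dif X j x = \<zero>\<^bsub>obj X (j + 1)\<^esub>}"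

definition coboundaries :: "('r, 'a) cpx \<Rightarrow> int \<Rightarrow> 'a set" where
  "coboundaries X j = dif X (j - 1) ` carrier (obj X (j - 1))"

definition cohomology :: "('r, 'a) cpx \<Rightarrow> int \<Rightarrow> ('r, 'a set) module" where
  "cohomology X j = quot_module (sub_module (obj X j) (cocycles X j)) (coboundaries X j)"

text \<open>The map on cohomology in degree \<open>j\<close> induced by the degree-\<open>j\<close> component \<open>v\<close> of a morphism
  into \<open>Y\<close>: it sends the class of \<open>x\<close> to the class of \<open>v x\<close>.\<close>

definition cohomology_map :: "('r, 'b) cpx \<Rightarrow> int \<Rightarrow> ('a \<Rightarrow> 'b) \<Rightarrow> 'a set \<Rightarrow> 'b set" where
  "cohomology_map Y j v S = (\<Union>x\<in>S. coboundaries Y j +>\<^bsub>obj Y j\<^esub> v x)"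

text \<open>\<open>single c A\<close> is the module \<open>A\<close> placed in cohomological degree \<open>c\<close>, that is \<open>A[-c]\<close>.\<close>

definition single :: "int \<Rightarrow> ('r, 'a) module \<Rightarrow> ('r, 'a) cpx" where
  "single c A = \<lparr>obj = (\<lambda>j. if j = c then A else sub_module A {\<zero>\<^bsub>A\<^esub>}), dif = (\<lambda>j x. \<zero>\<^bsub>A\<^esub>)\<rparr>"

text \<open>The morphism of complexes into \<open>Y\<close> that is \<open>g\<close> in degree \<open>c\<close> and zero in all other degrees.\<close>

definition single_map :: "int \<Rightarrow> ('a \<Rightarrow> 'b) \<Rightarrow> ('r, 'b) cpx \<Rightarrow> int \<Rightarrow> 'a \<Rightarrow> 'b" where
  "single_map c g Y j x = (if j = c then g x else \<zero>\<^bsub>obj Y j\<^esub>)"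

text \<open>The cokernel of a morphism \<open>u\<close> from \<open>X\<close> to \<open>Y\<close>.\<close>

definition coker_complex ::
    "('r, 'a) cpx \<Rightarrow> ('r, 'b) cpx \<Rightarrow> (int \<Rightarrow> 'a \<Rightarrow> 'b) \<Rightarrow> ('r, 'b set) cpx" where
  "coker_complex X Y u =
     \<lparr>obj = (\<lambda>j. quot_module (obj Y j) (u j ` carrier (obj X j))),
      dif = (\<lambda>j S. \<Union>y\<in>S. (u (j + 1) ` carrier (obj X (j + 1))) +>\<^bsub>obj Y (j + 1)\<^esub> dif Y j y)\<rparr>"

text \<open>The total Hom complex: in degree \<open>n\<close> the product over all \<open>p\<close> of \<open>Hom(A\<^sup>p, X\<^sup>p\<^sup>+\<^sup>n)\<close>, with
  differential \<open>f \<mapsto> d\<^sub>X f - (-1)\<^sup>n f d\<^sub>A\<close>.\<close>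

definition Hom_complex ::
    "('r, 'q) ring_scheme \<Rightarrow> ('r, 'a) cpx \<Rightarrow> ('r, 'b) cpx \<Rightarrow> ('r, int \<Rightarrow> 'a \<Rightarrow> 'b) cpx" where
  "Hom_complex R A X =
     (let H = (\<lambda>n p. Hom R (obj A p) (obj X (p + n))) in
      \<lparr>obj = (\<lambda>n. mk_module
         {f. \<forall>p. f p \<in> carrier (H n p)}
         (\<lambda>p. \<zero>\<^bsub>H n p\<^esub>)
         (\<lambda>f g p. f p \<oplus>\<^bsub>H n p\<^esub> g p)
         (\<lambda>r f p. r \<odot>\<^bsub>H n p\<^esub> f p)),
       dif = (\<lambda>n f p. \<lambda>a\<in>carrier (obj A p).
         let y = dif X (p + n) (f p a); z = f (p + 1) (dif A p a); Y = obj X (p + n + 1)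
         in if even n then y \<ominus>\<^bsub>Y\<^esub> z else y \<oplus>\<^bsub>Y\<^esub> z)\<rparr>)"

text \<open>\<open>Hom(X, A)\<close> for a complex \<open>X\<close> and a module \<open>A\<close>, with \<open>Hom(X\<^sup>-\<^sup>j, A)\<close> in degree \<open>j\<close>; the
  differential is precomposition with that of \<open>X\<close> (no sign).\<close>

definition dual_complex ::
    "('r, 'q) ring_scheme \<Rightarrow> ('r, 'k) module \<Rightarrow> ('r, 'a) cpx \<Rightarrow> ('r, 'a \<Rightarrow> 'k) cpx" where
  "dual_complex R A X =
     \<lparr>obj = (\<lambda>j. Hom R (obj X (- j)) A),
      dif = (\<lambda>j f. compose (carrier (obj X (- j - 1))) f (dif X (- j - 1)))\<rparr>"

definition injective_resolution ::
    "('r, 'q) ring_scheme \<Rightarrow> ('r, 'm) module \<Rightarrow> ('m \<Rightarrow> 'e) \<Rightarrow> ('r, 'e) cpx \<Rightarrow> bool" where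
  "injective_resolution R M \<epsilon> E \<longleftrightarrow> cochain_complex R E \<and>
     (\<forall>j. injective_module R (obj E j)) \<and> (\<forall>j<0. zero_module (obj E j)) \<and>
     \<epsilon> \<in> mod_hom R M (obj E 0) \<and> inj_on \<epsilon> (carrier M) \<and>
     cocycles E 0 = \<epsilon> ` carrier M \<and> (\<forall>j>0. cocycles E j = coboundaries E j)"

text \<open>Minimality: each \<open>E\<^sup>j\<close> is an injective hull of the kernel of its differential.\<close>

definition minimal_injective_resolution ::
    "('r, 'q) ring_scheme \<Rightarrow> ('r, 'm) module \<Rightarrow> ('m \<Rightarrow> 'e) \<Rightarrow> ('r, 'e) cpx \<Rightarrow> bool" where
  "minimal_injective_resolution R M \<epsilon> E \<longleftrightarrow>
     injective_resolution R M \<epsilon> E \<and> (\<forall>j. essential R (cocycles E j) (obj E j))"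


section \<open>The standard free resolution\<close>

text \<open>Every \<open>R\<close>-module \<open>T\<close> has a standard free resolution \<open>F\<close>, functorial in \<open>T\<close>:  \<open>F\<^sub>0\<close> is free on the
  elements of \<open>T\<close>, and \<open>F\<^sub>p\<^sub>+\<^sub>1\<close> is free on the set of all formal linear combinations (lists of pairs of
  a basis element of \<open>F\<^sub>p\<close> and a coefficient) that are mapped to zero; see \<open>std_res_exact\<close> below for
  exactness.  The following type contains the basis elements of all \<open>F\<^sub>p\<close>.\<close>

datatype ('t, 'r) syz = Gen 't | Rel "(('t, 'r) syz \<times> 'r) list"

definition free_module :: "('r, 'q) ring_scheme \<Rightarrow> 'b set \<Rightarrow> ('r, 'b \<Rightarrow> 'r) module" where
  "free_module R B = mk_module
     {f. (\<forall>b. f b \<in> carrier R) \<and> finite {b. f b \<noteq> \<zero>\<^bsub>R\<^esub>} \<and> {b. f b \<noteq> \<zero>\<^bsub>R\<^esub>} \<subseteq> B}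
     (\<lambda>b. \<zero>\<^bsub>R\<^esub>) (\<lambda>f g b. f b \<oplus>\<^bsub>R\<^esub> g b) (\<lambda>r f b. r \<otimes>\<^bsub>R\<^esub> f b)"

fun formal_comb :: "('r, 'q) ring_scheme \<Rightarrow> ('b \<times> 'r) list \<Rightarrow> 'b \<Rightarrow> 'r" where
  "formal_comb R [] = (\<lambda>b. \<zero>\<^bsub>R\<^esub>)"
| "formal_comb R ((b', r) # l) =
     (\<lambda>b. if b = b' then r \<oplus>\<^bsub>R\<^esub> formal_comb R l b else formal_comb R l b)"

definition linear_ext ::
    "('r, 'q) ring_scheme \<Rightarrow> ('r, 'a) module \<Rightarrow> ('b \<Rightarrow> 'a) \<Rightarrow> ('b \<Rightarrow> 'r) \<Rightarrow> 'a" where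
  "linear_ext R A e f = (\<Oplus>\<^bsub>A\<^esub>b\<in>{b. f b \<noteq> \<zero>\<^bsub>R\<^esub>}. f b \<odot>\<^bsub>A\<^esub> e b)"

text \<open>The augmentation \<open>F\<^sub>0 \<rightarrow> T\<close> and the differentials \<open>F\<^sub>p\<^sub>+\<^sub>1 \<rightarrow> F\<^sub>p\<close>; the formula for the latter does not
  depend on \<open>p\<close>.\<close>

definition std_aug ::
    "('r, 'q) ring_scheme \<Rightarrow> ('r, 't) module \<Rightarrow> (('t, 'r) syz \<Rightarrow> 'r) \<Rightarrow> 't" where
  "std_aug R T = linear_ext R T (\<lambda>b. case b of Gen t \<Rightarrow> t | Rel l \<Rightarrow> \<zero>\<^bsub>T\<^esub>)"

definition std_bd ::
    "('r, 'q) ring_scheme \<Rightarrow> (('t, 'r) syz \<Rightarrow> 'r) \<Rightarrow> ('t, 'r) syz \<Rightarrow> 'r" where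
  "std_bd R = linear_ext R (free_module R UNIV)
     (\<lambda>b. case b of Gen t \<Rightarrow> (\<lambda>_. \<zero>\<^bsub>R\<^esub>) | Rel l \<Rightarrow> formal_comb R l)"

fun std_basis ::
    "('r, 'q) ring_scheme \<Rightarrow> ('r, 't) module \<Rightarrow> nat \<Rightarrow> ('t, 'r) syz set" where
  "std_basis R T 0 = Gen ` carrier T"
| "std_basis R T (Suc 0) =
     {Rel l | l. set l \<subseteq> std_basis R T 0 \<times> carrier R \<and> std_aug R T (formal_comb R l) = \<zero>\<^bsub>T\<^esub>}"
| "std_basis R T (Suc (Suc p)) =
     {Rel l | l. set l \<subseteq> std_basis R T (Suc p) \<times> carrier R \<and>
                 std_bd R (formal_comb R l) = (\<lambda>b. \<zero>\<^bsub>R\<^esub>)}"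

text \<open>Homological degree \<open>p\<close> becomes cohomological degree \<open>-p\<close>; the free module on the empty set sits
  in the positive degrees.\<close>

definition std_res ::
    "('r, 'q) ring_scheme \<Rightarrow> ('r, 't) module \<Rightarrow> ('r, ('t, 'r) syz \<Rightarrow> 'r) cpx" where
  "std_res R T =
     \<lparr>obj = (\<lambda>j. free_module R (if j \<le> 0 then std_basis R T (nat (- j)) else {})),
      dif = (\<lambda>j. if j < 0 then std_bd R else (\<lambda>f b. \<zero>\<^bsub>R\<^esub>))\<rparr>"

text \<open>The chain map of standard resolutions lifting a homomorphism \<open>g\<close>, namely the linear extension of
  the map on bases that applies \<open>g\<close> to all generators.\<close>

definition std_map ::
    "('r, 'q) ring_scheme \<Rightarrow> ('t \<Rightarrow> 'u) \<Rightarrow> (('t, 'r) syz \<Rightarrow> 'r) \<Rightarrow> (('u, 'r) syz \<Rightarrow> 'r)" where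
  "std_map R g = linear_ext R (free_module R UNIV) (\<lambda>b. formal_comb R [(map_syz g id b, \<one>\<^bsub>R\<^esub>)])"


section \<open>Ext and local cohomology\<close>

definition Ext ::
    "('r, 'q) ring_scheme \<Rightarrow> ('r, 't) module \<Rightarrow> ('r, 'x) cpx \<Rightarrow> int \<Rightarrow>
     ('r, (int \<Rightarrow> (('t, 'r) syz \<Rightarrow> 'r) \<Rightarrow> 'x) set) module" where
  "Ext R T X n = cohomology (Hom_complex R (std_res R T) X) n"

text \<open>\<open>Ext_map R T Y u n\<close> is \<open>Ext\<^sup>n(T, X) \<rightarrow> Ext\<^sup>n(T, Y)\<close> for a morphism of complexes \<open>u\<close> from \<open>X\<close> to \<open>Y\<close>, and
  \<open>Ext_comap R T X g n\<close> is \<open>Ext\<^sup>n(U, X) \<rightarrow> Ext\<^sup>n(T, X)\<close> for a homomorphism \<open>g\<close> from \<open>T\<close> to \<open>U\<close>.\<close>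

definition Ext_map ::
    "('r, 'q) ring_scheme \<Rightarrow> ('r, 't) module \<Rightarrow> ('r, 'y) cpx \<Rightarrow> (int \<Rightarrow> 'x \<Rightarrow> 'y) \<Rightarrow> int \<Rightarrow>
     (int \<Rightarrow> (('t, 'r) syz \<Rightarrow> 'r) \<Rightarrow> 'x) set \<Rightarrow> (int \<Rightarrow> (('t, 'r) syz \<Rightarrow> 'r) \<Rightarrow> 'y) set" where
  "Ext_map R T Y u n = cohomology_map (Hom_complex R (std_res R T) Y) n
     (\<lambda>f p. compose (carrier (obj (std_res R T) p)) (u (p + n)) (f p))"

definition Ext_comap ::
    "('r, 'q) ring_scheme \<Rightarrow> ('r, 't) module \<Rightarrow> ('r, 'x) cpx \<Rightarrow> ('t \<Rightarrow> 'u) \<Rightarrow> int \<Rightarrow>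
     (int \<Rightarrow> (('u, 'r) syz \<Rightarrow> 'r) \<Rightarrow> 'x) set \<Rightarrow> (int \<Rightarrow> (('t, 'r) syz \<Rightarrow> 'r) \<Rightarrow> 'x) set" where
  "Ext_comap R T X g n = cohomology_map (Hom_complex R (std_res R T) X) n
     (\<lambda>f p. compose (carrier (obj (std_res R T) p)) (f p) (std_map R g))"

text \<open>The direct limit of a sequence of modules \<open>A 0 \<rightarrow> A 1 \<rightarrow> \<dots>\<close> with transition maps \<open>t s\<close> from \<open>A s\<close> to
  \<open>A (Suc s)\<close>: its elements are the classes of pairs \<open>(s, x)\<close> with \<open>x\<close> in \<open>A s\<close>, two pairs being identified
  when they become equal at some later stage.\<close>

fun transit :: "(nat \<Rightarrow> 'a \<Rightarrow> 'a) \<Rightarrow> nat \<Rightarrow> nat \<Rightarrow> 'a \<Rightarrow> 'a" where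
  "transit t s 0 x = x"
| "transit t s (Suc k) x = t (s + k) (transit t s k x)"

definition dirlim_class ::
    "(nat \<Rightarrow> ('r, 'a) module) \<Rightarrow> (nat \<Rightarrow> 'a \<Rightarrow> 'a) \<Rightarrow> nat \<Rightarrow> 'a \<Rightarrow> (nat \<times> 'a) set" where
  "dirlim_class A t s x =
     {(u, y). y \<in> carrier (A u) \<and> (\<exists>k l. s + k = u + l \<and> transit t s k x = transit t u l y)}"

definition dirlim ::
    "(nat \<Rightarrow> ('r, 'a) module) \<Rightarrow> (nat \<Rightarrow> 'a \<Rightarrow> 'a) \<Rightarrow> ('r, (nat \<times> 'a) set) module" where
  "dirlim A t = mk_module
     {dirlim_class A t s x | s x. x \<in> carrier (A s)}
     (dirlim_class A t 0 \<zero>\<^bsub>A 0\<^esub>)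
     (\<lambda>P Q. \<Union>(s, x)\<in>P. \<Union>(u, y)\<in>Q. let v = max s u in
        dirlim_class A t v (transit t s (v - s) x \<oplus>\<^bsub>A v\<^esub> transit t u (v - u) y))
     (\<lambda>r P. \<Union>(s, x)\<in>P. dirlim_class A t s (r \<odot>\<^bsub>A s\<^esub> x))"

definition dirlim_map ::
    "(nat \<Rightarrow> ('r, 'b) module) \<Rightarrow> (nat \<Rightarrow> 'b \<Rightarrow> 'b) \<Rightarrow> (nat \<Rightarrow> 'a \<Rightarrow> 'b) \<Rightarrow>
     (nat \<times> 'a) set \<Rightarrow> (nat \<times> 'b) set" where
  "dirlim_map B t \<phi> P = (\<Union>(s, x)\<in>P. dirlim_class B t s (\<phi> s x))"

text \<open>The modules \<open>N/I\<^sup>sN\<close>, the projections between them, and \<open>H\<^sup>i\<^sub>I(N, X)\<close>.\<close>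

definition adic_quot ::
    "('r, 'q) ring_scheme \<Rightarrow> 'r set \<Rightarrow> ('r, 'n) module \<Rightarrow> nat \<Rightarrow> ('r, 'n set) module" where
  "adic_quot R I N s = quot_module N (ideal_smult R (ideal_power R I s) N)"

definition adic_proj ::
    "('r, 'q) ring_scheme \<Rightarrow> 'r set \<Rightarrow> ('r, 'n) module \<Rightarrow> nat \<Rightarrow> 'n set \<Rightarrow> 'n set" where
  "adic_proj R I N s S = (\<Union>x\<in>S. ideal_smult R (ideal_power R I s) N +>\<^bsub>N\<^esub> x)"

definition gen_lc_transition ::
    "('r, 'q) ring_scheme \<Rightarrow> 'r set \<Rightarrow> ('r, 'n) module \<Rightarrow> ('r, 'x) cpx \<Rightarrow> int \<Rightarrow> nat \<Rightarrow>
     (int \<Rightarrow> (('n set, 'r) syz \<Rightarrow> 'r) \<Rightarrow> 'x) set \<Rightarrow> (int \<Rightarrow> (('n set, 'r) syz \<Rightarrow> 'r) \<Rightarrow> 'x) set" where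
  "gen_lc_transition R I N X i s =
     Ext_comap R (adic_quot R I N (Suc s)) X (adic_proj R I N s) i"

definition gen_lc ::
    "('r, 'q) ring_scheme \<Rightarrow> 'r set \<Rightarrow> ('r, 'n) module \<Rightarrow> ('r, 'x) cpx \<Rightarrow> int \<Rightarrow>
     ('r, (nat \<times> (int \<Rightarrow> (('n set, 'r) syz \<Rightarrow> 'r) \<Rightarrow> 'x) set) set) module" where
  "gen_lc R I N X i =
     dirlim (\<lambda>s. Ext R (adic_quot R I N s) X i) (gen_lc_transition R I N X i)"

text \<open>The map into \<open>H\<^sup>i\<^sub>I(N, Y)\<close> that is the direct limit of maps \<open>\<phi> s\<close> into \<open>Ext\<^sup>i(N/I\<^sup>sN, Y)\<close>.\<close>

definition gen_lc_map ::
    "('r, 'q) ring_scheme \<Rightarrow> 'r set \<Rightarrow> ('r, 'n) module \<Rightarrow> ('r, 'y) cpx \<Rightarrow> int \<Rightarrow> (nat \<Rightarrow> 'a \<Rightarrow> _) \<Rightarrow>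
     (nat \<times> 'a) set \<Rightarrow> (nat \<times> (int \<Rightarrow> (('n set, 'r) syz \<Rightarrow> 'r) \<Rightarrow> 'y) set) set" where
  "gen_lc_map R I N Y i \<phi> =
     dirlim_map (\<lambda>s. Ext R (adic_quot R I N s) Y i) (gen_lc_transition R I N Y i) \<phi>"

definition torsion_complex ::
    "('r, 'q) ring_scheme \<Rightarrow> 'r set \<Rightarrow> ('r, 'a) cpx \<Rightarrow> ('r, 'a) cpx" where
  "torsion_complex R I X =
     X\<lparr>obj := (\<lambda>j. sub_module (obj X j)
       {x \<in> carrier (obj X j). \<exists>s. \<forall>a\<in>ideal_power R I s. a \<odot>\<^bsub>obj X j\<^esub> x = \<zero>\<^bsub>obj X j\<^esub>})\<rparr>"

text \<open>\<open>H\<^sup>i\<^sub>I(M)\<close> and \<open>grade(I, M)\<close>, computed from an injective resolution \<open>E\<close> of \<open>M\<close>.  The infimum is taken in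
  the extended reals, where that of the empty set is \<open>\<infinity>\<close>.\<close>

definition local_cohomology ::
    "('r, 'q) ring_scheme \<Rightarrow> 'r set \<Rightarrow> ('r, 'e) cpx \<Rightarrow> int \<Rightarrow> ('r, 'e set) module" where
  "local_cohomology R I E i = cohomology (torsion_complex R I E) i"

definition grade :: "('r, 'q) ring_scheme \<Rightarrow> 'r set \<Rightarrow> ('r, 'e) cpx \<Rightarrow> ereal" where
  "grade R I E = Inf ((\<lambda>i. ereal (real_of_int i)) ` {i. \<not> zero_module (local_cohomology R I E i)})"

text \<open>The embedding of \<open>H\<^sup>c\<^sub>I(M)[-c]\<close> into \<open>\<Gamma>\<^sub>I(E)\<close>.  When \<open>\<Gamma>\<^sub>I(E)\<^sup>c\<^sup>-\<^sup>1 = 0\<close> there are no nonzero coboundaries in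
  degree \<open>c\<close>, so each class is a singleton \<open>{x}\<close>, and the embedding sends it to the cocycle \<open>x\<close>.\<close>

definition lc_embedding ::
    "('r, 'q) ring_scheme \<Rightarrow> 'r set \<Rightarrow> ('r, 'e) cpx \<Rightarrow> int \<Rightarrow> int \<Rightarrow> 'e set \<Rightarrow> 'e" where
  "lc_embedding R I E c = single_map c the_elem (torsion_complex R I E)"

definition truncation_complex ::
    "('r, 'q) ring_scheme \<Rightarrow> 'r set \<Rightarrow> ('r, 'e) cpx \<Rightarrow> int \<Rightarrow> ('r, 'e set) cpx" where
  "truncation_complex R I E c =
     coker_complex (single c (local_cohomology R I E c)) (torsion_complex R I E)
       (lc_embedding R I E c)"


section \<open>The natural homomorphisms\<close>

text \<open>In the first group of maps, a class in \<open>Ext\<^sup>i(T, H)\<close> is regarded as one in \<open>Ext\<^sup>i\<^sup>+\<^sup>c(T, H[-c])\<close>: by lemma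
  \<open>Ext_single_shift\<close> below these two modules are equal.\<close>

definition res_map :: "('m \<Rightarrow> 'e) \<Rightarrow> ('r, 'e) cpx \<Rightarrow> int \<Rightarrow> 'm \<Rightarrow> 'e" where
  "res_map \<epsilon> E = single_map 0 \<epsilon> E"

definition incl_map :: "int \<Rightarrow> 'e \<Rightarrow> 'e" where
  "incl_map j x = x"

definition nat_level ::
    "('r, 'q) ring_scheme \<Rightarrow> 'r set \<Rightarrow> ('r, 'm) module \<Rightarrow> ('m \<Rightarrow> 'e) \<Rightarrow> ('r, 'e) cpx \<Rightarrow> int \<Rightarrow>
     ('r, 't) module \<Rightarrow> int \<Rightarrow>
     (int \<Rightarrow> (('t, 'r) syz \<Rightarrow> 'r) \<Rightarrow> 'e set) set \<Rightarrow> (int \<Rightarrow> (('t, 'r) syz \<Rightarrow> 'r) \<Rightarrow> 'm) set" where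
  "nat_level R I M \<epsilon> E c T i =
     inv_into (carrier (Ext R T (single 0 M) (i + c))) (Ext_map R T E (res_map \<epsilon> E) (i + c)) \<circ>
     Ext_map R T E incl_map (i + c) \<circ>
     Ext_map R T (torsion_complex R I E) (lc_embedding R I E c) (i + c)"

definition nat_map where
  "nat_map R I M \<epsilon> E c N i =
     gen_lc_map R I N (single 0 M) (i + c) (\<lambda>s. nat_level R I M \<epsilon> E c (adic_quot R I N s) i)"

text \<open>Matlis duals, with \<open>K\<close> an injective hull of the residue field: the duals of \<open>M \<rightarrow> E\<close>, of
  \<open>\<Gamma>\<^sub>I(E) \<rightarrow> E\<close> and of \<open>H[-c] \<rightarrow> \<Gamma>\<^sub>I(E)\<close>; the last one is a morphism from \<open>D(\<Gamma>\<^sub>I(E))\<close> to \<open>D(H)[c]\<close>.\<close>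

definition dual_res_map where
  "dual_res_map R K M \<epsilon> = single_map 0 (\<lambda>f. compose (carrier M) f \<epsilon>) (single 0 (Hom R M K))"

definition dual_incl_map where
  "dual_incl_map R I E j f = restrict f (carrier (obj (torsion_complex R I E) (- j)))"

definition dual_lc_embedding where
  "dual_lc_embedding R I K E c =
     (let H = local_cohomology R I E c in
      single_map (- c) (\<lambda>f. compose (carrier H) f (lc_embedding R I E c c))
        (single (- c) (Hom R H K)))"

definition dual_nat_level ::
    "('r, 'q) ring_scheme \<Rightarrow> 'r set \<Rightarrow> ('r, 'k) module \<Rightarrow> ('r, 'm) module \<Rightarrow> ('m \<Rightarrow> 'e) \<Rightarrow>
     ('r, 'e) cpx \<Rightarrow> int \<Rightarrow> ('r, 't) module \<Rightarrow> int \<Rightarrow>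
     (int \<Rightarrow> (('t, 'r) syz \<Rightarrow> 'r) \<Rightarrow> 'm \<Rightarrow> 'k) set \<Rightarrow>
     (int \<Rightarrow> (('t, 'r) syz \<Rightarrow> 'r) \<Rightarrow> 'e set \<Rightarrow> 'k) set" where
  "dual_nat_level R I K M \<epsilon> E c T i =
     Ext_map R T (single (- c) (Hom R (local_cohomology R I E c) K))
       (dual_lc_embedding R I K E c) i \<circ>
     Ext_map R T (dual_complex R K (torsion_complex R I E)) (dual_incl_map R I E) i \<circ>
     inv_into (carrier (Ext R T (dual_complex R K E) i))
       (Ext_map R T (single 0 (Hom R M K)) (dual_res_map R K M \<epsilon>) i)"

definition dual_nat_map where
  "dual_nat_map R I K M \<epsilon> E c N i =
     gen_lc_map R I N (single 0 (Hom R (local_cohomology R I E c) K)) (i + c)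
       (\<lambda>s. dual_nat_level R I K M \<epsilon> E c (adic_quot R I N s) i)"


section \<open>Auxiliary facts\<close>

lemma injective_module_extend:
  fixes R :: "('r, 'q) ring_scheme" and A :: "('r, 'a) module" and B :: "('r, 'b) module"
  assumes inj: "injective_module R A" and B: "module R B" and K: "submodule K R B"
    and f: "f \<in> mod_hom R (sub_module B K) A"
  shows "\<exists>g \<in> mod_hom R B A. \<forall>x\<in>K. g x = f x"
proof -
  interpret B: module R B by fact
  interpret A: module R A using inj unfolding injective_module_def by blast
  have KB: "K \<subseteq> carrier B" using B.submoduleE(1)[OF K] .
  have f_in: "f x \<in> carrier A" if "x \<in> K" for x
    using f that unfolding mod_hom_def sub_module_def by auto
  have f_add: "f (x \<oplus>\<^bsub>B\<^esub> y) = f x \<oplus>\<^bsub>A\<^esub> f y" if "x \<in> K" "y \<in> K" for x y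
    using f that unfolding mod_hom_def sub_module_def by auto
  have f_smult: "f (r \<odot>\<^bsub>B\<^esub> x) = r \<odot>\<^bsub>A\<^esub> f x" if "x \<in> K" "r \<in> carrier R" for r x
    using f that unfolding mod_hom_def sub_module_def by auto
  have K_zero: "\<zero>\<^bsub>B\<^esub> \<in> K"
    using K subgroup.one_closed[of K "add_monoid B"] unfolding submodule_def by simp
  have K_add: "x \<oplus>\<^bsub>B\<^esub> y \<in> K" if "x \<in> K" "y \<in> K" for x y
    using B.submoduleE(5)[OF K] that by blast
  have K_smult: "r \<odot>\<^bsub>B\<^esub> x \<in> K" if "x \<in> K" "r \<in> carrier R" for r x
    using B.submoduleE(4)[OF K] that by blast
  have f_zero: "f \<zero>\<^bsub>B\<^esub> = \<zero>\<^bsub>A\<^esub>"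
    using f_smult[OF K_zero, of "\<zero>\<^bsub>R\<^esub>"] f_in[OF K_zero] by simp
  define good where "good G \<longleftrightarrow> G \<subseteq> carrier B \<times> carrier A \<and> (\<forall>x\<in>K. (x, f x) \<in> G) \<and>
      (\<forall>x y x' y'. (x, y) \<in> G \<longrightarrow> (x', y') \<in> G \<longrightarrow> (x \<oplus>\<^bsub>B\<^esub> x', y \<oplus>\<^bsub>A\<^esub> y') \<in> G) \<and>
      (\<forall>r x y. r \<in> carrier R \<longrightarrow> (x, y) \<in> G \<longrightarrow> (r \<odot>\<^bsub>B\<^esub> x, r \<odot>\<^bsub>A\<^esub> y) \<in> G) \<and>
      (\<forall>y. (\<zero>\<^bsub>B\<^esub>, y) \<in> G \<longrightarrow> y = \<zero>\<^bsub>A\<^esub>)" for G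
  have D1: "X \<subseteq> carrier B \<times> carrier A"
    and D2: "\<forall>x\<in>K. (x, f x) \<in> X"
    and D3: "\<forall>x y x' y'. (x, y) \<in> X \<longrightarrow> (x', y') \<in> X \<longrightarrow> (x \<oplus>\<^bsub>B\<^esub> x', y \<oplus>\<^bsub>A\<^esub> y') \<in> X"
    and D4: "\<forall>r x y. r \<in> carrier R \<longrightarrow> (x, y) \<in> X \<longrightarrow> (r \<odot>\<^bsub>B\<^esub> x, r \<odot>\<^bsub>A\<^esub> y) \<in> X"
    and D5: "\<forall>y. (\<zero>\<^bsub>B\<^esub>, y) \<in> X \<longrightarrow> y = \<zero>\<^bsub>A\<^esub>" if "good X" for X
    using that unfolding good_def by - (elim conjE, assumption)+
  have good0: "good ((\<lambda>x. (x, f x)) ` K)"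
    unfolding good_def
  proof (intro conjI allI impI ballI)
    show "(\<lambda>x. (x, f x)) ` K \<subseteq> carrier B \<times> carrier A" using KB f_in by blast
  next
    fix x y x' y' assume "(x, y) \<in> (\<lambda>x. (x, f x)) ` K" "(x', y') \<in> (\<lambda>x. (x, f x)) ` K"
    then have "x \<in> K" "y = f x" "x' \<in> K" "y' = f x'" by auto
    then show "(x \<oplus>\<^bsub>B\<^esub> x', y \<oplus>\<^bsub>A\<^esub> y') \<in> (\<lambda>x. (x, f x)) ` K"
      using K_add[of x x'] f_add[of x x', symmetric] by (simp add: image_iff)
  next
    fix r x y assume "r \<in> carrier R" "(x, y) \<in> (\<lambda>x. (x, f x)) ` K"
    then have "r \<in> carrier R" "x \<in> K" "y = f x" by auto
    then show "(r \<odot>\<^bsub>B\<^esub> x, r \<odot>\<^bsub>A\<^esub> y) \<in> (\<lambda>x. (x, f x)) ` K"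
      using K_smult[of x r] f_smult[of x r, symmetric] by (simp add: image_iff)
  next
    fix y assume "(\<zero>\<^bsub>B\<^esub>, y) \<in> (\<lambda>x. (x, f x)) ` K"
    then have "y = f \<zero>\<^bsub>B\<^esub>" by auto
    then show "y = \<zero>\<^bsub>A\<^esub>" using f_zero by simp
  qed simp
  have "\<exists>G\<in>Collect good. \<forall>X\<in>Collect good. G \<subseteq> X \<longrightarrow> X = G"
  proof (rule subset_Zorn_nonempty)
    show "Collect good \<noteq> {}" using good0 by blast
  next
    fix \<C> assume ne: "\<C> \<noteq> {}" and ch: "subset.chain (Collect good) \<C>"
    have g: "good X" if "X \<in> \<C>" for X
      using ch that unfolding subset.chain_def by blast
    have "good (\<Union>\<C>)"
      unfolding good_def
    proof (intro conjI allI impI ballI)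
      show "\<Union>\<C> \<subseteq> carrier B \<times> carrier A" using D1[OF g] by blast
    next
      fix x assume "x \<in> K" then show "(x, f x) \<in> \<Union>\<C>" using D2[OF g] ne by blast
    next
      fix x y x' y' assume "(x, y) \<in> \<Union>\<C>" "(x', y') \<in> \<Union>\<C>"
      then obtain X Y where XY: "X \<in> \<C>" "Y \<in> \<C>" "(x, y) \<in> X" "(x', y') \<in> Y" by blast
      then have "X \<subseteq> Y \<or> Y \<subseteq> X" using ch unfolding subset.chain_def by blast
      then obtain Z where "Z \<in> \<C>" "(x, y) \<in> Z" "(x', y') \<in> Z" using XY by blast
      then show "(x \<oplus>\<^bsub>B\<^esub> x', y \<oplus>\<^bsub>A\<^esub> y') \<in> \<Union>\<C>" using D3[OF g[of Z], rule_format] by blast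
    next
      fix r x y assume "r \<in> carrier R" "(x, y) \<in> \<Union>\<C>"
      then show "(r \<odot>\<^bsub>B\<^esub> x, r \<odot>\<^bsub>A\<^esub> y) \<in> \<Union>\<C>" using D4[OF g, rule_format] by blast
    next
      fix y assume "(\<zero>\<^bsub>B\<^esub>, y) \<in> \<Union>\<C>"
      then show "y = \<zero>\<^bsub>A\<^esub>" using D5[OF g, rule_format] by blast
    qed
    then show "\<Union>\<C> \<in> Collect good" by simp
  qed
  then obtain G where good: "good G" and max: "\<And>X. good X \<Longrightarrow> G \<subseteq> X \<Longrightarrow> X = G" by blast
  have G_in: "x \<in> carrier B \<and> y \<in> carrier A" if "(x, y) \<in> G" for x y
    using D1[OF good] that by blast
  have G_f: "(x, f x) \<in> G" if "x \<in> K" for x using D2[OF good] that by blast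
  have G_add: "(x \<oplus>\<^bsub>B\<^esub> x', y \<oplus>\<^bsub>A\<^esub> y') \<in> G" if "(x, y) \<in> G" "(x', y') \<in> G" for x y x' y'
    by (rule D3[OF good, rule_format, OF that])
  have G_smult: "(r \<odot>\<^bsub>B\<^esub> x, r \<odot>\<^bsub>A\<^esub> y) \<in> G" if "r \<in> carrier R" "(x, y) \<in> G" for r x y
    by (rule D4[OF good, rule_format, OF that])
  have G_zero: "y = \<zero>\<^bsub>A\<^esub>" if "(\<zero>\<^bsub>B\<^esub>, y) \<in> G" for y
    by (rule D5[OF good, rule_format, OF that])
  have G_neg: "(\<ominus>\<^bsub>B\<^esub> x, \<ominus>\<^bsub>A\<^esub> y) \<in> G" if "(x, y) \<in> G" for x y
    using G_smult[of "\<ominus>\<^bsub>R\<^esub> \<one>\<^bsub>R\<^esub>", OF _ that] G_in[OF that]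
    by (simp add: A.smult_l_minus B.smult_l_minus)
  have G_fun: "y = y'" if "(x, y) \<in> G" "(x, y') \<in> G" for x y y'
  proof -
    have "(x \<oplus>\<^bsub>B\<^esub> \<ominus>\<^bsub>B\<^esub> x, y \<oplus>\<^bsub>A\<^esub> \<ominus>\<^bsub>A\<^esub> y') \<in> G" using G_add[OF that(1) G_neg[OF that(2)]] .
    then have "y \<oplus>\<^bsub>A\<^esub> \<ominus>\<^bsub>A\<^esub> y' = \<zero>\<^bsub>A\<^esub>"
      using G_zero G_in[OF that(1)] by (simp add: B.r_neg)
    then show ?thesis using G_in[OF that(1)] G_in[OF that(2)] A.minus_equality[of y "\<ominus>\<^bsub>A\<^esub> y'"] by simp
  qed
  have total: "\<exists>y. (b, y) \<in> G" if b: "b \<in> carrier B" for b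
  proof -
    define J where "J = {r \<in> carrier R. \<exists>y. (r \<odot>\<^bsub>B\<^esub> b, y) \<in> G}"
    define h where "h r = (THE y. (r \<odot>\<^bsub>B\<^esub> b, y) \<in> G)" for r
    have h: "(r \<odot>\<^bsub>B\<^esub> b, h r) \<in> G" if "r \<in> J" for r
      using that G_fun unfolding J_def h_def by (auto intro: theI2)
    have hI: "r \<in> J \<and> h r = y" if "r \<in> carrier R" "(r \<odot>\<^bsub>B\<^esub> b, y) \<in> G" for r y
      using that h G_fun unfolding J_def by blast
    let ?R = "ring_module R"
    have modR: "module R ?R"
    proof (rule moduleI)
      show "cring R" by (rule B.R.is_cring)
      have "\<exists>y\<in>carrier R. y \<oplus>\<^bsub>R\<^esub> x = \<zero>\<^bsub>R\<^esub>" if "x \<in> carrier R" for x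
        using B.R.l_neg[OF that] B.R.a_inv_closed[OF that] by (rule bexI)
      then show "abelian_group ?R"
        by (intro abelian_groupI) (simp_all add: ring_module_def B.R.a_ac)
    qed (simp_all add: ring_module_def B.R.l_distr B.R.r_distr B.R.m_assoc)
    interpret RR: module R ?R by (rule modR)
    have J_add: "r \<oplus>\<^bsub>R\<^esub> r' \<in> J \<and> h (r \<oplus>\<^bsub>R\<^esub> r') = h r \<oplus>\<^bsub>A\<^esub> h r'" if "r \<in> J" "r' \<in> J" for r r'
      using G_add[OF h[OF that(1)] h[OF that(2)]] that b hI
      by (auto simp: J_def B.smult_l_distr[symmetric])
    have J_mul: "s \<otimes>\<^bsub>R\<^esub> r \<in> J \<and> h (s \<otimes>\<^bsub>R\<^esub> r) = s \<odot>\<^bsub>A\<^esub> h r" if "r \<in> J" "s \<in> carrier R" for r s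
      using G_smult[OF that(2) h[OF that(1)]] that b hI
      by (auto simp: J_def B.smult_assoc1[symmetric])
    have JR: "J \<subseteq> carrier R" unfolding J_def by blast
    have J0: "\<zero>\<^bsub>R\<^esub> \<in> J" using hI[of "\<zero>\<^bsub>R\<^esub>" "f \<zero>\<^bsub>B\<^esub>"] b G_f[OF K_zero] by simp
    have inv: "\<ominus>\<^bsub>?R\<^esub> r = \<ominus>\<^bsub>R\<^esub> r" if "r \<in> carrier R" for r
      using that B.R.l_neg RR.M.minus_equality[of "\<ominus>\<^bsub>R\<^esub> r" r] by (simp add: ring_module_def)
    have subJ: "submodule J R ?R"
    proof (rule RR.submoduleI)
      fix a assume a: "a \<in> J"
      then have "(\<ominus>\<^bsub>R\<^esub> \<one>\<^bsub>R\<^esub>) \<otimes>\<^bsub>R\<^esub> a \<in> J" using J_mul by simp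
      then show "\<ominus>\<^bsub>?R\<^esub> a \<in> J" using a JR inv by (simp add: B.R.l_minus subset_iff)
    qed (use JR J0 J_add J_mul in \<open>auto simp: ring_module_def\<close>)
    have hhom: "h \<in> mod_hom R (sub_module ?R J) A"
      using h G_in J_add J_mul by (auto simp: mod_hom_def sub_module_def ring_module_def mk_module_def)
    obtain g where g: "g \<in> mod_hom R ?R A" "\<forall>x\<in>J. g x = h x"
      using inj modR subJ hhom unfolding injective_module_def by blast
    define a where "a = g \<one>\<^bsub>R\<^esub>"
    have a: "a \<in> carrier A" using g(1) by (auto simp: a_def mod_hom_def ring_module_def)
    have ga: "g r = r \<odot>\<^bsub>A\<^esub> a" if "r \<in> carrier R" for r
    proof -
      have "g (r \<otimes>\<^bsub>R\<^esub> \<one>\<^bsub>R\<^esub>) = r \<odot>\<^bsub>A\<^esub> g \<one>\<^bsub>R\<^esub>"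
        using g(1) that by (simp add: mod_hom_def ring_module_def del: B.R.r_one)
      then show ?thesis using that by (simp add: a_def)
    qed
    define G' where "G' = {(x \<oplus>\<^bsub>B\<^esub> r \<odot>\<^bsub>B\<^esub> b, y \<oplus>\<^bsub>A\<^esub> r \<odot>\<^bsub>A\<^esub> a) | x y r. (x, y) \<in> G \<and> r \<in> carrier R}"
    have sub: "G \<subseteq> G'"
    proof
      fix p assume p: "p \<in> G"
      then obtain x y where xy: "p = (x, y)" by (cases p)
      then have "p = (x \<oplus>\<^bsub>B\<^esub> \<zero>\<^bsub>R\<^esub> \<odot>\<^bsub>B\<^esub> b, y \<oplus>\<^bsub>A\<^esub> \<zero>\<^bsub>R\<^esub> \<odot>\<^bsub>A\<^esub> a)" using G_in[of x y] p xy a b by simp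
      moreover have "(x, y) \<in> G" using p xy by simp
      ultimately show "p \<in> G'" unfolding G'_def mem_Collect_eq using B.R.zero_closed
        by (intro exI[of _ x] exI[of _ y] exI[of _ "\<zero>\<^bsub>R\<^esub>"] conjI)
    qed
    have "good G'"
      unfolding good_def
    proof (intro conjI allI impI ballI)
      show "G' \<subseteq> carrier B \<times> carrier A" using a b unfolding G'_def by (auto dest!: G_in)
    next
      fix x assume "x \<in> K" then show "(x, f x) \<in> G'" using G_f sub by blast
    next
      fix x y x' y' assume "(x, y) \<in> G'" "(x', y') \<in> G'"
      then obtain u v r u' v' r' where *: "(u, v) \<in> G" "r \<in> carrier R" "(u', v') \<in> G" "r' \<in> carrier R"
        "x = u \<oplus>\<^bsub>B\<^esub> r \<odot>\<^bsub>B\<^esub> b" "y = v \<oplus>\<^bsub>A\<^esub> r \<odot>\<^bsub>A\<^esub> a"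
        "x' = u' \<oplus>\<^bsub>B\<^esub> r' \<odot>\<^bsub>B\<^esub> b" "y' = v' \<oplus>\<^bsub>A\<^esub> r' \<odot>\<^bsub>A\<^esub> a"
        unfolding G'_def by blast
      have "x \<oplus>\<^bsub>B\<^esub> x' = (u \<oplus>\<^bsub>B\<^esub> u') \<oplus>\<^bsub>B\<^esub> (r \<oplus>\<^bsub>R\<^esub> r') \<odot>\<^bsub>B\<^esub> b"
        "y \<oplus>\<^bsub>A\<^esub> y' = (v \<oplus>\<^bsub>A\<^esub> v') \<oplus>\<^bsub>A\<^esub> (r \<oplus>\<^bsub>R\<^esub> r') \<odot>\<^bsub>A\<^esub> a"
        using * a b G_in[OF *(1)] G_in[OF *(3)]
        by (simp_all add: A.smult_l_distr B.smult_l_distr A.a_ac B.a_ac)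
      then show "(x \<oplus>\<^bsub>B\<^esub> x', y \<oplus>\<^bsub>A\<^esub> y') \<in> G'"
        unfolding G'_def using G_add[OF *(1,3)] *(2,4) by blast
    next
      fix s x y assume s: "s \<in> carrier R" and "(x, y) \<in> G'"
      then obtain u v r where *: "(u, v) \<in> G" "r \<in> carrier R"
        "x = u \<oplus>\<^bsub>B\<^esub> r \<odot>\<^bsub>B\<^esub> b" "y = v \<oplus>\<^bsub>A\<^esub> r \<odot>\<^bsub>A\<^esub> a"
        unfolding G'_def by blast
      have "s \<odot>\<^bsub>B\<^esub> x = s \<odot>\<^bsub>B\<^esub> u \<oplus>\<^bsub>B\<^esub> (s \<otimes>\<^bsub>R\<^esub> r) \<odot>\<^bsub>B\<^esub> b"
        "s \<odot>\<^bsub>A\<^esub> y = s \<odot>\<^bsub>A\<^esub> v \<oplus>\<^bsub>A\<^esub> (s \<otimes>\<^bsub>R\<^esub> r) \<odot>\<^bsub>A\<^esub> a"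
        using * s a b G_in[OF *(1)]
        by (simp_all add: A.smult_r_distr B.smult_r_distr A.smult_assoc1 B.smult_assoc1)
      then show "(s \<odot>\<^bsub>B\<^esub> x, s \<odot>\<^bsub>A\<^esub> y) \<in> G'"
        unfolding G'_def using G_smult[OF s *(1)] *(2) s by blast
    next
      fix y assume "(\<zero>\<^bsub>B\<^esub>, y) \<in> G'"
      then obtain u v r where *: "(u, v) \<in> G" "r \<in> carrier R"
        "\<zero>\<^bsub>B\<^esub> = u \<oplus>\<^bsub>B\<^esub> r \<odot>\<^bsub>B\<^esub> b" "y = v \<oplus>\<^bsub>A\<^esub> r \<odot>\<^bsub>A\<^esub> a"
        unfolding G'_def by blast
      have u: "u \<in> carrier B" "v \<in> carrier A" using G_in[OF *(1)] by auto
      have "\<ominus>\<^bsub>B\<^esub> u = r \<odot>\<^bsub>B\<^esub> b"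
        using B.minus_equality[of "r \<odot>\<^bsub>B\<^esub> b" u] B.a_comm[of u "r \<odot>\<^bsub>B\<^esub> b"] * u b by simp
      then have "(r \<odot>\<^bsub>B\<^esub> b, \<ominus>\<^bsub>A\<^esub> v) \<in> G" using G_neg[OF *(1)] by simp
      then have "r \<in> J" "h r = \<ominus>\<^bsub>A\<^esub> v" using hI *(2) by auto
      then have "r \<odot>\<^bsub>A\<^esub> a = \<ominus>\<^bsub>A\<^esub> v" using g(2) ga[OF *(2)] by metis
      then show "y = \<zero>\<^bsub>A\<^esub>" using *(4) u by (simp add: A.r_neg)
    qed
    then have "G' = G" using max sub by blast
    moreover have "(\<zero>\<^bsub>B\<^esub> \<oplus>\<^bsub>B\<^esub> \<one>\<^bsub>R\<^esub> \<odot>\<^bsub>B\<^esub> b, f \<zero>\<^bsub>B\<^esub> \<oplus>\<^bsub>A\<^esub> \<one>\<^bsub>R\<^esub> \<odot>\<^bsub>A\<^esub> a) \<in> G'"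
      unfolding G'_def using G_f[OF K_zero] by blast
    ultimately show ?thesis using b by auto
  qed
  define g where "g b = (THE y. (b, y) \<in> G)" for b
  have g: "(b, g b) \<in> G" if "b \<in> carrier B" for b
    using total[OF that] G_fun unfolding g_def by (auto intro: theI2)
  have gI: "g b = y" if "(b, y) \<in> G" for b y using that g G_in G_fun by blast
  have "g \<in> mod_hom R B A"
    unfolding mod_hom_def
  proof (intro CollectI conjI ballI funcsetI)
    fix x assume x: "x \<in> carrier B"
    show "g x \<in> carrier A" using g[OF x] G_in by blast
    fix y assume y: "y \<in> carrier B"
    show "g (x \<oplus>\<^bsub>B\<^esub> y) = g x \<oplus>\<^bsub>A\<^esub> g y" by (rule gI[OF G_add[OF g[OF x] g[OF y]]])
  next
    fix r x assume "r \<in> carrier R" "x \<in> carrier B"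
    then show "g (r \<odot>\<^bsub>B\<^esub> x) = r \<odot>\<^bsub>A\<^esub> g x" by (intro gI G_smult g)
  qed
  moreover have "\<forall>x\<in>K. g x = f x" using gI G_f by blast
  ultimately show ?thesis by blast
qed

lemma mod_homD:
  assumes "f \<in> mod_hom R A B"
  shows "x \<in> carrier A \<Longrightarrow> f x \<in> carrier B"
    and "x \<in> carrier A \<Longrightarrow> y \<in> carrier A \<Longrightarrow> f (x \<oplus>\<^bsub>A\<^esub> y) = f x \<oplus>\<^bsub>B\<^esub> f y"
    and "r \<in> carrier R \<Longrightarrow> x \<in> carrier A \<Longrightarrow> f (r \<odot>\<^bsub>A\<^esub> x) = r \<odot>\<^bsub>B\<^esub> f x"
  using assms unfolding mod_hom_def by auto

lemma mod_hom_zero: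
  assumes "f \<in> mod_hom R A B" "module R A" "module R B"
  shows "f \<zero>\<^bsub>A\<^esub> = \<zero>\<^bsub>B\<^esub>"
proof -
  interpret A: module R A by fact
  interpret B: module R B by fact
  have "f (\<zero>\<^bsub>R\<^esub> \<odot>\<^bsub>A\<^esub> \<zero>\<^bsub>A\<^esub>) = \<zero>\<^bsub>R\<^esub> \<odot>\<^bsub>B\<^esub> f \<zero>\<^bsub>A\<^esub>"
    by (rule mod_homD(3)[OF assms(1)]) auto
  then show ?thesis using mod_homD(1)[OF assms(1) A.zero_closed] by simp
qed

lemma mod_hom_finsum:
  assumes f: "f \<in> mod_hom R A B" and A: "module R A" and B: "module R B"
    and S: "finite S" and g: "g \<in> S \<rightarrow> carrier A"
  shows "f (\<Oplus>\<^bsub>A\<^esub>b\<in>S. g b) = (\<Oplus>\<^bsub>B\<^esub>b\<in>S. f (g b))"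
proof -
  interpret A: module R A by fact
  interpret B: module R B by fact
  show ?thesis
    using S g
  proof (induction S rule: finite_induct)
    case empty
    then show ?case using mod_hom_zero[OF f A B] by simp
  next
    case (insert b S)
    have 1: "(\<lambda>b. f (g b)) \<in> S \<rightarrow> carrier B" "f (g b) \<in> carrier B" "g \<in> S \<rightarrow> carrier A" "g b \<in> carrier A"
      using insert.prems mod_homD(1)[OF f] by auto
    have "f (\<Oplus>\<^bsub>A\<^esub>b\<in>insert b S. g b) = f (g b \<oplus>\<^bsub>A\<^esub> (\<Oplus>\<^bsub>A\<^esub>b\<in>S. g b))"
      using A.finsum_insert[OF insert.hyps 1(3,4)] by simp
    also have "\<dots> = f (g b) \<oplus>\<^bsub>B\<^esub> f (\<Oplus>\<^bsub>A\<^esub>b\<in>S. g b)"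
      using 1 by (intro mod_homD(2)[OF f] A.finsum_closed)
    also have "\<dots> = (\<Oplus>\<^bsub>B\<^esub>b\<in>insert b S. f (g b))"
      using B.finsum_insert[OF insert.hyps 1(1,2)] insert.IH[OF 1(3)] by simp
    finally show ?case .
  qed
qed

lemma free_module_simps:
  "f \<in> carrier (free_module R B) \<longleftrightarrow> (\<forall>b. f b \<in> carrier R) \<and> finite {b. f b \<noteq> \<zero>\<^bsub>R\<^esub>} \<and> {b. f b \<noteq> \<zero>\<^bsub>R\<^esub>} \<subseteq> B"
  "\<zero>\<^bsub>free_module R B\<^esub> = (\<lambda>b. \<zero>\<^bsub>R\<^esub>)"
  "f \<oplus>\<^bsub>free_module R B\<^esub> g = (\<lambda>b. f b \<oplus>\<^bsub>R\<^esub> g b)"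
  "r \<odot>\<^bsub>free_module R B\<^esub> f = (\<lambda>b. r \<otimes>\<^bsub>R\<^esub> f b)"
  by (simp_all add: free_module_def)

lemma free_module_module:
  assumes "cring R"
  shows "module R (free_module R B)"
proof -
  interpret cring R by fact
  let ?F = "free_module R B"
  have add: "f \<oplus>\<^bsub>?F\<^esub> g \<in> carrier ?F" if "f \<in> carrier ?F" "g \<in> carrier ?F" for f g
  proof -
    have "{b. f b \<oplus>\<^bsub>R\<^esub> g b \<noteq> \<zero>\<^bsub>R\<^esub>} \<subseteq> {b. f b \<noteq> \<zero>\<^bsub>R\<^esub>} \<union> {b. g b \<noteq> \<zero>\<^bsub>R\<^esub>}"
      by auto
    moreover have "finite ({b. f b \<noteq> \<zero>\<^bsub>R\<^esub>} \<union> {b. g b \<noteq> \<zero>\<^bsub>R\<^esub>})"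
      "{b. f b \<noteq> \<zero>\<^bsub>R\<^esub>} \<union> {b. g b \<noteq> \<zero>\<^bsub>R\<^esub>} \<subseteq> B"
      using that unfolding free_module_simps by auto
    ultimately have "finite {b. f b \<oplus>\<^bsub>R\<^esub> g b \<noteq> \<zero>\<^bsub>R\<^esub>}" "{b. f b \<oplus>\<^bsub>R\<^esub> g b \<noteq> \<zero>\<^bsub>R\<^esub>} \<subseteq> B"
      by (blast intro: finite_subset)+
    then show ?thesis using that unfolding free_module_simps by auto
  qed
  have smult: "r \<odot>\<^bsub>?F\<^esub> f \<in> carrier ?F" if "f \<in> carrier ?F" "r \<in> carrier R" for f r
  proof -
    have "{b. r \<otimes>\<^bsub>R\<^esub> f b \<noteq> \<zero>\<^bsub>R\<^esub>} \<subseteq> {b. f b \<noteq> \<zero>\<^bsub>R\<^esub>}"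
      using that by auto
    moreover have "finite {b. f b \<noteq> \<zero>\<^bsub>R\<^esub>}" "{b. f b \<noteq> \<zero>\<^bsub>R\<^esub>} \<subseteq> B"
      using that unfolding free_module_simps by auto
    ultimately have "finite {b. r \<otimes>\<^bsub>R\<^esub> f b \<noteq> \<zero>\<^bsub>R\<^esub>}" "{b. r \<otimes>\<^bsub>R\<^esub> f b \<noteq> \<zero>\<^bsub>R\<^esub>} \<subseteq> B"
      by (blast intro: finite_subset)+
    then show ?thesis using that unfolding free_module_simps by auto
  qed
  have in_R: "f b \<in> carrier R" if "f \<in> carrier ?F" for f b
    using that unfolding free_module_simps by blast
  show ?thesis
  proof (rule moduleI)
    show "cring R" by fact
    show "abelian_group ?F"
    proof (rule abelian_groupI)
      fix f assume f: "f \<in> carrier ?F"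
      have "(\<ominus>\<^bsub>R\<^esub> \<one>\<^bsub>R\<^esub>) \<odot>\<^bsub>?F\<^esub> f \<oplus>\<^bsub>?F\<^esub> f = \<zero>\<^bsub>?F\<^esub>"
        unfolding free_module_simps using in_R[OF f] by (simp add: l_minus l_neg)
      then show "\<exists>g\<in>carrier ?F. g \<oplus>\<^bsub>?F\<^esub> f = \<zero>\<^bsub>?F\<^esub>"
        using smult[OF f, of "\<ominus>\<^bsub>R\<^esub> \<one>\<^bsub>R\<^esub>"] by (intro bexI) auto
    qed (use add in_R in \<open>simp_all add: a_ac free_module_simps(2,3)\<close>, simp add: free_module_simps)
  qed (use smult in_R in \<open>simp_all add: l_distr r_distr m_assoc free_module_simps(3,4)\<close>)
qed

lemma linear_ext_superset:
  assumes A: "module R A" and f: "f \<in> carrier (free_module R B)" and e: "e \<in> B \<rightarrow> carrier A"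
    and S: "finite S" "{b. f b \<noteq> \<zero>\<^bsub>R\<^esub>} \<subseteq> S" "S \<subseteq> B"
  shows "linear_ext R A e f = (\<Oplus>\<^bsub>A\<^esub>b\<in>S. f b \<odot>\<^bsub>A\<^esub> e b)"
proof -
  interpret A: module R A by fact
  have fR: "f b \<in> carrier R" for b using f unfolding free_module_simps by blast
  show ?thesis
    unfolding linear_ext_def
  proof (rule A.add.finprod_mono_neutral_cong_left)
    show "\<And>i. i \<in> S - {b. f b \<noteq> \<zero>\<^bsub>R\<^esub>} \<Longrightarrow> f i \<odot>\<^bsub>A\<^esub> e i = \<zero>\<^bsub>A\<^esub>"
      using e S(3) by (auto simp: Pi_iff subset_iff)
    show "(\<lambda>b. f b \<odot>\<^bsub>A\<^esub> e b) \<in> S \<rightarrow> carrier A" using fR e S(3) by auto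
  qed (use S in auto)
qed

lemma linear_ext_hom:
  assumes A: "module R A" and e: "e \<in> B \<rightarrow> carrier A"
  shows "linear_ext R A e \<in> mod_hom R (free_module R B) A"
proof -
  interpret A: module R A by fact
  let ?F = "free_module R B"
  interpret F: module R ?F by (rule free_module_module) (rule A.R.is_cring)
  let ?s = "\<lambda>f. {b. f b \<noteq> \<zero>\<^bsub>R\<^esub>}"
  have fR: "f b \<in> carrier R" and fs: "finite (?s f)" "?s f \<subseteq> B" if "f \<in> carrier ?F" for f b
    using that unfolding free_module_simps by auto
  have fA: "(\<lambda>b. f b \<odot>\<^bsub>A\<^esub> e b) \<in> S \<rightarrow> carrier A" if "f \<in> carrier ?F" "S \<subseteq> B" for f S
    using fR[OF that(1)] e that(2) by auto
  show ?thesis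
    unfolding mod_hom_def
  proof (intro CollectI conjI ballI funcsetI)
    fix f assume f: "f \<in> carrier ?F"
    show "linear_ext R A e f \<in> carrier A"
      unfolding linear_ext_def by (rule A.finsum_closed) (rule fA[OF f fs(2)[OF f]])
    fix g assume g: "g \<in> carrier ?F"
    let ?S = "?s f \<union> ?s g"
    have S: "finite ?S" "?S \<subseteq> B" using fs[OF f] fs[OF g] by auto
    have "linear_ext R A e (f \<oplus>\<^bsub>?F\<^esub> g) = (\<Oplus>\<^bsub>A\<^esub>b\<in>?S. (f \<oplus>\<^bsub>?F\<^esub> g) b \<odot>\<^bsub>A\<^esub> e b)"
      by (rule linear_ext_superset[OF A F.a_closed[OF f g] e S(1) _ S(2)])
         (auto simp: free_module_simps)
    also have "\<dots> = (\<Oplus>\<^bsub>A\<^esub>b\<in>?S. f b \<odot>\<^bsub>A\<^esub> e b \<oplus>\<^bsub>A\<^esub> g b \<odot>\<^bsub>A\<^esub> e b)"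
    proof (rule A.finsum_cong')
      fix b assume "b \<in> ?S"
      then have "e b \<in> carrier A" using S(2) e by blast
      then show "(f \<oplus>\<^bsub>?F\<^esub> g) b \<odot>\<^bsub>A\<^esub> e b = f b \<odot>\<^bsub>A\<^esub> e b \<oplus>\<^bsub>A\<^esub> g b \<odot>\<^bsub>A\<^esub> e b"
        unfolding free_module_simps using fR[OF f] fR[OF g] by (simp add: A.smult_l_distr)
    qed (use fA[OF f S(2)] fA[OF g S(2)] in auto)
    also have "\<dots> = (\<Oplus>\<^bsub>A\<^esub>b\<in>?S. f b \<odot>\<^bsub>A\<^esub> e b) \<oplus>\<^bsub>A\<^esub> (\<Oplus>\<^bsub>A\<^esub>b\<in>?S. g b \<odot>\<^bsub>A\<^esub> e b)"
      by (rule A.finsum_addf[OF fA[OF f S(2)] fA[OF g S(2)]])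
    also have "\<dots> = linear_ext R A e f \<oplus>\<^bsub>A\<^esub> linear_ext R A e g"
      using linear_ext_superset[OF A f e S(1) _ S(2)] linear_ext_superset[OF A g e S(1) _ S(2)] by simp
    finally show "linear_ext R A e (f \<oplus>\<^bsub>?F\<^esub> g) = linear_ext R A e f \<oplus>\<^bsub>A\<^esub> linear_ext R A e g" .
  next
    fix r f assume r: "r \<in> carrier R" and f: "f \<in> carrier ?F"
    let ?S = "?s f"
    note S = fs[OF f]
    have "linear_ext R A e (r \<odot>\<^bsub>?F\<^esub> f) = (\<Oplus>\<^bsub>A\<^esub>b\<in>?S. (r \<odot>\<^bsub>?F\<^esub> f) b \<odot>\<^bsub>A\<^esub> e b)"
      by (rule linear_ext_superset[OF A F.smult_closed[OF r f] e S(1) _ S(2)])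
         (use r in \<open>auto simp: free_module_simps\<close>)
    also have "\<dots> = (\<Oplus>\<^bsub>A\<^esub>b\<in>?S. r \<odot>\<^bsub>A\<^esub> (f b \<odot>\<^bsub>A\<^esub> e b))"
    proof (rule A.finsum_cong')
      fix b assume "b \<in> ?S"
      then have "e b \<in> carrier A" using S(2) e by blast
      then show "(r \<odot>\<^bsub>?F\<^esub> f) b \<odot>\<^bsub>A\<^esub> e b = r \<odot>\<^bsub>A\<^esub> (f b \<odot>\<^bsub>A\<^esub> e b)"
        unfolding free_module_simps using fR[OF f] r by (simp add: A.smult_assoc1)
    qed (use fA[OF f S(2)] r in auto)
    also have "\<dots> = r \<odot>\<^bsub>A\<^esub> linear_ext R A e f"
      unfolding linear_ext_def using A.finsum_smult_ldistr[OF S(1) r fA[OF f S(2)]] by simp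
    finally show "linear_ext R A e (r \<odot>\<^bsub>?F\<^esub> f) = r \<odot>\<^bsub>A\<^esub> linear_ext R A e f" .
  qed
qed

lemma finsum_free_module_UNIV:
  assumes R: "cring R" and S: "finite S" and g: "g \<in> S \<rightarrow> carrier (free_module R B)"
  shows "(\<Oplus>\<^bsub>free_module R UNIV\<^esub>b\<in>S. g b) = (\<Oplus>\<^bsub>free_module R B\<^esub>b\<in>S. g b)"
proof -
  let ?F = "free_module R B" and ?U = "free_module R UNIV"
  interpret F: module R ?F by (rule free_module_module[OF R])
  interpret U: module R ?U by (rule free_module_module[OF R])
  have sub: "carrier ?F \<subseteq> carrier ?U" by (auto simp: free_module_simps)
  show ?thesis
    using S g
  proof (induction S rule: finite_induct)
    case empty
    then show ?case by (simp add: free_module_simps)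
  next
    case (insert b S)
    then have g: "g \<in> S \<rightarrow> carrier ?F" "g b \<in> carrier ?F" "g \<in> S \<rightarrow> carrier ?U" "g b \<in> carrier ?U"
      using sub by auto
    show ?case
      unfolding F.finsum_insert[OF insert.hyps g(1,2)] U.finsum_insert[OF insert.hyps g(3,4)]
        insert.IH[OF g(1)] by (simp only: free_module_simps)
  qed
qed

lemma linear_ext_free_hom:
  assumes R: "cring R" and e: "e \<in> B \<rightarrow> carrier (free_module R B')"
  shows "linear_ext R (free_module R UNIV) e \<in> mod_hom R (free_module R B) (free_module R B')"
proof -
  let ?F' = "free_module R B'" and ?U = "free_module R UNIV"
  interpret F': module R ?F' by (rule free_module_module[OF R])
  have "linear_ext R ?U e f = linear_ext R ?F' e f" if f: "f \<in> carrier (free_module R B)" for f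
  proof -
    have "(\<lambda>b. f b \<odot>\<^bsub>?F'\<^esub> e b) \<in> {b. f b \<noteq> \<zero>\<^bsub>R\<^esub>} \<rightarrow> carrier ?F'"
      using f e unfolding free_module_simps(1)[of f] by (intro funcsetI F'.smult_closed) auto
    then show ?thesis
      using f finsum_free_module_UNIV[OF R, of "{b. f b \<noteq> \<zero>\<^bsub>R\<^esub>}" "\<lambda>b. f b \<odot>\<^bsub>?F'\<^esub> e b" B']
      unfolding linear_ext_def free_module_simps(1,4) by simp
  qed
  moreover have "f \<oplus>\<^bsub>free_module R B\<^esub> g \<in> carrier (free_module R B)"
    "r \<in> carrier R \<Longrightarrow> r \<odot>\<^bsub>free_module R B\<^esub> f \<in> carrier (free_module R B)"
    if "f \<in> carrier (free_module R B)" "g \<in> carrier (free_module R B)" for f g r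
    using free_module_module[OF R, of B] that
    by (auto intro: module.smult_closed abelian_monoid.a_closed[OF abelian_group.axioms(1)[OF module.axioms(2)]])
  ultimately show ?thesis
    using linear_ext_hom[OF free_module_module[OF R] e] unfolding mod_hom_def
    by (simp add: Pi_iff)
qed

lemma formal_comb_closed:
  assumes R: "cring R" and l: "set l \<subseteq> B \<times> carrier R"
  shows "formal_comb R l \<in> carrier (free_module R B)"
  using l
proof (induction l)
  case Nil
  then show ?case using R by (simp add: free_module_simps cring.cring_simprules)
next
  case (Cons p l)
  obtain b r where p: "p = (b, r)" by (cases p)
  interpret cring R by fact
  from Cons have IH: "formal_comb R l \<in> carrier (free_module R B)" "b \<in> B" "r \<in> carrier R"
    by (auto simp: p)
  have "{b'. formal_comb R (p # l) b' \<noteq> \<zero>\<^bsub>R\<^esub>} \<subseteq> insert b {b'. formal_comb R l b' \<noteq> \<zero>\<^bsub>R\<^esub>}"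
    by (auto simp: p)
  moreover have "finite (insert b {b'. formal_comb R l b' \<noteq> \<zero>\<^bsub>R\<^esub>})"
    "insert b {b'. formal_comb R l b' \<noteq> \<zero>\<^bsub>R\<^esub>} \<subseteq> B"
    using IH by (auto simp: free_module_simps)
  ultimately have "finite {b'. formal_comb R (p # l) b' \<noteq> \<zero>\<^bsub>R\<^esub>}"
    "{b'. formal_comb R (p # l) b' \<noteq> \<zero>\<^bsub>R\<^esub>} \<subseteq> B"
    by (blast intro: finite_subset)+
  moreover have "formal_comb R (p # l) b' \<in> carrier R" for b'
    using IH unfolding free_module_simps(1) by (auto simp: p)
  ultimately show ?case unfolding free_module_simps(1) by blast
qed

lemma formal_comb_surj:
  assumes R: "cring R" and f: "f \<in> carrier (free_module R B)"
  obtains l where "set l \<subseteq> B \<times> carrier R" "formal_comb R l = f"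
proof -
  interpret cring R by fact
  have *: "\<exists>l. set l \<subseteq> B \<times> carrier R \<and> formal_comb R l = f"
    if "finite S" "\<And>b. f b \<in> carrier R" "S \<subseteq> B" "{b. f b \<noteq> \<zero>\<^bsub>R\<^esub>} \<subseteq> S" for S f
    using that
  proof (induction S arbitrary: f rule: finite_induct)
    case empty
    then have "f = (\<lambda>b. \<zero>\<^bsub>R\<^esub>)" by auto
    then show ?case by (intro exI[of _ "[]"]) simp
  next
    case (insert b S)
    have "\<exists>l. set l \<subseteq> B \<times> carrier R \<and> formal_comb R l = f(b := \<zero>\<^bsub>R\<^esub>)"
      by (rule insert.IH) (use insert.prems in \<open>auto split: if_splits\<close>)
    then obtain l where "set l \<subseteq> B \<times> carrier R" "formal_comb R l = f(b := \<zero>\<^bsub>R\<^esub>)" by blast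
    then show ?case
      using insert.prems by (intro exI[of _ "(b, f b) # l"]) auto
  qed
  show thesis
    using *[of "{b. f b \<noteq> \<zero>\<^bsub>R\<^esub>}" f] f that unfolding free_module_simps(1) by blast
qed

lemma linear_ext_basis:
  assumes A: "module R A" and e: "e b \<in> carrier A"
  shows "linear_ext R A e (formal_comb R [(b, \<one>\<^bsub>R\<^esub>)]) = e b"
proof -
  interpret A: module R A by fact
  have "linear_ext R A e (formal_comb R [(b, \<one>\<^bsub>R\<^esub>)]) =
      (\<Oplus>\<^bsub>A\<^esub>b'\<in>{b}. formal_comb R [(b, \<one>\<^bsub>R\<^esub>)] b' \<odot>\<^bsub>A\<^esub> e b')"
    by (rule linear_ext_superset[OF A formal_comb_closed[OF A.R.is_cring, of _ "{b}"]]) (use e in auto)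
  also have "\<dots> = e b" using e by simp
  finally show ?thesis .
qed

lemma std_bd_hom:
  assumes R: "cring R"
  shows "std_bd R \<in> mod_hom R (free_module R (std_basis R T (Suc p))) (free_module R (std_basis R T p))"
  unfolding std_bd_def
proof (rule linear_ext_free_hom[OF R], rule funcsetI)
  fix b assume "b \<in> std_basis R T (Suc p)"
  then obtain l where "b = Rel l" "set l \<subseteq> std_basis R T p \<times> carrier R" by (cases p) auto
  then show "(case b of Gen t \<Rightarrow> \<lambda>_. \<zero>\<^bsub>R\<^esub> | Rel l \<Rightarrow> formal_comb R l) \<in> carrier (free_module R (std_basis R T p))"
    using formal_comb_closed[OF R] by simp
qed

lemma std_aug_hom:
  assumes T: "module R T"
  shows "std_aug R T \<in> mod_hom R (free_module R (std_basis R T 0)) T"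
  unfolding std_aug_def by (rule linear_ext_hom[OF T]) auto

lemma std_bd_Rel:
  assumes R: "cring R" and b: "Rel l \<in> std_basis R T (Suc p)"
  shows "std_bd R (formal_comb R [(Rel l, \<one>\<^bsub>R\<^esub>)]) = formal_comb R l"
proof -
  have "set l \<subseteq> std_basis R T p \<times> carrier R" using b by (cases p) auto
  then have l: "set l \<subseteq> UNIV \<times> carrier R" by auto
  from linear_ext_basis[OF free_module_module[OF R], of "\<lambda>b. case b of Gen t \<Rightarrow> \<lambda>_. \<zero>\<^bsub>R\<^esub> | Rel l \<Rightarrow> formal_comb R l" "Rel l" UNIV]
  show ?thesis using formal_comb_closed[OF R l] unfolding std_bd_def by simp
qed

lemma hom_std_bd_zero:
  assumes A: "module R A" and h: "h \<in> mod_hom R (free_module R (std_basis R T p)) A"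
    and z: "\<And>l. Rel l \<in> std_basis R T (Suc p) \<Longrightarrow> h (formal_comb R l) = \<zero>\<^bsub>A\<^esub>"
    and f: "f \<in> carrier (free_module R (std_basis R T (Suc p)))"
  shows "h (std_bd R f) = \<zero>\<^bsub>A\<^esub>"
proof -
  interpret A: module R A by fact
  note R = A.R.is_cring
  let ?F = "free_module R (std_basis R T p)" and ?U = "free_module R UNIV"
  interpret F: module R ?F by (rule free_module_module[OF R])
  let ?s = "{b. f b \<noteq> \<zero>\<^bsub>R\<^esub>}"
  let ?e = "\<lambda>b. case b of Gen t \<Rightarrow> \<lambda>_. \<zero>\<^bsub>R\<^esub> | Rel l \<Rightarrow> formal_comb R l"
  have fR: "f b \<in> carrier R" and fs: "finite ?s" "?s \<subseteq> std_basis R T (Suc p)" for b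
    using f unfolding free_module_simps(1) by auto
  have e: "?e b \<in> carrier ?F \<and> h (?e b) = \<zero>\<^bsub>A\<^esub>" if "b \<in> ?s" for b
  proof -
    have b: "b \<in> std_basis R T (Suc p)" using that fs by blast
    then obtain l where l: "b = Rel l" "set l \<subseteq> std_basis R T p \<times> carrier R" by (cases p) auto
    then show ?thesis using formal_comb_closed[OF R l(2)] z[of l] b by simp
  qed
  have c: "(\<lambda>b. f b \<odot>\<^bsub>?F\<^esub> ?e b) \<in> ?s \<rightarrow> carrier ?F"
    by (intro funcsetI F.smult_closed fR) (use e in blast)
  have "std_bd R f = (\<Oplus>\<^bsub>?F\<^esub>b\<in>?s. f b \<odot>\<^bsub>?F\<^esub> ?e b)"
    unfolding std_bd_def linear_ext_def using finsum_free_module_UNIV[OF R fs(1) c]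
    by (simp only: free_module_simps)
  then have "h (std_bd R f) = (\<Oplus>\<^bsub>A\<^esub>b\<in>?s. h (f b \<odot>\<^bsub>?F\<^esub> ?e b))"
    using mod_hom_finsum[OF h F.module_axioms A fs(1) c] by simp
  also have "\<dots> = (\<Oplus>\<^bsub>A\<^esub>b\<in>?s. \<zero>\<^bsub>A\<^esub>)"
  proof (rule A.finsum_cong')
    fix b assume b: "b \<in> ?s"
    have "h (f b \<odot>\<^bsub>?F\<^esub> ?e b) = f b \<odot>\<^bsub>A\<^esub> h (?e b)"
      using e[OF b] by (intro mod_homD(3)[OF h] fR) blast
    then show "h (f b \<odot>\<^bsub>?F\<^esub> ?e b) = \<zero>\<^bsub>A\<^esub>" using e[OF b] fR by simp
  qed auto
  finally show ?thesis by simp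
qed

lemma std_res_cochain_complex:
  assumes T: "module R T"
  shows "cochain_complex R (std_res R T)"
proof -
  interpret T: module R T by fact
  note R = T.R.is_cring
  have "dif (std_res R T) j \<in> mod_hom R (obj (std_res R T) j) (obj (std_res R T) (j + 1))" for j
  proof (cases "j < 0")
    case True
    then obtain p where p: "nat (- j) = Suc p" "nat (- (j + 1)) = p" by (cases "nat (- j)") auto
    then show ?thesis using True std_bd_hom[OF R, of T p] by (simp add: std_res_def)
  next
    case False
    then show ?thesis
      using T.R.zero_closed by (simp add: std_res_def mod_hom_def free_module_simps)
  qed
  moreover have "dif (std_res R T) (j + 1) (dif (std_res R T) j x) = \<zero>\<^bsub>obj (std_res R T) (j + 2)\<^esub>"
    if x: "x \<in> carrier (obj (std_res R T) j)" for j x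
  proof (cases "j + 1 < 0")
    case True
    then have p: "nat (- j) = Suc (Suc (nat (- j - 2)))" by linarith
    have "std_bd R (std_bd R x) = \<zero>\<^bsub>free_module R (std_basis R T (nat (- j - 2)))\<^esub>"
      by (rule hom_std_bd_zero[OF free_module_module[OF R] std_bd_hom[OF R]])
         (use x True p in \<open>auto simp: std_res_def free_module_simps(2)\<close>)
    then show ?thesis using True by (simp add: std_res_def free_module_simps(2))
  next
    case False
    then show ?thesis by (simp add: std_res_def free_module_simps(2))
  qed
  moreover have "module R (obj (std_res R T) j)" for j
    by (simp add: std_res_def free_module_module[OF R])
  ultimately show ?thesis
    unfolding cochain_complex_def by blast
qed

text \<open>The standard resolution is exact in negative degrees, and its augmentation identifies
  the cokernel of the last differential with \<open>T\<close>.\<close>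

lemma std_res_exact:
  assumes T: "module R T"
  shows "j < 0 \<Longrightarrow> cocycles (std_res R T) j = coboundaries (std_res R T) j"
    and "std_aug R T ` carrier (obj (std_res R T) 0) = carrier T"
    and "{f \<in> carrier (obj (std_res R T) 0). std_aug R T f = \<zero>\<^bsub>T\<^esub>} = coboundaries (std_res R T) 0"
proof -
  interpret T: module R T by fact
  note R = T.R.is_cring
  let ?F = "\<lambda>p. free_module R (std_basis R T p)"
  have one: "formal_comb R [(b, \<one>\<^bsub>R\<^esub>)] \<in> carrier (free_module R B)" if "b \<in> B" for b B
    by (rule formal_comb_closed[OF R]) (use that in auto)
  show "cocycles (std_res R T) j = coboundaries (std_res R T) j" if j: "j < 0"
  proof (intro subset_antisym subsetI)
    obtain p where p: "nat (- j) = Suc p" using j by (cases "nat (- j)") auto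
    then have p': "nat (1 - j) = Suc (Suc p)" using j by linarith
    fix x assume "x \<in> cocycles (std_res R T) j"
    then have x: "x \<in> carrier (?F (Suc p))" "std_bd R x = (\<lambda>b. \<zero>\<^bsub>R\<^esub>)"
      using j p by (auto simp: cocycles_def std_res_def free_module_simps(2))
    obtain l where l: "set l \<subseteq> std_basis R T (Suc p) \<times> carrier R" "formal_comb R l = x"
      using formal_comb_surj[OF R x(1)] .
    then have b: "Rel l \<in> std_basis R T (Suc (Suc p))" using x(2) by simp
    have "x = std_bd R (formal_comb R [(Rel l, \<one>\<^bsub>R\<^esub>)])" using std_bd_Rel[OF R b] l(2) by simp
    moreover have "formal_comb R [(Rel l, \<one>\<^bsub>R\<^esub>)] \<in> carrier (?F (Suc (Suc p)))" by (rule one[OF b])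
    ultimately show "x \<in> coboundaries (std_res R T) j"
      using j p' unfolding coboundaries_def by (simp add: std_res_def)
  next
    fix x assume "x \<in> coboundaries (std_res R T) j"
    then obtain y where y: "y \<in> carrier (obj (std_res R T) (j - 1))" "x = dif (std_res R T) (j - 1) y"
      unfolding coboundaries_def by blast
    have C: "cochain_complex R (std_res R T)" by (rule std_res_cochain_complex[OF T])
    then have "dif (std_res R T) (j - 1) \<in> mod_hom R (obj (std_res R T) (j - 1)) (obj (std_res R T) (j - 1 + 1))"
      unfolding cochain_complex_def by blast
    then have "x \<in> carrier (obj (std_res R T) j)"
      using y by (simp add: mod_hom_def Pi_iff)
    moreover have "dif (std_res R T) (j - 1 + 1) (dif (std_res R T) (j - 1) y) = \<zero>\<^bsub>obj (std_res R T) (j - 1 + 2)\<^esub>"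
      using C y unfolding cochain_complex_def by blast
    ultimately show "x \<in> cocycles (std_res R T) j"
      using y unfolding cocycles_def by (simp add: add.commute)
  qed
  have obj0: "obj (std_res R T) 0 = ?F 0"
    and cob0: "coboundaries (std_res R T) 0 = std_bd R ` carrier (?F (Suc 0))"
    by (simp_all add: std_res_def coboundaries_def)
  have aug: "std_aug R T \<in> mod_hom R (?F 0) T" by (rule std_aug_hom[OF T])
  show "std_aug R T ` carrier (obj (std_res R T) 0) = carrier T"
  proof (intro subset_antisym subsetI)
    fix t assume t: "t \<in> carrier T"
    have "std_aug R T (formal_comb R [(Gen t, \<one>\<^bsub>R\<^esub>)]) = t"
      unfolding std_aug_def
      using linear_ext_basis[OF T, of "\<lambda>b. case b of Gen t \<Rightarrow> t | Rel l \<Rightarrow> \<zero>\<^bsub>T\<^esub>" "Gen t"] t by simp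
    moreover have "formal_comb R [(Gen t, \<one>\<^bsub>R\<^esub>)] \<in> carrier (?F 0)" by (rule one) (use t in simp)
    ultimately show "t \<in> std_aug R T ` carrier (obj (std_res R T) 0)"
      unfolding obj0 by (metis image_eqI)
  next
    fix t assume "t \<in> std_aug R T ` carrier (obj (std_res R T) 0)"
    then show "t \<in> carrier T" using mod_homD(1)[OF aug] by (auto simp: std_res_def)
  qed
  show "{f \<in> carrier (obj (std_res R T) 0). std_aug R T f = \<zero>\<^bsub>T\<^esub>} = coboundaries (std_res R T) 0"
  proof (intro subset_antisym subsetI)
    fix x assume "x \<in> {f \<in> carrier (obj (std_res R T) 0). std_aug R T f = \<zero>\<^bsub>T\<^esub>}"
    then have x: "x \<in> carrier (?F 0)" "std_aug R T x = \<zero>\<^bsub>T\<^esub>"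
      by (auto simp: std_res_def)
    obtain l where l: "set l \<subseteq> std_basis R T 0 \<times> carrier R" "formal_comb R l = x"
      using formal_comb_surj[OF R x(1)] .
    then have b: "Rel l \<in> std_basis R T (Suc 0)" using x(2) by simp
    have "x = std_bd R (formal_comb R [(Rel l, \<one>\<^bsub>R\<^esub>)])" using std_bd_Rel[OF R b] l(2) by simp
    moreover have "formal_comb R [(Rel l, \<one>\<^bsub>R\<^esub>)] \<in> carrier (?F (Suc 0))" by (rule one[OF b])
    ultimately show "x \<in> coboundaries (std_res R T) 0"
      unfolding cob0 by (rule image_eqI)
  next
    fix x assume "x \<in> coboundaries (std_res R T) 0"
    then obtain y where y: "y \<in> carrier (?F (Suc 0))" "x = std_bd R y"
      unfolding coboundaries_def by (auto simp: std_res_def)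
    have "std_aug R T x = \<zero>\<^bsub>T\<^esub>" unfolding y(2)
      by (rule hom_std_bd_zero[OF T aug _ y(1)]) simp
    moreover have "x \<in> carrier (?F 0)" using y mod_homD(1)[OF std_bd_hom[OF R]] by blast
    ultimately show "x \<in> {f \<in> carrier (obj (std_res R T) 0). std_aug R T f = \<zero>\<^bsub>T\<^esub>}"
      by (simp add: std_res_def)
  qed
qed

lemma Hom_smult_closed:
  assumes A: "module R A" and B: "module R B" and r: "r \<in> carrier R" and f: "f \<in> carrier (Hom R A B)"
  shows "r \<odot>\<^bsub>Hom R A B\<^esub> f \<in> carrier (Hom R A B)"
proof -
  interpret A: module R A by fact
  interpret B: module R B by fact
  have f: "f \<in> mod_hom R A B" using f by (simp add: Hom_def)
  note fx = mod_homD[OF f]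
  have "(\<lambda>x\<in>carrier A. r \<odot>\<^bsub>B\<^esub> f x) \<in> mod_hom R A B"
    unfolding mod_hom_def
  proof (intro CollectI conjI ballI funcsetI)
    fix x assume x: "x \<in> carrier A"
    then show "(\<lambda>x\<in>carrier A. r \<odot>\<^bsub>B\<^esub> f x) x \<in> carrier B" using r fx(1) by simp
    fix y assume y: "y \<in> carrier A"
    show "(\<lambda>x\<in>carrier A. r \<odot>\<^bsub>B\<^esub> f x) (x \<oplus>\<^bsub>A\<^esub> y) =
        (\<lambda>x\<in>carrier A. r \<odot>\<^bsub>B\<^esub> f x) x \<oplus>\<^bsub>B\<^esub> (\<lambda>x\<in>carrier A. r \<odot>\<^bsub>B\<^esub> f x) y"
      using x y r fx(1)[OF x] fx(1)[OF y] fx(2)[OF x y] by (simp add: B.smult_r_distr)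
  next
    fix q x assume q: "q \<in> carrier R" and x: "x \<in> carrier A"
    have "r \<odot>\<^bsub>B\<^esub> (q \<odot>\<^bsub>B\<^esub> f x) = q \<odot>\<^bsub>B\<^esub> (r \<odot>\<^bsub>B\<^esub> f x)"
      using q r fx(1)[OF x] A.R.m_comm[OF q r] by (simp add: B.smult_assoc1[symmetric])
    then show "(\<lambda>x\<in>carrier A. r \<odot>\<^bsub>B\<^esub> f x) (q \<odot>\<^bsub>A\<^esub> x) = q \<odot>\<^bsub>B\<^esub> (\<lambda>x\<in>carrier A. r \<odot>\<^bsub>B\<^esub> f x) x"
      using x q fx(3)[OF q x] by simp
  qed
  then show ?thesis by (simp add: Hom_def)
qed

lemma single_module:
  assumes "module R A"
  shows "module R (obj (single c A) j)"
proof -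
  interpret module R A by fact
  have "submodule {\<zero>\<^bsub>A\<^esub>} R A" by (rule submoduleI) auto
  then show ?thesis
    using submodule.submodule_is_module[OF _ assms] assms by (auto simp: single_def sub_module_def)
qed

lemma Ext_single_shift:
  fixes R :: "('r, 'q) ring_scheme" and T :: "('r, 't) module" and A :: "('r, 'x) module"
  assumes T: "module R T" and A: "module R A"
  shows "Ext R T (single c A) (i + c) = Ext R T (single 0 A) i"
proof -
  let ?F = "std_res R T" and ?S = "single 0 A"
  let ?H = "\<lambda>c. Hom_complex R ?F (single c A)"
  have F: "module R (obj ?F p)" "dif ?F p \<in> mod_hom R (obj ?F p) (obj ?F (p + 1))" for p
    using std_res_cochain_complex[OF T] unfolding cochain_complex_def by auto
  have S: "module R (obj ?S j)" for j by (rule single_module[OF A])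
  interpret A: module R A by fact
  have objS: "obj (single c A) (j + c) = obj ?S j" for j by (simp add: single_def)
  have objH: "obj (?H c) (n + c) = obj (?H 0) n" for n
    unfolding Hom_complex_def Let_def using objS by (simp add: add.assoc[symmetric])
  have difH: "dif (?H c') n f = (\<lambda>p. \<lambda>a\<in>carrier (obj ?F p).
      if even n then \<zero>\<^bsub>A\<^esub> \<ominus>\<^bsub>obj (single c' A) (p + n + 1)\<^esub> f (p + 1) (dif ?F p a)
      else \<zero>\<^bsub>A\<^esub> \<oplus>\<^bsub>obj (single c' A) (p + n + 1)\<^esub> f (p + 1) (dif ?F p a))" for c' n f
    unfolding Hom_complex_def Let_def by (simp add: single_def cong: if_cong)
  have zeroS: "\<zero>\<^bsub>obj ?S j\<^esub> = \<zero>\<^bsub>A\<^esub>" for j by (simp add: single_def sub_module_def)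
  define neg where "neg f = (\<lambda>p. (\<ominus>\<^bsub>R\<^esub> \<one>\<^bsub>R\<^esub>) \<odot>\<^bsub>Hom R (obj ?F p) A\<^esub> f p)"
    for f :: "int \<Rightarrow> (('t, 'r) syz \<Rightarrow> 'r) \<Rightarrow> 'x"
  have smultS: "r \<odot>\<^bsub>Hom R (obj ?F p) (obj ?S j)\<^esub> f = r \<odot>\<^bsub>Hom R (obj ?F p) A\<^esub> f" for r p j f
    by (simp add: Hom_def single_def sub_module_def)
  have carH: "f \<in> carrier (obj (?H 0) n) \<longleftrightarrow> (\<forall>p. f p \<in> carrier (Hom R (obj ?F p) (obj ?S (p + n))))" for f n
    unfolding Hom_complex_def Let_def by simp
  have neg: "neg f \<in> carrier (obj (?H 0) n)" if "f \<in> carrier (obj (?H 0) n)" for f n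
    using that Hom_smult_closed[OF F(1) S, of "\<ominus>\<^bsub>R\<^esub> \<one>\<^bsub>R\<^esub>"] unfolding carH neg_def smultS by simp
  have val: "f (p + 1) (dif ?F p a) \<in> carrier (obj ?S (p + n + 1))"
    if "f \<in> carrier (obj (?H 0) n)" "a \<in> carrier (obj ?F p)" for f n p a
  proof -
    have "f (p + 1) \<in> mod_hom R (obj ?F (p + 1)) (obj ?S (p + 1 + n))"
      using that(1) unfolding carH Hom_def by simp
    then show ?thesis
      using mod_homD(1)[OF _ mod_homD(1)[OF F(2) that(2)]] by (simp add: algebra_simps)
  qed
  have key: "dif (?H c) (n + c) f = (if even c then dif (?H 0) n f else dif (?H 0) n (neg f))"
    if f: "f \<in> carrier (obj (?H 0) n)" for f n
  proof -
    have "dif (?H c) (n + c) f p a = (if even c then dif (?H 0) n f else dif (?H 0) n (neg f)) p a" for p a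
    proof (cases "a \<in> carrier (obj ?F p)")
      case a: True
      interpret Y: module R "obj ?S (p + n + 1)" by (rule S)
      let ?z = "f (p + 1) (dif ?F p a)"
      have obj: "obj (single c A) (p + (n + c) + 1) = obj ?S (p + n + 1)"
        using objS[of "p + n + 1"] by (simp add: algebra_simps)
      have z: "?z \<in> carrier (obj ?S (p + n + 1))" by (rule val[OF f a])
      have "neg f (p + 1) (dif ?F p a) = (\<ominus>\<^bsub>R\<^esub> \<one>\<^bsub>R\<^esub>) \<odot>\<^bsub>A\<^esub> ?z"
        using mod_homD(1)[OF F(2) a] unfolding neg_def Hom_def by simp
      also have "\<dots> = (\<ominus>\<^bsub>R\<^esub> \<one>\<^bsub>R\<^esub>) \<odot>\<^bsub>obj ?S (p + n + 1)\<^esub> ?z"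
        by (simp add: single_def sub_module_def)
      also have "\<dots> = \<ominus>\<^bsub>obj ?S (p + n + 1)\<^esub> ?z"
        using z by (simp add: Y.smult_l_minus)
      finally have n: "neg f (p + 1) (dif ?F p a) = \<ominus>\<^bsub>obj ?S (p + n + 1)\<^esub> ?z" .
      show ?thesis
        using a z n Y.M.minus_minus[OF z] unfolding difH obj
        by (auto simp: a_minus_def zeroS[of "p + n + 1", symmetric])
    next
      case False
      then show ?thesis unfolding difH by simp
    qed
    then show ?thesis by (intro ext)
  qed
  have nn: "neg (neg f) = f" if f: "f \<in> carrier (obj (?H 0) n)" for f n
  proof (intro ext)
    fix p a
    have fp: "f p \<in> mod_hom R (obj ?F p) (obj ?S (p + n))" "f p \<in> extensional (carrier (obj ?F p))"
      using f unfolding carH Hom_def by auto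
    show "neg (neg f) p a = f p a"
    proof (cases "a \<in> carrier (obj ?F p)")
      case True
      then have "f p a \<in> carrier A"
        using mod_homD(1)[OF fp(1) True] by (auto simp: single_def sub_module_def split: if_splits)
      then show ?thesis using True by (simp add: neg_def Hom_def A.smult_l_minus A.minus_minus)
    next
      case False
      then show ?thesis using fp(2) by (simp add: neg_def Hom_def extensional_def)
    qed
  qed
  have "coboundaries (?H c) (i + c) = coboundaries (?H 0) i"
  proof -
    have "(\<lambda>f. dif (?H c) (i - 1 + c) f) ` carrier (obj (?H 0) (i - 1)) =
        dif (?H 0) (i - 1) ` carrier (obj (?H 0) (i - 1))"
    proof (cases "even c")
      case True
      then show ?thesis using key by (intro image_cong) auto
    next
      case False
      show ?thesis
      proof (intro subset_antisym subsetI)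
        fix x assume "x \<in> (\<lambda>f. dif (?H c) (i - 1 + c) f) ` carrier (obj (?H 0) (i - 1))"
        then show "x \<in> dif (?H 0) (i - 1) ` carrier (obj (?H 0) (i - 1))"
          using key False neg by auto
      next
        fix x assume "x \<in> dif (?H 0) (i - 1) ` carrier (obj (?H 0) (i - 1))"
        then obtain f where f: "f \<in> carrier (obj (?H 0) (i - 1))" "x = dif (?H 0) (i - 1) f" by blast
        then have "x = dif (?H c) (i - 1 + c) (neg f)"
          using key[OF neg[OF f(1)]] nn[OF f(1)] False by simp
        then show "x \<in> (\<lambda>f. dif (?H c) (i - 1 + c) f) ` carrier (obj (?H 0) (i - 1))"
          using neg[OF f(1)] by blast
      qed
    qed
    then show ?thesis
      unfolding coboundaries_def using objH[of "i - 1"] by (simp add: algebra_simps)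
  qed
  moreover have "cocycles (?H c) (i + c) = cocycles (?H 0) i"
  proof -
    have zH: "\<zero>\<^bsub>obj (?H 0) n\<^esub> = (\<lambda>p. \<lambda>a\<in>carrier (obj ?F p). \<zero>\<^bsub>A\<^esub>)" for n
      unfolding Hom_complex_def Let_def Hom_def using zeroS by simp
    have "dif (?H 0) i (neg f) = \<zero>\<^bsub>obj (?H 0) (i + 1)\<^esub> \<longleftrightarrow> dif (?H 0) i f = \<zero>\<^bsub>obj (?H 0) (i + 1)\<^esub>"
      if f: "f \<in> carrier (obj (?H 0) i)" for f
    proof -
      have "dif (?H 0) i g = \<zero>\<^bsub>obj (?H 0) (i + 1)\<^esub> \<longleftrightarrow>
          (\<forall>p. \<forall>a\<in>carrier (obj ?F p). g (p + 1) (dif ?F p a) = \<zero>\<^bsub>A\<^esub>)"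
        if g: "g \<in> carrier (obj (?H 0) i)" for g
      proof -
        have "dif (?H 0) i g p a = \<zero>\<^bsub>A\<^esub> \<longleftrightarrow> g (p + 1) (dif ?F p a) = \<zero>\<^bsub>A\<^esub>"
          if a: "a \<in> carrier (obj ?F p)" for p a
        proof -
          interpret Y: module R "obj ?S (p + i + 1)" by (rule S)
          have "g (p + 1) (dif ?F p a) \<in> carrier (obj ?S (p + i + 1))" by (rule val[OF g a])
          then show ?thesis
            using a Y.M.minus_minus[of "g (p + 1) (dif ?F p a)"] Y.add.inv_eq_1_iff
            unfolding difH by (auto simp: a_minus_def zeroS[of "p + i + 1", symmetric])
        qed
        moreover have "dif (?H 0) i g p \<in> extensional (carrier (obj ?F p))" for p
          unfolding difH by simp
        ultimately show ?thesis
          unfolding zH fun_eq_iff by (auto simp: restrict_def extensional_def)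
      qed
      note * = this
      have "(\<ominus>\<^bsub>R\<^esub> \<one>\<^bsub>R\<^esub>) \<odot>\<^bsub>A\<^esub> x = \<zero>\<^bsub>A\<^esub> \<longleftrightarrow> x = \<zero>\<^bsub>A\<^esub>" if "x \<in> carrier A" for x
        using that A.M.minus_minus[OF that] by (auto simp: A.smult_l_minus)
      moreover have "f (p + 1) (dif ?F p a) \<in> carrier A" if "a \<in> carrier (obj ?F p)" for p a
        using val[OF f that] by (auto simp: single_def sub_module_def split: if_splits)
      moreover have "neg f (p + 1) (dif ?F p a) = (\<ominus>\<^bsub>R\<^esub> \<one>\<^bsub>R\<^esub>) \<odot>\<^bsub>A\<^esub> f (p + 1) (dif ?F p a)"
        if "a \<in> carrier (obj ?F p)" for p a
        using mod_homD(1)[OF F(2) that] unfolding neg_def Hom_def by simp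
      ultimately show ?thesis unfolding *[OF f] *[OF neg[OF f]] by simp
    qed
    then show ?thesis
      unfolding cocycles_def using objH[of i] objH[of "i + 1"] key[of _ i]
      by (auto simp: algebra_simps split: if_splits)
  qed
  ultimately show ?thesis
    unfolding Ext_def cohomology_def using objH[of i] by simp
qed

end

theory Submission
  imports Defs
begin

text \<open>
  Let \<open>F\<^sub>s\<close> be the standard free resolution of \<open>N/I\<^sup>sN\<close>.  It is free, so \<open>Hom(F\<^sub>s, -)\<close> turns a short
  exact sequence \<open>X \<rightarrow> Y \<rightarrow> Z\<close> of complexes into one of Hom complexes, compatibly with the passage
  from \<open>s\<close> to \<open>s + 1\<close>.  Filtered colimits are exact, so the groups \<open>H\<^sup>i\<^sub>I(N, -)\<close> sit in a long exact
  sequence, and this sequence shows that \<open>H\<^sup>i\<^sub>I(N, X) \<rightarrow> H\<^sup>i\<^sub>I(N, Y)\<close> is an isomorphism for all \<open>i\<close> if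
  and only if \<open>H\<^sup>i\<^sub>I(N, Z) = 0\<close> for all \<open>i\<close>; likewise \<open>H\<^sup>i\<^sub>I(N, Y) \<rightarrow> H\<^sup>i\<^sub>I(N, Z)\<close> is one for all \<open>i\<close> if
  and only if all \<open>H\<^sup>i\<^sub>I(N, X)\<close> vanish.  These two consequences are obtained by diagram chases with
  cocycles (\<open>lim_iso_iff_coker_acyclic\<close>, \<open>lim_iso_iff_ker_acyclic\<close>, combined in
  \<open>gen_lc_short_exact\<close>).

  Part (i) is the first one for the sequence \<open>H[-c] \<rightarrow> \<Gamma>\<^sub>I(E) \<rightarrow> C\<close> that defines the truncation
  complex, with \<open>H = H\<^sup>c\<^sub>I(M)\<close>, and part (ii) is the second one for its dual
  \<open>D(C) \<rightarrow> D(\<Gamma>\<^sub>I(E)) \<rightarrow> D(H)[c]\<close>, which is exact because the dualizing module is injective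
  (\<open>dual_single_short_exact\<close>).  That the first map is an embedding at all rests on \<open>\<Gamma>\<^sub>I(E)\<^sup>j = 0\<close> for
  \<open>j < c\<close>, which follows from the minimality of \<open>E\<close> and the definition of the grade
  (\<open>torsion_complex_below_grade\<close>).  The maps of the theorem differ from these only by the comparison
  isomorphisms, which remain to be explained.

  The map \<open>M \<rightarrow> E\<close> has an acyclic cokernel, and \<open>Hom(F\<^sub>s, Z)\<close> is acyclic for every acyclic \<open>Z\<close>,
  bounded or not, because a null homotopy can be built from degree 0 downwards
  (\<open>std_res_null_homotopy\<close>).

  For \<open>\<Gamma>\<^sub>I(E) \<rightarrow> E\<close> let \<open>a\<^sub>1, \<dots>, a\<^sub>r\<close> generate \<open>I\<close> and filter \<open>E\<close> by the subcomplexes \<open>E\<^sub>k\<close> of elements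
  killed by powers of each of \<open>a\<^sub>1, \<dots>, a\<^sub>k\<close>.  Then \<open>E\<^sub>0 = E\<close> and \<open>E\<^sub>r = \<Gamma>\<^sub>I(E)\<close>, so it suffices that
  \<open>Hom(F\<^sub>s, E\<^sub>k/E\<^sub>k\<^sub>+\<^sub>1)\<close> is acyclic.  Put \<open>b = a\<^sub>k\<^sub>+\<^sub>1\<^sup>s\<close>.  Multiplication by \<open>b\<close> is bijective on \<open>E\<^sub>k/E\<^sub>k\<^sub>+\<^sub>1\<close>:
  an element \<open>x\<close> of an injective module over a Noetherian ring is divisible by \<open>b\<close> up to
  \<open>b\<close>-torsion, and the quotient can be chosen in the same \<open>E\<^sub>k\<close> as \<open>x\<close>, because it can be chosen to
  be killed by everything that kills \<open>x\<close> (\<open>injective_divisible\<close>, \<open>torsion_quotient_bij\<close>).  On the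
  other hand \<open>b\<close> kills \<open>N/I\<^sup>sN\<close>, so that it is null homotopic on \<open>F\<^sub>s\<close>.  A map that is both zero and
  bijective on cohomology leaves no cohomology (\<open>Hom_complex_acyclic_of_bij\<close>).  Duality preserves
  acyclicity and the bijectivity of \<open>b\<close>, so the same argument applies to the duals of both maps
  (\<open>dual_acyclic\<close>, \<open>dual_bij\<close>, \<open>Ext_dual_torsion_iso\<close>).
\<close>

section \<open>Modules and their quotients\<close>

lemma module_minus_add:
  assumes "module R A" "b \<in> carrier A" "y \<in> carrier A"
  shows "b \<oplus>\<^bsub>A\<^esub> (y \<ominus>\<^bsub>A\<^esub> b) = y" "(b \<oplus>\<^bsub>A\<^esub> y) \<ominus>\<^bsub>A\<^esub> y = b"
    and "b \<ominus>\<^bsub>A\<^esub> y = \<zero>\<^bsub>A\<^esub> \<longleftrightarrow> b = y" "y \<ominus>\<^bsub>A\<^esub> \<zero>\<^bsub>A\<^esub> = y"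
proof -
  interpret module R A by fact
  show "b \<oplus>\<^bsub>A\<^esub> (y \<ominus>\<^bsub>A\<^esub> b) = y"
    using assms(2,3) M.a_lcomm[of b y "\<ominus>\<^bsub>A\<^esub> b"] by (simp add: a_minus_def M.r_neg)
  show "(b \<oplus>\<^bsub>A\<^esub> y) \<ominus>\<^bsub>A\<^esub> y = b"
    using assms(2,3) by (simp add: a_minus_def M.a_assoc M.r_neg)
  show "b \<ominus>\<^bsub>A\<^esub> y = \<zero>\<^bsub>A\<^esub> \<longleftrightarrow> b = y"
    using assms(2,3) M.minus_equality[of b "\<ominus>\<^bsub>A\<^esub> y"] by (auto simp: a_minus_def M.r_neg)
  show "y \<ominus>\<^bsub>A\<^esub> \<zero>\<^bsub>A\<^esub> = y" using assms(3) add.inv_one by (simp add: a_minus_def a_inv_def)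
qed

lemma smult_swap:
  assumes "module R A" "r \<in> carrier R" "s \<in> carrier R" "x \<in> carrier A"
  shows "r \<odot>\<^bsub>A\<^esub> (s \<odot>\<^bsub>A\<^esub> x) = s \<odot>\<^bsub>A\<^esub> (r \<odot>\<^bsub>A\<^esub> x)"
proof -
  interpret module R A by fact
  show ?thesis using smult_assoc1[of r s x] smult_assoc1[of s r x] R.m_comm[of r s] assms by simp
qed

lemma submodule_criterion:
  assumes "module R A" "K \<subseteq> carrier A" "\<zero>\<^bsub>A\<^esub> \<in> K"
    and "\<And>x y. x \<in> K \<Longrightarrow> y \<in> K \<Longrightarrow> x \<oplus>\<^bsub>A\<^esub> y \<in> K"
    and "\<And>r x. r \<in> carrier R \<Longrightarrow> x \<in> K \<Longrightarrow> r \<odot>\<^bsub>A\<^esub> x \<in> K"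
  shows "submodule K R A"
proof -
  interpret module R A by fact
  show ?thesis
  proof (rule submoduleI)
    fix x assume "x \<in> K"
    then show "\<ominus>\<^bsub>A\<^esub> x \<in> K"
      using assms(5)[of "\<ominus>\<^bsub>R\<^esub> \<one>\<^bsub>R\<^esub>" x] assms(2) by (auto simp: smult_l_minus)
  qed (use assms in auto)
qed

lemma submodule_zero:
  assumes "submodule K R A"
  shows "\<zero>\<^bsub>A\<^esub> \<in> K"
  using submodule.axioms(1)[OF assms] subgroup.one_closed by fastforce

lemma sub_module_simps [simp]:
  "carrier (sub_module A K) = K"
  "\<zero>\<^bsub>sub_module A K\<^esub> = \<zero>\<^bsub>A\<^esub>"
  "x \<oplus>\<^bsub>sub_module A K\<^esub> y = x \<oplus>\<^bsub>A\<^esub> y"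
  "r \<odot>\<^bsub>sub_module A K\<^esub> x = r \<odot>\<^bsub>A\<^esub> x"
  "L +>\<^bsub>sub_module A K\<^esub> x = L +>\<^bsub>A\<^esub> x"
  by (simp_all add: sub_module_def a_r_coset_def')

lemma sub_module_module:
  assumes "module R A" "submodule K R A"
  shows "module R (sub_module A K)"
  using submodule.submodule_is_module[OF assms(2,1)] by (simp add: sub_module_def)

lemma submodule_sub_module:
  assumes A: "module R A" and L: "submodule L R A" and K: "submodule K R A" "K \<subseteq> L"
  shows "submodule K R (sub_module A L)"
  using module.submoduleE[OF A K(1)] submodule_zero[OF K(1)] K(2)
  by (intro submodule_criterion sub_module_module A L) auto

lemma submodule_abelian_subgroup:
  assumes "module R A" "submodule K R A"
  shows "abelian_subgroup K A"
  using assms(1) submodule.axioms(1)[OF assms(2)]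
  by (intro abelian_subgroupI3 additive_subgroup.intro) (simp_all add: module_def)

context
  fixes R :: "('r, 'q) ring_scheme" and A :: "('r, 'a) module" and K :: "'a set"
  assumes A: "module R A" and K: "submodule K R A"
begin

interpretation module R A by (rule A)
interpretation K: abelian_subgroup K A by (rule submodule_abelian_subgroup[OF A K])

lemma coset_eq_iff:
  assumes "x \<in> carrier A" "y \<in> carrier A"
  shows "K +>\<^bsub>A\<^esub> x = K +>\<^bsub>A\<^esub> y \<longleftrightarrow> x \<ominus>\<^bsub>A\<^esub> y \<in> K"
proof -
  have "K +>\<^bsub>A\<^esub> x = K +>\<^bsub>A\<^esub> y \<longleftrightarrow> x \<in> K +>\<^bsub>A\<^esub> y"
    using K.a_rcos_self[OF assms(1)] K.a_repr_independence'[OF _ assms(2), of x] by auto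
  then show ?thesis using K.a_rcos_module[OF assms(2,1)] by (simp add: a_minus_def)
qed

lemma coset_mem:
  assumes "x \<in> carrier A"
  shows "x \<in> K +>\<^bsub>A\<^esub> x"
  by (rule K.a_rcos_self[OF assms])

lemma coset_zero: "K +>\<^bsub>A\<^esub> \<zero>\<^bsub>A\<^esub> = K"
  using submoduleE(1)[OF K] by (rule a_coset_add_zero)

lemma coset_zero_iff:
  assumes "x \<in> carrier A"
  shows "K +>\<^bsub>A\<^esub> x = K \<longleftrightarrow> x \<in> K"
  using coset_eq_iff[OF assms zero_closed] module_minus_add(4)[OF A zero_closed assms] by (simp add: coset_zero)

lemma coset_add:
  assumes "x \<in> carrier A" "y \<in> carrier A"
  shows "(K +>\<^bsub>A\<^esub> x) <+>\<^bsub>A\<^esub> (K +>\<^bsub>A\<^esub> y) = K +>\<^bsub>A\<^esub> (x \<oplus>\<^bsub>A\<^esub> y)"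
  by (rule K.a_rcos_sum[OF assms])

text \<open>A map that is constant on a coset may be evaluated at the given representative; this is how
  the unions in the definitions of maps out of quotients are computed.\<close>

lemma UN_coset:
  assumes x: "x \<in> carrier A"
    and const: "\<And>y. y \<in> carrier A \<Longrightarrow> y \<ominus>\<^bsub>A\<^esub> x \<in> K \<Longrightarrow> f y = f x"
  shows "(\<Union>y\<in>K +>\<^bsub>A\<^esub> x. f y) = f x"
proof -
  have "f y = f x" if "y \<in> K +>\<^bsub>A\<^esub> x" for y
  proof -
    have y: "y \<in> carrier A" using that K.a_elemrcos_carrier[OF x] by simp
    then show ?thesis using const K.a_rcos_module[OF x y] that by (simp add: a_minus_def)
  qed
  then show ?thesis using coset_mem[OF x] by blast
qed

lemma quot_module_carrier: "carrier (quot_module A K) = (\<lambda>x. K +>\<^bsub>A\<^esub> x) ` carrier A"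
  by (auto simp: quot_module_def A_RCOSETS_def')

lemma quot_module_zero: "\<zero>\<^bsub>quot_module A K\<^esub> = K"
  by (simp add: quot_module_def)

lemma quot_module_add:
  assumes "x \<in> carrier A" "y \<in> carrier A"
  shows "(K +>\<^bsub>A\<^esub> x) \<oplus>\<^bsub>quot_module A K\<^esub> (K +>\<^bsub>A\<^esub> y) = K +>\<^bsub>A\<^esub> (x \<oplus>\<^bsub>A\<^esub> y)"
  by (simp add: quot_module_def coset_add[OF assms])

lemma quot_module_smult:
  assumes r: "r \<in> carrier R" and x: "x \<in> carrier A"
  shows "r \<odot>\<^bsub>quot_module A K\<^esub> (K +>\<^bsub>A\<^esub> x) = K +>\<^bsub>A\<^esub> (r \<odot>\<^bsub>A\<^esub> x)"
  unfolding quot_module_def mk_module_simps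
proof (rule UN_coset[OF x])
  fix y assume y: "y \<in> carrier A" "y \<ominus>\<^bsub>A\<^esub> x \<in> K"
  then have "r \<odot>\<^bsub>A\<^esub> (y \<ominus>\<^bsub>A\<^esub> x) \<in> K" using submoduleE(4)[OF K r] by blast
  then show "K +>\<^bsub>A\<^esub> (r \<odot>\<^bsub>A\<^esub> y) = K +>\<^bsub>A\<^esub> (r \<odot>\<^bsub>A\<^esub> x)"
    using coset_eq_iff[of "r \<odot>\<^bsub>A\<^esub> y" "r \<odot>\<^bsub>A\<^esub> x"] r x y(1)
    by (simp add: a_minus_def smult_r_distr smult_r_minus)
qed

lemma quot_module_module: "module R (quot_module A K)"
proof (rule moduleI)
  show "cring R" by (rule is_cring)
  note simps = quot_module_carrier quot_module_add coset_eq_iff quot_module_smult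
  have zero: "\<zero>\<^bsub>quot_module A K\<^esub> = K +>\<^bsub>A\<^esub> \<zero>\<^bsub>A\<^esub>"
    by (simp add: quot_module_zero coset_zero)
  show "abelian_group (quot_module A K)"
  proof (rule abelian_groupI)
    fix X assume "X \<in> carrier (quot_module A K)"
    then obtain x where x: "x \<in> carrier A" "X = K +>\<^bsub>A\<^esub> x" by (auto simp: quot_module_carrier)
    show "\<exists>Y\<in>carrier (quot_module A K). Y \<oplus>\<^bsub>quot_module A K\<^esub> X = \<zero>\<^bsub>quot_module A K\<^esub>"
      using x l_neg[of x] quot_module_add[of "\<ominus>\<^bsub>A\<^esub> x" x]
      by (intro bexI[of _ "K +>\<^bsub>A\<^esub> \<ominus>\<^bsub>A\<^esub> x"]) (auto simp: quot_module_carrier zero)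
  qed (auto simp: quot_module_carrier quot_module_add zero a_ac)
qed (auto simp: quot_module_carrier quot_module_add quot_module_smult smult_l_distr
    smult_r_distr smult_assoc1)

end

lemma quot_module_sub_module:
  assumes "module R A" "submodule L R A" "submodule K R A" "K \<subseteq> L"
  shows "module R (quot_module (sub_module A L) K)"
  by (rule quot_module_module[OF sub_module_module[OF assms(1,2)] submodule_sub_module[OF assms]])

section \<open>Homomorphisms of modules\<close>

lemma mod_homI:
  assumes "\<And>x. x \<in> carrier A \<Longrightarrow> f x \<in> carrier B"
    and "\<And>x y. x \<in> carrier A \<Longrightarrow> y \<in> carrier A \<Longrightarrow> f (x \<oplus>\<^bsub>A\<^esub> y) = f x \<oplus>\<^bsub>B\<^esub> f y"
    and "\<And>r x. r \<in> carrier R \<Longrightarrow> x \<in> carrier A \<Longrightarrow> f (r \<odot>\<^bsub>A\<^esub> x) = r \<odot>\<^bsub>B\<^esub> f x"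
  shows "f \<in> mod_hom R A B"
  using assms unfolding mod_hom_def by auto

lemma mod_hom_minus:
  assumes "f \<in> mod_hom R A B" "module R A" "module R B" "x \<in> carrier A" "y \<in> carrier A"
  shows "f (\<ominus>\<^bsub>A\<^esub> x) = \<ominus>\<^bsub>B\<^esub> f x" and "f (x \<ominus>\<^bsub>A\<^esub> y) = f x \<ominus>\<^bsub>B\<^esub> f y"
proof -
  interpret A: module R A by fact
  interpret B: module R B by fact
  have *: "f (\<ominus>\<^bsub>A\<^esub> x) = \<ominus>\<^bsub>B\<^esub> f x" if "x \<in> carrier A" for x
    using mod_homD(3)[OF assms(1), of "\<ominus>\<^bsub>R\<^esub> \<one>\<^bsub>R\<^esub>" x] mod_homD(1)[OF assms(1) that] that
    by (simp add: A.smult_l_minus B.smult_l_minus)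
  show "f (\<ominus>\<^bsub>A\<^esub> x) = \<ominus>\<^bsub>B\<^esub> f x" by (rule *[OF assms(4)])
  show "f (x \<ominus>\<^bsub>A\<^esub> y) = f x \<ominus>\<^bsub>B\<^esub> f y"
    using mod_homD(2)[OF assms(1,4), of "\<ominus>\<^bsub>A\<^esub> y"] assms(5) *[OF assms(5)] by (simp add: a_minus_def)
qed

lemma mod_hom_comp:
  assumes "f \<in> mod_hom R A B" "g \<in> mod_hom R B C"
  shows "g \<circ> f \<in> mod_hom R A C"
  using mod_homD[OF assms(1)] mod_homD[OF assms(2)] by (intro mod_homI) auto

lemma smult_hom:
  assumes "module R A" "b \<in> carrier R"
  shows "(\<lambda>x. b \<odot>\<^bsub>A\<^esub> x) \<in> mod_hom R A A"
proof -
  interpret module R A by fact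
  show ?thesis using assms(2) smult_swap[OF assms] by (intro mod_homI) (auto simp: smult_r_distr)
qed

lemma mod_hom_add:
  assumes f: "f \<in> mod_hom R A B" and g: "g \<in> mod_hom R A B" and B: "module R B"
  shows "(\<lambda>x. f x \<oplus>\<^bsub>B\<^esub> g x) \<in> mod_hom R A B"
proof -
  interpret B: module R B by fact
  show ?thesis
    using mod_homD[OF f] mod_homD[OF g] by (intro mod_homI) (auto simp: B.a_ac B.smult_r_distr)
qed

lemma mod_hom_eq_iff:
  assumes "f \<in> mod_hom R A B" "module R A" "module R B" "x \<in> carrier A" "y \<in> carrier A"
  shows "f x = f y \<longleftrightarrow> f (x \<ominus>\<^bsub>A\<^esub> y) = \<zero>\<^bsub>B\<^esub>"
  using mod_hom_minus(2)[OF assms] module_minus_add(3)[OF assms(3)] mod_homD(1)[OF assms(1)] assms(4,5) by simp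

lemma mod_hom_inj_iff:
  assumes "f \<in> mod_hom R A B" "module R A" "module R B"
  shows "inj_on f (carrier A) \<longleftrightarrow> (\<forall>x\<in>carrier A. f x = \<zero>\<^bsub>B\<^esub> \<longrightarrow> x = \<zero>\<^bsub>A\<^esub>)"
proof -
  interpret A: module R A by fact
  have "x = y" if "\<forall>x\<in>carrier A. f x = \<zero>\<^bsub>B\<^esub> \<longrightarrow> x = \<zero>\<^bsub>A\<^esub>" "x \<in> carrier A" "y \<in> carrier A" "f x = f y" for x y
    using mod_hom_eq_iff[OF assms that(2,3)] module_minus_add(3)[OF assms(2) that(2,3)] that by simp
  then show ?thesis
    using mod_hom_zero[OF assms] by (metis A.zero_closed inj_on_def)
qed

lemma mod_isoD:
  assumes "f \<in> mod_iso R A B"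
  shows "f \<in> mod_hom R A B" "inj_on f (carrier A)" "f ` carrier A = carrier B"
  using assms by (auto simp: mod_iso_def bij_betw_def)

lemma mod_isoI:
  assumes "f \<in> mod_hom R A B" "inj_on f (carrier A)" "f ` carrier A = carrier B"
  shows "f \<in> mod_iso R A B"
  using assms by (auto simp: mod_iso_def bij_betw_def)

lemma mod_iso_comp:
  assumes "f \<in> mod_iso R A B" "g \<in> mod_iso R B C"
  shows "g \<circ> f \<in> mod_iso R A C"
  using assms mod_hom_comp bij_betw_trans unfolding mod_iso_def by blast

lemma mod_iso_inv_into:
  assumes f: "f \<in> mod_iso R A B" and A: "module R A"
  shows "inv_into (carrier A) f \<in> mod_iso R B A"
proof -
  interpret A: module R A by fact
  note fD = mod_isoD[OF f]
  let ?g = "inv_into (carrier A) f"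
  have g: "?g y \<in> carrier A" "f (?g y) = y" if "y \<in> carrier B" for y
    using that fD(3) by (auto intro: inv_into_into f_inv_into_f)
  have eq: "?g (f x) = x" if "x \<in> carrier A" for x
    using that fD(2) by (rule inv_into_f_f[rotated])
  have "?g \<in> mod_hom R B A"
  proof (rule mod_homI)
    fix x y assume xy: "x \<in> carrier B" "y \<in> carrier B"
    have "?g (f (?g x \<oplus>\<^bsub>A\<^esub> ?g y)) = ?g x \<oplus>\<^bsub>A\<^esub> ?g y"
      using g xy by (intro eq) auto
    then show "?g (x \<oplus>\<^bsub>B\<^esub> y) = ?g x \<oplus>\<^bsub>A\<^esub> ?g y"
      using g xy mod_homD(2)[OF fD(1)] by simp
  next
    fix r x assume rx: "r \<in> carrier R" "x \<in> carrier B"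
    have "?g (f (r \<odot>\<^bsub>A\<^esub> ?g x)) = r \<odot>\<^bsub>A\<^esub> ?g x" using g rx by (intro eq) auto
    then show "?g (r \<odot>\<^bsub>B\<^esub> x) = r \<odot>\<^bsub>A\<^esub> ?g x" using g rx mod_homD(3)[OF fD(1)] by simp
  qed (rule g)
  moreover have "bij_betw ?g (carrier B) (carrier A)"
    using f unfolding mod_iso_def by (auto intro: bij_betw_inv_into)
  ultimately show ?thesis unfolding mod_iso_def by blast
qed

lemma coset_hom:
  assumes "module R A" "submodule K R A"
  shows "(\<lambda>x. K +>\<^bsub>A\<^esub> x) \<in> mod_hom R A (quot_module A K)"
  using assms by (intro mod_homI) (auto simp: quot_module_carrier quot_module_add quot_module_smult)

lemma submodule_image:
  assumes f: "f \<in> mod_hom R A B" and A: "module R A" and B: "module R B"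
  shows "submodule (f ` carrier A) R B"
proof -
  interpret A: module R A by fact
  have "f x \<oplus>\<^bsub>B\<^esub> f y \<in> f ` carrier A" if "x \<in> carrier A" "y \<in> carrier A" for x y
    using mod_homD(2)[OF f that] that by (metis A.a_closed imageI)
  moreover have "r \<odot>\<^bsub>B\<^esub> f x \<in> f ` carrier A" if "r \<in> carrier R" "x \<in> carrier A" for r x
    using mod_homD(3)[OF f that] that by (metis A.smult_closed imageI)
  moreover have "\<zero>\<^bsub>B\<^esub> \<in> f ` carrier A"
    using mod_hom_zero[OF f A B] by (metis A.zero_closed imageI)
  ultimately show ?thesis
    using mod_homD(1)[OF f] by (intro submodule_criterion B) auto
qed

lemma submodule_kernel:
  assumes f: "f \<in> mod_hom R A B" and A: "module R A" and B: "module R B"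
  shows "submodule {x \<in> carrier A. f x = \<zero>\<^bsub>B\<^esub>} R A"
proof -
  interpret A: module R A by fact
  interpret B: module R B by fact
  show ?thesis
    using mod_hom_zero[OF f A B] mod_homD(2,3)[OF f] by (intro submodule_criterion A) auto
qed

section \<open>Cohomology of a complex\<close>

definition coh_class :: "('r, 'a) cpx \<Rightarrow> int \<Rightarrow> 'a \<Rightarrow> 'a set" where
  "coh_class X j x = coboundaries X j +>\<^bsub>obj X j\<^esub> x"

definition chain_map ::
    "('r, 'q) ring_scheme \<Rightarrow> ('r, 'a) cpx \<Rightarrow> ('r, 'b) cpx \<Rightarrow> (int \<Rightarrow> 'a \<Rightarrow> 'b) \<Rightarrow> bool" where
  "chain_map R X Y u \<longleftrightarrow> (\<forall>j. u j \<in> mod_hom R (obj X j) (obj Y j)) \<and>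
     (\<forall>j. \<forall>x\<in>carrier (obj X j). u (j + 1) (dif X j x) = dif Y j (u j x))"

lemma chain_mapD:
  assumes "chain_map R X Y u"
  shows "u j \<in> mod_hom R (obj X j) (obj Y j)"
    and "x \<in> carrier (obj X j) \<Longrightarrow> u (j + 1) (dif X j x) = dif Y j (u j x)"
  using assms unfolding chain_map_def by auto

lemma chain_map_comp:
  assumes "chain_map R X Y u" "chain_map R Y Z v"
  shows "chain_map R X Z (\<lambda>j. v j \<circ> u j)"
  using mod_hom_comp[OF chain_mapD(1)[OF assms(1)] chain_mapD(1)[OF assms(2)]]
    chain_mapD(2)[OF assms(1)] chain_mapD(2)[OF assms(2)] mod_homD(1)[OF chain_mapD(1)[OF assms(1)]]
  unfolding chain_map_def by simp

lemma cochain_complexD: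
  assumes "cochain_complex R X"
  shows "module R (obj X j)"
    and "dif X j \<in> mod_hom R (obj X j) (obj X (j + 1))"
    and "x \<in> carrier (obj X j) \<Longrightarrow> dif X (j + 1) (dif X j x) = \<zero>\<^bsub>obj X (j + 2)\<^esub>"
  using assms unfolding cochain_complex_def by auto

context
  fixes R :: "('r, 'q) ring_scheme" and X :: "('r, 'a) cpx"
  assumes X: "cochain_complex R X"
begin

lemma cocycles_submodule: "submodule (cocycles X j) R (obj X j)"
  unfolding cocycles_def by (intro submodule_kernel cochain_complexD X)

lemma coboundaries_submodule: "submodule (coboundaries X j) R (obj X j)"
  unfolding coboundaries_def
  using submodule_image[OF cochain_complexD(2)[OF X, of "j - 1"]] cochain_complexD(1)[OF X] by simp

lemma coboundaries_subset: "coboundaries X j \<subseteq> cocycles X j"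
  using cochain_complexD(3)[OF X, of _ "j - 1"] mod_homD(1)[OF cochain_complexD(2)[OF X, of "j - 1"]]
  unfolding coboundaries_def cocycles_def by (auto simp: algebra_simps)

lemma cohomology_module: "module R (cohomology X j)"
  unfolding cohomology_def
  by (rule quot_module_sub_module[OF cochain_complexD(1)[OF X] cocycles_submodule
      coboundaries_submodule coboundaries_subset])

lemma cohomology_carrier: "carrier (cohomology X j) = coh_class X j ` cocycles X j"
  unfolding cohomology_def coh_class_def
  using quot_module_carrier[OF sub_module_module[OF cochain_complexD(1)[OF X] cocycles_submodule]
      submodule_sub_module[OF cochain_complexD(1)[OF X] cocycles_submodule
      coboundaries_submodule coboundaries_subset]] by simp

lemma coh_class_hom: "coh_class X j \<in> mod_hom R (sub_module (obj X j) (cocycles X j)) (cohomology X j)"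
  using coset_hom[OF sub_module_module[OF cochain_complexD(1)[OF X] cocycles_submodule]
      submodule_sub_module[OF cochain_complexD(1)[OF X] cocycles_submodule
      coboundaries_submodule coboundaries_subset]]
  unfolding cohomology_def coh_class_def by (simp add: coh_class_def)

lemma coh_class_eq_iff:
  assumes "x \<in> cocycles X j" "y \<in> cocycles X j"
  shows "coh_class X j x = coh_class X j y \<longleftrightarrow> x \<ominus>\<^bsub>obj X j\<^esub> y \<in> coboundaries X j"
  unfolding coh_class_def using assms
  by (intro coset_eq_iff[OF cochain_complexD(1)[OF X] coboundaries_submodule])
     (auto simp: cocycles_def)

lemma cohomology_zero: "\<zero>\<^bsub>cohomology X j\<^esub> = coboundaries X j"
  by (simp add: cohomology_def quot_module_def)

lemma coh_class_zero_iff: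
  assumes "x \<in> cocycles X j"
  shows "coh_class X j x = \<zero>\<^bsub>cohomology X j\<^esub> \<longleftrightarrow> x \<in> coboundaries X j"
  unfolding coh_class_def cohomology_zero using assms
  by (intro coset_zero_iff[OF cochain_complexD(1)[OF X] coboundaries_submodule])
     (auto simp: cocycles_def)

end

context
  fixes R :: "('r, 'q) ring_scheme" and X :: "('r, 'a) cpx" and Y :: "('r, 'b) cpx" and u
  assumes X: "cochain_complex R X" and Y: "cochain_complex R Y" and u: "chain_map R X Y u"
begin

lemma chain_map_cocycles: "x \<in> cocycles X j \<Longrightarrow> u j x \<in> cocycles Y j"
  using chain_mapD(2)[OF u, of x j] mod_homD(1)[OF chain_mapD(1)[OF u]]
    mod_hom_zero[OF chain_mapD(1)[OF u, of "j + 1"] cochain_complexD(1)[OF X] cochain_complexD(1)[OF Y]]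
  unfolding cocycles_def by auto

lemma chain_map_coboundaries: "x \<in> coboundaries X j \<Longrightarrow> u j x \<in> coboundaries Y j"
  using chain_mapD(2)[OF u, of _ "j - 1"] mod_homD(1)[OF chain_mapD(1)[OF u], of _ "j - 1"]
  unfolding coboundaries_def by auto

lemma cohomology_map_class:
  assumes x: "x \<in> cocycles X j"
  shows "cohomology_map Y j (u j) (coh_class X j x) = coh_class Y j (u j x)"
  unfolding cohomology_map_def coh_class_def
proof (rule UN_coset[OF cochain_complexD(1)[OF X] coboundaries_submodule[OF X]])
  show x': "x \<in> carrier (obj X j)" using x by (simp add: cocycles_def)
  fix y assume y: "y \<in> carrier (obj X j)" "y \<ominus>\<^bsub>obj X j\<^esub> x \<in> coboundaries X j"
  note hom = chain_mapD(1)[OF u, of j]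
  have "u j (y \<ominus>\<^bsub>obj X j\<^esub> x) \<in> coboundaries Y j" by (rule chain_map_coboundaries[OF y(2)])
  then show "coboundaries Y j +>\<^bsub>obj Y j\<^esub> u j y = coboundaries Y j +>\<^bsub>obj Y j\<^esub> u j x"
    using coset_eq_iff[OF cochain_complexD(1)[OF Y] coboundaries_submodule[OF Y]]
      mod_hom_minus(2)[OF hom cochain_complexD(1)[OF X] cochain_complexD(1)[OF Y] y(1) x']
      mod_homD(1)[OF hom] x' y(1) by simp
qed

lemma cohomology_map_hom: "cohomology_map Y j (u j) \<in> mod_hom R (cohomology X j) (cohomology Y j)"
proof (rule mod_homI)
  note homX = mod_homD[OF coh_class_hom[OF X, of j], simplified]
  note homY = mod_homD[OF coh_class_hom[OF Y, of j], simplified]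
  note sub = module.submoduleE[OF cochain_complexD(1)[OF X] cocycles_submodule[OF X, of j]]
  note homu = mod_homD[OF chain_mapD(1)[OF u, of j]]
  fix S assume "S \<in> carrier (cohomology X j)"
  then obtain x where x: "x \<in> cocycles X j" "S = coh_class X j x"
    by (auto simp: cohomology_carrier[OF X])
  show "cohomology_map Y j (u j) S \<in> carrier (cohomology Y j)"
    using x chain_map_cocycles cohomology_map_class by (simp add: homY)
  {
    fix S' assume "S' \<in> carrier (cohomology X j)"
    then obtain x' where x': "x' \<in> cocycles X j" "S' = coh_class X j x'"
      by (auto simp: cohomology_carrier[OF X])
    have "S \<oplus>\<^bsub>cohomology X j\<^esub> S' = coh_class X j (x \<oplus>\<^bsub>obj X j\<^esub> x')"
      using x x' homX by simp
    then show "cohomology_map Y j (u j) (S \<oplus>\<^bsub>cohomology X j\<^esub> S') =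
        cohomology_map Y j (u j) S \<oplus>\<^bsub>cohomology Y j\<^esub> cohomology_map Y j (u j) S'"
      using x x' chain_map_cocycles sub(1,5) homu by (simp add: cohomology_map_class homY subset_iff)
  }
  fix r assume r: "r \<in> carrier R"
  have "r \<odot>\<^bsub>cohomology X j\<^esub> S = coh_class X j (r \<odot>\<^bsub>obj X j\<^esub> x)"
    using x r homX by simp
  then show "cohomology_map Y j (u j) (r \<odot>\<^bsub>cohomology X j\<^esub> S) =
      r \<odot>\<^bsub>cohomology Y j\<^esub> cohomology_map Y j (u j) S"
    using x r chain_map_cocycles sub(1,4) homu by (simp add: cohomology_map_class homY subset_iff)
qed

end

section \<open>Sequential direct limits of modules\<close>

definition mod_system ::
    "('r, 'q) ring_scheme \<Rightarrow> (nat \<Rightarrow> ('r, 'a) module) \<Rightarrow> (nat \<Rightarrow> 'a \<Rightarrow> 'a) \<Rightarrow> bool" where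
  "mod_system R A t \<longleftrightarrow> (\<forall>s. module R (A s)) \<and> (\<forall>s. t s \<in> mod_hom R (A s) (A (Suc s)))"

definition system_map ::
    "('r, 'q) ring_scheme \<Rightarrow> (nat \<Rightarrow> ('r, 'a) module) \<Rightarrow> (nat \<Rightarrow> 'a \<Rightarrow> 'a) \<Rightarrow>
     (nat \<Rightarrow> ('r, 'b) module) \<Rightarrow> (nat \<Rightarrow> 'b \<Rightarrow> 'b) \<Rightarrow> (nat \<Rightarrow> 'a \<Rightarrow> 'b) \<Rightarrow> bool" where
  "system_map R A t B t' \<phi> \<longleftrightarrow> (\<forall>s. \<phi> s \<in> mod_hom R (A s) (B s)) \<and>
     (\<forall>s. \<forall>x\<in>carrier (A s). \<phi> (Suc s) (t s x) = t' s (\<phi> s x))"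

lemma transit_add: "transit t s (k + l) x = transit t (s + k) l (transit t s k x)"
  by (induction l) (simp_all add: add.assoc)

lemma transit_closed:
  assumes "\<And>s x. x \<in> C s \<Longrightarrow> t s x \<in> C (Suc s)" "x \<in> C s"
  shows "transit t s k x \<in> C (s + k)"
  using assms by (induction k) auto

lemma transit_natural:
  assumes "\<And>s x. x \<in> C s \<Longrightarrow> t s x \<in> C (Suc s)" "x \<in> C s"
    and "\<And>s x. x \<in> C s \<Longrightarrow> \<phi> (Suc s) (t s x) = t' s (\<phi> s x)"
  shows "\<phi> (s + k) (transit t s k x) = transit t' s k (\<phi> s x)"
proof (induction k)
  case (Suc k)
  then show ?case using assms(3) transit_closed[of C t x s k] assms(1,2) by auto
qed simp

lemma transit_hom:
  assumes A: "mod_system R A t"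
  shows "transit t s k \<in> mod_hom R (A s) (A (s + k))"
proof (induction k)
  case 0
  then show ?case by (auto simp: mod_hom_def)
next
  case (Suc k)
  have "t (s + k) \<circ> transit t s k \<in> mod_hom R (A s) (A (Suc (s + k)))"
    using A by (intro mod_hom_comp[OF Suc]) (auto simp: mod_system_def)
  then show ?case by (simp add: comp_def)
qed

text \<open>The relation that defines the direct limit is an equivalence relation: two witnesses of
  equality at later stages can be pushed to a common stage.\<close>

lemma dirlim_class_eq_iff:
  assumes y: "y \<in> carrier (A u)"
  shows "dirlim_class A t s x = dirlim_class A t u y \<longleftrightarrow>
    (\<exists>k l. s + k = u + l \<and> transit t s k x = transit t u l y)"
proof -
  define rel where "rel s x u y \<longleftrightarrow> (\<exists>k l. s + k = u + l \<and> transit t s k x = transit t u l y)"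
    for s x u y
  have cls: "dirlim_class A t s x = {(u, y). y \<in> carrier (A u) \<and> rel s x u y}" for s x
    by (simp add: dirlim_class_def rel_def)
  have refl: "rel s x s x" for s x unfolding rel_def by blast
  have sym: "rel s x u y \<Longrightarrow> rel u y s x" for s x u y unfolding rel_def by metis
  have trans: "rel s x w z" if xy: "rel s x u y" and yz: "rel u y w z" for s x u y w z
  proof -
    obtain k l where 1: "s + k = u + l" "transit t s k x = transit t u l y"
      using xy unfolding rel_def by blast
    obtain k' l' where 2: "u + k' = w + l'" "transit t u k' y = transit t w l' z"
      using yz unfolding rel_def by blast
    note * = 1 2
    have "transit t s (k + k') x = transit t (u + l) k' (transit t u l y)"
      using * by (simp add: transit_add)
    also have "\<dots> = transit t u (k' + l) y" using transit_add[of t u l k' y] by (simp add: add.commute)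
    also have "\<dots> = transit t w (l' + l) z" using * by (simp add: transit_add)
    finally show ?thesis unfolding rel_def using *(1,3)
      by (intro exI[of _ "k + k'"] exI[of _ "l' + l"]) auto
  qed
  have "dirlim_class A t s x = dirlim_class A t u y \<longleftrightarrow> rel s x u y"
  proof
    assume "dirlim_class A t s x = dirlim_class A t u y"
    moreover have "(u, y) \<in> dirlim_class A t u y" using y refl by (simp add: cls)
    ultimately have "(u, y) \<in> dirlim_class A t s x" by simp
    then show "rel s x u y" by (simp add: cls)
  next
    assume "rel s x u y"
    then have "rel s x w z \<longleftrightarrow> rel u y w z" for w z
      using trans[of s x u y w z] trans[of u y s x w z] sym[of s x u y] by blast
    then show "dirlim_class A t s x = dirlim_class A t u y" by (simp add: cls)
  qed
  then show ?thesis by (simp add: rel_def)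
qed

lemma dirlim_class_mem:
  "(u, y) \<in> dirlim_class A t s x \<longleftrightarrow> y \<in> carrier (A u) \<and> dirlim_class A t s x = dirlim_class A t u y"
proof -
  have "(u, y) \<in> dirlim_class A t s x \<longleftrightarrow> y \<in> carrier (A u) \<and>
      (\<exists>k l. s + k = u + l \<and> transit t s k x = transit t u l y)"
    by (simp add: dirlim_class_def)
  then show ?thesis using dirlim_class_eq_iff[of y A u t s x] by blast
qed

lemma dirlim_carrier: "carrier (dirlim A t) = {dirlim_class A t s x | s x. x \<in> carrier (A s)}"
  by (simp add: dirlim_def)

context
  fixes R :: "('r, 'q) ring_scheme" and A :: "nat \<Rightarrow> ('r, 'a) module" and t
  assumes sys: "mod_system R A t"
begin

lemma mod_systemD: "module R (A s)" "t s \<in> mod_hom R (A s) (A (Suc s))"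
  using sys by (auto simp: mod_system_def)

lemma dirlim_class_transit:
  assumes "x \<in> carrier (A s)"
  shows "dirlim_class A t (s + k) (transit t s k x) = dirlim_class A t s x"
  using dirlim_class_eq_iff[of x A s t "s + k" "transit t s k x"] assms
  by (metis add_0_right transit.simps(1))

lemma dirlim_class_add_cong:
  assumes "a \<in> carrier (A w)" "b \<in> carrier (A w)" "x \<in> carrier (A v)" "y \<in> carrier (A v)"
    and "dirlim_class A t w a = dirlim_class A t v x" "dirlim_class A t w b = dirlim_class A t v y"
  shows "dirlim_class A t w (a \<oplus>\<^bsub>A w\<^esub> b) = dirlim_class A t v (x \<oplus>\<^bsub>A v\<^esub> y)"
proof -
  interpret V: module R "A v" by (rule mod_systemD)
  obtain k l where 1: "w + k = v + l" "transit t w k a = transit t v l x"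
    using assms(3,5) by (auto simp: dirlim_class_eq_iff)
  obtain k' l' where 2: "w + k' = v + l'" "transit t w k' b = transit t v l' y"
    using assms(4,6) by (auto simp: dirlim_class_eq_iff)
  have eq: "l' + k = l + k'" using 1(1) 2(1) by linarith
  have x: "transit t w (k + k') a = transit t v (l + k') x"
    using 1 by (simp add: transit_add)
  have "transit t w (k' + k) b = transit t v (l' + k) y"
    using 2 by (simp add: transit_add)
  then have y: "transit t w (k + k') b = transit t v (l + k') y"
    using eq by (simp add: add.commute)
  have "transit t w (k + k') (a \<oplus>\<^bsub>A w\<^esub> b) = transit t v (l + k') (x \<oplus>\<^bsub>A v\<^esub> y)"
    using mod_homD(2)[OF transit_hom[OF sys, of w "k + k'"] assms(1,2)]
      mod_homD(2)[OF transit_hom[OF sys, of v "l + k'"] assms(3,4)] x y 1(1)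
    by (simp add: add.assoc[symmetric])
  then show ?thesis
    unfolding dirlim_class_eq_iff[where A = A and u = v, OF V.a_closed[OF assms(3,4)]]
    using 1(1) by (intro exI[of _ "k + k'"] exI[of _ "l + k'"] conjI) auto
qed

lemma dirlim_add:
  assumes x: "x \<in> carrier (A v)" and y: "y \<in> carrier (A v)"
  shows "dirlim_class A t v x \<oplus>\<^bsub>dirlim A t\<^esub> dirlim_class A t v y = dirlim_class A t v (x \<oplus>\<^bsub>A v\<^esub> y)"
proof -
  have *: "dirlim_class A t (max s u)
      (transit t s (max s u - s) x' \<oplus>\<^bsub>A (max s u)\<^esub> transit t u (max s u - u) y') =
      dirlim_class A t v (x \<oplus>\<^bsub>A v\<^esub> y)"
    if "(s, x') \<in> dirlim_class A t v x" "(u, y') \<in> dirlim_class A t v y" for s x' u y'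
  proof -
    have x': "x' \<in> carrier (A s)" "dirlim_class A t s x' = dirlim_class A t v x"
      and y': "y' \<in> carrier (A u)" "dirlim_class A t u y' = dirlim_class A t v y"
      using that by (auto simp: dirlim_class_mem)
    have "dirlim_class A t (max s u) (transit t s (max s u - s) x') = dirlim_class A t v x"
      "transit t s (max s u - s) x' \<in> carrier (A (max s u))"
      using dirlim_class_transit[OF x'(1), of "max s u - s"] x'(2)
        mod_homD(1)[OF transit_hom[OF sys] x'(1), of "max s u - s"] by auto
    moreover have "dirlim_class A t (max s u) (transit t u (max s u - u) y') = dirlim_class A t v y"
      "transit t u (max s u - u) y' \<in> carrier (A (max s u))"
      using dirlim_class_transit[OF y'(1), of "max s u - u"] y'(2)
        mod_homD(1)[OF transit_hom[OF sys] y'(1), of "max s u - u"] by auto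
    ultimately show ?thesis by (intro dirlim_class_add_cong x y)
  qed
  have ne: "(v, x) \<in> dirlim_class A t v x" "(v, y) \<in> dirlim_class A t v y"
    using x y by (auto simp: dirlim_class_mem)
  have "(\<Union>(u, y')\<in>dirlim_class A t v y. let w = max s u in
        dirlim_class A t w (transit t s (w - s) x' \<oplus>\<^bsub>A w\<^esub> transit t u (w - u) y')) =
      dirlim_class A t v (x \<oplus>\<^bsub>A v\<^esub> y)" if "(s, x') \<in> dirlim_class A t v x" for s x'
  proof -
    have "(\<Union>(u, y')\<in>dirlim_class A t v y. let w = max s u in
        dirlim_class A t w (transit t s (w - s) x' \<oplus>\<^bsub>A w\<^esub> transit t u (w - u) y')) =
        (\<Union>p\<in>dirlim_class A t v y. dirlim_class A t v (x \<oplus>\<^bsub>A v\<^esub> y))"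
      using *[OF that] by (intro SUP_cong) (auto simp: Let_def)
    then show ?thesis using ne(2) by blast
  qed
  then have "(\<Union>(s, x')\<in>dirlim_class A t v x. \<Union>(u, y')\<in>dirlim_class A t v y. let w = max s u in
        dirlim_class A t w (transit t s (w - s) x' \<oplus>\<^bsub>A w\<^esub> transit t u (w - u) y')) =
      (\<Union>p\<in>dirlim_class A t v x. dirlim_class A t v (x \<oplus>\<^bsub>A v\<^esub> y))"
    by (intro SUP_cong) auto
  then show ?thesis using ne(1) by (auto simp: dirlim_def)
qed

lemma dirlim_smult:
  assumes r: "r \<in> carrier R" and x: "x \<in> carrier (A v)"
  shows "r \<odot>\<^bsub>dirlim A t\<^esub> dirlim_class A t v x = dirlim_class A t v (r \<odot>\<^bsub>A v\<^esub> x)"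
proof -
  interpret V: module R "A v" by (rule mod_systemD)
  have *: "dirlim_class A t s (r \<odot>\<^bsub>A s\<^esub> x') = dirlim_class A t v (r \<odot>\<^bsub>A v\<^esub> x)"
    if "(s, x') \<in> dirlim_class A t v x" for s x'
  proof -
    have x': "x' \<in> carrier (A s)" "dirlim_class A t s x' = dirlim_class A t v x"
      using that by (auto simp: dirlim_class_mem)
    then obtain k l where 1: "s + k = v + l" "transit t s k x' = transit t v l x"
      using x by (auto simp: dirlim_class_eq_iff)
    then have "transit t s k (r \<odot>\<^bsub>A s\<^esub> x') = transit t v l (r \<odot>\<^bsub>A v\<^esub> x)"
      using mod_homD(3)[OF transit_hom[OF sys] r x'(1), of k] mod_homD(3)[OF transit_hom[OF sys] r x, of l]
      by simp
    then show ?thesis using 1 r x by (subst dirlim_class_eq_iff) auto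
  qed
  have "(\<Union>(s, x')\<in>dirlim_class A t v x. dirlim_class A t s (r \<odot>\<^bsub>A s\<^esub> x')) =
      (\<Union>p\<in>dirlim_class A t v x. dirlim_class A t v (r \<odot>\<^bsub>A v\<^esub> x))"
    using * by (intro SUP_cong) auto
  moreover have "(v, x) \<in> dirlim_class A t v x" using x by (auto simp: dirlim_class_mem)
  ultimately show ?thesis by (auto simp: dirlim_def)
qed

lemma dirlim_zero_iff:
  assumes x: "x \<in> carrier (A s)"
  shows "dirlim_class A t s x = \<zero>\<^bsub>dirlim A t\<^esub> \<longleftrightarrow> (\<exists>k. transit t s k x = \<zero>\<^bsub>A (s + k)\<^esub>)"
proof -
  have z: "transit t u l \<zero>\<^bsub>A u\<^esub> = \<zero>\<^bsub>A (u + l)\<^esub>" for u l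
    by (rule mod_hom_zero[OF transit_hom[OF sys] mod_systemD(1) mod_systemD(1)])
  have mem: "\<zero>\<^bsub>A 0\<^esub> \<in> carrier (A 0)"
  proof -
    interpret V: module R "A 0" by (rule mod_systemD)
    show ?thesis by simp
  qed
  show ?thesis
  proof
    assume "dirlim_class A t s x = \<zero>\<^bsub>dirlim A t\<^esub>"
    then obtain k l where "s + k = 0 + l" "transit t s k x = transit t 0 l \<zero>\<^bsub>A 0\<^esub>"
      using dirlim_class_eq_iff[of "\<zero>\<^bsub>A 0\<^esub>" A 0 t s x, OF mem] by (auto simp: dirlim_def)
    then show "\<exists>k. transit t s k x = \<zero>\<^bsub>A (s + k)\<^esub>" using z[of 0 l] by auto
  next
    assume "\<exists>k. transit t s k x = \<zero>\<^bsub>A (s + k)\<^esub>"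
    then obtain k where "transit t s k x = \<zero>\<^bsub>A (s + k)\<^esub>" ..
    then have "s + k = 0 + (s + k)" "transit t s k x = transit t 0 (s + k) \<zero>\<^bsub>A 0\<^esub>"
      using z[of 0 "s + k"] by auto
    then show "dirlim_class A t s x = \<zero>\<^bsub>dirlim A t\<^esub>"
      using dirlim_class_eq_iff[of "\<zero>\<^bsub>A 0\<^esub>" A 0 t s x, OF mem] by (auto simp: dirlim_def)
  qed
qed

lemma dirlim_zero_module_iff:
  "zero_module (dirlim A t) \<longleftrightarrow> (\<forall>s. \<forall>x\<in>carrier (A s). \<exists>k. transit t s k x = \<zero>\<^bsub>A (s + k)\<^esub>)"
proof -
  have "\<zero>\<^bsub>A 0\<^esub> \<in> carrier (A 0)"
  proof -
    interpret V: module R "A 0" by (rule mod_systemD)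
    show ?thesis by simp
  qed
  then have "\<zero>\<^bsub>dirlim A t\<^esub> \<in> carrier (dirlim A t)" by (auto simp: dirlim_def)
  then have "zero_module (dirlim A t) \<longleftrightarrow>
      (\<forall>s. \<forall>x\<in>carrier (A s). dirlim_class A t s x = \<zero>\<^bsub>dirlim A t\<^esub>)"
    unfolding zero_module_def dirlim_carrier by blast
  then show ?thesis by (simp add: dirlim_zero_iff)
qed

end

lemma common_stage:
  assumes A: "mod_system R A t" and "P \<in> carrier (dirlim A t)" "Q \<in> carrier (dirlim A t)"
  obtains v x y where "x \<in> carrier (A v)" "y \<in> carrier (A v)"
    "P = dirlim_class A t v x" "Q = dirlim_class A t v y"
proof -
  obtain s x u y where *: "x \<in> carrier (A s)" "P = dirlim_class A t s x"
    "y \<in> carrier (A u)" "Q = dirlim_class A t u y"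
    using assms(2,3) by (auto simp: dirlim_carrier)
  show thesis
  proof (rule that)
    show "transit t s u x \<in> carrier (A (s + u))" "P = dirlim_class A t (s + u) (transit t s u x)"
      using mod_homD(1)[OF transit_hom[OF A] *(1)] dirlim_class_transit[OF A *(1)] * by auto
    show "transit t u s y \<in> carrier (A (s + u))" "Q = dirlim_class A t (s + u) (transit t u s y)"
      using mod_homD(1)[OF transit_hom[OF A] *(3), of s] dirlim_class_transit[OF A *(3), of s] *
      by (auto simp: add.commute)
  qed
qed

lemma system_mapD:
  assumes "system_map R A t B t' \<phi>"
  shows "\<phi> s \<in> mod_hom R (A s) (B s)"
    and "x \<in> carrier (A s) \<Longrightarrow> \<phi> (Suc s) (t s x) = t' s (\<phi> s x)"
  using assms by (auto simp: system_map_def)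

lemma system_map_comp:
  assumes "system_map R A t B t' \<phi>" "system_map R B t' C t'' \<psi>"
  shows "system_map R A t C t'' (\<lambda>s. \<psi> s \<circ> \<phi> s)"
  using mod_hom_comp[OF system_mapD(1)[OF assms(1)] system_mapD(1)[OF assms(2)]]
    system_mapD(2)[OF assms(1)] system_mapD(2)[OF assms(2)] mod_homD(1)[OF system_mapD(1)[OF assms(1)]]
  unfolding system_map_def by simp

lemma system_map_inv:
  assumes A: "mod_system R A t"
    and \<phi>: "system_map R A t B t' \<phi>" and iso: "\<And>s. \<phi> s \<in> mod_iso R (A s) (B s)"
  shows "system_map R B t' A t (\<lambda>s. inv_into (carrier (A s)) (\<phi> s))"
proof -
  have "inv_into (carrier (A (Suc s))) (\<phi> (Suc s)) (t' s y) = t s (inv_into (carrier (A s)) (\<phi> s) y)"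
    if y: "y \<in> carrier (B s)" for s y
  proof -
    let ?x = "inv_into (carrier (A s)) (\<phi> s) y"
    have x: "?x \<in> carrier (A s)" "\<phi> s ?x = y"
      using y mod_isoD(3)[OF iso] by (auto intro: inv_into_into f_inv_into_f)
    then have "t' s y = \<phi> (Suc s) (t s ?x)" using system_mapD(2)[OF \<phi> x(1)] by simp
    moreover have "t s ?x \<in> carrier (A (Suc s))" using mod_homD(1)[OF mod_systemD(2)[OF A] x(1)] .
    ultimately show ?thesis using mod_isoD(2)[OF iso] by (simp add: inv_into_f_f)
  qed
  then show ?thesis
    using mod_isoD(1)[OF mod_iso_inv_into[OF iso mod_systemD(1)[OF A]]] unfolding system_map_def by simp
qed

context
  fixes R :: "('r, 'q) ring_scheme" and A :: "nat \<Rightarrow> ('r, 'a) module" and t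
    and B :: "nat \<Rightarrow> ('r, 'b) module" and t' \<phi>
  assumes A: "mod_system R A t" and B: "mod_system R B t'" and \<phi>: "system_map R A t B t' \<phi>"
begin

lemma system_map_transit:
  assumes "x \<in> carrier (A s)"
  shows "\<phi> (s + k) (transit t s k x) = transit t' s k (\<phi> s x)"
  using transit_natural[of "\<lambda>s. carrier (A s)" t x s \<phi> t' k] assms
    mod_homD(1)[OF mod_systemD(2)[OF A]] system_mapD(2)[OF \<phi>] by blast

lemma dirlim_map_class:
  assumes x: "x \<in> carrier (A s)"
  shows "dirlim_map B t' \<phi> (dirlim_class A t s x) = dirlim_class B t' s (\<phi> s x)"
proof -
  have "dirlim_class B t' u (\<phi> u y) = dirlim_class B t' s (\<phi> s x)"
    if "(u, y) \<in> dirlim_class A t s x" for u y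
  proof -
    have y: "y \<in> carrier (A u)" "dirlim_class A t s x = dirlim_class A t u y"
      using that by (auto simp: dirlim_class_mem)
    obtain k l where *: "s + k = u + l" "transit t s k x = transit t u l y"
      using y by (auto simp: dirlim_class_eq_iff)
    then have "transit t' s k (\<phi> s x) = transit t' u l (\<phi> u y)"
      using system_map_transit[OF x, of k] system_map_transit[OF y(1), of l] by simp
    then have "dirlim_class B t' s (\<phi> s x) = dirlim_class B t' u (\<phi> u y)"
      using * mod_homD(1)[OF system_mapD(1)[OF \<phi>] y(1)] by (subst dirlim_class_eq_iff) auto
    then show ?thesis by simp
  qed
  then have "dirlim_map B t' \<phi> (dirlim_class A t s x) =
      (\<Union>p\<in>dirlim_class A t s x. dirlim_class B t' s (\<phi> s x))"
    unfolding dirlim_map_def by (intro SUP_cong) auto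
  moreover have "(s, x) \<in> dirlim_class A t s x" using x by (simp add: dirlim_class_mem)
  ultimately show ?thesis by auto
qed

lemma dirlim_map_hom: "dirlim_map B t' \<phi> \<in> mod_hom R (dirlim A t) (dirlim B t')"
proof (rule mod_homI)
  note h = mod_homD[OF system_mapD(1)[OF \<phi>]]
  fix P assume P: "P \<in> carrier (dirlim A t)"
  then obtain s x where x: "x \<in> carrier (A s)" "P = dirlim_class A t s x"
    by (auto simp: dirlim_carrier)
  then show "dirlim_map B t' \<phi> P \<in> carrier (dirlim B t')"
    using h(1) by (auto simp: dirlim_map_class dirlim_carrier)
  {
    fix r assume r: "r \<in> carrier R"
    interpret V: module R "A s" by (rule mod_systemD[OF A])
    show "dirlim_map B t' \<phi> (r \<odot>\<^bsub>dirlim A t\<^esub> P) = r \<odot>\<^bsub>dirlim B t'\<^esub> dirlim_map B t' \<phi> P"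
      using r x h by (simp add: dirlim_smult[OF A] dirlim_smult[OF B] dirlim_map_class)
  }
  fix Q assume Q: "Q \<in> carrier (dirlim A t)"
  obtain v x y where v: "x \<in> carrier (A v)" "y \<in> carrier (A v)"
    "P = dirlim_class A t v x" "Q = dirlim_class A t v y"
    using common_stage[OF A P Q] .
  interpret V: module R "A v" by (rule mod_systemD[OF A])
  show "dirlim_map B t' \<phi> (P \<oplus>\<^bsub>dirlim A t\<^esub> Q) =
      dirlim_map B t' \<phi> P \<oplus>\<^bsub>dirlim B t'\<^esub> dirlim_map B t' \<phi> Q"
    using h v by (simp add: dirlim_add[OF A] dirlim_add[OF B] dirlim_map_class)
qed

lemma dirlim_map_inj_iff:
  "inj_on (dirlim_map B t' \<phi>) (carrier (dirlim A t)) \<longleftrightarrow>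
    (\<forall>s. \<forall>x\<in>carrier (A s). \<phi> s x = \<zero>\<^bsub>B s\<^esub> \<longrightarrow> (\<exists>k. transit t s k x = \<zero>\<^bsub>A (s + k)\<^esub>))"
proof
  assume inj: "inj_on (dirlim_map B t' \<phi>) (carrier (dirlim A t))"
  show "\<forall>s. \<forall>x\<in>carrier (A s). \<phi> s x = \<zero>\<^bsub>B s\<^esub> \<longrightarrow> (\<exists>k. transit t s k x = \<zero>\<^bsub>A (s + k)\<^esub>)"
  proof (intro allI ballI impI)
    fix s x assume x: "x \<in> carrier (A s)" "\<phi> s x = \<zero>\<^bsub>B s\<^esub>"
    interpret V: module R "A s" by (rule mod_systemD[OF A])
    have z: "\<zero>\<^bsub>A s\<^esub> \<in> carrier (A s)" by simp
    have "dirlim_class A t s x = dirlim_class A t s \<zero>\<^bsub>A s\<^esub>"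
      using x(2) mod_hom_zero[OF system_mapD(1)[OF \<phi>] mod_systemD(1)[OF A] mod_systemD(1)[OF B]] x(1) z
      by (intro inj_onD[OF inj]) (auto simp: dirlim_map_class dirlim_carrier)
    then obtain k where "transit t s k x = transit t s k \<zero>\<^bsub>A s\<^esub>"
      using dirlim_class_eq_iff[of "\<zero>\<^bsub>A s\<^esub>" A s t s x, OF z] by auto
    then show "\<exists>k. transit t s k x = \<zero>\<^bsub>A (s + k)\<^esub>"
      using mod_hom_zero[OF transit_hom[OF A] mod_systemD(1)[OF A] mod_systemD(1)[OF A]] by metis
  qed
next
  assume ker: "\<forall>s. \<forall>x\<in>carrier (A s). \<phi> s x = \<zero>\<^bsub>B s\<^esub> \<longrightarrow> (\<exists>k. transit t s k x = \<zero>\<^bsub>A (s + k)\<^esub>)"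
  show "inj_on (dirlim_map B t' \<phi>) (carrier (dirlim A t))"
  proof (rule inj_onI)
    fix P Q assume P: "P \<in> carrier (dirlim A t)" and Q: "Q \<in> carrier (dirlim A t)"
      and eq: "dirlim_map B t' \<phi> P = dirlim_map B t' \<phi> Q"
    obtain v x y where v: "x \<in> carrier (A v)" "y \<in> carrier (A v)"
      "P = dirlim_class A t v x" "Q = dirlim_class A t v y"
      using common_stage[OF A P Q] .
    have yB: "\<phi> v y \<in> carrier (B v)" by (rule mod_homD(1)[OF system_mapD(1)[OF \<phi>] v(2)])
    have "dirlim_class B t' v (\<phi> v x) = dirlim_class B t' v (\<phi> v y)"
      using eq v by (simp add: dirlim_map_class)
    then obtain k where k: "transit t' v k (\<phi> v x) = transit t' v k (\<phi> v y)"
      using dirlim_class_eq_iff[of "\<phi> v y" B v t' v "\<phi> v x", OF yB] by auto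
    let ?x = "transit t v k x" and ?y = "transit t v k y"
    interpret V: module R "A (v + k)" by (rule mod_systemD[OF A])
    have xy: "?x \<in> carrier (A (v + k))" "?y \<in> carrier (A (v + k))"
      using mod_homD(1)[OF transit_hom[OF A]] v by auto
    have "\<phi> (v + k) (?x \<ominus>\<^bsub>A (v + k)\<^esub> ?y) = \<zero>\<^bsub>B (v + k)\<^esub>"
      using mod_hom_eq_iff[OF system_mapD(1)[OF \<phi>] mod_systemD(1)[OF A] mod_systemD(1)[OF B] xy]
        k v by (simp add: system_map_transit)
    then obtain l where "transit t (v + k) l (?x \<ominus>\<^bsub>A (v + k)\<^esub> ?y) = \<zero>\<^bsub>A (v + k + l)\<^esub>"
      using ker V.M.minus_closed[OF xy] by blast
    then have "transit t (v + k) l ?x = transit t (v + k) l ?y"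
      using mod_hom_eq_iff[OF transit_hom[OF A] mod_systemD(1)[OF A] mod_systemD(1)[OF A] xy] by blast
    then show "P = Q"
      unfolding v(3,4) dirlim_class_eq_iff[where A = A and u = v, OF v(2)] transit_add[symmetric]
      by blast
  qed
qed

lemma dirlim_map_surj_iff:
  "dirlim_map B t' \<phi> ` carrier (dirlim A t) = carrier (dirlim B t') \<longleftrightarrow>
    (\<forall>s. \<forall>y\<in>carrier (B s). \<exists>k. transit t' s k y \<in> \<phi> (s + k) ` carrier (A (s + k)))"
proof
  assume surj: "dirlim_map B t' \<phi> ` carrier (dirlim A t) = carrier (dirlim B t')"
  show "\<forall>s. \<forall>y\<in>carrier (B s). \<exists>k. transit t' s k y \<in> \<phi> (s + k) ` carrier (A (s + k))"
  proof (intro allI ballI)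
    fix s y assume y: "y \<in> carrier (B s)"
    then have "dirlim_class B t' s y \<in> dirlim_map B t' \<phi> ` carrier (dirlim A t)"
      unfolding surj by (auto simp: dirlim_carrier)
    then obtain u x where x: "x \<in> carrier (A u)"
      "dirlim_class B t' s y = dirlim_class B t' u (\<phi> u x)"
      by (auto simp: dirlim_carrier dirlim_map_class)
    then obtain k l where "s + k = u + l" "transit t' s k y = transit t' u l (\<phi> u x)"
      using mod_homD(1)[OF system_mapD(1)[OF \<phi>] x(1)] by (auto simp: dirlim_class_eq_iff)
    moreover have "transit t' u l (\<phi> u x) \<in> \<phi> (u + l) ` carrier (A (u + l))"
      using system_map_transit[OF x(1), of l, symmetric] mod_homD(1)[OF transit_hom[OF A] x(1)] by auto
    ultimately show "\<exists>k. transit t' s k y \<in> \<phi> (s + k) ` carrier (A (s + k))" by metis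
  qed
next
  assume *: "\<forall>s. \<forall>y\<in>carrier (B s). \<exists>k. transit t' s k y \<in> \<phi> (s + k) ` carrier (A (s + k))"
  have "Q \<in> dirlim_map B t' \<phi> ` carrier (dirlim A t)" if Q: "Q \<in> carrier (dirlim B t')" for Q
  proof -
    obtain s y where y: "y \<in> carrier (B s)" "Q = dirlim_class B t' s y"
      using Q by (auto simp: dirlim_carrier)
    obtain k x where x: "x \<in> carrier (A (s + k))" "transit t' s k y = \<phi> (s + k) x"
      using * y(1) by blast
    have "Q = dirlim_map B t' \<phi> (dirlim_class A t (s + k) x)"
      using y x dirlim_class_transit[OF B y(1), of k] by (simp add: dirlim_map_class)
    then show ?thesis using x by (auto simp: dirlim_carrier)
  qed
  then show "dirlim_map B t' \<phi> ` carrier (dirlim A t) = carrier (dirlim B t')"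
    using mod_homD(1)[OF dirlim_map_hom] by blast
qed

lemma dirlim_map_iso:
  assumes iso: "\<And>s. \<phi> s \<in> mod_iso R (A s) (B s)"
  shows "dirlim_map B t' \<phi> \<in> mod_iso R (dirlim A t) (dirlim B t')"
proof (rule mod_isoI[OF dirlim_map_hom])
  have "x = \<zero>\<^bsub>A s\<^esub>" if "x \<in> carrier (A s)" "\<phi> s x = \<zero>\<^bsub>B s\<^esub>" for s x
    using mod_isoD(1,2)[OF iso, of s] mod_hom_inj_iff[OF _ mod_systemD(1)[OF A] mod_systemD(1)[OF B]] that
    by blast
  then show "inj_on (dirlim_map B t' \<phi>) (carrier (dirlim A t))"
    unfolding dirlim_map_inj_iff by (intro allI ballI impI exI[of _ 0]) simp
  have "y \<in> \<phi> s ` carrier (A s)" if "y \<in> carrier (B s)" for s y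
    using mod_isoD(3)[OF iso, of s] that by simp
  then show "dirlim_map B t' \<phi> ` carrier (dirlim A t) = carrier (dirlim B t')"
    unfolding dirlim_map_surj_iff by (intro allI ballI exI[of _ 0]) simp
qed

end

lemma dirlim_map_comp:
  assumes A: "mod_system R A t" and B: "mod_system R B t'" and C: "mod_system R C t''"
    and \<phi>: "system_map R A t B t' \<phi>" and \<psi>: "system_map R B t' C t'' \<psi>"
    and P: "P \<in> carrier (dirlim A t)"
  shows "dirlim_map C t'' (\<lambda>s. \<psi> s \<circ> \<phi> s) P = dirlim_map C t'' \<psi> (dirlim_map B t' \<phi> P)"
proof -
  obtain s x where x: "x \<in> carrier (A s)" "P = dirlim_class A t s x"
    using P by (auto simp: dirlim_carrier)
  then show ?thesis
    using dirlim_map_class[OF A C system_map_comp[OF \<phi> \<psi>] x(1)] dirlim_map_class[OF A B \<phi> x(1)]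
      dirlim_map_class[OF B C \<psi> mod_homD(1)[OF system_mapD(1)[OF \<phi>] x(1)]] by simp
qed

text \<open>A direct limit of isomorphisms is an isomorphism and can be cancelled from a composite.\<close>

lemma dirlim_map_comp_iso_left_iff:
  assumes A: "mod_system R A t" and B: "mod_system R B t'" and C: "mod_system R C t''"
    and \<phi>: "system_map R A t B t' \<phi>" and \<psi>: "system_map R B t' C t'' \<psi>"
    and iso: "\<And>s. \<psi> s \<in> mod_iso R (B s) (C s)"
  shows "dirlim_map C t'' (\<lambda>s. \<psi> s \<circ> \<phi> s) \<in> mod_iso R (dirlim A t) (dirlim C t'') \<longleftrightarrow>
    dirlim_map B t' \<phi> \<in> mod_iso R (dirlim A t) (dirlim B t')"
proof -
  have \<psi>': "bij_betw (dirlim_map C t'' \<psi>) (carrier (dirlim B t')) (carrier (dirlim C t''))"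
    using dirlim_map_iso[OF B C \<psi> iso] by (simp add: mod_iso_def)
  have "bij_betw (dirlim_map C t'' (\<lambda>s. \<psi> s \<circ> \<phi> s)) (carrier (dirlim A t)) (carrier (dirlim C t'')) \<longleftrightarrow>
      bij_betw (dirlim_map C t'' \<psi> \<circ> dirlim_map B t' \<phi>) (carrier (dirlim A t)) (carrier (dirlim C t''))"
    using dirlim_map_comp[OF A B C \<phi> \<psi>] by (intro bij_betw_cong) simp
  also have "\<dots> \<longleftrightarrow> bij_betw (dirlim_map B t' \<phi>) (carrier (dirlim A t)) (carrier (dirlim B t'))"
    using mod_homD(1)[OF dirlim_map_hom[OF A B \<phi>]]
    by (intro bij_betw_comp_iff2[OF \<psi>', symmetric] image_subsetI)
  finally show ?thesis
    using dirlim_map_hom[OF A B \<phi>] dirlim_map_hom[OF A C system_map_comp[OF \<phi> \<psi>]]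
    by (simp add: mod_iso_def)
qed

lemma dirlim_map_comp_iso_right_iff:
  assumes A: "mod_system R A t" and B: "mod_system R B t'" and C: "mod_system R C t''"
    and \<phi>: "system_map R A t B t' \<phi>" and \<psi>: "system_map R B t' C t'' \<psi>"
    and iso: "\<And>s. \<phi> s \<in> mod_iso R (A s) (B s)"
  shows "dirlim_map C t'' (\<lambda>s. \<psi> s \<circ> \<phi> s) \<in> mod_iso R (dirlim A t) (dirlim C t'') \<longleftrightarrow>
    dirlim_map C t'' \<psi> \<in> mod_iso R (dirlim B t') (dirlim C t'')"
proof -
  have \<phi>': "bij_betw (dirlim_map B t' \<phi>) (carrier (dirlim A t)) (carrier (dirlim B t'))"
    using dirlim_map_iso[OF A B \<phi> iso] by (simp add: mod_iso_def)
  have "bij_betw (dirlim_map C t'' (\<lambda>s. \<psi> s \<circ> \<phi> s)) (carrier (dirlim A t)) (carrier (dirlim C t'')) \<longleftrightarrow>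
      bij_betw (dirlim_map C t'' \<psi> \<circ> dirlim_map B t' \<phi>) (carrier (dirlim A t)) (carrier (dirlim C t''))"
    using dirlim_map_comp[OF A B C \<phi> \<psi>] by (intro bij_betw_cong) simp
  also have "\<dots> \<longleftrightarrow> bij_betw (dirlim_map C t'' \<psi>) (carrier (dirlim B t')) (carrier (dirlim C t''))"
    by (rule bij_betw_comp_iff[OF \<phi>', symmetric])
  finally show ?thesis
    using dirlim_map_hom[OF B C \<psi>] dirlim_map_hom[OF A C system_map_comp[OF \<phi> \<psi>]]
    by (simp add: mod_iso_def)
qed

section \<open>Long exact sequences in the limit\<close>

definition short_exact ::
    "('r, 'q) ring_scheme \<Rightarrow> ('r, 'a) cpx \<Rightarrow> ('r, 'b) cpx \<Rightarrow> ('r, 'c) cpx \<Rightarrow>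
     (int \<Rightarrow> 'a \<Rightarrow> 'b) \<Rightarrow> (int \<Rightarrow> 'b \<Rightarrow> 'c) \<Rightarrow> bool" where
  "short_exact R X Y Z u v \<longleftrightarrow>
     cochain_complex R X \<and> cochain_complex R Y \<and> cochain_complex R Z \<and>
     chain_map R X Y u \<and> chain_map R Y Z v \<and>
     (\<forall>j. inj_on (u j) (carrier (obj X j))) \<and>
     (\<forall>j. u j ` carrier (obj X j) = {y \<in> carrier (obj Y j). v j y = \<zero>\<^bsub>obj Z j\<^esub>}) \<and>
     (\<forall>j. v j ` carrier (obj Y j) = carrier (obj Z j))"

lemma short_exactD:
  assumes "short_exact R X Y Z u v"
  shows "cochain_complex R X" "cochain_complex R Y" "cochain_complex R Z"
    and "chain_map R X Y u" "chain_map R Y Z v" "inj_on (u j) (carrier (obj X j))"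
    and "u j ` carrier (obj X j) = {y \<in> carrier (obj Y j). v j y = \<zero>\<^bsub>obj Z j\<^esub>}"
    and "v j ` carrier (obj Y j) = carrier (obj Z j)"
  using assms by (simp_all add: short_exact_def)

lemma cocyclesD:
  assumes "x \<in> cocycles X j"
  shows "x \<in> carrier (obj X j)" "dif X j x = \<zero>\<^bsub>obj X (j + 1)\<^esub>"
  using assms by (auto simp: cocycles_def)

lemma coboundariesE:
  assumes "x \<in> coboundaries X j"
  obtains y where "y \<in> carrier (obj X (j - 1))" "x = dif X (j - 1) y"
  using assms by (auto simp: coboundaries_def)

lemma coboundariesI:
  assumes "y \<in> carrier (obj X (j - 1))"
  shows "dif X (j - 1) y \<in> coboundaries X j"
  using assms by (simp add: coboundaries_def)

lemma coboundaries_closed: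
  assumes "cochain_complex R X" "x \<in> coboundaries X j"
  shows "x \<in> carrier (obj X j)"
  using cocyclesD(1)[OF subsetD[OF coboundaries_subset[OF assms(1)] assms(2)]] .

lemma dif_coboundary:
  assumes X: "cochain_complex R X" and "x \<in> coboundaries X j"
  shows "dif X j x = \<zero>\<^bsub>obj X (j + 1)\<^esub>"
  using coboundaries_subset[OF X] assms(2) by (auto simp: cocycles_def)

text \<open>Only two kinds of lifting occur in the diagram chases below.  A cocycle of \<open>Z\<close> lifts to \<open>Y\<close>,
  with a differential that comes from \<open>X\<close> (the connecting homomorphism, as a relation); and an
  element of \<open>Y\<close> with a coboundary as its image in \<open>Z\<close> comes from \<open>X\<close> after correction by a
  coboundary of \<open>Y\<close>.\<close>

context
  fixes R :: "('r, 'q) ring_scheme" and X :: "('r, 'a) cpx" and Y :: "('r, 'b) cpx"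
    and Z :: "('r, 'c) cpx" and u v
  assumes ex: "short_exact R X Y Z u v"
begin

interpretation X: module R "obj X j" for j
  by (rule cochain_complexD(1)[OF short_exactD(1)[OF ex]])
interpretation Y: module R "obj Y j" for j
  by (rule cochain_complexD(1)[OF short_exactD(2)[OF ex]])
interpretation Z: module R "obj Z j" for j
  by (rule cochain_complexD(1)[OF short_exactD(3)[OF ex]])

lemma short_exact_zero:
  assumes "x \<in> carrier (obj X j)"
  shows "v j (u j x) = \<zero>\<^bsub>obj Z j\<^esub>"
  using short_exactD(7)[OF ex, of j] assms by blast

lemma short_exact_cocycle:
  assumes x: "x \<in> carrier (obj X j)" and d: "dif Y j (u j x) = \<zero>\<^bsub>obj Y (j + 1)\<^esub>"
  shows "x \<in> cocycles X j"
proof -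
  have dx: "dif X j x \<in> carrier (obj X (j + 1))"
    by (rule mod_homD(1)[OF cochain_complexD(2)[OF short_exactD(1)[OF ex]] x])
  moreover have "u (j + 1) (dif X j x) = \<zero>\<^bsub>obj Y (j + 1)\<^esub>"
    using chain_mapD(2)[OF short_exactD(4)[OF ex] x] d by simp
  ultimately have "dif X j x = \<zero>\<^bsub>obj X (j + 1)\<^esub>"
    using short_exactD(6)[OF ex, of "j + 1"]
      mod_hom_inj_iff[OF chain_mapD(1)[OF short_exactD(4)[OF ex]] X.module_axioms Y.module_axioms] by blast
  then show ?thesis using x by (simp add: cocycles_def)
qed

lemma short_exact_connecting:
  assumes z: "z \<in> cocycles Z j"
  obtains y x where "y \<in> carrier (obj Y j)" "v j y = z" "x \<in> cocycles X (j + 1)"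
    "dif Y j y = u (j + 1) x"
proof -
  obtain y where y: "y \<in> carrier (obj Y j)" "v j y = z"
    using short_exactD(8)[OF ex, of j] cocyclesD(1)[OF z] by (metis imageE)
  have dy: "dif Y j y \<in> carrier (obj Y (j + 1))"
    by (rule mod_homD(1)[OF cochain_complexD(2)[OF short_exactD(2)[OF ex]] y(1)])
  moreover have "v (j + 1) (dif Y j y) = \<zero>\<^bsub>obj Z (j + 1)\<^esub>"
    using chain_mapD(2)[OF short_exactD(5)[OF ex] y(1)] y(2) cocyclesD(2)[OF z] by simp
  ultimately obtain x where x: "x \<in> carrier (obj X (j + 1))" "dif Y j y = u (j + 1) x"
    using short_exactD(7)[OF ex, of "j + 1"] by blast
  have "dif Y (j + 1) (u (j + 1) x) = \<zero>\<^bsub>obj Y (j + 1 + 1)\<^esub>"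
    using cochain_complexD(3)[OF short_exactD(2)[OF ex] y(1)] x(2) by (simp add: add.assoc)
  from that[OF y short_exact_cocycle[OF x(1) this] x(2)] show thesis .
qed

lemma short_exact_coboundary_lift:
  assumes y: "y \<in> carrier (obj Y j)" and vy: "v j y \<in> coboundaries Z j"
  obtains b x where "b \<in> coboundaries Y j" "x \<in> carrier (obj X j)" "y = b \<oplus>\<^bsub>obj Y j\<^esub> u j x"
proof -
  obtain z where z: "z \<in> carrier (obj Z (j - 1))" "v j y = dif Z (j - 1) z"
    using coboundariesE[OF vy] .
  obtain y' where y': "y' \<in> carrier (obj Y (j - 1))" "v (j - 1) y' = z"
    using short_exactD(8)[OF ex, of "j - 1"] z(1) by (metis imageE)
  define b where "b = dif Y (j - 1) y'"
  have b: "b \<in> coboundaries Y j" unfolding b_def by (rule coboundariesI[OF y'(1)])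
  then have bY: "b \<in> carrier (obj Y j)"
    by (rule coboundaries_closed[OF short_exactD(2)[OF ex]])
  have "v j b = v j y"
    using chain_mapD(2)[OF short_exactD(5)[OF ex] y'(1)] y'(2) z(2) by (simp add: b_def)
  then have "v j (y \<ominus>\<^bsub>obj Y j\<^esub> b) = \<zero>\<^bsub>obj Z j\<^esub>"
    using mod_hom_eq_iff[OF chain_mapD(1)[OF short_exactD(5)[OF ex]] Y.module_axioms Z.module_axioms y bY] by simp
  moreover have "y \<ominus>\<^bsub>obj Y j\<^esub> b \<in> carrier (obj Y j)" using y bY by simp
  ultimately obtain x where x: "x \<in> carrier (obj X j)" "y \<ominus>\<^bsub>obj Y j\<^esub> b = u j x"
    using short_exactD(7)[OF ex, of j] by blast
  have "b \<oplus>\<^bsub>obj Y j\<^esub> (y \<ominus>\<^bsub>obj Y j\<^esub> b) = y"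
    by (rule module_minus_add(1)[OF Y.module_axioms bY y])
  then show thesis using that[OF b x(1)] x(2) by simp
qed

end

definition cpx_system ::
    "('r, 'q) ring_scheme \<Rightarrow> (nat \<Rightarrow> ('r, 'a) cpx) \<Rightarrow> (nat \<Rightarrow> int \<Rightarrow> 'a \<Rightarrow> 'a) \<Rightarrow> bool" where
  "cpx_system R X t \<longleftrightarrow> (\<forall>s. cochain_complex R (X s)) \<and> (\<forall>s. chain_map R (X s) (X (Suc s)) (t s))"

definition cpx_system_map ::
    "('r, 'q) ring_scheme \<Rightarrow> (nat \<Rightarrow> ('r, 'a) cpx) \<Rightarrow> (nat \<Rightarrow> int \<Rightarrow> 'a \<Rightarrow> 'a) \<Rightarrow>
     (nat \<Rightarrow> ('r, 'b) cpx) \<Rightarrow> (nat \<Rightarrow> int \<Rightarrow> 'b \<Rightarrow> 'b) \<Rightarrow> (nat \<Rightarrow> int \<Rightarrow> 'a \<Rightarrow> 'b) \<Rightarrow> bool" where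
  "cpx_system_map R X t Y t' u \<longleftrightarrow> (\<forall>s. chain_map R (X s) (Y s) (u s)) \<and>
     (\<forall>s j. \<forall>x\<in>carrier (obj (X s) j). u (Suc s) j (t s j x) = t' s j (u s j x))"

abbreviation "coh_sys X i \<equiv> (\<lambda>s::nat. cohomology (X s) i)"
abbreviation "coh_trans X t i \<equiv> (\<lambda>s::nat. cohomology_map (X (Suc s)) i (t s i))"

abbreviation "stage_map t s k j \<equiv> transit (\<lambda>s. t s j) s k"

text \<open>What the vanishing of a limit of cohomology modules, and the injectivity and surjectivity of a
  map between two of them, mean for cocycles: everything may be tested at a later stage.\<close>

definition lim_acyclic where
  "lim_acyclic X t i \<longleftrightarrow> (\<forall>s. \<forall>x\<in>cocycles (X s) i. \<exists>k. stage_map t s k i x \<in> coboundaries (X (s + k)) i)"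

definition lim_inj where
  "lim_inj X t Y u i \<longleftrightarrow> (\<forall>s. \<forall>x\<in>cocycles (X s) i. u s i x \<in> coboundaries (Y s) i \<longrightarrow>
     (\<exists>k. stage_map t s k i x \<in> coboundaries (X (s + k)) i))"

definition lim_surj where
  "lim_surj X Y t' u i \<longleftrightarrow> (\<forall>s. \<forall>y\<in>cocycles (Y s) i. \<exists>k. \<exists>b\<in>coboundaries (Y (s + k)) i.
     \<exists>x\<in>cocycles (X (s + k)) i. stage_map t' s k i y = b \<oplus>\<^bsub>obj (Y (s + k)) i\<^esub> u (s + k) i x)"

lemma cpx_systemD:
  assumes "cpx_system R X t"
  shows "cochain_complex R (X s)" "chain_map R (X s) (X (Suc s)) (t s)"
  using assms by (auto simp: cpx_system_def)

lemma cpx_system_mapD: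
  assumes "cpx_system_map R X t Y t' u"
  shows "chain_map R (X s) (Y s) (u s)"
    and "x \<in> carrier (obj (X s) j) \<Longrightarrow> u (Suc s) j (t s j x) = t' s j (u s j x)"
  using assms by (auto simp: cpx_system_map_def)

context
  fixes R :: "('r, 'q) ring_scheme" and X :: "nat \<Rightarrow> ('r, 'a) cpx" and t
  assumes X: "cpx_system R X t"
begin

lemma stage_map_chain_map: "chain_map R (X s) (X (s + k)) (stage_map t s k)"
proof (induction k)
  case 0
  then show ?case by (auto simp: chain_map_def mod_hom_def)
next
  case (Suc k)
  show ?case
    using chain_map_comp[OF Suc cpx_systemD(2)[OF X]] by (simp add: comp_def)
qed

lemma coh_sys: "mod_system R (coh_sys X i) (coh_trans X t i)"
  unfolding mod_system_def
  using cohomology_module[OF cpx_systemD(1)[OF X]]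
    cohomology_map_hom[OF cpx_systemD(1)[OF X] cpx_systemD(1)[OF X] cpx_systemD(2)[OF X]] by blast

lemma transit_coh_class:
  assumes "x \<in> cocycles (X s) i"
  shows "transit (coh_trans X t i) s k (coh_class (X s) i x) = coh_class (X (s + k)) i (stage_map t s k i x)"
proof (rule transit_natural[of "\<lambda>s. cocycles (X s) i" "\<lambda>s. t s i", symmetric])
  fix s x assume x: "x \<in> cocycles (X s) i"
  note * = cpx_systemD(1)[OF X] cpx_systemD(1)[OF X] cpx_systemD(2)[OF X]
  show "t s i x \<in> cocycles (X (Suc s)) i" by (rule chain_map_cocycles[OF * x])
  show "coh_class (X (Suc s)) i (t s i x) = cohomology_map (X (Suc s)) i (t s i) (coh_class (X s) i x)"
    by (rule cohomology_map_class[OF * x, symmetric])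
qed (rule assms)

lemma stage_map_cocycle:
  assumes "x \<in> cocycles (X s) i"
  shows "stage_map t s k i x \<in> cocycles (X (s + k)) i"
  by (rule chain_map_cocycles[OF cpx_systemD(1)[OF X] cpx_systemD(1)[OF X] stage_map_chain_map assms])

lemma lim_acyclic_iff:
  "zero_module (dirlim (coh_sys X i) (coh_trans X t i)) \<longleftrightarrow> lim_acyclic X t i"
  unfolding dirlim_zero_module_iff[OF coh_sys] lim_acyclic_def
  by (simp add: cohomology_carrier[OF cpx_systemD(1)[OF X]] transit_coh_class
      coh_class_zero_iff[OF cpx_systemD(1)[OF X]] stage_map_cocycle)

end

context
  fixes R :: "('r, 'q) ring_scheme" and X :: "nat \<Rightarrow> ('r, 'a) cpx" and t
    and Y :: "nat \<Rightarrow> ('r, 'b) cpx" and t' u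
  assumes X: "cpx_system R X t" and Y: "cpx_system R Y t'" and u: "cpx_system_map R X t Y t' u"
begin

lemma coh_sys_map:
  "system_map R (coh_sys X i) (coh_trans X t i) (coh_sys Y i) (coh_trans Y t' i)
     (\<lambda>s. cohomology_map (Y s) i (u s i))"
  unfolding system_map_def
proof (intro conjI allI ballI)
  fix s
  note uD = cpx_systemD(1)[OF X] cpx_systemD(1)[OF Y] cpx_system_mapD(1)[OF u]
  note XD = cpx_systemD(1)[OF X] cpx_systemD(1)[OF X] cpx_systemD(2)[OF X]
  note YD = cpx_systemD(1)[OF Y] cpx_systemD(1)[OF Y] cpx_systemD(2)[OF Y]
  show "cohomology_map (Y s) i (u s i) \<in> mod_hom R (cohomology (X s) i) (cohomology (Y s) i)"
    by (rule cohomology_map_hom[OF uD])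
  fix S assume "S \<in> carrier (cohomology (X s) i)"
  then obtain x where x: "x \<in> cocycles (X s) i" "S = coh_class (X s) i x"
    by (auto simp: cohomology_carrier[OF cpx_systemD(1)[OF X]])
  then show "cohomology_map (Y (Suc s)) i (u (Suc s) i) (cohomology_map (X (Suc s)) i (t s i) S) =
      cohomology_map (Y (Suc s)) i (t' s i) (cohomology_map (Y s) i (u s i) S)"
    using cpx_system_mapD(2)[OF u cocyclesD(1)[OF x(1)]]
      chain_map_cocycles[OF XD x(1)] chain_map_cocycles[OF uD x(1)]
    by (simp add: cohomology_map_class[OF XD] cohomology_map_class[OF YD] cohomology_map_class[OF uD])
qed

lemma stage_map_natural:
  assumes "x \<in> carrier (obj (X s) i)"
  shows "u (s + k) i (stage_map t s k i x) = stage_map t' s k i (u s i x)"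
proof (rule transit_natural[of "\<lambda>s. carrier (obj (X s) i)" "\<lambda>s. t s i"])
  fix s x assume x: "x \<in> carrier (obj (X s) i)"
  show "t s i x \<in> carrier (obj (X (Suc s)) i)"
    by (rule mod_homD(1)[OF chain_mapD(1)[OF cpx_systemD(2)[OF X]] x])
  show "u (Suc s) i (t s i x) = t' s i (u s i x)" by (rule cpx_system_mapD(2)[OF u x])
qed (rule assms)

lemma lim_iso_iff:
  "dirlim_map (coh_sys Y i) (coh_trans Y t' i) (\<lambda>s. cohomology_map (Y s) i (u s i))
      \<in> mod_iso R (dirlim (coh_sys X i) (coh_trans X t i)) (dirlim (coh_sys Y i) (coh_trans Y t' i)) \<longleftrightarrow>
    lim_inj X t Y u i \<and> lim_surj X Y t' u i"
proof -
  note sys = coh_sys[OF X] coh_sys[OF Y] coh_sys_map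
  note uD = cpx_systemD(1)[OF X] cpx_systemD(1)[OF Y] cpx_system_mapD(1)[OF u]
  have inj: "inj_on (dirlim_map (coh_sys Y i) (coh_trans Y t' i) (\<lambda>s. cohomology_map (Y s) i (u s i)))
      (carrier (dirlim (coh_sys X i) (coh_trans X t i))) \<longleftrightarrow> lim_inj X t Y u i"
    unfolding dirlim_map_inj_iff[OF sys] lim_inj_def
    by (simp add: cohomology_carrier[OF cpx_systemD(1)[OF X]] cohomology_map_class[OF uD]
        transit_coh_class[OF X] coh_class_zero_iff[OF cpx_systemD(1)[OF X]] stage_map_cocycle[OF X]
        coh_class_zero_iff[OF cpx_systemD(1)[OF Y]] chain_map_cocycles[OF uD])
  have "transit (coh_trans Y t' i) s k (coh_class (Y s) i y) \<in>
        cohomology_map (Y (s + k)) i (u (s + k) i) ` carrier (cohomology (X (s + k)) i) \<longleftrightarrow>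
      (\<exists>b\<in>coboundaries (Y (s + k)) i. \<exists>x\<in>cocycles (X (s + k)) i.
        stage_map t' s k i y = b \<oplus>\<^bsub>obj (Y (s + k)) i\<^esub> u (s + k) i x)"
    if y: "y \<in> cocycles (Y s) i" for s k y
  proof -
    interpret Y: module R "obj (Y (s + k)) i" by (rule cochain_complexD(1)[OF cpx_systemD(1)[OF Y]])
    let ?y = "stage_map t' s k i y"
    have y': "?y \<in> cocycles (Y (s + k)) i" by (rule stage_map_cocycle[OF Y that])
    have "coh_class (Y (s + k)) i ?y = coh_class (Y (s + k)) i (u (s + k) i x) \<longleftrightarrow>
        (\<exists>b\<in>coboundaries (Y (s + k)) i. ?y = b \<oplus>\<^bsub>obj (Y (s + k)) i\<^esub> u (s + k) i x)"
      if x: "x \<in> cocycles (X (s + k)) i" for x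
    proof -
      have c: "?y \<in> carrier (obj (Y (s + k)) i)" "u (s + k) i x \<in> carrier (obj (Y (s + k)) i)"
        "\<And>b. b \<in> coboundaries (Y (s + k)) i \<Longrightarrow> b \<in> carrier (obj (Y (s + k)) i)"
        using cocyclesD(1)[OF y'] cocyclesD(1)[OF chain_map_cocycles[OF uD x]]
          coboundaries_closed[OF cpx_systemD(1)[OF Y]] by auto
      have "?y \<ominus>\<^bsub>obj (Y (s + k)) i\<^esub> u (s + k) i x = b \<longleftrightarrow> ?y = b \<oplus>\<^bsub>obj (Y (s + k)) i\<^esub> u (s + k) i x"
        if "b \<in> coboundaries (Y (s + k)) i" for b
        using c(1,2) c(3)[OF that] by (auto simp: a_minus_def Y.M.a_assoc Y.M.r_neg Y.M.l_neg)
      then show ?thesis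
        unfolding coh_class_eq_iff[OF cpx_systemD(1)[OF Y] y' chain_map_cocycles[OF uD x]] by auto
    qed
    then show ?thesis
      unfolding transit_coh_class[OF Y that] cohomology_carrier[OF cpx_systemD(1)[OF X]]
      by (auto simp: image_iff cohomology_map_class[OF uD])
  qed
  then have surj: "dirlim_map (coh_sys Y i) (coh_trans Y t' i) (\<lambda>s. cohomology_map (Y s) i (u s i)) `
      carrier (dirlim (coh_sys X i) (coh_trans X t i)) = carrier (dirlim (coh_sys Y i) (coh_trans Y t' i))
      \<longleftrightarrow> lim_surj X Y t' u i"
    unfolding dirlim_map_surj_iff[OF sys] lim_surj_def
    by (simp add: cohomology_carrier[OF cpx_systemD(1)[OF Y]])
  show ?thesis
    using inj surj dirlim_map_hom[OF sys] by (auto simp: mod_iso_def bij_betw_def)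
qed

end

context
  fixes R :: "('r, 'q) ring_scheme" and X :: "nat \<Rightarrow> ('r, 'a) cpx" and Y :: "nat \<Rightarrow> ('r, 'b) cpx"
    and Z :: "nat \<Rightarrow> ('r, 'c) cpx" and t t' t'' u v
  assumes X: "cpx_system R X t" and Y: "cpx_system R Y t'" and Z: "cpx_system R Z t''"
    and u: "cpx_system_map R X t Y t' u" and v: "cpx_system_map R Y t' Z t'' v"
    and ex: "\<And>s. short_exact R (X s) (Y s) (Z s) (u s) (v s)"
begin

interpretation X: module R "obj (X s) j" for s j
  by (rule cochain_complexD(1)[OF cpx_systemD(1)[OF X]])
interpretation Y: module R "obj (Y s) j" for s j
  by (rule cochain_complexD(1)[OF cpx_systemD(1)[OF Y]])
interpretation Z: module R "obj (Z s) j" for s j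
  by (rule cochain_complexD(1)[OF cpx_systemD(1)[OF Z]])

private lemmas uD = chain_mapD(1)[OF cpx_system_mapD(1)[OF u]]
private lemmas vD = chain_mapD(1)[OF cpx_system_mapD(1)[OF v]]
private lemmas dX = cochain_complexD(2)[OF cpx_systemD(1)[OF X]]
private lemmas dY = cochain_complexD(2)[OF cpx_systemD(1)[OF Y]]
private lemmas tX = chain_mapD(1)[OF stage_map_chain_map[OF X]]
private lemmas tY = chain_mapD(1)[OF stage_map_chain_map[OF Y]]

private lemma u_inj: "x \<in> carrier (obj (X s) j) \<Longrightarrow> x' \<in> carrier (obj (X s) j) \<Longrightarrow> u s j x = u s j x' \<Longrightarrow> x = x'"
  using short_exactD(6)[OF ex] by (metis inj_onD)

private lemma cobY: "b \<in> coboundaries (Y s) j \<Longrightarrow> b \<in> carrier (obj (Y s) j)"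
  by (rule coboundaries_closed[OF cpx_systemD(1)[OF Y]])

private lemma cobZ: "b \<in> coboundaries (Z s) j \<Longrightarrow> b \<in> carrier (obj (Z s) j)"
  by (rule coboundaries_closed[OF cpx_systemD(1)[OF Z]])

private lemma dif_lift:
  assumes b: "b \<in> coboundaries (Y s) j" and x: "x \<in> carrier (obj (X s) j)"
  shows "dif (Y s) j (b \<oplus>\<^bsub>obj (Y s) j\<^esub> u s j x) = u s (j + 1) (dif (X s) j x)"
  using mod_homD(2)[OF dY cobY[OF b] mod_homD(1)[OF uD x]] dif_coboundary[OF cpx_systemD(1)[OF Y] b]
    chain_mapD(2)[OF cpx_system_mapD(1)[OF u] x] mod_homD(1)[OF dY mod_homD(1)[OF uD x]] by simp

private lemma lift_cocycle:
  assumes y: "y \<in> cocycles (Y s) j" "v s j y \<in> coboundaries (Z s) j"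
  obtains b x where "b \<in> coboundaries (Y s) j" "x \<in> cocycles (X s) j" "y = b \<oplus>\<^bsub>obj (Y s) j\<^esub> u s j x"
proof -
  obtain b x where bx: "b \<in> coboundaries (Y s) j" "x \<in> carrier (obj (X s) j)"
    "y = b \<oplus>\<^bsub>obj (Y s) j\<^esub> u s j x"
    using short_exact_coboundary_lift[OF ex cocyclesD(1)[OF y(1)] y(2)] .
  have "dif (Y s) j (u s j x) = \<zero>\<^bsub>obj (Y s) (j + 1)\<^esub>"
    using dif_lift[OF bx(1,2)] bx(3) cocyclesD(2)[OF y(1)]
      chain_mapD(2)[OF cpx_system_mapD(1)[OF u] bx(2)] by simp
  then show thesis using that bx short_exact_cocycle[OF ex bx(2)] by blast
qed

text \<open>If the connecting homomorphism sends the class of \<open>v y\<close> to a class that dies at a later stage,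
  then there \<open>v y\<close> lifts to a cocycle: subtract from \<open>y\<close> a cochain that bounds \<open>x\<close>.\<close>

private lemma connecting_correct:
  assumes y: "y \<in> carrier (obj (Y s) j)" and x: "x \<in> cocycles (X s) (j + 1)"
    and dy: "dif (Y s) j y = u s (j + 1) x"
    and k: "stage_map t s k (j + 1) x \<in> coboundaries (X (s + k)) (j + 1)"
  obtains y' where "y' \<in> cocycles (Y (s + k)) j" "v (s + k) j y' = stage_map t'' s k j (v s j y)"
proof -
  obtain a where a: "a \<in> carrier (obj (X (s + k)) j)"
    "stage_map t s k (j + 1) x = dif (X (s + k)) j a"
    using coboundariesE[OF k] by auto
  let ?y = "stage_map t' s k j y" and ?ua = "u (s + k) j a" and ?O = "obj (Y (s + k))"
  have c: "?y \<in> carrier (?O j)" "?ua \<in> carrier (?O j)"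
    by (rule mod_homD(1)[OF tY y], rule mod_homD(1)[OF uD a(1)])
  have "dif (Y (s + k)) j ?y = u (s + k) (j + 1) (dif (X (s + k)) j a)"
    using chain_mapD(2)[OF stage_map_chain_map[OF Y] y] dy
      stage_map_natural[OF X Y u cocyclesD(1)[OF x], of k] a(2) by simp
  also have "\<dots> = dif (Y (s + k)) j ?ua"
    by (rule chain_mapD(2)[OF cpx_system_mapD(1)[OF u] a(1)])
  finally have "dif (Y (s + k)) j (?y \<ominus>\<^bsub>?O j\<^esub> ?ua) = \<zero>\<^bsub>?O (j + 1)\<^esub>"
    using mod_hom_eq_iff[OF dY Y.module_axioms Y.module_axioms c] by simp
  then have "?y \<ominus>\<^bsub>?O j\<^esub> ?ua \<in> cocycles (Y (s + k)) j" using c by (simp add: cocycles_def)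
  moreover have "v (s + k) j (?y \<ominus>\<^bsub>?O j\<^esub> ?ua) = stage_map t'' s k j (v s j y)"
    using mod_hom_minus(2)[OF vD Y.module_axioms Z.module_axioms c] short_exact_zero[OF ex a(1)]
      stage_map_natural[OF Y Z v y, of k] mod_homD(1)[OF vD c(1)] Z.M.add.inv_one
    by (simp add: a_minus_def a_inv_def)
  ultimately show thesis by (rule that)
qed

text \<open>The chase is that of the long exact sequence, except that every use of a hypothesis moves to a
  later stage.  When \<open>Z\<close> is acyclic in the limit, injectivity in degree \<open>i\<close> uses this in degree
  \<open>i - 1\<close>, surjectivity in degree \<open>i\<close>.  Conversely, a cocycle of \<open>Z\<close> lifts to a cocycle of \<open>Y\<close> by
  injectivity in degree \<open>i + 1\<close>, and that cocycle comes from \<open>X\<close>, up to a coboundary, by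
  surjectivity in degree \<open>i\<close>.\<close>

lemma lim_iso_iff_coker_acyclic:
  "(\<forall>i. lim_inj X t Y u i \<and> lim_surj X Y t' u i) \<longleftrightarrow> (\<forall>i. lim_acyclic Z t'' i)"
proof
  assume Z0: "\<forall>i. lim_acyclic Z t'' i"
  show "\<forall>i. lim_inj X t Y u i \<and> lim_surj X Y t' u i"
  proof (intro allI conjI)
    fix i
    show "lim_inj X t Y u i"
      unfolding lim_inj_def
    proof (intro allI ballI impI)
      fix s x assume x: "x \<in> cocycles (X s) i" and ux: "u s i x \<in> coboundaries (Y s) i"
      obtain y where y: "y \<in> carrier (obj (Y s) (i - 1))" "u s i x = dif (Y s) (i - 1) y"
        using coboundariesE[OF ux] .
      have "dif (Z s) (i - 1) (v s (i - 1) y) = v s i (u s i x)"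
        using chain_mapD(2)[OF cpx_system_mapD(1)[OF v] y(1)] y(2) by simp
      then have "v s (i - 1) y \<in> cocycles (Z s) (i - 1)"
        using short_exact_zero[OF ex cocyclesD(1)[OF x]] mod_homD(1)[OF vD y(1)]
        by (simp add: cocycles_def)
      then obtain k where k: "stage_map t'' s k (i - 1) (v s (i - 1) y) \<in> coboundaries (Z (s + k)) (i - 1)"
        using Z0 unfolding lim_acyclic_def by blast
      let ?y = "stage_map t' s k (i - 1) y" and ?x = "stage_map t s k i x"
      have y': "?y \<in> carrier (obj (Y (s + k)) (i - 1))" by (rule mod_homD(1)[OF tY y(1)])
      have "v (s + k) (i - 1) ?y \<in> coboundaries (Z (s + k)) (i - 1)"
        using k stage_map_natural[OF Y Z v y(1), of k] by simp
      then obtain b a where ba: "b \<in> coboundaries (Y (s + k)) (i - 1)" "a \<in> carrier (obj (X (s + k)) (i - 1))"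
        "?y = b \<oplus>\<^bsub>obj (Y (s + k)) (i - 1)\<^esub> u (s + k) (i - 1) a"
        using short_exact_coboundary_lift[OF ex y'] by blast
      have "u (s + k) i ?x = u (s + k) i (dif (X (s + k)) (i - 1) a)"
        using stage_map_natural[OF X Y u cocyclesD(1)[OF x], of k] y(2)
          chain_mapD(2)[OF stage_map_chain_map[OF Y] y(1), of k] dif_lift[OF ba(1,2)] ba(3) by simp
      then have "?x = dif (X (s + k)) (i - 1) a"
        using mod_homD(1)[OF tX cocyclesD(1)[OF x]] mod_homD(1)[OF dX ba(2)] by (intro u_inj) auto
      then show "\<exists>k. stage_map t s k i x \<in> coboundaries (X (s + k)) i"
        using coboundariesI[OF ba(2)] by metis
    qed
    show "lim_surj X Y t' u i"
      unfolding lim_surj_def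
    proof (intro allI ballI)
      fix s y assume y: "y \<in> cocycles (Y s) i"
      have "v s i y \<in> cocycles (Z s) i"
        by (rule chain_map_cocycles[OF cpx_systemD(1)[OF Y] cpx_systemD(1)[OF Z] cpx_system_mapD(1)[OF v] y])
      then obtain k where k: "stage_map t'' s k i (v s i y) \<in> coboundaries (Z (s + k)) i"
        using Z0 unfolding lim_acyclic_def by blast
      then have "v (s + k) i (stage_map t' s k i y) \<in> coboundaries (Z (s + k)) i"
        using stage_map_natural[OF Y Z v cocyclesD(1)[OF y], of k] by simp
      then show "\<exists>k. \<exists>b\<in>coboundaries (Y (s + k)) i. \<exists>x\<in>cocycles (X (s + k)) i.
          stage_map t' s k i y = b \<oplus>\<^bsub>obj (Y (s + k)) i\<^esub> u (s + k) i x"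
        using lift_cocycle[OF stage_map_cocycle[OF Y y]] by metis
    qed
  qed
next
  assume iso: "\<forall>i. lim_inj X t Y u i \<and> lim_surj X Y t' u i"
  show "\<forall>i. lim_acyclic Z t'' i"
    unfolding lim_acyclic_def
  proof (intro allI ballI)
    fix i s z assume z: "z \<in> cocycles (Z s) i"
    obtain y x where yx: "y \<in> carrier (obj (Y s) i)" "v s i y = z" "x \<in> cocycles (X s) (i + 1)"
      "dif (Y s) i y = u s (i + 1) x"
      using short_exact_connecting[OF ex z] .
    have "u s (i + 1) x \<in> coboundaries (Y s) (i + 1)"
      using coboundariesI[of y "Y s" "i + 1"] yx(1,4) by simp
    then obtain k where "stage_map t s k (i + 1) x \<in> coboundaries (X (s + k)) (i + 1)"
      using iso yx(3) unfolding lim_inj_def by blast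
    then obtain y' where y': "y' \<in> cocycles (Y (s + k)) i" "v (s + k) i y' = stage_map t'' s k i z"
      using connecting_correct[OF yx(1,3,4)] yx(2) by metis
    obtain l b a where l: "b \<in> coboundaries (Y (s + k + l)) i" "a \<in> cocycles (X (s + k + l)) i"
      "stage_map t' (s + k) l i y' = b \<oplus>\<^bsub>obj (Y (s + k + l)) i\<^esub> u (s + k + l) i a"
      using iso y'(1) unfolding lim_surj_def by blast
    have b: "v (s + k + l) i b \<in> coboundaries (Z (s + k + l)) i"
      by (rule chain_map_coboundaries[OF cpx_systemD(1)[OF Y] cpx_systemD(1)[OF Z] cpx_system_mapD(1)[OF v] l(1)])
    have "stage_map t'' s (k + l) i z = v (s + k + l) i (stage_map t' (s + k) l i y')"
      using y'(2) stage_map_natural[OF Y Z v cocyclesD(1)[OF y'(1)], of l] by (simp add: transit_add)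
    also have "\<dots> = v (s + k + l) i b"
      using l(3) mod_homD(2)[OF vD cobY[OF l(1)] mod_homD(1)[OF uD cocyclesD(1)[OF l(2)]]]
        short_exact_zero[OF ex cocyclesD(1)[OF l(2)]] cobZ[OF b] by simp
    finally have "stage_map t'' s (k + l) i z \<in> coboundaries (Z (s + (k + l))) i"
      using b by (simp add: add.assoc)
    then show "\<exists>k. stage_map t'' s k i z \<in> coboundaries (Z (s + k)) i" by blast
  qed
qed

text \<open>The chase of the long exact sequence again.  In the backward direction, \<open>u x\<close> becomes the
  coboundary of some \<open>y\<close> by injectivity in degree \<open>i\<close>; then \<open>v y\<close> is a cocycle, and by surjectivity
  in degree \<open>i - 1\<close> the element \<open>y\<close> can be corrected by a cocycle so that it comes from \<open>X\<close>, up to a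
  coboundary.\<close>

lemma lim_iso_iff_ker_acyclic:
  "(\<forall>i. lim_inj Y t' Z v i \<and> lim_surj Y Z t'' v i) \<longleftrightarrow> (\<forall>i. lim_acyclic X t i)"
proof
  assume X0: "\<forall>i. lim_acyclic X t i"
  show "\<forall>i. lim_inj Y t' Z v i \<and> lim_surj Y Z t'' v i"
  proof (intro allI conjI)
    fix i
    show "lim_inj Y t' Z v i"
      unfolding lim_inj_def
    proof (intro allI ballI impI)
      fix s y assume y: "y \<in> cocycles (Y s) i" and vy: "v s i y \<in> coboundaries (Z s) i"
      obtain b x where bx: "b \<in> coboundaries (Y s) i" "x \<in> cocycles (X s) i"
        "y = b \<oplus>\<^bsub>obj (Y s) i\<^esub> u s i x"
        using lift_cocycle[OF y vy] .
      obtain k where k: "stage_map t s k i x \<in> coboundaries (X (s + k)) i"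
        using X0 bx(2) unfolding lim_acyclic_def by blast
      have "stage_map t' s k i b \<in> coboundaries (Y (s + k)) i"
        by (rule chain_map_coboundaries[OF cpx_systemD(1)[OF Y] cpx_systemD(1)[OF Y]
              stage_map_chain_map[OF Y] bx(1)])
      moreover have "u (s + k) i (stage_map t s k i x) \<in> coboundaries (Y (s + k)) i"
        by (rule chain_map_coboundaries[OF cpx_systemD(1)[OF X] cpx_systemD(1)[OF Y]
              cpx_system_mapD(1)[OF u] k])
      ultimately have "stage_map t' s k i b \<oplus>\<^bsub>obj (Y (s + k)) i\<^esub> u (s + k) i (stage_map t s k i x)
          \<in> coboundaries (Y (s + k)) i"
        by (rule Y.submoduleE(5)[OF coboundaries_submodule[OF cpx_systemD(1)[OF Y]]])
      then show "\<exists>k. stage_map t' s k i y \<in> coboundaries (Y (s + k)) i"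
        using mod_homD(2)[OF tY cobY[OF bx(1)] mod_homD(1)[OF uD cocyclesD(1)[OF bx(2)]], of k]
          stage_map_natural[OF X Y u cocyclesD(1)[OF bx(2)], of k] bx(3) by metis
    qed
    show "lim_surj Y Z t'' v i"
      unfolding lim_surj_def
    proof (intro allI ballI)
      fix s z assume z: "z \<in> cocycles (Z s) i"
      obtain y x where yx: "y \<in> carrier (obj (Y s) i)" "v s i y = z" "x \<in> cocycles (X s) (i + 1)"
        "dif (Y s) i y = u s (i + 1) x"
        using short_exact_connecting[OF ex z] .
      obtain k where "stage_map t s k (i + 1) x \<in> coboundaries (X (s + k)) (i + 1)"
        using X0 yx(3) unfolding lim_acyclic_def by blast
      then obtain y' where y': "y' \<in> cocycles (Y (s + k)) i" "v (s + k) i y' = stage_map t'' s k i z"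
        using connecting_correct[OF yx(1,3,4)] yx(2) by metis
      have "stage_map t'' s k i z = \<zero>\<^bsub>obj (Z (s + k)) i\<^esub> \<oplus>\<^bsub>obj (Z (s + k)) i\<^esub> v (s + k) i y'"
        using y' mod_homD(1)[OF vD cocyclesD(1)[OF y'(1)]] by simp
      moreover have "\<zero>\<^bsub>obj (Z (s + k)) i\<^esub> \<in> coboundaries (Z (s + k)) i"
        by (rule submodule_zero[OF coboundaries_submodule[OF cpx_systemD(1)[OF Z]]])
      ultimately show "\<exists>k. \<exists>b\<in>coboundaries (Z (s + k)) i. \<exists>x\<in>cocycles (Y (s + k)) i.
          stage_map t'' s k i z = b \<oplus>\<^bsub>obj (Z (s + k)) i\<^esub> v (s + k) i x"
        using y'(1) by blast
    qed
  qed
next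
  assume iso: "\<forall>i. lim_inj Y t' Z v i \<and> lim_surj Y Z t'' v i"
  show "\<forall>i. lim_acyclic X t i"
    unfolding lim_acyclic_def
  proof (intro allI ballI)
    fix i s x assume x: "x \<in> cocycles (X s) i"
    have ux: "u s i x \<in> cocycles (Y s) i"
      by (rule chain_map_cocycles[OF cpx_systemD(1)[OF X] cpx_systemD(1)[OF Y] cpx_system_mapD(1)[OF u] x])
    have "v s i (u s i x) \<in> coboundaries (Z s) i"
      using short_exact_zero[OF ex cocyclesD(1)[OF x]]
        submodule_zero[OF coboundaries_submodule[OF cpx_systemD(1)[OF Z]]] by simp
    then obtain k where "stage_map t' s k i (u s i x) \<in> coboundaries (Y (s + k)) i"
      using iso ux unfolding lim_inj_def by blast
    then obtain y where y: "y \<in> carrier (obj (Y (s + k)) (i - 1))"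
      "stage_map t' s k i (u s i x) = dif (Y (s + k)) (i - 1) y"
      by (rule coboundariesE)
    let ?x = "stage_map t s k i x"
    have x': "?x \<in> carrier (obj (X (s + k)) i)" by (rule mod_homD(1)[OF tX cocyclesD(1)[OF x]])
    have dy: "dif (Y (s + k)) (i - 1) y = u (s + k) i ?x"
      using y(2) stage_map_natural[OF X Y u cocyclesD(1)[OF x], of k] by simp
    have "dif (Z (s + k)) (i - 1) (v (s + k) (i - 1) y) = v (s + k) i (u (s + k) i ?x)"
      using chain_mapD(2)[OF cpx_system_mapD(1)[OF v] y(1)] dy by simp
    then have "v (s + k) (i - 1) y \<in> cocycles (Z (s + k)) (i - 1)"
      using short_exact_zero[OF ex x'] mod_homD(1)[OF vD y(1)] by (simp add: cocycles_def)
    then obtain l b y' where l: "b \<in> coboundaries (Z (s + k + l)) (i - 1)" "y' \<in> cocycles (Y (s + k + l)) (i - 1)"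
      "stage_map t'' (s + k) l (i - 1) (v (s + k) (i - 1) y) =
        b \<oplus>\<^bsub>obj (Z (s + k + l)) (i - 1)\<^esub> v (s + k + l) (i - 1) y'"
      using iso unfolding lim_surj_def by blast
    let ?m = "s + k + l"
    let ?O = "obj (Y ?m)" and ?y = "stage_map t' (s + k) l (i - 1) y"
    have c: "?y \<in> carrier (?O (i - 1))" "y' \<in> carrier (?O (i - 1))"
      by (rule mod_homD(1)[OF tY y(1)], rule cocyclesD(1)[OF l(2)])
    have vc: "v ?m (i - 1) y' \<in> carrier (obj (Z ?m) (i - 1))" by (rule mod_homD(1)[OF vD c(2)])
    have "v ?m (i - 1) (?y \<ominus>\<^bsub>?O (i - 1)\<^esub> y') = b"
      using mod_hom_minus(2)[OF vD Y.module_axioms Z.module_axioms c] l(3)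
        stage_map_natural[OF Y Z v y(1), of l] vc cobZ[OF l(1)]
      by (simp add: a_minus_def Z.M.a_assoc Z.M.r_neg)
    then have "v ?m (i - 1) (?y \<ominus>\<^bsub>?O (i - 1)\<^esub> y') \<in> coboundaries (Z ?m) (i - 1)" using l(1) by simp
    moreover have "?y \<ominus>\<^bsub>?O (i - 1)\<^esub> y' \<in> carrier (?O (i - 1))" using c by simp
    ultimately obtain b' a where ba: "b' \<in> coboundaries (Y ?m) (i - 1)" "a \<in> carrier (obj (X ?m) (i - 1))"
      "?y \<ominus>\<^bsub>?O (i - 1)\<^esub> y' = b' \<oplus>\<^bsub>?O (i - 1)\<^esub> u ?m (i - 1) a"
      using short_exact_coboundary_lift[OF ex] by metis
    have "dif (Y ?m) (i - 1) (?y \<ominus>\<^bsub>?O (i - 1)\<^esub> y') = dif (Y ?m) (i - 1) ?y"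
      using mod_hom_minus(2)[OF dY Y.module_axioms Y.module_axioms c] cocyclesD(2)[OF l(2)]
        mod_homD(1)[OF dY c(1)] Y.M.add.inv_one by (simp add: a_minus_def a_inv_def)
    also have "\<dots> = u ?m i (stage_map t (s + k) l i ?x)"
      using chain_mapD(2)[OF stage_map_chain_map[OF Y] y(1), of l] dy
        stage_map_natural[OF X Y u x', of l] by simp
    finally have "u ?m i (stage_map t (s + k) l i ?x) = u ?m i (dif (X ?m) (i - 1) a)"
      using dif_lift[OF ba(1,2)] ba(3) by simp
    then have "stage_map t (s + k) l i ?x = dif (X ?m) (i - 1) a"
      using mod_homD(1)[OF tX x'] mod_homD(1)[OF dX ba(2)] by (intro u_inj) auto
    then have "stage_map t s (k + l) i x \<in> coboundaries (X (s + (k + l))) i"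
      using coboundariesI[OF ba(2)] by (simp add: transit_add add.assoc)
    then show "\<exists>k. stage_map t s k i x \<in> coboundaries (X (s + k)) i" by blast
  qed
qed

end

text \<open>For a single short exact sequence, the constant system gives the usual consequences of the
  long exact sequence.\<close>

lemma transit_id [simp]: "transit (\<lambda>s x. x) s k x = x"
  by (induction k) auto

context
  fixes R :: "('r, 'q) ring_scheme" and X :: "('r, 'a) cpx" and Y :: "('r, 'b) cpx" and u
  assumes X: "cochain_complex R X" and Y: "cochain_complex R Y" and u: "chain_map R X Y u"
begin

lemma const_system: "cpx_system R (\<lambda>s. X) (\<lambda>s j x. x)"
  using X by (auto simp: cpx_system_def chain_map_def mod_hom_def)

lemma const_system_map: "cpx_system_map R (\<lambda>s. X) (\<lambda>s j x. x) (\<lambda>s. Y) (\<lambda>s j x. x) (\<lambda>s. u)"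
  using u by (simp add: cpx_system_map_def)

end

lemma const_iso:
  fixes R :: "('r, 'q) ring_scheme" and X :: "('r, 'a) cpx" and Y :: "('r, 'b) cpx"
  assumes X: "cochain_complex R X" and Y: "cochain_complex R Y" and u: "chain_map R X Y u"
    and inj: "lim_inj (\<lambda>s. X) (\<lambda>s j x. x) (\<lambda>s. Y) (\<lambda>s. u) i"
    and surj: "lim_surj (\<lambda>s. X) (\<lambda>s. Y) (\<lambda>s j x. x) (\<lambda>s. u) i"
  shows "cohomology_map Y i (u i) \<in> mod_iso R (cohomology X i) (cohomology Y i)"
proof (rule mod_isoI[OF cohomology_map_hom[OF X Y u]])
  show "inj_on (cohomology_map Y i (u i)) (carrier (cohomology X i))"
    unfolding mod_hom_inj_iff[OF cohomology_map_hom[OF X Y u] cohomology_module[OF X] cohomology_module[OF Y]]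
    using inj by (auto simp: lim_inj_def cohomology_carrier[OF X] cohomology_map_class[OF X Y u]
        coh_class_zero_iff[OF X] coh_class_zero_iff[OF Y] chain_map_cocycles[OF X Y u])
  interpret Y: module R "obj Y i" by (rule cochain_complexD(1)[OF Y])
  have "coh_class Y i y \<in> cohomology_map Y i (u i) ` carrier (cohomology X i)" if y: "y \<in> cocycles Y i" for y
  proof -
    obtain b x where bx: "b \<in> coboundaries Y i" "x \<in> cocycles X i" "y = b \<oplus>\<^bsub>obj Y i\<^esub> u i x"
      using surj y by (auto simp: lim_surj_def)
    have c: "b \<in> carrier (obj Y i)" "u i x \<in> carrier (obj Y i)"
      using coboundaries_closed[OF Y bx(1)] cocyclesD(1)[OF chain_map_cocycles[OF X Y u bx(2)]] .
    then have "coh_class Y i y = coh_class Y i (u i x)"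
      unfolding coh_class_eq_iff[OF Y y chain_map_cocycles[OF X Y u bx(2)]]
      using bx(1,3) by (simp add: a_minus_def Y.M.a_assoc Y.M.r_neg)
    then have "coh_class Y i y = cohomology_map Y i (u i) (coh_class X i x)"
      by (simp add: cohomology_map_class[OF X Y u bx(2)])
    then show ?thesis using bx(2) unfolding cohomology_carrier[OF X] by blast
  qed
  then show "cohomology_map Y i (u i) ` carrier (cohomology X i) = carrier (cohomology Y i)"
    using mod_homD(1)[OF cohomology_map_hom[OF X Y u]] by (auto simp: cohomology_carrier[OF Y])
qed

definition acyclic_cpx :: "('r, 'a) cpx \<Rightarrow> bool" where
  "acyclic_cpx X \<longleftrightarrow> (\<forall>i. cocycles X i \<subseteq> coboundaries X i)"

lemma short_exact_iso_of_acyclic: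
  assumes ex: "short_exact R X Y Z u v"
  shows "acyclic_cpx Z \<Longrightarrow> cohomology_map Y i (u i) \<in> mod_iso R (cohomology X i) (cohomology Y i)"
    and "acyclic_cpx X \<Longrightarrow> cohomology_map Z i (v i) \<in> mod_iso R (cohomology Y i) (cohomology Z i)"
proof -
  note D = short_exactD[OF ex]
  note c = const_system[OF D(1,2,4)] const_system[OF D(2,3,5)]
  have Z: "cpx_system R (\<lambda>s. Z) (\<lambda>s j x. x)"
    using D(3) by (auto simp: cpx_system_def chain_map_def mod_hom_def)
  note seq = c(1,2) Z const_system_map[OF D(1,2,4)] const_system_map[OF D(2,3,5)] ex
  show "cohomology_map Y i (u i) \<in> mod_iso R (cohomology X i) (cohomology Y i)" if "acyclic_cpx Z"
  proof -
    have "\<forall>i. lim_acyclic (\<lambda>s. Z) (\<lambda>s j x. x) i"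
      using that unfolding acyclic_cpx_def lim_acyclic_def by auto
    then show ?thesis
      using lim_iso_iff_coker_acyclic[OF seq] by (intro const_iso D) blast+
  qed
  show "cohomology_map Z i (v i) \<in> mod_iso R (cohomology Y i) (cohomology Z i)" if "acyclic_cpx X"
  proof -
    have "\<forall>i. lim_acyclic (\<lambda>s. X) (\<lambda>s j x. x) i"
      using that unfolding acyclic_cpx_def lim_acyclic_def by auto
    then show ?thesis
      using lim_iso_iff_ker_acyclic[OF seq] by (intro const_iso D) blast+
  qed
qed

section \<open>The Hom complex\<close>

lemma Hom_simps:
  "f \<in> carrier (Hom R A B) \<longleftrightarrow> f \<in> mod_hom R A B \<and> f \<in> extensional (carrier A)"
  "\<zero>\<^bsub>Hom R A B\<^esub> = (\<lambda>x\<in>carrier A. \<zero>\<^bsub>B\<^esub>)"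
  "f \<oplus>\<^bsub>Hom R A B\<^esub> g = (\<lambda>x\<in>carrier A. f x \<oplus>\<^bsub>B\<^esub> g x)"
  "r \<odot>\<^bsub>Hom R A B\<^esub> f = (\<lambda>x\<in>carrier A. r \<odot>\<^bsub>B\<^esub> f x)"
  by (auto simp: Hom_def)

lemma Hom_eqI:
  assumes "f \<in> extensional (carrier A)" "g \<in> extensional (carrier A)"
    and "\<And>x. x \<in> carrier A \<Longrightarrow> f x = g x"
  shows "f = g"
  using assms by (rule extensionalityI)

lemma mod_hom_restrict:
  assumes A: "module R A" and f: "f \<in> mod_hom R A B"
  shows "restrict f (carrier A) \<in> carrier (Hom R A B)"
proof -
  interpret A: module R A by fact
  show ?thesis using mod_homD[OF f] by (auto simp: Hom_simps intro!: mod_homI)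
qed

lemma Hom_compose:
  assumes A: "module R A" and f: "f \<in> mod_hom R A B" and g: "g \<in> mod_hom R B C"
  shows "compose (carrier A) g f \<in> carrier (Hom R A C)"
  using mod_hom_restrict[OF A mod_hom_comp[OF f g]] by (simp add: compose_def comp_def)

lemma mod_hom_zero_map:
  assumes "module R A" "module R B"
  shows "(\<lambda>x. \<zero>\<^bsub>B\<^esub>) \<in> mod_hom R A B"
proof -
  interpret B: module R B by fact
  show ?thesis by (rule mod_homI) auto
qed

lemma Hom_module:
  assumes A: "module R A" and B: "module R B"
  shows "module R (Hom R A B)"
proof -
  interpret A: module R A by fact
  interpret B: module R B by fact
  let ?H = "Hom R A B"
  have val: "f x \<in> carrier B" if "f \<in> carrier ?H" "x \<in> carrier A" for f x
    using that mod_homD(1) by (fastforce simp: Hom_simps)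
  have add: "f \<oplus>\<^bsub>?H\<^esub> g \<in> carrier ?H" if "f \<in> carrier ?H" "g \<in> carrier ?H" for f g
  proof -
    have f: "f \<in> mod_hom R A B" "g \<in> mod_hom R A B" using that by (auto simp: Hom_simps)
    from mod_hom_restrict[OF A mod_hom_add[OF f B]] show ?thesis by (simp add: Hom_simps)
  qed
  have smult: "r \<odot>\<^bsub>?H\<^esub> f \<in> carrier ?H" if "r \<in> carrier R" "f \<in> carrier ?H" for r f
    by (rule Hom_smult_closed[OF A B that])
  have zero: "\<zero>\<^bsub>?H\<^esub> \<in> carrier ?H"
    using mod_hom_restrict[OF A mod_hom_zero_map[OF A B]] by (simp add: Hom_simps)
  show ?thesis
  proof (rule moduleI)
    show "cring R" by (rule A.R.is_cring)
    show "abelian_group ?H"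
    proof (rule abelian_groupI)
      fix f assume f: "f \<in> carrier ?H"
      have "(\<ominus>\<^bsub>R\<^esub> \<one>\<^bsub>R\<^esub>) \<odot>\<^bsub>?H\<^esub> f \<oplus>\<^bsub>?H\<^esub> f = \<zero>\<^bsub>?H\<^esub>"
        using val[OF f] by (auto simp: Hom_simps B.smult_l_minus B.l_neg intro!: restrict_ext)
      then show "\<exists>g\<in>carrier ?H. g \<oplus>\<^bsub>?H\<^esub> f = \<zero>\<^bsub>?H\<^esub>"
        using smult[OF _ f, of "\<ominus>\<^bsub>R\<^esub> \<one>\<^bsub>R\<^esub>"] by auto
      show "\<zero>\<^bsub>?H\<^esub> \<oplus>\<^bsub>?H\<^esub> f = f"
        using val[OF f] f by (auto simp: Hom_simps intro!: Hom_eqI[of _ A])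
    next
      fix f g h assume "f \<in> carrier ?H" "g \<in> carrier ?H" "h \<in> carrier ?H"
      then show "f \<oplus>\<^bsub>?H\<^esub> g \<oplus>\<^bsub>?H\<^esub> h = f \<oplus>\<^bsub>?H\<^esub> (g \<oplus>\<^bsub>?H\<^esub> h)"
        using val by (auto simp: Hom_simps(2-4) B.a_assoc intro!: restrict_ext)
    next
      fix f g assume "f \<in> carrier ?H" "g \<in> carrier ?H"
      then show "f \<oplus>\<^bsub>?H\<^esub> g = g \<oplus>\<^bsub>?H\<^esub> f"
        using val by (auto simp: Hom_simps(2-4) B.a_comm intro!: restrict_ext)
    qed (use add zero in auto)
  next
    fix f assume f: "f \<in> carrier ?H"
    then show "\<one>\<^bsub>R\<^esub> \<odot>\<^bsub>?H\<^esub> f = f"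
      using val[OF f] by (auto simp: Hom_simps intro!: Hom_eqI[of _ A])
  qed (use smult val in \<open>auto simp: Hom_simps(2-4) B.smult_l_distr B.smult_r_distr B.smult_assoc1
      intro!: restrict_ext\<close>)
qed

lemma product_module:
  assumes R: "cring R" and H: "\<And>p. module R (H p)"
  shows "module R (mk_module {f. \<forall>p. f p \<in> carrier (H p)} (\<lambda>p. \<zero>\<^bsub>H p\<^esub>)
    (\<lambda>f g p. f p \<oplus>\<^bsub>H p\<^esub> g p) (\<lambda>r f p. r \<odot>\<^bsub>H p\<^esub> f p))" (is "module R ?P")
proof -
  interpret H: module R "H p" for p by (rule H)
  interpret R: cring R by (rule R)
  show ?thesis
  proof (rule moduleI[OF R])
    show "abelian_group ?P"
    proof (rule abelian_groupI)
      fix f assume f: "f \<in> carrier ?P"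
      show "\<exists>g\<in>carrier ?P. g \<oplus>\<^bsub>?P\<^esub> f = \<zero>\<^bsub>?P\<^esub>"
        using f by (intro bexI[of _ "\<lambda>p. \<ominus>\<^bsub>H p\<^esub> f p"]) (auto simp: H.M.l_neg)
    qed (auto simp: H.M.a_assoc intro: H.M.a_comm)
  qed (auto simp: H.smult_l_distr H.smult_r_distr H.smult_assoc1)
qed

text \<open>With this scalar the differential of the Hom complex is a sum, whatever the parity.\<close>

definition hom_sign :: "('r, 'q) ring_scheme \<Rightarrow> int \<Rightarrow> 'r" where
  "hom_sign R n = (if even n then \<ominus>\<^bsub>R\<^esub> \<one>\<^bsub>R\<^esub> else \<one>\<^bsub>R\<^esub>)"

lemma Hom_complex_carrier:
  "f \<in> carrier (obj (Hom_complex R A X) n) \<longleftrightarrow> (\<forall>p. f p \<in> carrier (Hom R (obj A p) (obj X (p + n))))"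
  by (simp add: Hom_complex_def)

lemma Hom_complex_ops:
  "\<zero>\<^bsub>obj (Hom_complex R A X) n\<^esub> p = \<zero>\<^bsub>Hom R (obj A p) (obj X (p + n))\<^esub>"
  "(f \<oplus>\<^bsub>obj (Hom_complex R A X) n\<^esub> g) p = f p \<oplus>\<^bsub>Hom R (obj A p) (obj X (p + n))\<^esub> g p"
  "(r \<odot>\<^bsub>obj (Hom_complex R A X) n\<^esub> f) p = r \<odot>\<^bsub>Hom R (obj A p) (obj X (p + n))\<^esub> f p"
  by (simp_all add: Hom_complex_def)

lemma Hom_complex_hom:
  assumes "f \<in> carrier (obj (Hom_complex R A X) n)" "p + n = q"
  shows "f p \<in> mod_hom R (obj A p) (obj X q)"
  using assms by (auto simp: Hom_complex_carrier Hom_simps)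

lemma Hom_complex_eqI:
  assumes "f \<in> carrier (obj (Hom_complex R A X) n)" "g \<in> carrier (obj (Hom_complex R A X) n)"
    and "\<And>p a. a \<in> carrier (obj A p) \<Longrightarrow> f p a = g p a"
  shows "f = g"
proof
  fix p show "f p = g p"
    using assms by (intro Hom_eqI[of _ "obj A p"]) (auto simp: Hom_complex_carrier Hom_simps)
qed

context
  fixes R :: "('r, 'q) ring_scheme" and A :: "('r, 'a) cpx" and X :: "('r, 'x) cpx"
  assumes A: "cochain_complex R A" and X: "cochain_complex R X"
begin

interpretation A: module R "obj A j" for j by (rule cochain_complexD(1)[OF A])
interpretation X: module R "obj X j" for j by (rule cochain_complexD(1)[OF X])

lemma hom_sign_simps:
  "hom_sign R n \<in> carrier R"
  "x \<in> carrier (obj X j) \<Longrightarrow> hom_sign R n \<odot>\<^bsub>obj X j\<^esub> (hom_sign R n \<odot>\<^bsub>obj X j\<^esub> x) = x"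
  "x \<in> carrier (obj X j) \<Longrightarrow> hom_sign R (n - 1) \<odot>\<^bsub>obj X j\<^esub> x = \<ominus>\<^bsub>obj X j\<^esub> (hom_sign R n \<odot>\<^bsub>obj X j\<^esub> x)"
  "x \<in> carrier (obj X j) \<Longrightarrow> hom_sign R (n + 1) \<odot>\<^bsub>obj X j\<^esub> x = \<ominus>\<^bsub>obj X j\<^esub> (hom_sign R n \<odot>\<^bsub>obj X j\<^esub> x)"
  by (simp_all add: hom_sign_def X.smult_l_minus X.smult_r_minus X.M.minus_minus)

lemma Hom_complex_dif:
  assumes f: "f \<in> carrier (obj (Hom_complex R A X) n)" and a: "a \<in> carrier (obj A p)" and q: "p + n + 1 = q"
  shows "dif (Hom_complex R A X) n f p a =
    dif X (p + n) (f p a) \<oplus>\<^bsub>obj X q\<^esub> hom_sign R n \<odot>\<^bsub>obj X q\<^esub> f (p + 1) (dif A p a)"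
proof -
  have "f (p + 1) (dif A p a) \<in> carrier (obj X q)"
    using mod_homD(1)[OF Hom_complex_hom[OF f, of "p + 1" q] mod_homD(1)[OF cochain_complexD(2)[OF A] a]] q
    by simp
  then show ?thesis
    unfolding q[symmetric] Hom_complex_def Let_def using a
    by (simp add: hom_sign_def a_minus_def X.smult_l_minus)
qed

lemma Hom_complex_dif_ext: "dif (Hom_complex R A X) n f p \<in> extensional (carrier (obj A p))"
  by (simp add: Hom_complex_def Let_def)

lemma Hom_complex_dif_closed:
  assumes f: "f \<in> carrier (obj (Hom_complex R A X) n)"
  shows "dif (Hom_complex R A X) n f \<in> carrier (obj (Hom_complex R A X) (n + 1))"
proof -
  have "dif (Hom_complex R A X) n f p \<in> carrier (Hom R (obj A p) (obj X (p + (n + 1))))" for p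
  proof -
    let ?q = "p + n + 1"
    have 1: "dif X (p + n) \<circ> f p \<in> mod_hom R (obj A p) (obj X ?q)"
      by (rule mod_hom_comp[OF Hom_complex_hom[OF f refl] cochain_complexD(2)[OF X]])
    have 2: "f (p + 1) \<circ> dif A p \<in> mod_hom R (obj A p) (obj X ?q)"
      by (rule mod_hom_comp[OF cochain_complexD(2)[OF A] Hom_complex_hom[OF f]]) simp
    note mod_hom_add[OF 1 mod_hom_comp[OF 2 smult_hom[OF X.module_axioms hom_sign_simps(1)]] X.module_axioms, of n]
    from mod_hom_restrict[OF A.module_axioms this]
    have "restrict (\<lambda>a. dif X (p + n) (f p a) \<oplus>\<^bsub>obj X ?q\<^esub> hom_sign R n \<odot>\<^bsub>obj X ?q\<^esub> f (p + 1) (dif A p a))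
        (carrier (obj A p)) \<in> carrier (Hom R (obj A p) (obj X ?q))" (is "restrict ?g _ \<in> _")
      by (simp add: comp_def)
    moreover have "dif (Hom_complex R A X) n f p = restrict ?g (carrier (obj A p))"
      using Hom_complex_dif[OF f _ refl] by (intro Hom_eqI[of _ "obj A p"] Hom_complex_dif_ext) auto
    ultimately show ?thesis by (simp add: add.assoc)
  qed
  then show ?thesis by (simp add: Hom_complex_carrier)
qed

lemma Hom_complex_module: "module R (obj (Hom_complex R A X) n)"
proof -
  have "obj (Hom_complex R A X) n = mk_module {f. \<forall>p. f p \<in> carrier (Hom R (obj A p) (obj X (p + n)))}
      (\<lambda>p. \<zero>\<^bsub>Hom R (obj A p) (obj X (p + n))\<^esub>)
      (\<lambda>f g p. f p \<oplus>\<^bsub>Hom R (obj A p) (obj X (p + n))\<^esub> g p)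
      (\<lambda>r f p. r \<odot>\<^bsub>Hom R (obj A p) (obj X (p + n))\<^esub> f p)"
    by (simp add: Hom_complex_def)
  then show ?thesis
    using product_module[of R "\<lambda>p. Hom R (obj A p) (obj X (p + n))"]
      Hom_module[OF A.module_axioms X.module_axioms] A.R.is_cring by simp
qed

lemma Hom_complex_zero_iff:
  assumes "f \<in> carrier (obj (Hom_complex R A X) n)"
  shows "f = \<zero>\<^bsub>obj (Hom_complex R A X) n\<^esub> \<longleftrightarrow> (\<forall>p. \<forall>a\<in>carrier (obj A p). f p a = \<zero>\<^bsub>obj X (p + n)\<^esub>)"
proof -
  interpret H: module R "obj (Hom_complex R A X) n" by (rule Hom_complex_module)
  have z: "\<zero>\<^bsub>obj (Hom_complex R A X) n\<^esub> p a = \<zero>\<^bsub>obj X (p + n)\<^esub>" if "a \<in> carrier (obj A p)" for p a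
    using that by (simp add: Hom_complex_ops Hom_simps)
  show ?thesis
  proof
    assume "f = \<zero>\<^bsub>obj (Hom_complex R A X) n\<^esub>"
    then show "\<forall>p. \<forall>a\<in>carrier (obj A p). f p a = \<zero>\<^bsub>obj X (p + n)\<^esub>" using z by simp
  next
    assume "\<forall>p. \<forall>a\<in>carrier (obj A p). f p a = \<zero>\<^bsub>obj X (p + n)\<^esub>"
    then show "f = \<zero>\<^bsub>obj (Hom_complex R A X) n\<^esub>"
      using z by (intro Hom_complex_eqI[OF assms H.zero_closed]) simp
  qed
qed

lemma Hom_complex_cochain_complex: "cochain_complex R (Hom_complex R A X)"
  unfolding cochain_complex_def
proof (intro conjI allI ballI)
  let ?H = "Hom_complex R A X"
  interpret H: module R "obj ?H n" for n by (rule Hom_complex_module)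
  show "module R (obj ?H n)" for n by (rule Hom_complex_module)
  have val: "f p a \<in> carrier (obj X (p + n))" if "f \<in> carrier (obj ?H n)" "a \<in> carrier (obj A p)" for f n p a
    by (rule mod_homD(1)[OF Hom_complex_hom[OF that(1) refl] that(2)])
  have val': "f (p + 1) (dif A p a) \<in> carrier (obj X (p + n + 1))"
    if "f \<in> carrier (obj ?H n)" "a \<in> carrier (obj A p)" for f n p a
    using mod_homD(1)[OF Hom_complex_hom[OF that(1), of "p + 1" "p + n + 1"]
        mod_homD(1)[OF cochain_complexD(2)[OF A] that(2)]] by simp
  have dval: "dif X (p + n) (f p a) \<in> carrier (obj X (p + n + 1))"
    if "f \<in> carrier (obj ?H n)" "a \<in> carrier (obj A p)" for f n p a
    by (rule mod_homD(1)[OF cochain_complexD(2)[OF X] val[OF that]])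
  show "dif ?H n \<in> mod_hom R (obj ?H n) (obj ?H (n + 1))" for n
  proof (rule mod_homI)
    fix f assume f: "f \<in> carrier (obj ?H n)"
    note s = hom_sign_simps(1)[of n]
    show "dif ?H n f \<in> carrier (obj ?H (n + 1))" by (rule Hom_complex_dif_closed[OF f])
    {
      fix g assume g: "g \<in> carrier (obj ?H n)"
      show "dif ?H n (f \<oplus>\<^bsub>obj ?H n\<^esub> g) = dif ?H n f \<oplus>\<^bsub>obj ?H (n + 1)\<^esub> dif ?H n g"
      proof (rule Hom_complex_eqI[OF Hom_complex_dif_closed[OF H.M.a_closed[OF f g]]
            H.M.a_closed[OF Hom_complex_dif_closed[OF f] Hom_complex_dif_closed[OF g]]])
        fix p a assume a: "a \<in> carrier (obj A p)"
        have da: "dif A p a \<in> carrier (obj A (p + 1))" by (rule mod_homD(1)[OF cochain_complexD(2)[OF A] a])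
        let ?O = "obj X (p + n + 1)"
        have idx: "p + (n + 1) = p + n + 1" "p + 1 + n = p + n + 1" by auto
        have e1: "(f \<oplus>\<^bsub>obj ?H n\<^esub> g) p a = f p a \<oplus>\<^bsub>obj X (p + n)\<^esub> g p a"
          using a by (simp add: Hom_complex_ops Hom_simps)
        have e2: "(f \<oplus>\<^bsub>obj ?H n\<^esub> g) (p + 1) (dif A p a) = f (p + 1) (dif A p a) \<oplus>\<^bsub>?O\<^esub> g (p + 1) (dif A p a)"
          using da by (simp add: Hom_complex_ops Hom_simps idx)
        have e3: "(dif ?H n f \<oplus>\<^bsub>obj ?H (n + 1)\<^esub> dif ?H n g) p a = dif ?H n f p a \<oplus>\<^bsub>?O\<^esub> dif ?H n g p a"
          using a by (simp add: Hom_complex_ops Hom_simps idx)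
        show "dif ?H n (f \<oplus>\<^bsub>obj ?H n\<^esub> g) p a = (dif ?H n f \<oplus>\<^bsub>obj ?H (n + 1)\<^esub> dif ?H n g) p a"
          unfolding e3 Hom_complex_dif[OF H.M.a_closed[OF f g] a refl] Hom_complex_dif[OF f a refl]
            Hom_complex_dif[OF g a refl] e1 e2
          using dval[OF f a] dval[OF g a] val'[OF f a] val'[OF g a] s
          by (simp add: mod_homD(2)[OF cochain_complexD(2)[OF X] val[OF f a] val[OF g a]] X.smult_r_distr X.M.a_ac)
      qed
    }
    fix r assume r: "r \<in> carrier R"
    show "dif ?H n (r \<odot>\<^bsub>obj ?H n\<^esub> f) = r \<odot>\<^bsub>obj ?H (n + 1)\<^esub> dif ?H n f"
    proof (rule Hom_complex_eqI[OF Hom_complex_dif_closed[OF H.smult_closed[OF r f]]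
          H.smult_closed[OF r Hom_complex_dif_closed[OF f]]])
      fix p a assume a: "a \<in> carrier (obj A p)"
      have da: "dif A p a \<in> carrier (obj A (p + 1))" by (rule mod_homD(1)[OF cochain_complexD(2)[OF A] a])
      let ?O = "obj X (p + n + 1)"
      have idx: "p + (n + 1) = p + n + 1" "p + 1 + n = p + n + 1" by auto
      have e1: "(r \<odot>\<^bsub>obj ?H n\<^esub> f) p a = r \<odot>\<^bsub>obj X (p + n)\<^esub> f p a"
        using a by (simp add: Hom_complex_ops Hom_simps)
      have e2: "(r \<odot>\<^bsub>obj ?H n\<^esub> f) (p + 1) (dif A p a) = r \<odot>\<^bsub>?O\<^esub> f (p + 1) (dif A p a)"
        using da by (simp add: Hom_complex_ops Hom_simps idx)
      have e3: "(r \<odot>\<^bsub>obj ?H (n + 1)\<^esub> dif ?H n f) p a = r \<odot>\<^bsub>?O\<^esub> dif ?H n f p a"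
        using a by (simp add: Hom_complex_ops Hom_simps idx)
      note smult_swap[OF X.module_axioms s r val'[OF f a]]
      then show "dif ?H n (r \<odot>\<^bsub>obj ?H n\<^esub> f) p a = (r \<odot>\<^bsub>obj ?H (n + 1)\<^esub> dif ?H n f) p a"
        unfolding e3 Hom_complex_dif[OF H.smult_closed[OF r f] a refl] Hom_complex_dif[OF f a refl] e1 e2
        using dval[OF f a] val'[OF f a] s r
        by (simp add: mod_homD(3)[OF cochain_complexD(2)[OF X] r val[OF f a]] X.smult_r_distr)
    qed
  qed
  fix n f assume f: "f \<in> carrier (obj ?H n)"
  note df = Hom_complex_dif_closed[OF f]
  have "dif ?H (n + 1) (dif ?H n f) \<in> carrier (obj ?H (n + 2))"
    using Hom_complex_dif_closed[OF df] by (simp add: add.assoc)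
  moreover have "dif ?H (n + 1) (dif ?H n f) p a = \<zero>\<^bsub>obj X (p + (n + 2))\<^esub>"
    if a: "a \<in> carrier (obj A p)" for p a
  proof -
    have da: "dif A p a \<in> carrier (obj A (p + 1))" by (rule mod_homD(1)[OF cochain_complexD(2)[OF A] a])
    note s = hom_sign_simps(1)[of n] hom_sign_simps(1)[of "n + 1"]
    let ?q = "p + n + 2" and ?w = "f (p + 1) (dif A p a)"
    have idx: "p + (n + 1) = p + n + 1" "p + 1 + n = p + n + 1" "p + n + 1 + 1 = ?q" "p + 1 + n + 1 = ?q"
      "p + (n + 1) + 1 = ?q" "p + (n + 2) = ?q" by auto
    have dw: "dif X (p + n + 1) ?w \<in> carrier (obj X ?q)"
      using mod_homD(1)[OF cochain_complexD(2)[OF X] val'[OF f a]] by (simp only: idx)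
    have z: "f (p + 1 + 1) (dif A (p + 1) (dif A p a)) = \<zero>\<^bsub>obj X ?q\<^esub>"
      using cochain_complexD(3)[OF A a] mod_hom_zero[OF Hom_complex_hom[OF f] A.module_axioms X.module_axioms, of "p + 2" ?q]
      by (simp add: add.assoc)
    have e1: "dif X (p + n + 1) (dif ?H n f p a) = hom_sign R n \<odot>\<^bsub>obj X ?q\<^esub> dif X (p + n + 1) ?w"
      unfolding Hom_complex_dif[OF f a refl]
        mod_homD(2)[OF cochain_complexD(2)[OF X] dval[OF f a] X.smult_closed[OF s(1) val'[OF f a]]]
        mod_homD(3)[OF cochain_complexD(2)[OF X] s(1) val'[OF f a]] cochain_complexD(3)[OF X val[OF f a]] idx
      using dw s by simp
    have e2: "dif ?H n f (p + 1) (dif A p a) = dif X (p + n + 1) ?w"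
      unfolding Hom_complex_dif[OF f da idx(4)] z idx using dw s by simp
    show ?thesis
      unfolding Hom_complex_dif[OF df a idx(5)] idx(1,6) e1 e2 hom_sign_simps(4)[OF dw]
      using X.M.r_neg[OF X.smult_closed[OF s(1) dw]] .
  qed
  ultimately show "dif ?H (n + 1) (dif ?H n f) = \<zero>\<^bsub>obj ?H (n + 2)\<^esub>"
    by (simp add: Hom_complex_zero_iff)
qed

end

text \<open>The map of Hom complexes induced by chain maps \<open>g\<close> in the first and \<open>u\<close> in the second argument.\<close>

definition hom_map ::
    "('r, 'a) cpx \<Rightarrow> (int \<Rightarrow> 'a \<Rightarrow> 'b) \<Rightarrow> (int \<Rightarrow> 'x \<Rightarrow> 'y) \<Rightarrow> int \<Rightarrow> (int \<Rightarrow> 'b \<Rightarrow> 'x) \<Rightarrow> int \<Rightarrow> 'a \<Rightarrow> 'y" where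
  "hom_map A g u n f p = (\<lambda>a\<in>carrier (obj A p). u (p + n) (f p (g p a)))"

abbreviation (input) "hom_post A u \<equiv> hom_map A (\<lambda>p a. a) u"
abbreviation (input) "hom_pre A g \<equiv> hom_map A g (\<lambda>j x. x)"

lemma id_chain_map: "chain_map R X X (\<lambda>j x. x)"
  by (auto simp: chain_map_def mod_hom_def)

context
  fixes R :: "('r, 'q) ring_scheme" and A :: "('r, 'a) cpx" and B :: "('r, 'b) cpx"
    and X :: "('r, 'x) cpx" and Y :: "('r, 'y) cpx" and g u
  assumes A: "cochain_complex R A" and B: "cochain_complex R B"
    and X: "cochain_complex R X" and Y: "cochain_complex R Y"
    and g: "chain_map R A B g" and u: "chain_map R X Y u"
begin

interpretation HX: module R "obj (Hom_complex R B X) n" for n by (rule Hom_complex_module[OF B X])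
interpretation HY: module R "obj (Hom_complex R A Y) n" for n by (rule Hom_complex_module[OF A Y])

lemma hom_map_chain_map: "chain_map R (Hom_complex R B X) (Hom_complex R A Y) (hom_map A g u)"
proof -
  let ?X = "Hom_complex R B X" and ?Y = "Hom_complex R A Y"
  note uD = mod_homD[OF chain_mapD(1)[OF u]] and gD = mod_homD[OF chain_mapD(1)[OF g]]
  have mem: "hom_map A g u n f \<in> carrier (obj ?Y n)" if "f \<in> carrier (obj ?X n)" for n f
    using mod_hom_restrict[OF cochain_complexD(1)[OF A] mod_hom_comp[OF mod_hom_comp[OF chain_mapD(1)[OF g]
          Hom_complex_hom[OF that refl]] chain_mapD(1)[OF u]]]
    by (simp add: Hom_complex_carrier hom_map_def comp_def)
  have app: "hom_map A g u n f p a = u (p + n) (f p (g p a))" if "a \<in> carrier (obj A p)" for n f p a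
    using that by (simp add: hom_map_def)
  have val: "f p (g p a) \<in> carrier (obj X (p + n))" if "f \<in> carrier (obj ?X n)" "a \<in> carrier (obj A p)" for f n p a
    by (rule mod_homD(1)[OF Hom_complex_hom[OF that(1) refl] gD(1)[OF that(2)]])
  show ?thesis
    unfolding chain_map_def
  proof (intro conjI allI ballI)
    fix n
    show "hom_map A g u n \<in> mod_hom R (obj ?X n) (obj ?Y n)"
    proof (rule mod_homI)
      fix f assume f: "f \<in> carrier (obj ?X n)"
      show "hom_map A g u n f \<in> carrier (obj ?Y n)" by (rule mem[OF f])
      {
        fix h assume h: "h \<in> carrier (obj ?X n)"
        show "hom_map A g u n (f \<oplus>\<^bsub>obj ?X n\<^esub> h) = hom_map A g u n f \<oplus>\<^bsub>obj ?Y n\<^esub> hom_map A g u n h"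
          using val[OF f] val[OF h]
          by (intro Hom_complex_eqI[OF mem[OF HX.M.a_closed[OF f h]] HY.M.a_closed[OF mem[OF f] mem[OF h]]])
             (simp add: app Hom_complex_ops Hom_simps uD gD)
      }
      fix r assume r: "r \<in> carrier R"
      show "hom_map A g u n (r \<odot>\<^bsub>obj ?X n\<^esub> f) = r \<odot>\<^bsub>obj ?Y n\<^esub> hom_map A g u n f"
        using val[OF f] r
        by (intro Hom_complex_eqI[OF mem[OF HX.smult_closed[OF r f]] HY.smult_closed[OF r mem[OF f]]])
           (simp add: app Hom_complex_ops Hom_simps uD gD)
    qed
    fix f assume f: "f \<in> carrier (obj ?X n)"
    note df = Hom_complex_dif_closed[OF B X f]
    show "hom_map A g u (n + 1) (dif ?X n f) = dif ?Y n (hom_map A g u n f)"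
    proof (rule Hom_complex_eqI[OF mem[OF df] Hom_complex_dif_closed[OF A Y mem[OF f]]])
      fix p a assume a: "a \<in> carrier (obj A p)"
      have da: "dif A p a \<in> carrier (obj A (p + 1))" by (rule mod_homD(1)[OF cochain_complexD(2)[OF A] a])
      have idx: "p + (n + 1) = p + n + 1" "p + 1 + n = p + n + 1" by auto
      note s = hom_sign_simps(1)[OF A X, of n]
      interpret X: module R "obj X j" for j by (rule cochain_complexD(1)[OF X])
      have dv: "dif X (p + n) (f p (g p a)) \<in> carrier (obj X (p + n + 1))"
        by (rule mod_homD(1)[OF cochain_complexD(2)[OF X] val[OF f a]])
      show "hom_map A g u (n + 1) (dif ?X n f) p a = dif ?Y n (hom_map A g u n f) p a"
        unfolding app[OF a] Hom_complex_dif[OF B X f gD(1)[OF a] refl] Hom_complex_dif[OF A Y mem[OF f] a refl]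
          app[OF da] idx
        using dv val[OF f da, unfolded idx] s chain_mapD(2)[OF u val[OF f a]]
        by (simp add: uD chain_mapD(2)[OF g a])
    qed
  qed
qed

end

lemmas hom_post_chain_map = hom_map_chain_map[OF _ _ _ _ id_chain_map]
lemmas hom_pre_chain_map = hom_map_chain_map[OF _ _ _ _ _ id_chain_map]

lemma hom_post_pre:
  assumes "chain_map R A B g" "f \<in> carrier (obj (Hom_complex R B X) n)"
  shows "hom_post A u n (hom_pre A g n f) = hom_pre A g n (hom_post B u n f)"
  using mod_homD(1)[OF chain_mapD(1)[OF assms(1)]] by (intro ext) (simp add: hom_map_def)

lemma hom_post_comp:
  assumes "\<And>j x. w j x = v j (u j x)"
  shows "hom_post A w i f = hom_post A v i (hom_post A u i f)"
  by (intro ext) (simp add: hom_map_def assms)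

section \<open>Free modules and the standard resolution\<close>

abbreviation unit_comb :: "('r, 'q) ring_scheme \<Rightarrow> 'b \<Rightarrow> 'b \<Rightarrow> 'r" where
  "unit_comb R b \<equiv> formal_comb R [(b, \<one>\<^bsub>R\<^esub>)]"

lemma unit_comb_closed:
  assumes "cring R" "b \<in> B"
  shows "unit_comb R b \<in> carrier (free_module R B)"
proof -
  interpret cring R by fact
  show ?thesis using assms(2) by (intro formal_comb_closed[OF assms(1)]) auto
qed

lemma free_hom_eqI:
  assumes A: "module R A" and f: "f \<in> mod_hom R (free_module R B) A" and g: "g \<in> mod_hom R (free_module R B) A"
    and eq: "\<And>b. b \<in> B \<Longrightarrow> f (unit_comb R b) = g (unit_comb R b)" and x: "x \<in> carrier (free_module R B)"
  shows "f x = g x"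
proof -
  interpret A: module R A by fact
  note R = A.R.is_cring
  interpret F: module R "free_module R B" by (rule free_module_module[OF R])
  obtain l where l: "set l \<subseteq> B \<times> carrier R" "formal_comb R l = x"
    using formal_comb_surj[OF R x] .
  have "f (formal_comb R l) = g (formal_comb R l)" using l(1)
  proof (induction l)
    case Nil
    then show ?case
      using mod_hom_zero[OF f F.module_axioms A] mod_hom_zero[OF g F.module_axioms A]
      by (simp add: free_module_simps)
  next
    case (Cons p l)
    obtain b r where p: "p = (b, r)" by (cases p)
    have b: "b \<in> B" "r \<in> carrier R" "set l \<subseteq> B \<times> carrier R" using Cons.prems p by auto
    note c = unit_comb_closed[OF R b(1)] formal_comb_closed[OF R b(3)]
    have fl: "formal_comb R l c \<in> carrier R" for c
      using c(2) unfolding free_module_simps(1) by blast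
    have "formal_comb R (p # l) = r \<odot>\<^bsub>free_module R B\<^esub> unit_comb R b \<oplus>\<^bsub>free_module R B\<^esub> formal_comb R l"
      using b(2) fl by (intro ext) (simp add: p free_module_simps)
    then show ?case
      using Cons.IH[OF b(3)] eq[OF b(1)] c b(2) F.smult_closed[OF b(2) c(1)]
        mod_homD(2,3)[OF f] mod_homD(2,3)[OF g] by simp
  qed
  then show ?thesis using l(2) by simp
qed

lemma free_lift:
  assumes A: "module R A" and C: "module R C" and f: "f \<in> mod_hom R (free_module R B) C"
    and v: "v \<in> mod_hom R A C" and surj: "\<And>x. x \<in> carrier (free_module R B) \<Longrightarrow> f x \<in> v ` carrier A"
  obtains g where "g \<in> mod_hom R (free_module R B) A" "\<And>x. x \<in> carrier (free_module R B) \<Longrightarrow> v (g x) = f x"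
proof -
  interpret A: module R A by fact
  note R = A.R.is_cring
  define e where "e b = (SOME a. a \<in> carrier A \<and> v a = f (unit_comb R b))" for b
  have e: "e b \<in> carrier A \<and> v (e b) = f (unit_comb R b)" if "b \<in> B" for b
  proof -
    have "\<exists>a. a \<in> carrier A \<and> v a = f (unit_comb R b)"
      using surj[OF unit_comb_closed[OF R that]] by (metis imageE)
    then show ?thesis unfolding e_def by (rule someI_ex)
  qed
  have g: "linear_ext R A e \<in> mod_hom R (free_module R B) A"
    by (rule linear_ext_hom[OF A]) (use e in auto)
  have "(v \<circ> linear_ext R A e) x = f x" if "x \<in> carrier (free_module R B)" for x
    using e linear_ext_basis[OF A, of e]
    by (intro free_hom_eqI[OF C mod_hom_comp[OF g v] f _ that]) simp
  then show thesis using that[OF g] by simp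
qed

lemma std_res_obj: "\<exists>B. obj (std_res R T) p = free_module R B"
  by (auto simp: std_res_def)

text \<open>The Hom complex is a product over all degrees, so lifts may be chosen in each degree
  separately.\<close>

lemma std_res_lift:
  assumes T: "module R T" and X: "cochain_complex R X" and Y: "cochain_complex R Y" and u: "chain_map R X Y u"
    and f: "f \<in> carrier (obj (Hom_complex R (std_res R T) Y) n)"
    and im: "\<And>p a. a \<in> carrier (obj (std_res R T) p) \<Longrightarrow> f p a \<in> u (p + n) ` carrier (obj X (p + n))"
  shows "f \<in> hom_post (std_res R T) u n ` carrier (obj (Hom_complex R (std_res R T) X) n)"
proof -
  let ?F = "std_res R T"
  have F: "cochain_complex R ?F" by (rule std_res_cochain_complex[OF T])
  have "\<exists>g. g \<in> carrier (Hom R (obj ?F p) (obj X (p + n))) \<and> (\<forall>a\<in>carrier (obj ?F p). u (p + n) (g a) = f p a)" for p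
  proof -
    obtain B where B: "obj ?F p = free_module R B" using std_res_obj by blast
    have "f p a \<in> u (p + n) ` carrier (obj X (p + n))" if "a \<in> carrier (free_module R B)" for a
      using im that unfolding B[symmetric] .
    then obtain g where "g \<in> mod_hom R (obj ?F p) (obj X (p + n))" "\<And>a. a \<in> carrier (obj ?F p) \<Longrightarrow> u (p + n) (g a) = f p a"
      using free_lift[OF cochain_complexD(1)[OF X] cochain_complexD(1)[OF Y]
          Hom_complex_hom[OF f refl, of p, unfolded B] chain_mapD(1)[OF u]] unfolding B by metis
    then show ?thesis
      using mod_hom_restrict[OF cochain_complexD(1)[OF F]]
      by (intro exI[of _ "restrict g (carrier (obj ?F p))"]) auto
  qed
  then obtain g where g: "\<And>p. g p \<in> carrier (Hom R (obj ?F p) (obj X (p + n)))"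
    "\<And>p a. a \<in> carrier (obj ?F p) \<Longrightarrow> u (p + n) (g p a) = f p a"
    by metis
  have g': "g \<in> carrier (obj (Hom_complex R ?F X) n)" using g(1) by (simp add: Hom_complex_carrier)
  have "hom_post ?F u n g = f"
    using g(2) mod_homD(1)[OF chain_mapD(1)[OF hom_post_chain_map[OF F F X Y u]] g']
    by (intro Hom_complex_eqI[OF _ f]) (simp_all add: hom_map_def)
  then show ?thesis using g' by blast
qed

text \<open>Because the standard resolution consists of free modules, Hom out of it is exact.\<close>

lemma hom_post_short_exact:
  assumes T: "module R T" and ex: "short_exact R X Y Z u v"
  shows "short_exact R (Hom_complex R (std_res R T) X) (Hom_complex R (std_res R T) Y)
    (Hom_complex R (std_res R T) Z) (hom_post (std_res R T) u) (hom_post (std_res R T) v)"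
proof -
  note D = short_exactD[OF ex]
  let ?F = "std_res R T"
  have F: "cochain_complex R ?F" by (rule std_res_cochain_complex[OF T])
  note H = Hom_complex_cochain_complex[OF F D(1)] Hom_complex_cochain_complex[OF F D(2)]
    Hom_complex_cochain_complex[OF F D(3)] hom_post_chain_map[OF F F D(1,2,4)] hom_post_chain_map[OF F F D(2,3,5)]
  have app_u: "hom_post ?F u n f p a = u (p + n) (f p a)"
    and app_v: "hom_post ?F v n g p a = v (p + n) (g p a)" if "a \<in> carrier (obj ?F p)" for n f g p a
    using that by (simp_all add: hom_map_def)
  have zero: "hom_post ?F v n f = \<zero>\<^bsub>obj (Hom_complex R ?F Z) n\<^esub> \<longleftrightarrow>
      (\<forall>p. \<forall>a\<in>carrier (obj ?F p). f p a \<in> u (p + n) ` carrier (obj X (p + n)))"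
    if f: "f \<in> carrier (obj (Hom_complex R ?F Y) n)" for n f
    unfolding Hom_complex_zero_iff[OF F D(3) mod_homD(1)[OF chain_mapD(1)[OF H(5)] f]] D(7)
    using app_v mod_homD(1)[OF Hom_complex_hom[OF f refl]] by auto
  have inj: "inj_on (hom_post ?F u n) (carrier (obj (Hom_complex R ?F X) n))" for n
  proof (rule inj_onI)
    fix f g assume f: "f \<in> carrier (obj (Hom_complex R ?F X) n)" and g: "g \<in> carrier (obj (Hom_complex R ?F X) n)"
      and eq: "hom_post ?F u n f = hom_post ?F u n g"
    have "f p a = g p a" if a: "a \<in> carrier (obj ?F p)" for p a
    proof -
      have "u (p + n) (f p a) = u (p + n) (g p a)" using eq app_u[OF a] by metis
      then show ?thesis
        using mod_homD(1)[OF Hom_complex_hom[OF f refl] a] mod_homD(1)[OF Hom_complex_hom[OF g refl] a]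
          inj_onD[OF D(6)] by metis
    qed
    then show "f = g" by (rule Hom_complex_eqI[OF f g])
  qed
  have im: "hom_post ?F u n ` carrier (obj (Hom_complex R ?F X) n) =
      {f \<in> carrier (obj (Hom_complex R ?F Y) n). hom_post ?F v n f = \<zero>\<^bsub>obj (Hom_complex R ?F Z) n\<^esub>}" for n
  proof (intro subset_antisym subsetI)
    fix f' assume "f' \<in> hom_post ?F u n ` carrier (obj (Hom_complex R ?F X) n)"
    then obtain f where f: "f \<in> carrier (obj (Hom_complex R ?F X) n)" "f' = hom_post ?F u n f" by blast
    then show "f' \<in> {f \<in> carrier (obj (Hom_complex R ?F Y) n). hom_post ?F v n f = \<zero>\<^bsub>obj (Hom_complex R ?F Z) n\<^esub>}"
      using zero mod_homD(1)[OF chain_mapD(1)[OF H(4)] f(1)] mod_homD(1)[OF Hom_complex_hom[OF f(1) refl]]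
      by (simp add: app_u)
  qed (use zero std_res_lift[OF T D(1,2,4)] in blast)
  have surj: "hom_post ?F v n ` carrier (obj (Hom_complex R ?F Y) n) = carrier (obj (Hom_complex R ?F Z) n)" for n
  proof (intro subset_antisym subsetI)
    fix f assume f: "f \<in> carrier (obj (Hom_complex R ?F Z) n)"
    show "f \<in> hom_post ?F v n ` carrier (obj (Hom_complex R ?F Y) n)"
      by (rule std_res_lift[OF T D(2,3,5) f]) (simp only: D(8) mod_homD(1)[OF Hom_complex_hom[OF f refl]])
  qed (use mod_homD(1)[OF chain_mapD(1)[OF H(5)]] in blast)
  show ?thesis unfolding short_exact_def using H inj im surj by blast
qed

subsection \<open>Functoriality\<close>

abbreviation map_comb :: "('t \<Rightarrow> 'u) \<Rightarrow> (('t, 'r) syz \<times> 'r) list \<Rightarrow> (('u, 'r) syz \<times> 'r) list" where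
  "map_comb g \<equiv> map (map_prod (map_syz g id) id)"

context
  fixes R :: "('r, 'q) ring_scheme" and T :: "('r, 't) module" and U :: "('r, 'u) module" and g
  assumes T: "module R T" and U: "module R U" and g: "g \<in> mod_hom R T U"
begin

interpretation T: module R T by (rule T)

private lemma R: "cring R" by (rule T.R.is_cring)

lemma std_map_unit_comb: "std_map R g (unit_comb R b) = unit_comb R (map_syz g id b)"
  unfolding std_map_def
  by (rule linear_ext_basis[OF free_module_module[OF R]]) (rule unit_comb_closed[OF R], simp)

lemma std_map_hom:
  assumes "\<And>b. b \<in> B \<Longrightarrow> map_syz g id b \<in> B'"
  shows "std_map R g \<in> mod_hom R (free_module R B) (free_module R B')"
  unfolding std_map_def using assms
  by (intro linear_ext_free_hom[OF R] funcsetI unit_comb_closed[OF R])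

lemma std_map_formal_comb:
  assumes "set l \<subseteq> UNIV \<times> carrier R"
  shows "std_map R g (formal_comb R l) = formal_comb R (map_comb g l)"
  using assms
proof (induction l)
  note hom = std_map_hom[of UNIV UNIV, simplified]
  interpret F: module R "free_module R (UNIV :: ('t, 'r) syz set)" by (rule free_module_module[OF R])
  case Nil
  show ?case
    using mod_hom_zero[OF hom free_module_module[OF R] free_module_module[OF R]] by (simp add: free_module_simps)
next
  case (Cons p l)
  note hom = std_map_hom[of UNIV UNIV, simplified]
  obtain b r where p: "p = (b, r)" by (cases p)
  have b: "r \<in> carrier R" "set l \<subseteq> UNIV \<times> carrier R" using Cons.prems p by auto
  then have b': "set (map_comb g l) \<subseteq> UNIV \<times> carrier R" by auto
  interpret F: module R "free_module R (UNIV :: ('t, 'r) syz set)" by (rule free_module_module[OF R])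
  have split: "formal_comb R ((b, r) # l) =
      r \<odot>\<^bsub>free_module R UNIV\<^esub> unit_comb R b \<oplus>\<^bsub>free_module R UNIV\<^esub> formal_comb R l"
    if "r \<in> carrier R" "set l \<subseteq> UNIV \<times> carrier R" for b :: 'c and r l
  proof -
    have "formal_comb R l c \<in> carrier R" for c
      using formal_comb_closed[OF R that(2)] unfolding free_module_simps(1) by blast
    then show ?thesis using that(1) by (intro ext) (simp add: free_module_simps)
  qed
  have c: "unit_comb R b \<in> carrier (free_module R UNIV)" "formal_comb R l \<in> carrier (free_module R UNIV)"
    by (rule unit_comb_closed[OF R], simp) (rule formal_comb_closed[OF R b(2)])
  have "std_map R g (formal_comb R (p # l)) =
      r \<odot>\<^bsub>free_module R UNIV\<^esub> unit_comb R (map_syz g id b) \<oplus>\<^bsub>free_module R UNIV\<^esub> formal_comb R (map_comb g l)"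
    unfolding p split[OF b] mod_homD(2)[OF hom F.smult_closed[OF b(1) c(1)] c(2)]
      mod_homD(3)[OF hom b(1) c(1)] std_map_unit_comb Cons.IH[OF b(2)] ..
  also have "\<dots> = formal_comb R ((map_syz g id b, r) # map_comb g l)"
    by (rule split[OF b(1) b', symmetric])
  also have "(map_syz g id b, r) # map_comb g l = map_comb g (p # l)" by (simp add: p)
  finally show ?case .
qed

lemma map_comb_subset:
  assumes "\<And>b. b \<in> B \<Longrightarrow> map_syz g id b \<in> B'" "set l \<subseteq> B \<times> carrier R"
  shows "set (map_comb g l) \<subseteq> B' \<times> carrier R"
  using assms by auto

lemma std_basis_map_0: "b \<in> std_basis R T 0 \<Longrightarrow> map_syz g id b \<in> std_basis R U 0"
  using mod_homD(1)[OF g] by auto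

lemma std_aug_map:
  assumes "x \<in> carrier (free_module R (std_basis R T 0))"
  shows "std_aug R U (std_map R g x) = g (std_aug R T x)"
proof -
  have "std_aug R T (unit_comb R (Gen t)) = t" if "t \<in> carrier T" for t
    unfolding std_aug_def
    using linear_ext_basis[OF T, of "\<lambda>b. case b of Gen t \<Rightarrow> t | Rel l \<Rightarrow> \<zero>\<^bsub>T\<^esub>" "Gen t"] that by simp
  moreover have "std_aug R U (unit_comb R (Gen t)) = t" if "t \<in> carrier U" for t
    unfolding std_aug_def
    using linear_ext_basis[OF U, of "\<lambda>b. case b of Gen t \<Rightarrow> t | Rel l \<Rightarrow> \<zero>\<^bsub>U\<^esub>" "Gen t"] that by simp
  ultimately have "(std_aug R U \<circ> std_map R g) x = (g \<circ> std_aug R T) x"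
    using mod_homD(1)[OF g]
    by (intro free_hom_eqI[OF U mod_hom_comp[OF std_map_hom[OF std_basis_map_0] std_aug_hom[OF U]]
          mod_hom_comp[OF std_aug_hom[OF T] g] _ assms]) (auto simp: std_map_unit_comb simp del: formal_comb.simps)
  then show ?thesis by simp
qed

lemma std_bd_map:
  assumes p: "\<And>b. b \<in> std_basis R T p \<Longrightarrow> map_syz g id b \<in> std_basis R U p"
    and Sp: "\<And>b. b \<in> std_basis R T (Suc p) \<Longrightarrow> map_syz g id b \<in> std_basis R U (Suc p)"
    and x: "x \<in> carrier (free_module R (std_basis R T (Suc p)))"
  shows "std_bd R (std_map R g x) = std_map R g (std_bd R x)"
proof -
  have "std_bd R (std_map R g (unit_comb R b)) = std_map R g (std_bd R (unit_comb R b))"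
    if b: "b \<in> std_basis R T (Suc p)" for b
  proof -
    obtain l where l: "b = Rel l" "set l \<subseteq> std_basis R T p \<times> carrier R" using b by (cases p) auto
    have "map_syz g id (Rel l) = Rel (map_comb g l)" by simp
    then have b': "Rel (map_comb g l) \<in> std_basis R U (Suc p)" using Sp[OF b] l(1) by simp
    have l': "set l \<subseteq> UNIV \<times> carrier R" using l(2) by blast
    show ?thesis
      using std_bd_Rel[OF R b'] std_bd_Rel[OF R b[unfolded l(1)]] std_map_formal_comb[OF l']
      by (simp add: l(1) std_map_unit_comb del: formal_comb.simps)
  qed
  then have "(std_bd R \<circ> std_map R g) x = (std_map R g \<circ> std_bd R) x"
    by (intro free_hom_eqI[OF free_module_module[OF R] mod_hom_comp[OF std_map_hom[OF Sp] std_bd_hom[OF R]]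
          mod_hom_comp[OF std_bd_hom[OF R] std_map_hom[OF p]] _ x]) (auto simp del: formal_comb.simps)
  then show ?thesis by simp
qed

text \<open>A basis element in positive degree is a relation among basis elements of the previous degree.
  Applying \<open>g\<close> to all generators in it gives a relation again, because \<open>std_map\<close> commutes with the
  augmentation and the boundary in lower degrees; this is why the induction has to interleave the
  two statements.\<close>

lemma std_basis_map: "b \<in> std_basis R T p \<Longrightarrow> map_syz g id b \<in> std_basis R U p"
proof (induction p arbitrary: b rule: less_induct)
  case (less p)
  have sub: "set (map_comb g l) \<subseteq> std_basis R U q \<times> carrier R"
    if "q < p" "set l \<subseteq> std_basis R T q \<times> carrier R" for q l
    using map_comb_subset[OF less.IH[OF that(1)] that(2)] by blast
  have comb: "formal_comb R (map_comb g l) = std_map R g (formal_comb R l)"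
    if "set l \<subseteq> std_basis R T q \<times> carrier R" for q l
    using that by (intro std_map_formal_comb[symmetric]) auto
  consider "p = 0" | "p = Suc 0" | q where "p = Suc (Suc q)" by (metis not0_implies_Suc)
  then show ?case
  proof cases
    case 1
    then show ?thesis using less.prems std_basis_map_0 by metis
  next
    case 2
    then obtain l where l: "b = Rel l" "set l \<subseteq> std_basis R T 0 \<times> carrier R"
      "std_aug R T (formal_comb R l) = \<zero>\<^bsub>T\<^esub>"
      using less.prems by auto
    have "std_aug R U (formal_comb R (map_comb g l)) = \<zero>\<^bsub>U\<^esub>"
      using std_aug_map[OF formal_comb_closed[OF R l(2)]] comb[OF l(2)] l(3) mod_hom_zero[OF g T U] by simp
    then have "Rel (map_comb g l) \<in> std_basis R U (Suc 0)"
      unfolding std_basis.simps(2) using sub[OF _ l(2)] 2 by blast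
    moreover have "map_syz g id b = Rel (map_comb g l)" by (simp add: l(1))
    ultimately show ?thesis using 2 by metis
  next
    case 3
    then obtain l where l: "b = Rel l" "set l \<subseteq> std_basis R T (Suc q) \<times> carrier R"
      "std_bd R (formal_comb R l) = (\<lambda>b. \<zero>\<^bsub>R\<^esub>)"
      using less.prems by auto
    have "std_map R g (\<lambda>b. \<zero>\<^bsub>R\<^esub>) = (\<lambda>b. \<zero>\<^bsub>R\<^esub>)"
      using std_map_formal_comb[of "[]"] by simp
    then have "std_bd R (formal_comb R (map_comb g l)) = (\<lambda>b. \<zero>\<^bsub>R\<^esub>)"
      using std_bd_map[OF less.IH[of q] less.IH[of "Suc q"] formal_comb_closed[OF R l(2)]]
        comb[OF l(2)] l(3) 3 by simp
    then have "Rel (map_comb g l) \<in> std_basis R U (Suc (Suc q))"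
      unfolding std_basis.simps(3) using sub[OF _ l(2)] 3 by blast
    moreover have "map_syz g id b = Rel (map_comb g l)" by (simp add: l(1))
    ultimately show ?thesis using 3 by metis
  qed
qed

lemma std_map_chain_map: "chain_map R (std_res R T) (std_res R U) (\<lambda>p. std_map R g)"
  unfolding chain_map_def
proof (intro conjI allI ballI)
  fix j
  show "std_map R g \<in> mod_hom R (obj (std_res R T) j) (obj (std_res R U) j)"
    using std_map_hom[OF std_basis_map] std_map_hom[of "{}" "{}"] by (simp add: std_res_def)
  fix x assume x: "x \<in> carrier (obj (std_res R T) j)"
  have zero: "std_map R g (\<lambda>b. \<zero>\<^bsub>R\<^esub>) = (\<lambda>b. \<zero>\<^bsub>R\<^esub>)"
    using std_map_formal_comb[of "[]"] by simp
  show "std_map R g (dif (std_res R T) j x) = dif (std_res R U) j (std_map R g x)"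
  proof (cases "j < 0")
    case True
    then obtain p where "nat (- j) = Suc p" by (cases "nat (- j)") auto
    then show ?thesis
      using x True std_bd_map[OF std_basis_map std_basis_map, of p x] by (simp add: std_res_def)
  next
    case False
    then show ?thesis by (simp add: std_res_def zero)
  qed
qed

end

section \<open>Vanishing of Ext\<close>

text \<open>Since the standard resolution is free and bounded above, a null homotopy can be built one
  degree at a time, starting from degree 0: the part of the cocycle not yet accounted for takes
  values in the cocycles of \<open>Y\<close>, hence in the coboundaries, and it can be lifted along the
  differential from a free module.  The lemma is used both for acyclic \<open>Y\<close> and for the resolution
  itself as \<open>Y\<close>, which is not exact in degree 0.\<close>

lemma std_res_null_homotopy:
  fixes R :: "('r, 'q) ring_scheme" and T :: "('r, 't) module" and Y :: "('r, 'y) cpx"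
  assumes T: "module R T" and Y: "cochain_complex R Y"
    and \<phi>: "\<phi> \<in> cocycles (Hom_complex R (std_res R T) Y) n"
    and start: "\<And>a. a \<in> carrier (obj (std_res R T) 0) \<Longrightarrow> \<phi> 0 a \<in> coboundaries Y n"
    and exact: "\<And>p. p < 0 \<Longrightarrow> cocycles Y (p + n) \<subseteq> coboundaries Y (p + n)"
  shows "\<phi> \<in> coboundaries (Hom_complex R (std_res R T) Y) n"
proof -
  let ?F = "std_res R T"
  let ?H = "Hom_complex R ?F Y"
  have F: "cochain_complex R ?F" by (rule std_res_cochain_complex[OF T])
  interpret Y: module R "obj Y j" for j by (rule cochain_complexD(1)[OF Y])
  interpret F: module R "obj ?F j" for j by (rule cochain_complexD(1)[OF F])
  note \<phi>D = cocyclesD[OF \<phi>]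
  define \<sigma> where "\<sigma> = hom_sign R (n - 1)"
  have \<sigma>: "\<sigma> \<in> carrier R" unfolding \<sigma>_def by (rule hom_sign_simps(1)[OF F Y])
  define \<tau> where "\<tau> = hom_sign R n"
  have \<tau>: "\<tau> \<in> carrier R" unfolding \<tau>_def by (rule hom_sign_simps(1)[OF F Y])
  have neg: "\<sigma> \<odot>\<^bsub>obj Y q\<^esub> y = \<ominus>\<^bsub>obj Y q\<^esub> (\<tau> \<odot>\<^bsub>obj Y q\<^esub> y)" if "y \<in> carrier (obj Y q)" for q y
    unfolding \<sigma>_def \<tau>_def by (rule hom_sign_simps(3)[OF F Y that])
  have \<phi>v: "\<phi> p a \<in> carrier (obj Y q)" if "a \<in> carrier (obj ?F p)" "p + n = q" for p a q
    by (rule mod_homD(1)[OF Hom_complex_hom[OF \<phi>D(1) that(2)] that(1)])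
  have d\<phi>: "dif Y q (\<phi> p a) = \<sigma> \<odot>\<^bsub>obj Y (q + 1)\<^esub> \<phi> (p + 1) (dif ?F p a)"
    if a: "a \<in> carrier (obj ?F p)" and q: "p + n = q" for p a q
  proof -
    have da: "dif ?F p a \<in> carrier (obj ?F (p + 1))" by (rule mod_homD(1)[OF cochain_complexD(2)[OF F] a])
    have v: "\<phi> (p + 1) (dif ?F p a) \<in> carrier (obj Y (q + 1))" using \<phi>v[OF da, of "q + 1"] q by simp
    have d: "dif Y q (\<phi> p a) \<in> carrier (obj Y (q + 1))"
      using mod_homD(1)[OF cochain_complexD(2)[OF Y] \<phi>v[OF a q]] .
    have "dif ?H n \<phi> p a = \<zero>\<^bsub>obj Y (q + 1)\<^esub>"
      using \<phi>D(2) a q by (simp add: Hom_complex_ops Hom_simps ac_simps)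
    then have "dif Y q (\<phi> p a) \<oplus>\<^bsub>obj Y (q + 1)\<^esub> \<tau> \<odot>\<^bsub>obj Y (q + 1)\<^esub> \<phi> (p + 1) (dif ?F p a) = \<zero>\<^bsub>obj Y (q + 1)\<^esub>"
      using Hom_complex_dif[OF F Y \<phi>D(1) a, of "q + 1"] q by (simp add: \<tau>_def)
    then show ?thesis
      using d v \<tau> by (simp add: neg Y.M.minus_equality)
  qed
  \<comment> \<open>One step: a homomorphism into the coboundaries lifts along the differential.\<close>
  have lift: "\<exists>g. g \<in> mod_hom R (obj ?F p) (obj Y (q - 1)) \<and> (\<forall>a\<in>carrier (obj ?F p). dif Y (q - 1) (g a) = h a)"
    if h: "h \<in> mod_hom R (obj ?F p) (obj Y q)" "\<And>a. a \<in> carrier (obj ?F p) \<Longrightarrow> h a \<in> coboundaries Y q" for h p q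
  proof -
    obtain B where B: "obj ?F p = free_module R B" using std_res_obj by blast
    have v: "dif Y (q - 1) \<in> mod_hom R (obj Y (q - 1)) (obj Y q)"
      using cochain_complexD(2)[OF Y, of "q - 1"] by simp
    obtain g where "g \<in> mod_hom R (obj ?F p) (obj Y (q - 1))" "\<And>a. a \<in> carrier (obj ?F p) \<Longrightarrow> dif Y (q - 1) (g a) = h a"
      using free_lift[OF Y.module_axioms Y.module_axioms h(1)[unfolded B] v] h(2)
      unfolding B coboundaries_def by metis
    then show ?thesis by blast
  qed
  \<comment> \<open>The component of the homotopy in degree \<open>-k\<close> is built from that in degree \<open>-(k - 1)\<close>.  \<open>P\<close> is
    the part of the homotopy relation that concerns cycles of the resolution; it makes the error in
    the next degree a cocycle of \<open>Y\<close>.  \<open>Q\<close> is the full relation between two consecutive components.\<close>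
  define P where "P k g \<longleftrightarrow> g \<in> mod_hom R (obj ?F (- int k)) (obj Y (- int k + n - 1)) \<and>
    (\<forall>a\<in>carrier (obj ?F (- int k)). dif ?F (- int k) a = \<zero>\<^bsub>obj ?F (- int k + 1)\<^esub> \<longrightarrow>
      dif Y (- int k + n - 1) (g a) = \<phi> (- int k) a)" for k g
  define Q where "Q k g g' \<longleftrightarrow> (\<forall>a\<in>carrier (obj ?F (- int k - 1)).
      dif Y (- int k - 1 + n - 1) (g' a) \<oplus>\<^bsub>obj Y (- int k - 1 + n)\<^esub>
        \<sigma> \<odot>\<^bsub>obj Y (- int k - 1 + n)\<^esub> g (dif ?F (- int k - 1) a) = \<phi> (- int k - 1) a)" for k g g'
  have "\<exists>\<psi>. \<forall>k. P k (\<psi> k) \<and> Q k (\<psi> k) (\<psi> (Suc k))"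
  proof (rule dependent_nat_choice)
    show "\<exists>g. P 0 g"
      using lift[OF Hom_complex_hom[OF \<phi>D(1), of 0 n]] start unfolding P_def by auto
  next
    fix g k assume g: "P k g"
    let ?p = "- int k - 1"
    have Sk: "- int (Suc k) = ?p" by simp
    have gh: "g \<in> mod_hom R (obj ?F (?p + 1)) (obj Y (?p + n))"
      using g by (simp add: P_def algebra_simps)
    have dF: "dif ?F ?p \<in> mod_hom R (obj ?F ?p) (obj ?F (?p + 1))" by (rule cochain_complexD(2)[OF F])
    \<comment> \<open>What the components built so far leave of \<open>\<phi>\<close> in degree \<open>-k - 1\<close>.\<close>
    define h where "h a = \<phi> ?p a \<oplus>\<^bsub>obj Y (?p + n)\<^esub> \<tau> \<odot>\<^bsub>obj Y (?p + n)\<^esub> g (dif ?F ?p a)" for a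
    have gd: "g (dif ?F ?p a) \<in> carrier (obj Y (?p + n))" if "a \<in> carrier (obj ?F ?p)" for a
      by (rule mod_homD(1)[OF gh mod_homD(1)[OF dF that]])
    have h: "h \<in> mod_hom R (obj ?F ?p) (obj Y (?p + n))"
      using mod_hom_add[OF Hom_complex_hom[OF \<phi>D(1) refl, of ?p]
          mod_hom_comp[OF mod_hom_comp[OF dF gh] smult_hom[OF Y.module_axioms \<tau>]] Y.module_axioms]
      by (simp add: h_def[abs_def] comp_def)
    have cob: "h a \<in> coboundaries Y (?p + n)" if a: "a \<in> carrier (obj ?F ?p)" for a
    proof -
      have da: "dif ?F ?p a \<in> carrier (obj ?F (?p + 1))" by (rule mod_homD(1)[OF dF a])
      have "dif ?F (?p + 1) (dif ?F ?p a) = \<zero>\<^bsub>obj ?F (?p + 2)\<^esub>" by (rule cochain_complexD(3)[OF F a])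
      then have dg: "dif Y (?p + n) (g (dif ?F ?p a)) = \<phi> (?p + 1) (dif ?F ?p a)"
        using g da by (simp add: P_def algebra_simps)
      have v: "\<phi> (?p + 1) (dif ?F ?p a) \<in> carrier (obj Y (?p + n + 1))" using \<phi>v[OF da, of "?p + n + 1"] by simp
      have "dif Y (?p + n) (h a) = dif Y (?p + n) (\<phi> ?p a) \<oplus>\<^bsub>obj Y (?p + n + 1)\<^esub> \<tau> \<odot>\<^bsub>obj Y (?p + n + 1)\<^esub> \<phi> (?p + 1) (dif ?F ?p a)"
        unfolding h_def dg[symmetric] mod_homD(3)[OF cochain_complexD(2)[OF Y] \<tau> gd[OF a], symmetric]
        by (rule mod_homD(2)[OF cochain_complexD(2)[OF Y] \<phi>v[OF a refl] Y.smult_closed[OF \<tau> gd[OF a]]])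
      also have "\<dots> = \<zero>\<^bsub>obj Y (?p + n + 1)\<^esub>"
        unfolding d\<phi>[OF a refl] neg[OF v] by (rule Y.M.l_neg[OF Y.smult_closed[OF \<tau> v]])
      finally have "h a \<in> cocycles Y (?p + n)" using mod_homD(1)[OF h a] by (simp add: cocycles_def)
      then show ?thesis using exact[of ?p] by auto
    qed
    obtain g' where g': "g' \<in> mod_hom R (obj ?F ?p) (obj Y (?p + n - 1))"
      "\<forall>a\<in>carrier (obj ?F ?p). dif Y (?p + n - 1) (g' a) = h a"
      using lift[OF h cob] by blast
    have Q': "Q k g g'"
      unfolding Q_def
    proof
      fix a assume a: "a \<in> carrier (obj ?F ?p)"
      show "dif Y (?p + n - 1) (g' a) \<oplus>\<^bsub>obj Y (?p + n)\<^esub> \<sigma> \<odot>\<^bsub>obj Y (?p + n)\<^esub> g (dif ?F ?p a) = \<phi> ?p a"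
        unfolding g'(2)[rule_format, OF a] h_def neg[OF gd[OF a]]
        using \<phi>v[OF a refl] Y.smult_closed[OF \<tau> gd[OF a]] by (simp add: Y.M.a_assoc Y.M.r_neg)
    qed
    have "dif Y (?p + n - 1) (g' a) = \<phi> ?p a"
      if a: "a \<in> carrier (obj ?F ?p)" and z: "dif ?F ?p a = \<zero>\<^bsub>obj ?F (?p + 1)\<^esub>" for a
      unfolding g'(2)[rule_format, OF a] h_def z mod_hom_zero[OF gh F.module_axioms Y.module_axioms]
      using \<phi>v[OF a refl] \<tau> by simp
    then have "P (Suc k) g'" unfolding P_def Sk using g'(1) by auto
    then show "\<exists>g'. P (Suc k) g' \<and> Q k g g'" using Q' by blast
  qed
  then obtain \<psi> where P: "\<And>k. P k (\<psi> k)" and Q: "\<And>k. Q k (\<psi> k) (\<psi> (Suc k))" by blast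
  define \<chi> where "\<chi> p = (if p \<le> 0 then restrict (\<psi> (nat (- p))) (carrier (obj ?F p))
    else (\<lambda>a\<in>carrier (obj ?F p). \<zero>\<^bsub>obj Y (p + n - 1)\<^esub>))" for p
  have \<chi>: "\<chi> p \<in> carrier (Hom R (obj ?F p) (obj Y (p + (n - 1))))" for p
  proof (cases "p \<le> 0")
    case True
    then have "\<psi> (nat (- p)) \<in> mod_hom R (obj ?F p) (obj Y (p + n - 1))"
      using P[of "nat (- p)"] by (simp add: P_def)
    then show ?thesis using True mod_hom_restrict[OF F.module_axioms] by (simp add: \<chi>_def algebra_simps)
  next
    case False
    then show ?thesis
      using mod_hom_restrict[OF F.module_axioms mod_hom_zero_map[OF F.module_axioms Y.module_axioms]]
      by (simp add: \<chi>_def algebra_simps)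
  qed
  then have \<chi>H: "\<chi> \<in> carrier (obj ?H (n - 1))" by (simp add: Hom_complex_carrier)
  have "dif ?H (n - 1) \<chi> p a = \<phi> p a" if a: "a \<in> carrier (obj ?F p)" for p a
  proof -
    have da: "dif ?F p a \<in> carrier (obj ?F (p + 1))" by (rule mod_homD(1)[OF cochain_complexD(2)[OF F] a])
    have *: "dif ?H (n - 1) \<chi> p a = dif Y (p + n - 1) (\<chi> p a) \<oplus>\<^bsub>obj Y (p + n)\<^esub> \<sigma> \<odot>\<^bsub>obj Y (p + n)\<^esub> \<chi> (p + 1) (dif ?F p a)"
      using Hom_complex_dif[OF F Y \<chi>H a, of "p + n"] unfolding \<sigma>_def by (simp add: algebra_simps)
    consider "p < 0" | "p = 0" | "p > 0" by linarith
    then show ?thesis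
    proof cases
      case 1
      then obtain k where "nat (- p) = Suc k" by (cases "nat (- p)") auto
      then have k: "p = - int k - 1" by linarith
      then have "nat (- p) = Suc k" "nat (- (p + 1)) = k" "p + 1 \<le> 0" by auto
      then have "\<chi> p a = \<psi> (Suc k) a" "\<chi> (p + 1) (dif ?F p a) = \<psi> k (dif ?F p a)"
        using a da by (simp_all add: \<chi>_def)
      then show ?thesis
        unfolding * using Q[of k] a unfolding Q_def by (simp add: k algebra_simps)
    next
      case 2
      have fz: "dif ?F p a = \<zero>\<^bsub>obj ?F (p + 1)\<^esub>" using 2 by (simp add: std_res_def free_module_simps)
      have "dif Y (p + n - 1) (\<chi> p a) = \<phi> p a"
        using P[of 0] a fz 2 unfolding P_def \<chi>_def by simp
      moreover have "\<chi> (p + 1) (dif ?F p a) = \<zero>\<^bsub>obj Y (p + n)\<^esub>" using 2 da by (simp add: \<chi>_def)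
      ultimately show ?thesis unfolding * using \<phi>v[OF a refl] \<sigma> by simp
    next
      case 3
      then have "a = \<zero>\<^bsub>obj ?F p\<^esub>" using a by (auto simp: std_res_def free_module_simps)
      then have "\<phi> p a = \<zero>\<^bsub>obj Y (p + n)\<^esub>"
        using mod_hom_zero[OF Hom_complex_hom[OF \<phi>D(1) refl] F.module_axioms Y.module_axioms] by simp
      moreover have "dif Y (p + n - 1) \<zero>\<^bsub>obj Y (p + n - 1)\<^esub> = \<zero>\<^bsub>obj Y (p + n)\<^esub>"
        using mod_hom_zero[OF cochain_complexD(2)[OF Y, of "p + n - 1"] Y.module_axioms Y.module_axioms] by simp
      ultimately show ?thesis unfolding * using 3 a da \<sigma> by (simp add: \<chi>_def)
    qed
  qed
  moreover have "dif ?H (n - 1) \<chi> \<in> carrier (obj ?H n)"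
    using Hom_complex_dif_closed[OF F Y \<chi>H] by simp
  ultimately have "dif ?H (n - 1) \<chi> = \<phi>" using \<phi>D(1) by (intro Hom_complex_eqI)
  then show ?thesis using coboundariesI[OF \<chi>H] by simp
qed

text \<open>In degree 0 the differential of the resolution is zero, so that a cocycle of the Hom complex
  sends \<open>F\<^sub>0\<close> into the cocycles of \<open>Y\<close>, and the construction of the homotopy can start.\<close>

lemma Hom_complex_acyclic:
  assumes T: "module R T" and Y: "cochain_complex R Y" and acyclic: "acyclic_cpx Y"
  shows "acyclic_cpx (Hom_complex R (std_res R T) Y)"
  unfolding acyclic_cpx_def
proof (intro allI subsetI)
  let ?F = "std_res R T"
  have F: "cochain_complex R ?F" by (rule std_res_cochain_complex[OF T])
  fix n \<phi> assume \<phi>: "\<phi> \<in> cocycles (Hom_complex R ?F Y) n"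
  interpret Y: module R "obj Y j" for j by (rule cochain_complexD(1)[OF Y])
  show "\<phi> \<in> coboundaries (Hom_complex R ?F Y) n"
  proof (rule std_res_null_homotopy[OF T Y \<phi>])
    show "cocycles Y (p + n) \<subseteq> coboundaries Y (p + n)" for p
      using acyclic by (simp add: acyclic_cpx_def)
    fix a assume a: "a \<in> carrier (obj ?F 0)"
    note \<phi>D = cocyclesD[OF \<phi>]
    have v: "\<phi> 0 a \<in> carrier (obj Y n)"
      using mod_homD(1)[OF Hom_complex_hom[OF \<phi>D(1)] a] by simp
    have "dif ?F 0 a = \<zero>\<^bsub>obj ?F 1\<^esub>" by (simp add: std_res_def free_module_simps)
    then have "\<phi> 1 (dif ?F 0 a) = \<zero>\<^bsub>obj Y (n + 1)\<^esub>"
      using mod_hom_zero[OF Hom_complex_hom[OF \<phi>D(1), of 1 "n + 1"] cochain_complexD(1)[OF F] Y.module_axioms] by simp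
    moreover have "dif (Hom_complex R ?F Y) n \<phi> 0 a = \<zero>\<^bsub>obj Y (n + 1)\<^esub>"
      using \<phi>D(2) a by (simp add: Hom_complex_ops Hom_simps)
    ultimately have "dif Y n (\<phi> 0 a) = \<zero>\<^bsub>obj Y (n + 1)\<^esub>"
      using Hom_complex_dif[OF F Y \<phi>D(1) a, of "n + 1"] hom_sign_simps(1)[OF F Y]
        mod_homD(1)[OF cochain_complexD(2)[OF Y] v] by simp
    then have "\<phi> 0 a \<in> cocycles Y n" using v by (simp add: cocycles_def)
    then show "\<phi> 0 a \<in> coboundaries Y n" using acyclic by (auto simp: acyclic_cpx_def)
  qed
qed

text \<open>If \<open>b\<close> kills \<open>T\<close>, then multiplication by \<open>b\<close> is null homotopic on the resolution of \<open>T\<close>.  So on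
  \<open>Ext(T, G)\<close> it is zero, while it is invertible when it is invertible on \<open>G\<close>.\<close>

lemma Hom_complex_acyclic_of_bij:
  fixes R :: "('r, 'q) ring_scheme" and T :: "('r, 't) module" and G :: "('r, 'y) cpx"
  assumes T: "module R T" and G: "cochain_complex R G" and b: "b \<in> carrier R"
    and kill: "\<And>x. x \<in> carrier T \<Longrightarrow> b \<odot>\<^bsub>T\<^esub> x = \<zero>\<^bsub>T\<^esub>"
    and bij: "\<And>j. bij_betw (\<lambda>x. b \<odot>\<^bsub>obj G j\<^esub> x) (carrier (obj G j)) (carrier (obj G j))"
  shows "acyclic_cpx (Hom_complex R (std_res R T) G)"
  unfolding acyclic_cpx_def
proof (intro allI subsetI)
  let ?F = "std_res R T"
  let ?H = "Hom_complex R ?F G" and ?E = "Hom_complex R ?F ?F"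
  have F: "cochain_complex R ?F" by (rule std_res_cochain_complex[OF T])
  interpret F: module R "obj ?F j" for j by (rule cochain_complexD(1)[OF F])
  interpret G: module R "obj G j" for j by (rule cochain_complexD(1)[OF G])
  interpret H: module R "obj ?H n" for n by (rule Hom_complex_module[OF F G])
  define \<beta> where "\<beta> p = (\<lambda>a\<in>carrier (obj ?F p). b \<odot>\<^bsub>obj ?F p\<^esub> a)" for p
  from mod_hom_restrict[OF F.module_axioms smult_hom[OF F.module_axioms b]]
  have \<beta>: "\<beta> \<in> carrier (obj ?E 0)" by (simp add: Hom_complex_carrier \<beta>_def)
  have "dif ?E 0 \<beta> p a = \<zero>\<^bsub>obj ?F (p + 1)\<^esub>" if a: "a \<in> carrier (obj ?F p)" for p a
  proof -
    have da: "dif ?F p a \<in> carrier (obj ?F (p + 1))" by (rule mod_homD(1)[OF cochain_complexD(2)[OF F] a])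
    show ?thesis
      unfolding Hom_complex_dif[OF F F \<beta> a, of "p + 1", simplified]
      using a da b mod_homD(3)[OF cochain_complexD(2)[OF F] b a]
      by (simp add: \<beta>_def hom_sign_def F.smult_l_minus F.M.r_neg)
  qed
  then have "dif ?E 0 \<beta> = \<zero>\<^bsub>obj ?E (0 + 1)\<^esub>"
    using Hom_complex_zero_iff[OF F F Hom_complex_dif_closed[OF F F \<beta>]] by simp
  then have \<beta>c: "\<beta> \<in> cocycles ?E 0" using \<beta> by (simp add: cocycles_def)
  have "\<beta> \<in> coboundaries ?E 0"
  proof (rule std_res_null_homotopy[OF T F \<beta>c])
    fix a assume a: "a \<in> carrier (obj ?F 0)"
    have aug: "std_aug R T \<in> mod_hom R (obj ?F 0) T"
      using std_aug_hom[OF T] by (simp add: std_res_def)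
    have "std_aug R T (b \<odot>\<^bsub>obj ?F 0\<^esub> a) = \<zero>\<^bsub>T\<^esub>"
      using mod_homD(3)[OF aug b a] kill[OF mod_homD(1)[OF aug a]] by simp
    then have "b \<odot>\<^bsub>obj ?F 0\<^esub> a \<in> coboundaries ?F 0"
      using std_res_exact(3)[OF T] b a F.smult_closed by blast
    then show "\<beta> 0 a \<in> coboundaries ?F 0" using a by (simp add: \<beta>_def)
  next
    fix p :: int assume "p < 0"
    then show "cocycles ?F (p + 0) \<subseteq> coboundaries ?F (p + 0)" using std_res_exact(1)[OF T] by simp
  qed
  then obtain h where h: "h \<in> carrier (obj ?E (- 1))" "\<beta> = dif ?E (- 1) h"
    using coboundariesE[of \<beta> ?E 0] by auto
  have hv: "h p a \<in> carrier (obj ?F (p - 1))" if "a \<in> carrier (obj ?F p)" for p a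
    using mod_homD(1)[OF Hom_complex_hom[OF h(1), of p "p - 1"] that] by simp
  have hb: "b \<odot>\<^bsub>obj ?F p\<^esub> a = dif ?F (p - 1) (h p a) \<oplus>\<^bsub>obj ?F p\<^esub> h (p + 1) (dif ?F p a)"
    if a: "a \<in> carrier (obj ?F p)" for p a
  proof -
    have "h (p + 1) (dif ?F p a) \<in> carrier (obj ?F p)"
      using hv[OF mod_homD(1)[OF cochain_complexD(2)[OF F] a]] by simp
    moreover have "\<beta> p a = dif ?E (- 1) h p a" unfolding h(2) ..
    then have "b \<odot>\<^bsub>obj ?F p\<^esub> a = dif ?E (- 1) h p a" using a by (simp add: \<beta>_def)
    ultimately show ?thesis
      using Hom_complex_dif[OF F F h(1) a, of p] by (simp add: hom_sign_def)
  qed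
  fix n f assume f: "f \<in> cocycles ?H n"
  note fD = cocyclesD[OF f]
  define quo where "quo j = inv_into (carrier (obj G j)) (\<lambda>x. b \<odot>\<^bsub>obj G j\<^esub> x)" for j
  have mul: "(\<lambda>x. b \<odot>\<^bsub>obj G j\<^esub> x) \<in> mod_iso R (obj G j) (obj G j)" for j
    using bij smult_hom[OF G.module_axioms b] unfolding mod_iso_def by blast
  have quo: "quo j \<in> mod_hom R (obj G j) (obj G j)" for j
    unfolding quo_def by (rule mod_isoD(1)[OF mod_iso_inv_into[OF mul G.module_axioms]])
  have bquo: "b \<odot>\<^bsub>obj G j\<^esub> quo j x = x" if "x \<in> carrier (obj G j)" for j x
    unfolding quo_def using mod_isoD(3)[OF mul] that by (simp add: f_inv_into_f[of x])
  have quob: "quo j (b \<odot>\<^bsub>obj G j\<^esub> x) = x" if "x \<in> carrier (obj G j)" for j x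
    unfolding quo_def using mod_isoD(2)[OF mul] that by (simp add: inv_into_f_f)
  \<comment> \<open>Dividing by \<open>b\<close> is a chain map, so \<open>f\<close> divided by \<open>b\<close> is again a cocycle.\<close>
  have "chain_map R G G quo"
    unfolding chain_map_def
  proof (intro conjI allI ballI quo)
    fix j x assume x: "x \<in> carrier (obj G j)"
    have "quo (j + 1) (dif G j x) = quo (j + 1) (b \<odot>\<^bsub>obj G (j + 1)\<^esub> dif G j (quo j x))"
      using mod_homD(3)[OF cochain_complexD(2)[OF G] b mod_homD(1)[OF quo x]] bquo[OF x] by simp
    also have "\<dots> = dif G j (quo j x)"
      by (rule quob[OF mod_homD(1)[OF cochain_complexD(2)[OF G] mod_homD(1)[OF quo x]]])
    finally show "quo (j + 1) (dif G j x) = dif G j (quo j x)" .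
  qed
  from chain_map_cocycles[OF Hom_complex_cochain_complex[OF F G] Hom_complex_cochain_complex[OF F G]
      hom_post_chain_map[OF F F G G this] f]
  have g: "hom_post ?F quo n f \<in> cocycles ?H n" .
  define g where "g = hom_post ?F quo n f"
  note gD = cocyclesD[OF g, folded g_def]
  have gf: "b \<odot>\<^bsub>obj G (p + n)\<^esub> g p a = f p a" if "a \<in> carrier (obj ?F p)" for p a
    using bquo[OF mod_homD(1)[OF Hom_complex_hom[OF fD(1) refl] that]] that
    by (simp add: g_def hom_map_def)
  have gv: "g p a \<in> carrier (obj G q)" if "a \<in> carrier (obj ?F p)" "p + n = q" for p a q
    by (rule mod_homD(1)[OF Hom_complex_hom[OF gD(1) that(2)] that(1)])
  define \<sigma> where "\<sigma> = hom_sign R (n - 1)"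
  have \<sigma>: "\<sigma> \<in> carrier R" unfolding \<sigma>_def by (rule hom_sign_simps(1)[OF F G])
  have dg: "dif G (p - 1 + n) (g (p - 1) a) = \<sigma> \<odot>\<^bsub>obj G (p + n)\<^esub> g p (dif ?F (p - 1) a)"
    if a: "a \<in> carrier (obj ?F (p - 1))" for p a
  proof -
    have da: "dif ?F (p - 1) a \<in> carrier (obj ?F p)"
      using mod_homD(1)[OF cochain_complexD(2)[OF F] a] by simp
    have v: "g p (dif ?F (p - 1) a) \<in> carrier (obj G (p + n))" by (rule gv[OF da refl])
    have idx: "p - 1 + n + 1 = p + n" by simp
    have d: "dif G (p - 1 + n) (g (p - 1) a) \<in> carrier (obj G (p + n))"
      using mod_homD(1)[OF cochain_complexD(2)[OF G] gv[OF a refl]] idx by simp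
    have "dif ?H n g (p - 1) a = \<zero>\<^bsub>obj G (p + n)\<^esub>"
      using gD(2) a by (simp add: Hom_complex_ops Hom_simps)
    then have "dif G (p - 1 + n) (g (p - 1) a) \<oplus>\<^bsub>obj G (p + n)\<^esub> hom_sign R n \<odot>\<^bsub>obj G (p + n)\<^esub> g p (dif ?F (p - 1) a) = \<zero>\<^bsub>obj G (p + n)\<^esub>"
      using Hom_complex_dif[OF F G gD(1) a idx] by simp
    then show ?thesis
      using d v hom_sign_simps(1)[OF F G] unfolding \<sigma>_def hom_sign_simps(3)[OF F G v]
      by (intro G.M.minus_equality[symmetric]) auto
  qed
  \<comment> \<open>Since \<open>b = dh + hd\<close> on the resolution and \<open>b g = f\<close>, the differential of the cochain \<open>g h\<close> is
      \<open>f\<close> up to sign.\<close>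
  define \<chi> where "\<chi> p = compose (carrier (obj ?F p)) (g (p - 1)) (h p)" for p
  have "\<chi> p \<in> carrier (Hom R (obj ?F p) (obj G (p + (n - 1))))" for p
    unfolding \<chi>_def
    by (rule Hom_compose[OF F.module_axioms Hom_complex_hom[OF h(1)] Hom_complex_hom[OF gD(1)]]) auto
  then have \<chi>: "\<chi> \<in> carrier (obj ?H (n - 1))" by (simp add: Hom_complex_carrier)
  have d\<chi>: "dif ?H (n - 1) \<chi> \<in> carrier (obj ?H n)" using Hom_complex_dif_closed[OF F G \<chi>] by simp
  have "\<sigma> \<odot>\<^bsub>obj ?H n\<^esub> dif ?H (n - 1) \<chi> = f"
  proof (rule Hom_complex_eqI[OF H.smult_closed[OF \<sigma> d\<chi>] fD(1)])
    fix p a assume a: "a \<in> carrier (obj ?F p)"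
    have da: "dif ?F p a \<in> carrier (obj ?F (p + 1))" by (rule mod_homD(1)[OF cochain_complexD(2)[OF F] a])
    let ?O = "obj G (p + n)"
    have h1: "dif ?F (p - 1) (h p a) \<in> carrier (obj ?F p)"
      using mod_homD(1)[OF cochain_complexD(2)[OF F] hv[OF a]] by simp
    have h2: "h (p + 1) (dif ?F p a) \<in> carrier (obj ?F p)" using hv[OF da] by simp
    note gp = mod_homD[OF Hom_complex_hom[OF gD(1) refl, of p]]
    have idx: "p + (n - 1) = p - 1 + n" by simp
    have "dif ?H (n - 1) \<chi> p a = dif G (p - 1 + n) (g (p - 1) (h p a)) \<oplus>\<^bsub>?O\<^esub> \<sigma> \<odot>\<^bsub>?O\<^esub> g p (h (p + 1) (dif ?F p a))"
      using Hom_complex_dif[OF F G \<chi> a, of "p + n"] a da unfolding \<sigma>_def idx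
      by (simp add: \<chi>_def compose_def)
    also have "\<dots> = \<sigma> \<odot>\<^bsub>?O\<^esub> g p (b \<odot>\<^bsub>obj ?F p\<^esub> a)"
      unfolding dg[OF hv[OF a]] hb[OF a] gp(2)[OF h1 h2] G.smult_r_distr[OF \<sigma> gp(1)[OF h1] gp(1)[OF h2]] ..
    also have "\<dots> = \<sigma> \<odot>\<^bsub>?O\<^esub> f p a" unfolding gp(3)[OF b a] gf[OF a] ..
    finally have "\<sigma> \<odot>\<^bsub>?O\<^esub> dif ?H (n - 1) \<chi> p a = f p a"
      using hom_sign_simps(2)[OF F G mod_homD(1)[OF Hom_complex_hom[OF fD(1) refl] a], of "n - 1"]
      by (simp add: \<sigma>_def)
    then show "(\<sigma> \<odot>\<^bsub>obj ?H n\<^esub> dif ?H (n - 1) \<chi>) p a = f p a"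
      using a by (simp add: Hom_complex_ops Hom_simps)
  qed
  then show "f \<in> coboundaries ?H n"
    using H.submoduleE(4)[OF coboundaries_submodule[OF Hom_complex_cochain_complex[OF F G]] \<sigma> coboundariesI[OF \<chi>]]
    by simp
qed

section \<open>Cokernels, subcomplexes and duals\<close>

text \<open>The differential of the cokernel complex is a union over a coset; it is independent of the
  representative because the images of \<open>u\<close> form a subcomplex, and everything follows from its value
  on a coset.\<close>

lemma coker_short_exact:
  assumes X: "cochain_complex R X" and Y: "cochain_complex R Y" and u: "chain_map R X Y u"
    and inj: "\<And>j. inj_on (u j) (carrier (obj X j))"
  shows "short_exact R X Y (coker_complex X Y u) u
    (\<lambda>j y. (u j ` carrier (obj X j)) +>\<^bsub>obj Y j\<^esub> y)"
proof -
  interpret Y: module R "obj Y j" for j by (rule cochain_complexD(1)[OF Y])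
  let ?K = "\<lambda>j. u j ` carrier (obj X j)" and ?Z = "coker_complex X Y u"
  let ?v = "\<lambda>j y. ?K j +>\<^bsub>obj Y j\<^esub> y"
  have K: "submodule (?K j) R (obj Y j)" for j
    by (rule submodule_image[OF chain_mapD(1)[OF u] cochain_complexD(1)[OF X] Y.module_axioms])
  note q = quot_module_module[OF Y.module_axioms K] quot_module_carrier[OF Y.module_axioms K]
  have objZ: "obj ?Z j = quot_module (obj Y j) (?K j)" for j by (simp add: coker_complex_def)
  have v: "?v j \<in> mod_hom R (obj Y j) (obj ?Z j)" for j
    unfolding objZ by (rule coset_hom[OF Y.module_axioms K])
  have dK: "dif Y j y \<in> ?K (j + 1)" if "y \<in> ?K j" for j y
  proof -
    obtain x where x: "x \<in> carrier (obj X j)" "y = u j x" using \<open>y \<in> ?K j\<close> by blast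
    then have "dif Y j y = u (j + 1) (dif X j x)" using chain_mapD(2)[OF u x(1)] by simp
    then show ?thesis using mod_homD(1)[OF cochain_complexD(2)[OF X] x(1)] by blast
  qed
  have dif: "dif ?Z j (?v j y) = ?v (j + 1) (dif Y j y)" if y: "y \<in> carrier (obj Y j)" for j y
  proof -
    note dY = cochain_complexD(2)[OF Y, of j]
    have "?v (j + 1) (dif Y j y') = ?v (j + 1) (dif Y j y)"
      if y': "y' \<in> carrier (obj Y j)" "y' \<ominus>\<^bsub>obj Y j\<^esub> y \<in> ?K j" for y'
      using coset_eq_iff[OF Y.module_axioms K mod_homD(1)[OF dY y'(1)] mod_homD(1)[OF dY y]]
        mod_hom_minus(2)[OF dY Y.module_axioms Y.module_axioms y'(1) y] dK[OF y'(2)] by simp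
    then have "(\<Union>y'\<in>?v j y. ?v (j + 1) (dif Y j y')) = ?v (j + 1) (dif Y j y)"
      by (rule UN_coset[OF Y.module_axioms K y])
    then show ?thesis by (simp add: coker_complex_def)
  qed
  have surj: "?v j ` carrier (obj Y j) = carrier (obj ?Z j)" for j by (simp add: objZ q(2))
  have Zm: "module R (obj ?Z j)" for j unfolding objZ by (rule q(1))
  have Z: "cochain_complex R ?Z"
    unfolding cochain_complex_def
  proof (intro conjI allI ballI Zm)
    note vD = mod_homD[OF v] and dD = mod_homD[OF cochain_complexD(2)[OF Y]]
    show "dif ?Z j \<in> mod_hom R (obj ?Z j) (obj ?Z (j + 1))" for j
    proof (rule mod_homI)
      fix S assume "S \<in> carrier (obj ?Z j)"
      then obtain y where y: "y \<in> carrier (obj Y j)" "S = ?v j y" unfolding surj[symmetric] by blast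
      show "dif ?Z j S \<in> carrier (obj ?Z (j + 1))" unfolding y(2) dif[OF y(1)] by (rule vD(1)[OF dD(1)[OF y(1)]])
      {
        fix S' assume "S' \<in> carrier (obj ?Z j)"
        then obtain y' where y': "y' \<in> carrier (obj Y j)" "S' = ?v j y'" unfolding surj[symmetric] by blast
        show "dif ?Z j (S \<oplus>\<^bsub>obj ?Z j\<^esub> S') = dif ?Z j S \<oplus>\<^bsub>obj ?Z (j + 1)\<^esub> dif ?Z j S'"
          unfolding y(2) y'(2) dif[OF y(1)] dif[OF y'(1)] vD(2)[OF y(1) y'(1), symmetric]
            dif[OF Y.M.a_closed[OF y(1) y'(1)]] dD(2)[OF y(1) y'(1)]
          by (rule vD(2)[OF dD(1)[OF y(1)] dD(1)[OF y'(1)]])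
      }
      fix r assume r: "r \<in> carrier R"
      show "dif ?Z j (r \<odot>\<^bsub>obj ?Z j\<^esub> S) = r \<odot>\<^bsub>obj ?Z (j + 1)\<^esub> dif ?Z j S"
        unfolding y(2) dif[OF y(1)] vD(3)[OF r y(1), symmetric] dif[OF Y.smult_closed[OF r y(1)]] dD(3)[OF r y(1)]
        by (rule vD(3)[OF r dD(1)[OF y(1)]])
    qed
    fix j S assume "S \<in> carrier (obj ?Z j)"
    then obtain y where y: "y \<in> carrier (obj Y j)" "S = ?v j y" unfolding surj[symmetric] by blast
    have "dif ?Z (j + 1) (dif ?Z j S) = ?v (j + 2) \<zero>\<^bsub>obj Y (j + 2)\<^esub>"
      unfolding y(2) dif[OF y(1)] dif[OF dD(1)[OF y(1)]] cochain_complexD(3)[OF Y y(1)] by (simp add: add.assoc)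
    then show "dif ?Z (j + 1) (dif ?Z j S) = \<zero>\<^bsub>obj ?Z (j + 2)\<^esub>"
      using mod_hom_zero[OF v Y.module_axioms Zm] by simp
  qed
  have cv: "chain_map R Y ?Z ?v" unfolding chain_map_def using v dif by simp
  have ker: "?K j = {y \<in> carrier (obj Y j). ?v j y = \<zero>\<^bsub>obj ?Z j\<^esub>}" for j
  proof -
    have "?v j y = \<zero>\<^bsub>obj ?Z j\<^esub> \<longleftrightarrow> y \<in> ?K j" if "y \<in> carrier (obj Y j)" for y
      using coset_zero_iff[OF Y.module_axioms K that] by (simp add: objZ quot_module_def)
    then show ?thesis using Y.submoduleE(1)[OF K] by blast
  qed
  show ?thesis
    unfolding short_exact_def using X Y Z u cv inj ker surj by blast
qed

subsection \<open>Subcomplexes\<close>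

definition subcomplex :: "('r, 'a) cpx \<Rightarrow> (int \<Rightarrow> 'a set) \<Rightarrow> ('r, 'a) cpx" where
  "subcomplex X C = X\<lparr>obj := (\<lambda>j. sub_module (obj X j) (C j))\<rparr>"

lemma subcomplex_simps [simp]:
  "obj (subcomplex X C) j = sub_module (obj X j) (C j)"
  "dif (subcomplex X C) = dif X"
  by (simp_all add: subcomplex_def)

lemma subcomplex_cochain_complex:
  assumes X: "cochain_complex R X" and C: "\<And>j. submodule (C j) R (obj X j)"
    and d: "\<And>j x. x \<in> C j \<Longrightarrow> dif X j x \<in> C (j + 1)"
  shows "cochain_complex R (subcomplex X C)"
proof -
  interpret X: module R "obj X j" for j by (rule cochain_complexD(1)[OF X])
  have CX: "x \<in> carrier (obj X j)" if "x \<in> C j" for x j using X.submoduleE(1)[OF C] that by blast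
  note D = mod_homD[OF cochain_complexD(2)[OF X]]
  show ?thesis
    unfolding cochain_complex_def
    using sub_module_module[OF X.module_axioms C] d D CX cochain_complexD(3)[OF X]
    by (auto intro!: mod_homI)
qed

lemma incl_chain_map:
  assumes "\<And>j. C j \<subseteq> C' j"
  shows "chain_map R (subcomplex X C) (subcomplex X C') incl_map"
  using subsetD[OF assms] by (auto simp: chain_map_def incl_map_def intro!: mod_homI)

lemma incl_inj: "inj_on (incl_map j) A"
  by (simp add: incl_map_def inj_on_def)

lemma incl_chain_map_full:
  assumes "\<And>j. C j \<subseteq> carrier (obj X j)"
  shows "chain_map R (subcomplex X C) X incl_map"
  using subsetD[OF assms] by (auto simp: chain_map_def incl_map_def intro!: mod_homI)

subsection \<open>A module in a single degree\<close>

lemma single_obj: "obj (single c A) j = (if j = c then A else sub_module A {\<zero>\<^bsub>A\<^esub>})"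
  and single_dif: "dif (single c A) j x = \<zero>\<^bsub>A\<^esub>"
  by (simp_all add: single_def)

lemma single_zero [simp]: "\<zero>\<^bsub>obj (single c A) j\<^esub> = \<zero>\<^bsub>A\<^esub>"
  by (simp add: single_obj)

lemma single_cochain_complex:
  assumes A: "module R A"
  shows "cochain_complex R (single c A)"
  unfolding cochain_complex_def
proof (intro conjI allI ballI single_module[OF A])
  interpret A: module R A by fact
  fix j
  show "dif (single c A) j \<in> mod_hom R (obj (single c A) j) (obj (single c A) (j + 1))"
    by (auto simp: single_obj single_dif intro!: mod_homI)
qed (simp_all add: single_dif)

lemma single_map_chain_map:
  assumes A: "module R A" and Y: "cochain_complex R Y"
    and g: "g \<in> mod_hom R A (obj Y c)" and z: "\<And>a. a \<in> carrier A \<Longrightarrow> dif Y c (g a) = \<zero>\<^bsub>obj Y (c + 1)\<^esub>"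
  shows "chain_map R (single c A) Y (single_map c g Y)"
proof -
  interpret A: module R A by fact
  interpret Y: module R "obj Y j" for j by (rule cochain_complexD(1)[OF Y])
  have "single_map c g Y j \<in> mod_hom R (obj (single c A) j) (obj Y j)" for j
    using g mod_hom_zero_map[OF sub_module_module[OF A] Y.module_axioms]
    by (auto simp: single_map_def single_obj mod_hom_def)
  moreover have "single_map c g Y (j + 1) \<zero>\<^bsub>A\<^esub> = \<zero>\<^bsub>obj Y (j + 1)\<^esub>" for j
    using mod_hom_zero[OF g A Y.module_axioms] by (simp add: single_map_def)
  moreover have "dif Y j (single_map c g Y j x) = \<zero>\<^bsub>obj Y (j + 1)\<^esub>" if "x \<in> carrier (obj (single c A) j)" for j x
    using z that mod_hom_zero[OF cochain_complexD(2)[OF Y] Y.module_axioms Y.module_axioms]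
    by (auto simp: single_map_def single_obj)
  ultimately show ?thesis by (simp add: chain_map_def single_dif)
qed

lemma single_map_inj:
  assumes "inj_on g (carrier A)"
  shows "inj_on (single_map c g Y j) (carrier (obj (single c A) j))"
  using assms by (auto simp: single_map_def single_obj inj_on_def)

subsection \<open>Duals\<close>

text \<open>The homomorphism theorem: \<open>f\<close> factors through the image of \<open>d\<close> when it vanishes on the kernel
  of \<open>d\<close>.\<close>

lemma hom_factor:
  assumes A: "module R A" and B: "module R B" and K: "module R K"
    and d: "d \<in> mod_hom R A B" and f: "f \<in> mod_hom R A K"
    and ker: "\<And>x. x \<in> carrier A \<Longrightarrow> d x = \<zero>\<^bsub>B\<^esub> \<Longrightarrow> f x = \<zero>\<^bsub>K\<^esub>"
  obtains h where "h \<in> mod_hom R (sub_module B (d ` carrier A)) K" "\<And>x. x \<in> carrier A \<Longrightarrow> h (d x) = f x"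
proof -
  interpret A: module R A by fact
  define h where "h b = f (SOME x. x \<in> carrier A \<and> d x = b)" for b
  have h: "h (d x) = f x" if x: "x \<in> carrier A" for x
  proof -
    let ?y = "SOME y. y \<in> carrier A \<and> d y = d x"
    have "\<exists>y. y \<in> carrier A \<and> d y = d x" using x by blast
    from someI_ex[OF this] have y: "?y \<in> carrier A" "d ?y = d x" by auto
    show ?thesis
      using ker[OF A.M.minus_closed[OF y(1) x]] y(2) mod_hom_eq_iff[OF d A B y(1) x] mod_hom_eq_iff[OF f A K y(1) x]
      by (simp add: h_def)
  qed
  have "h \<in> mod_hom R (sub_module B (d ` carrier A)) K"
  proof (rule mod_homI)
    fix b assume "b \<in> carrier (sub_module B (d ` carrier A))"
    then obtain x where x: "x \<in> carrier A" "b = d x" by auto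
    show "h b \<in> carrier K" using x h mod_homD(1)[OF f] by simp
    {
      fix b' assume "b' \<in> carrier (sub_module B (d ` carrier A))"
      then obtain x' where x': "x' \<in> carrier A" "b' = d x'" by auto
      show "h (b \<oplus>\<^bsub>sub_module B (d ` carrier A)\<^esub> b') = h b \<oplus>\<^bsub>K\<^esub> h b'"
        using h[OF A.M.a_closed[OF x(1) x'(1)]] h x x' mod_homD(2)[OF d x(1) x'(1)] mod_homD(2)[OF f x(1) x'(1)] by simp
    }
    fix r assume r: "r \<in> carrier R"
    show "h (r \<odot>\<^bsub>sub_module B (d ` carrier A)\<^esub> b) = r \<odot>\<^bsub>K\<^esub> h b"
      using h[OF A.smult_closed[OF r x(1)]] h x mod_homD(3)[OF d r x(1)] mod_homD(3)[OF f r x(1)] by simp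
  qed
  then show thesis using h by (rule that)
qed

text \<open>The extension property of an injective module in the form of a factorisation.\<close>

lemma injective_factor:
  assumes K: "injective_module R K" and A: "module R A" and B: "module R B"
    and d: "d \<in> mod_hom R A B" and f: "f \<in> mod_hom R A K"
    and ker: "\<And>x. x \<in> carrier A \<Longrightarrow> d x = \<zero>\<^bsub>B\<^esub> \<Longrightarrow> f x = \<zero>\<^bsub>K\<^esub>"
  obtains g where "g \<in> mod_hom R B K" "\<And>x. x \<in> carrier A \<Longrightarrow> g (d x) = f x"
proof -
  have "module R K" using K by (simp add: injective_module_def)
  from hom_factor[OF A B this d f ker]
  obtain h where h: "h \<in> mod_hom R (sub_module B (d ` carrier A)) K" "\<And>x. x \<in> carrier A \<Longrightarrow> h (d x) = f x" by blast
  from injective_module_extend[OF K B submodule_image[OF d A B] h(1)]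
  obtain g where "g \<in> mod_hom R B K" "\<forall>b\<in>d ` carrier A. g b = h b" by blast
  then show thesis using that[of g] h(2) by simp
qed

lemma dual_obj: "obj (dual_complex R K X) j = Hom R (obj X (- j)) K"
  and dual_dif: "dif (dual_complex R K X) j f = compose (carrier (obj X (- j - 1))) f (dif X (- j - 1))"
  by (simp_all add: dual_complex_def)

lemma precomp_hom:
  assumes A: "module R A" and B: "module R B" and u: "u \<in> mod_hom R A B"
  shows "(\<lambda>f. compose (carrier A) f u) \<in> mod_hom R (Hom R B K) (Hom R A K)"
proof (rule mod_homI)
  fix f assume "f \<in> carrier (Hom R B K)"
  then have f: "f \<in> mod_hom R B K" by (simp add: Hom_simps)
  show "compose (carrier A) f u \<in> carrier (Hom R A K)" by (rule Hom_compose[OF A u f])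
qed (auto simp: Hom_simps compose_def mod_homD(1)[OF u] intro!: restrict_ext)

lemma dual_cochain_complex:
  assumes X: "cochain_complex R X" and K: "module R K"
  shows "cochain_complex R (dual_complex R K X)"
  unfolding cochain_complex_def
proof (intro conjI allI ballI)
  fix j
  show "module R (obj (dual_complex R K X) j)"
    unfolding dual_obj by (rule Hom_module[OF cochain_complexD(1)[OF X] K])
  have idx: "- (j + 1) = - j - 1" by simp
  have idx2: "- j - 2 + 1 = - j - 1" "- j - 2 + 2 = - j" by simp_all
  have d: "dif X (- j - 1) \<in> mod_hom R (obj X (- j - 1)) (obj X (- j))" for j
    using cochain_complexD(2)[OF X, of "- j - 1"] by simp
  have "(\<lambda>f. compose (carrier (obj X (- j - 1))) f (dif X (- j - 1)))
      \<in> mod_hom R (Hom R (obj X (- j)) K) (Hom R (obj X (- j - 1)) K)"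
    by (rule precomp_hom[OF cochain_complexD(1)[OF X] cochain_complexD(1)[OF X] d])
  then show "dif (dual_complex R K X) j \<in> mod_hom R (obj (dual_complex R K X) j) (obj (dual_complex R K X) (j + 1))"
    unfolding dual_obj dual_dif[abs_def] idx .
  fix f assume "f \<in> carrier (obj (dual_complex R K X) j)"
  then have f: "f \<in> mod_hom R (obj X (- j)) K" by (simp add: dual_obj Hom_simps)
  have "compose (carrier (obj X (- j - 2))) (compose (carrier (obj X (- j - 1))) f (dif X (- j - 1))) (dif X (- j - 2)) x =
      (\<lambda>x\<in>carrier (obj X (- j - 2)). \<zero>\<^bsub>K\<^esub>) x" for x
    using cochain_complexD(3)[OF X, of x "- j - 2", unfolded idx2]
      mod_homD(1)[OF cochain_complexD(2)[OF X, of "- j - 2", unfolded idx2], of x]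
      mod_hom_zero[OF f cochain_complexD(1)[OF X] K] by (auto simp: compose_def)
  then show "dif (dual_complex R K X) (j + 1) (dif (dual_complex R K X) j f) = \<zero>\<^bsub>obj (dual_complex R K X) (j + 2)\<^esub>"
    by (intro ext) (simp add: dual_obj dual_dif Hom_simps algebra_simps)
qed

definition dual_map :: "('r, 'a) cpx \<Rightarrow> (int \<Rightarrow> 'a \<Rightarrow> 'b) \<Rightarrow> int \<Rightarrow> ('b \<Rightarrow> 'k) \<Rightarrow> 'a \<Rightarrow> 'k" where
  "dual_map X u j f = compose (carrier (obj X (- j))) f (u (- j))"

lemma dual_chain_map:
  assumes X: "cochain_complex R X" and Y: "cochain_complex R Y" and u: "chain_map R X Y u"
  shows "chain_map R (dual_complex R K Y) (dual_complex R K X) (dual_map X u)"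
  unfolding chain_map_def
proof (intro conjI allI ballI)
  fix j
  show "dual_map X u j \<in> mod_hom R (obj (dual_complex R K Y) j) (obj (dual_complex R K X) j)"
    using precomp_hom[OF cochain_complexD(1)[OF X] cochain_complexD(1)[OF Y] chain_mapD(1)[OF u]]
    by (simp add: dual_obj dual_map_def[abs_def])
  fix f assume "f \<in> carrier (obj (dual_complex R K Y) j)"
  have "compose (carrier (obj X (- j - 1))) (compose (carrier (obj Y (- j - 1))) f (dif Y (- j - 1))) (u (- j - 1)) x =
      compose (carrier (obj X (- j - 1))) (compose (carrier (obj X (- j))) f (u (- j))) (dif X (- j - 1)) x" for x
    using mod_homD(1)[OF chain_mapD(1)[OF u, of "- j - 1"], of x] chain_mapD(2)[OF u, of x "- j - 1"]
      mod_homD(1)[OF cochain_complexD(2)[OF X, of "- j - 1"], of x] by (simp add: compose_def)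
  moreover have "- (j + 1) = - j - 1" by simp
  ultimately show "dual_map X u (j + 1) (dif (dual_complex R K Y) j f) = dif (dual_complex R K X) j (dual_map X u j f)"
    unfolding dual_map_def dual_dif by (intro ext) (simp only:)
qed

text \<open>Exactness in front of the last term is left exactness of \<open>Hom(-, K)\<close>; surjectivity at the end
  comes from the injectivity of \<open>K\<close>, in the lemmas that follow.  The dual of the first map may be
  any \<open>w\<close> with the same kernel, because the dual of a module in a single degree is again such a
  module only up to isomorphism.\<close>

lemma dual_short_exact:
  fixes R :: "('r, 'q) ring_scheme" and K :: "('r, 'k) module"
  assumes K: "module R K" and ex: "short_exact R X Y Z u v"
    and W: "cochain_complex R W" and w: "chain_map R (dual_complex R K Y) W w"
    and surj: "\<And>j. w j ` carrier (obj (dual_complex R K Y) j) = carrier (obj W j)"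
    and ker: "\<And>j f. f \<in> carrier (obj (dual_complex R K Y) j) \<Longrightarrow>
      w j f = \<zero>\<^bsub>obj W j\<^esub> \<longleftrightarrow> (\<forall>x\<in>carrier (obj X (- j)). f (u (- j) x) = \<zero>\<^bsub>K\<^esub>)"
  shows "short_exact R (dual_complex R K Z) (dual_complex R K Y) W (dual_map Y v) w"
proof -
  note D = short_exactD[OF ex]
  interpret Y: module R "obj Y j" for j by (rule cochain_complexD(1)[OF D(2)])
  interpret Z: module R "obj Z j" for j by (rule cochain_complexD(1)[OF D(3)])
  note v = chain_mapD(1)[OF D(5)]
  have inj: "inj_on (dual_map Y v j) (carrier (obj (dual_complex R K Z) j))" for j
  proof (rule inj_onI)
    fix f g assume fg: "f \<in> carrier (obj (dual_complex R K Z) j)" "g \<in> carrier (obj (dual_complex R K Z) j)"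
      and eq: "dual_map Y v j f = dual_map Y v j g"
    have "f z = g z" if z: "z \<in> carrier (obj Z (- j))" for z
    proof -
      obtain y where y: "y \<in> carrier (obj Y (- j))" "z = v (- j) y" using D(8)[of "- j"] z by blast
      then show ?thesis using fun_cong[OF eq, of y] by (simp add: dual_map_def compose_def)
    qed
    then show "f = g" using fg by (intro Hom_eqI[of _ "obj Z (- j)"]) (auto simp: dual_obj Hom_simps)
  qed
  have im: "dual_map Y v j ` carrier (obj (dual_complex R K Z) j) =
      {f \<in> carrier (obj (dual_complex R K Y) j). w j f = \<zero>\<^bsub>obj W j\<^esub>}" for j
  proof (intro subset_antisym subsetI)
    fix f assume "f \<in> dual_map Y v j ` carrier (obj (dual_complex R K Z) j)"
    then obtain g where g: "g \<in> carrier (obj (dual_complex R K Z) j)" "f = dual_map Y v j g" by blast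
    have gh: "g \<in> mod_hom R (obj Z (- j)) K" using g(1) by (simp add: dual_obj Hom_simps)
    have f: "f \<in> carrier (obj (dual_complex R K Y) j)"
      unfolding g(2) by (rule mod_homD(1)[OF chain_mapD(1)[OF dual_chain_map[OF D(2,3,5)]] g(1)])
    moreover have "f (u (- j) x) = \<zero>\<^bsub>K\<^esub>" if x: "x \<in> carrier (obj X (- j))" for x
      using short_exact_zero[OF ex x] mod_homD(1)[OF chain_mapD(1)[OF D(4)] x]
        mod_hom_zero[OF gh Z.module_axioms K] by (simp add: g(2) dual_map_def compose_def)
    ultimately show "f \<in> {f \<in> carrier (obj (dual_complex R K Y) j). w j f = \<zero>\<^bsub>obj W j\<^esub>}"
      using ker by blast
  next
    fix f assume "f \<in> {f \<in> carrier (obj (dual_complex R K Y) j). w j f = \<zero>\<^bsub>obj W j\<^esub>}"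
    then have f: "f \<in> carrier (obj (dual_complex R K Y) j)" and z: "\<forall>x\<in>carrier (obj X (- j)). f (u (- j) x) = \<zero>\<^bsub>K\<^esub>"
      using ker by auto
    have fh: "f \<in> mod_hom R (obj Y (- j)) K" and fe: "f \<in> extensional (carrier (obj Y (- j)))"
      using f by (auto simp: dual_obj Hom_simps)
    have "f y = \<zero>\<^bsub>K\<^esub>" if y: "y \<in> carrier (obj Y (- j))" "v (- j) y = \<zero>\<^bsub>obj Z (- j)\<^esub>" for y
    proof -
      have "y \<in> u (- j) ` carrier (obj X (- j))" unfolding D(7) using y by simp
      then show ?thesis using z by blast
    qed
    from hom_factor[OF Y.module_axioms Z.module_axioms K v fh this]
    obtain h where h: "h \<in> mod_hom R (sub_module (obj Z (- j)) (v (- j) ` carrier (obj Y (- j)))) K"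
      "\<And>y. y \<in> carrier (obj Y (- j)) \<Longrightarrow> h (v (- j) y) = f y" by blast
    have "h \<in> mod_hom R (obj Z (- j)) K"
      using h(1) unfolding D(8) by (simp add: sub_module_def)
    from mod_hom_restrict[OF Z.module_axioms this]
    have "restrict h (carrier (obj Z (- j))) \<in> carrier (obj (dual_complex R K Z) j)" by (simp add: dual_obj)
    moreover have "dual_map Y v j (restrict h (carrier (obj Z (- j)))) = f"
      using fe h(2) mod_homD(1)[OF v] by (intro Hom_eqI[of _ "obj Y (- j)"]) (auto simp: dual_map_def compose_def)
    ultimately show "f \<in> dual_map Y v j ` carrier (obj (dual_complex R K Z) j)" by blast
  qed
  show ?thesis
    unfolding short_exact_def
    using dual_cochain_complex[OF D(3) K] dual_cochain_complex[OF D(2) K] W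
      dual_chain_map[OF D(2,3,5)] w inj im surj by blast
qed

context
  fixes R :: "('r, 'q) ring_scheme" and K :: "('r, 'k) module"
    and X :: "('r, 'a) cpx" and Y :: "('r, 'b) cpx" and Z :: "('r, 'c) cpx" and u v
  assumes K: "injective_module R K" and ex: "short_exact R X Y Z u v"
begin

private lemma Km: "module R K"
  using K by (simp add: injective_module_def)

private lemma dual_extend:
  assumes f: "f \<in> mod_hom R (obj X j) K"
  obtains g where "g \<in> carrier (Hom R (obj Y j) K)" "\<And>x. x \<in> carrier (obj X j) \<Longrightarrow> g (u j x) = f x"
proof -
  note D = short_exactD[OF ex]
  have X: "module R (obj X j)" and Y: "module R (obj Y j)"
    using cochain_complexD(1)[OF D(1)] cochain_complexD(1)[OF D(2)] by auto
  note u = chain_mapD(1)[OF D(4), of j]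
  have "f x = \<zero>\<^bsub>K\<^esub>" if "x \<in> carrier (obj X j)" "u j x = \<zero>\<^bsub>obj Y j\<^esub>" for x
  proof -
    have "x = \<zero>\<^bsub>obj X j\<^esub>" using D(6)[of j] mod_hom_inj_iff[OF u X Y] that by blast
    then show ?thesis using mod_hom_zero[OF f X Km] by simp
  qed
  from injective_factor[OF K X Y u f this]
  obtain g where g: "g \<in> mod_hom R (obj Y j) K" "\<And>x. x \<in> carrier (obj X j) \<Longrightarrow> g (u j x) = f x"
    by blast
  show thesis
    using that[OF mod_hom_restrict[OF Y g(1)]] g(2) mod_homD(1)[OF u] by simp
qed

lemma dual_short_exact_map:
  "short_exact R (dual_complex R K Z) (dual_complex R K Y) (dual_complex R K X) (dual_map Y v) (dual_map X u)"
proof (rule dual_short_exact[OF Km ex])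
  note D = short_exactD[OF ex]
  show "cochain_complex R (dual_complex R K X)" by (rule dual_cochain_complex[OF D(1) Km])
  show c: "chain_map R (dual_complex R K Y) (dual_complex R K X) (dual_map X u)"
    by (rule dual_chain_map[OF D(1,2,4)])
  show "dual_map X u j ` carrier (obj (dual_complex R K Y) j) = carrier (obj (dual_complex R K X) j)" for j
  proof (intro subset_antisym subsetI)
    fix f assume "f \<in> carrier (obj (dual_complex R K X) j)"
    then have f: "f \<in> mod_hom R (obj X (- j)) K" "f \<in> extensional (carrier (obj X (- j)))"
      by (auto simp: dual_obj Hom_simps)
    obtain g where g: "g \<in> carrier (Hom R (obj Y (- j)) K)" "\<And>x. x \<in> carrier (obj X (- j)) \<Longrightarrow> g (u (- j) x) = f x"
      using dual_extend[OF f(1)] by blast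
    have "dual_map X u j g = f"
      using f(2) g(2) by (intro Hom_eqI[of _ "obj X (- j)"]) (auto simp: dual_map_def compose_def)
    then show "f \<in> dual_map X u j ` carrier (obj (dual_complex R K Y) j)" using g(1) by (auto simp: dual_obj)
  qed (use mod_homD(1)[OF chain_mapD(1)[OF c]] in blast)
  show "dual_map X u j f = \<zero>\<^bsub>obj (dual_complex R K X) j\<^esub> \<longleftrightarrow> (\<forall>x\<in>carrier (obj X (- j)). f (u (- j) x) = \<zero>\<^bsub>K\<^esub>)" for j f
    by (auto simp: dual_map_def dual_obj Hom_simps compose_def fun_eq_iff restrict_def)
qed

end

lemma dual_single_short_exact:
  fixes R :: "('r, 'q) ring_scheme" and K :: "('r, 'k) module" and A :: "('r, 'a) module"
  assumes K: "injective_module R K" and A: "module R A"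
    and ex: "short_exact R (single c A) Y Z (single_map c g Y) v"
  shows "short_exact R (dual_complex R K Z) (dual_complex R K Y) (single (- c) (Hom R A K))
    (dual_map Y v) (single_map (- c) (\<lambda>f. compose (carrier A) f g) (single (- c) (Hom R A K)))"
    (is "short_exact R _ _ ?W _ ?w")
proof -
  note D = short_exactD[OF ex]
  have Km: "module R K" using K by (simp add: injective_module_def)
  note full = dual_short_exact_map[OF K ex]
  note DY = dual_cochain_complex[OF D(2) Km]
  have g: "g \<in> mod_hom R A (obj Y c)"
  proof -
    have "single_map c g Y c = g" by (intro ext) (simp add: single_map_def)
    then show ?thesis using chain_mapD(1)[OF D(4), of c] by (simp add: single_obj)
  qed
  have dg: "dif Y c (g x) = \<zero>\<^bsub>obj Y (c + 1)\<^esub>" if "x \<in> carrier A" for x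
    using chain_mapD(2)[OF D(4), of x c] that mod_hom_zero[OF chain_mapD(1)[OF D(4), of "c + 1"]
        cochain_complexD(1)[OF D(1)] cochain_complexD(1)[OF D(2)]]
    by (simp add: single_obj single_map_def single_dif)
  have H: "module R (Hom R A K)" by (rule Hom_module[OF A Km])
  interpret Y: module R "obj Y j" for j by (rule cochain_complexD(1)[OF D(2)])
  have W: "cochain_complex R ?W" by (rule single_cochain_complex[OF H])
  have pre: "(\<lambda>f. compose (carrier A) f g) \<in> mod_hom R (Hom R (obj Y c) K) (Hom R A K)"
    by (rule precomp_hom[OF A Y.module_axioms g])
  have w: "chain_map R (dual_complex R K Y) ?W ?w"
    unfolding chain_map_def
  proof (intro conjI allI ballI)
    fix j
    show "?w j \<in> mod_hom R (obj (dual_complex R K Y) j) (obj ?W j)"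
    proof (cases "j = - c")
      case True
      have "?w (- c) = (\<lambda>f. compose (carrier A) f g)" by (intro ext) (simp add: single_map_def)
      then show ?thesis using True pre by (simp add: dual_obj single_obj)
    next
      case False
      then have "?w j = (\<lambda>f. \<zero>\<^bsub>obj ?W j\<^esub>)" by (intro ext) (simp add: single_map_def)
      then show ?thesis
        using mod_hom_zero_map[OF cochain_complexD(1)[OF DY] cochain_complexD(1)[OF W]] by metis
    qed
    fix f assume f: "f \<in> carrier (obj (dual_complex R K Y) j)"
    show "?w (j + 1) (dif (dual_complex R K Y) j f) = dif ?W j (?w j f)"
    proof (cases "j + 1 = - c")
      case True
      then have j: "- j - 1 = c" "- j = c + 1" by auto
      have "f \<in> mod_hom R (obj Y (c + 1)) K" using f by (simp add: dual_obj Hom_simps j)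
      from mod_hom_zero[OF this Y.module_axioms Km]
      have "compose (carrier A) (compose (carrier (obj Y c)) f (dif Y c)) g x = (\<lambda>x\<in>carrier A. \<zero>\<^bsub>K\<^esub>) x" for x
        using dg mod_homD(1)[OF g] by (simp add: compose_def)
      then show ?thesis using True by (intro ext) (simp add: single_map_def single_dif dual_dif j Hom_simps)
    next
      case False
      then show ?thesis by (simp add: single_map_def single_dif)
    qed
  qed
  show ?thesis
  proof (rule dual_short_exact[OF Km ex W w])
    fix j
    show "?w j ` carrier (obj (dual_complex R K Y) j) = carrier (obj ?W j)"
    proof (cases "j = - c")
      case True
      have "dual_map (single c A) (single_map c g Y) (- c) ` carrier (Hom R (obj Y c) K) = carrier (Hom R A K)"
        using short_exactD(8)[OF full, of "- c"] by (simp add: dual_obj single_obj)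
      moreover have "dual_map (single c A) (single_map c g Y) (- c) f = compose (carrier A) f g" for f :: "_ \<Rightarrow> 'k"
        by (intro ext) (simp add: dual_map_def single_obj single_map_def compose_def)
      ultimately show ?thesis using True by (simp add: single_map_def dual_obj single_obj)
    next
      case False
      have "\<zero>\<^bsub>obj (dual_complex R K Y) j\<^esub> \<in> carrier (obj (dual_complex R K Y) j)"
        using module.carrier_is_submodule[OF cochain_complexD(1)[OF DY]] submodule_zero by blast
      then have ne: "carrier (obj (dual_complex R K Y) j) \<noteq> {}" by blast
      then show ?thesis using False by (auto simp: single_map_def single_obj)
    qed
    fix f assume f: "f \<in> carrier (obj (dual_complex R K Y) j)"
    show "?w j f = \<zero>\<^bsub>obj ?W j\<^esub> \<longleftrightarrow> (\<forall>x\<in>carrier (obj (single c A) (- j)). f (single_map c g Y (- j) x) = \<zero>\<^bsub>K\<^esub>)"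
    proof (cases "j = - c")
      case True
      then show ?thesis
        by (auto simp: single_map_def single_obj Hom_simps compose_def fun_eq_iff restrict_def)
    next
      case False
      then have "- j \<noteq> c" by auto
      moreover have "f \<in> mod_hom R (obj Y (- j)) K" using f by (simp add: dual_obj Hom_simps)
      ultimately show ?thesis
        using False mod_hom_zero[OF _ Y.module_axioms Km, of f "- j"] by (simp add: single_map_def single_obj)
    qed
  qed
qed

text \<open>A cocycle of the dual is a homomorphism that vanishes on coboundaries, hence on cocycles, so
  it factors through the next differential, and the second factor extends to the whole module by
  injectivity.\<close>

lemma dual_acyclic:
  assumes K: "injective_module R K" and Z: "cochain_complex R Z" and acyclic: "acyclic_cpx Z"
  shows "acyclic_cpx (dual_complex R K Z)"
  unfolding acyclic_cpx_def
proof (intro allI subsetI)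
  have Km: "module R K" using K by (simp add: injective_module_def)
  interpret Z: module R "obj Z j" for j by (rule cochain_complexD(1)[OF Z])
  fix j f assume f: "f \<in> cocycles (dual_complex R K Z) j"
  have fh: "f \<in> mod_hom R (obj Z (- j)) K" and fe: "f \<in> extensional (carrier (obj Z (- j)))"
    using cocyclesD(1)[OF f] by (auto simp: dual_obj Hom_simps)
  have fd: "f (dif Z (- j - 1) x) = \<zero>\<^bsub>K\<^esub>" if "x \<in> carrier (obj Z (- j - 1))" for x
    using fun_cong[OF cocyclesD(2)[OF f], of x] that by (simp add: dual_obj dual_dif Hom_simps compose_def)
  have "f x = \<zero>\<^bsub>K\<^esub>" if "x \<in> carrier (obj Z (- j))" "dif Z (- j) x = \<zero>\<^bsub>obj Z (- j + 1)\<^esub>" for x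
  proof -
    have "x \<in> cocycles Z (- j)" using that by (simp add: cocycles_def)
    then have "x \<in> coboundaries Z (- j)" using acyclic unfolding acyclic_cpx_def by blast
    then show ?thesis using fd by (auto elim: coboundariesE)
  qed
  from injective_factor[OF K Z.module_axioms Z.module_axioms cochain_complexD(2)[OF Z] fh this]
  obtain g where g: "g \<in> mod_hom R (obj Z (- j + 1)) K" "\<And>x. x \<in> carrier (obj Z (- j)) \<Longrightarrow> g (dif Z (- j) x) = f x"
    by blast
  have "restrict g (carrier (obj Z (- j + 1))) \<in> carrier (obj (dual_complex R K Z) (j - 1))"
    using mod_hom_restrict[OF Z.module_axioms g(1)] by (simp add: dual_obj)
  moreover have "dif Z (- j) x \<in> carrier (obj Z (1 - j))" if "x \<in> carrier (obj Z (- j))" for x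
    using mod_homD(1)[OF cochain_complexD(2)[OF Z] that] by simp
  then have "dif (dual_complex R K Z) (j - 1) (restrict g (carrier (obj Z (- j + 1)))) = f"
    using fe g(2)
    by (intro Hom_eqI[of _ "obj Z (- j)"]) (auto simp: dual_dif compose_def)
  ultimately show "f \<in> coboundaries (dual_complex R K Z) j" using coboundariesI by metis
qed

text \<open>Multiplication by \<open>b\<close> on the dual is precomposition with multiplication by \<open>b\<close>.\<close>

lemma dual_bij:
  fixes R :: "('r, 'q) ring_scheme" and K :: "('r, 'k) module" and G :: "('r, 'a) cpx"
  assumes G: "cochain_complex R G" and K: "module R K" and b: "b \<in> carrier R"
    and bij: "\<And>j. bij_betw (\<lambda>x. b \<odot>\<^bsub>obj G j\<^esub> x) (carrier (obj G j)) (carrier (obj G j))"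
  shows "bij_betw (\<lambda>f. b \<odot>\<^bsub>obj (dual_complex R K G) j\<^esub> f)
    (carrier (obj (dual_complex R K G) j)) (carrier (obj (dual_complex R K G) j))"
proof -
  interpret G: module R "obj G i" for i by (rule cochain_complexD(1)[OF G])
  let ?A = "obj G (- j)"
  have mul: "(\<lambda>x. b \<odot>\<^bsub>?A\<^esub> x) \<in> mod_iso R ?A ?A"
    using bij smult_hom[OF G.module_axioms b] unfolding mod_iso_def by blast
  let ?q = "inv_into (carrier ?A) (\<lambda>x. b \<odot>\<^bsub>?A\<^esub> x)"
  have q: "?q \<in> mod_hom R ?A ?A" by (rule mod_isoD(1)[OF mod_iso_inv_into[OF mul G.module_axioms]])
  have bq: "b \<odot>\<^bsub>?A\<^esub> ?q x = x" if "x \<in> carrier ?A" for x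
    using mod_isoD(3)[OF mul] that by (simp add: f_inv_into_f[of x])
  have bf: "(b \<odot>\<^bsub>Hom R ?A K\<^esub> f) x = f (b \<odot>\<^bsub>?A\<^esub> x)" if "f \<in> carrier (Hom R ?A K)" "x \<in> carrier ?A" for f x
    using that mod_homD(3)[of f R ?A K b x] b by (simp add: Hom_simps)
  interpret H: module R "Hom R ?A K" by (rule Hom_module[OF G.module_axioms K])
  have inj: "inj_on (\<lambda>f. b \<odot>\<^bsub>Hom R ?A K\<^esub> f) (carrier (Hom R ?A K))"
  proof (rule inj_onI)
    fix f g assume fg: "f \<in> carrier (Hom R ?A K)" "g \<in> carrier (Hom R ?A K)"
      and eq: "b \<odot>\<^bsub>Hom R ?A K\<^esub> f = b \<odot>\<^bsub>Hom R ?A K\<^esub> g"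
    have "f x = g x" if x: "x \<in> carrier ?A" for x
      using bf[OF fg(1) mod_homD(1)[OF q x]] bf[OF fg(2) mod_homD(1)[OF q x]] eq bq[OF x] by simp
    then show "f = g" using fg by (intro Hom_eqI[of _ ?A]) (auto simp: Hom_simps)
  qed
  have surj: "f \<in> (\<lambda>f. b \<odot>\<^bsub>Hom R ?A K\<^esub> f) ` carrier (Hom R ?A K)" if f: "f \<in> carrier (Hom R ?A K)" for f
  proof
    have fh: "f \<in> mod_hom R ?A K" using f by (simp add: Hom_simps)
    show g: "compose (carrier ?A) f ?q \<in> carrier (Hom R ?A K)" by (rule Hom_compose[OF G.module_axioms q fh])
    have "f x = (b \<odot>\<^bsub>Hom R ?A K\<^esub> compose (carrier ?A) f ?q) x" if x: "x \<in> carrier ?A" for x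
      using mod_homD(3)[OF fh b mod_homD(1)[OF q x]] bq[OF x] x by (simp add: Hom_simps compose_def)
    then show "f = b \<odot>\<^bsub>Hom R ?A K\<^esub> compose (carrier ?A) f ?q"
      using f by (intro Hom_eqI[of _ ?A]) (auto simp: Hom_simps(1,4))
  qed
  show ?thesis
    unfolding dual_obj
    by (intro bij_betw_imageI inj subset_antisym image_subsetI subsetI H.smult_closed b surj)
qed

section \<open>Torsion in complexes of injective modules\<close>

lemma ring_module_module:
  assumes "cring R"
  shows "module R (ring_module R)"
proof -
  interpret cring R by fact
  have "\<exists>y\<in>carrier R. y \<oplus>\<^bsub>R\<^esub> x = \<zero>\<^bsub>R\<^esub>" if "x \<in> carrier R" for x
    using l_neg[OF that] a_inv_closed[OF that] by (rule bexI)
  then have "abelian_group (ring_module R)"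
    by (intro abelian_groupI) (simp_all add: ring_module_def a_ac)
  then show ?thesis
    by (intro moduleI assms) (simp_all add: ring_module_def l_distr r_distr m_assoc)
qed

lemma ideal_transporter:
  assumes A: "module R A" and K: "submodule K R A" and x: "x \<in> carrier A"
  shows "ideal {r \<in> carrier R. r \<odot>\<^bsub>A\<^esub> x \<in> K} R"
proof -
  interpret module R A by fact
  note KE = submoduleE[OF K] submodule_zero[OF K]
  show ?thesis
  proof (rule idealI)
    show "ring R" by (rule cring.axioms(1)[OF is_cring])
    show "subgroup {r \<in> carrier R. r \<odot>\<^bsub>A\<^esub> x \<in> K} (add_monoid R)"
    proof (rule R.add.subgroupI)
      show "{r \<in> carrier R. r \<odot>\<^bsub>A\<^esub> x \<in> K} \<noteq> {}" using x KE(7) R.zero_closed by fastforce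
      fix r assume "r \<in> {r \<in> carrier R. r \<odot>\<^bsub>A\<^esub> x \<in> K}"
      then show "\<ominus>\<^bsub>R\<^esub> r \<in> {r \<in> carrier R. r \<odot>\<^bsub>A\<^esub> x \<in> K}" using x KE(3) by (simp add: smult_l_minus)
    qed (use x KE(5) in \<open>auto simp: smult_l_distr\<close>)
    fix r s assume r: "r \<in> {r \<in> carrier R. r \<odot>\<^bsub>A\<^esub> x \<in> K}" and s: "s \<in> carrier R"
    then show sr: "s \<otimes>\<^bsub>R\<^esub> r \<in> {r \<in> carrier R. r \<odot>\<^bsub>A\<^esub> x \<in> K}"
      using x KE(4) by (simp add: smult_assoc1)
    then show "r \<otimes>\<^bsub>R\<^esub> s \<in> {r \<in> carrier R. r \<odot>\<^bsub>A\<^esub> x \<in> K}" using R.m_comm[of r s] r s by simp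
  qed
qed

lemma zero_submodule:
  assumes "module R A"
  shows "submodule {\<zero>\<^bsub>A\<^esub>} R A"
proof -
  interpret module R A by fact
  show ?thesis by (rule submodule_criterion[OF assms]) auto
qed

text \<open>The annihilators of \<open>x\<close>, \<open>bx\<close>, \<open>b\<^sup>2x\<close>, \<dots> form an ascending chain of ideals.\<close>

lemma annihilator_stable:
  assumes N: "noetherian_ring R" and A: "module R A" and b: "b \<in> carrier R" and x: "x \<in> carrier A"
  obtains k :: nat where "\<And>r. r \<in> carrier R \<Longrightarrow> (b [^]\<^bsub>R\<^esub> Suc k) \<odot>\<^bsub>A\<^esub> (r \<odot>\<^bsub>A\<^esub> x) = \<zero>\<^bsub>A\<^esub> \<Longrightarrow>
    (b [^]\<^bsub>R\<^esub> k) \<odot>\<^bsub>A\<^esub> (r \<odot>\<^bsub>A\<^esub> x) = \<zero>\<^bsub>A\<^esub>"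
proof -
  interpret module R A by fact
  interpret noetherian_ring R by fact
  define J where "J k = {r \<in> carrier R. r \<odot>\<^bsub>A\<^esub> ((b [^]\<^bsub>R\<^esub> k) \<odot>\<^bsub>A\<^esub> x) \<in> {\<zero>\<^bsub>A\<^esub>}}" for k :: nat
  have bk: "b [^]\<^bsub>R\<^esub> k \<in> carrier R" for k :: nat using b by simp
  have J: "ideal (J k) R" for k
    unfolding J_def using x bk by (intro ideal_transporter[OF A zero_submodule[OF A]]) auto
  have swap: "r \<odot>\<^bsub>A\<^esub> ((b [^]\<^bsub>R\<^esub> k) \<odot>\<^bsub>A\<^esub> x) = (b [^]\<^bsub>R\<^esub> k) \<odot>\<^bsub>A\<^esub> (r \<odot>\<^bsub>A\<^esub> x)" if "r \<in> carrier R" for r and k :: nat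
    by (rule smult_swap[OF A that bk x])
  have step: "J k \<subseteq> J (Suc k)" for k
  proof
    fix r assume r: "r \<in> J k"
    then have rR: "r \<in> carrier R" by (simp add: J_def)
    have "(b [^]\<^bsub>R\<^esub> Suc k) \<odot>\<^bsub>A\<^esub> (r \<odot>\<^bsub>A\<^esub> x) = b \<odot>\<^bsub>A\<^esub> ((b [^]\<^bsub>R\<^esub> k) \<odot>\<^bsub>A\<^esub> (r \<odot>\<^bsub>A\<^esub> x))"
      using smult_assoc1[OF b bk smult_closed[OF rR x], of k] m_comm[OF b bk, of k] by simp
    then show "r \<in> J (Suc k)" using r swap[OF rR, of k] swap[OF rR, of "Suc k"] b
      by (simp add: J_def del: nat_pow_Suc)
  qed
  then have "mono J" by (simp add: mono_iff_le_Suc)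
  then have chain: "J k \<subseteq> J l \<or> J l \<subseteq> J k" for k l by (metis monoD linear)
  have "subset.chain {I. ideal I R} (range J)"
    unfolding subset.chain_def using J chain by auto
  then have "\<Union> (range J) \<in> range J" by (intro ideal_chain_is_trivial) auto
  then obtain k where k: "\<Union> (range J) = J k" by blast
  show thesis
  proof (rule that)
    fix r assume r: "r \<in> carrier R" "(b [^]\<^bsub>R\<^esub> Suc k) \<odot>\<^bsub>A\<^esub> (r \<odot>\<^bsub>A\<^esub> x) = \<zero>\<^bsub>A\<^esub>"
    then have "r \<in> J (Suc k)" using swap[OF r(1), of "Suc k"] by (simp add: J_def del: nat_pow_Suc)
    then have "r \<in> J k" using k by blast
    then show "(b [^]\<^bsub>R\<^esub> k) \<odot>\<^bsub>A\<^esub> (r \<odot>\<^bsub>A\<^esub> x) = \<zero>\<^bsub>A\<^esub>" using swap[OF r(1), of k] by (simp add: J_def)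
  qed
qed

text \<open>The quotient of \<open>x\<close> by \<open>b\<close> up to \<open>b\<close>-torsion is the value at \<open>x\<close> of an endomorphism: once the
  annihilators of the elements \<open>b\<^sup>k x\<close> have become stationary, the rule that sends \<open>b\<^sup>k\<^sup>+\<^sup>1 r x\<close> to
  \<open>b\<^sup>k r x\<close> is well defined, and it extends to the whole module by injectivity.  Being the value of
  an endomorphism, the quotient is killed by everything that kills \<open>x\<close>; this control over
  annihilators takes the place of the theorem of Artin and Rees.\<close>

lemma injective_divisible:
  assumes N: "noetherian_ring R" and E: "injective_module R A" and b: "b \<in> carrier R" and x: "x \<in> carrier A"
  obtains y and k :: nat where "y \<in> carrier A" "(b [^]\<^bsub>R\<^esub> Suc k) \<odot>\<^bsub>A\<^esub> y = (b [^]\<^bsub>R\<^esub> k) \<odot>\<^bsub>A\<^esub> x"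
    "\<And>r. r \<in> carrier R \<Longrightarrow> r \<odot>\<^bsub>A\<^esub> x = \<zero>\<^bsub>A\<^esub> \<Longrightarrow> r \<odot>\<^bsub>A\<^esub> y = \<zero>\<^bsub>A\<^esub>"
proof -
  have A: "module R A" using E by (simp add: injective_module_def)
  interpret module R A by (rule A)
  obtain k :: nat where k: "\<And>r. r \<in> carrier R \<Longrightarrow> (b [^]\<^bsub>R\<^esub> Suc k) \<odot>\<^bsub>A\<^esub> (r \<odot>\<^bsub>A\<^esub> x) = \<zero>\<^bsub>A\<^esub> \<Longrightarrow>
      (b [^]\<^bsub>R\<^esub> k) \<odot>\<^bsub>A\<^esub> (r \<odot>\<^bsub>A\<^esub> x) = \<zero>\<^bsub>A\<^esub>"
    using annihilator_stable[OF N A b x] by blast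
  let ?R = "ring_module R"
  have hom: "(\<lambda>r. c \<odot>\<^bsub>A\<^esub> (r \<odot>\<^bsub>A\<^esub> x)) \<in> mod_hom R ?R A" if c: "c \<in> carrier R" for c
  proof (rule mod_homI)
    fix r s assume r: "r \<in> carrier R" and s: "s \<in> carrier ?R"
    then have s: "s \<in> carrier R" by (simp add: ring_module_def)
    show "c \<odot>\<^bsub>A\<^esub> ((r \<odot>\<^bsub>?R\<^esub> s) \<odot>\<^bsub>A\<^esub> x) = r \<odot>\<^bsub>A\<^esub> (c \<odot>\<^bsub>A\<^esub> (s \<odot>\<^bsub>A\<^esub> x))"
      using smult_assoc1[OF r s x] smult_swap[OF A c r smult_closed[OF s x]] by (simp add: ring_module_def)
  qed (use c x in \<open>auto simp: ring_module_def smult_l_distr smult_r_distr\<close>)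
  have bk: "b [^]\<^bsub>R\<^esub> k \<in> carrier R" for k :: nat using b by simp
  obtain g where g: "g \<in> mod_hom R A A"
    "\<And>r. r \<in> carrier ?R \<Longrightarrow> g ((b [^]\<^bsub>R\<^esub> Suc k) \<odot>\<^bsub>A\<^esub> (r \<odot>\<^bsub>A\<^esub> x)) = (b [^]\<^bsub>R\<^esub> k) \<odot>\<^bsub>A\<^esub> (r \<odot>\<^bsub>A\<^esub> x)"
    using injective_factor[OF E ring_module_module[OF is_cring] A hom[OF bk] hom[OF bk]] k
    by (metis mk_module_simps(1) ring_module_def)
  show thesis
  proof (rule that)
    show "g x \<in> carrier A" by (rule mod_homD(1)[OF g(1) x])
    show "(b [^]\<^bsub>R\<^esub> Suc k) \<odot>\<^bsub>A\<^esub> g x = (b [^]\<^bsub>R\<^esub> k) \<odot>\<^bsub>A\<^esub> x"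
      using g(2)[of "\<one>\<^bsub>R\<^esub>"] mod_homD(3)[OF g(1) bk x, of "Suc k"] x by (simp add: ring_module_def del: nat_pow_Suc)
    show "r \<odot>\<^bsub>A\<^esub> g x = \<zero>\<^bsub>A\<^esub>" if "r \<in> carrier R" "r \<odot>\<^bsub>A\<^esub> x = \<zero>\<^bsub>A\<^esub>" for r
      using mod_homD(3)[OF g(1) that(1) x] that(2) mod_hom_zero[OF g(1) A A] by simp
  qed
qed

text \<open>The condition is imposed on the elements of \<open>S\<close> one by one, so that generators of an ideal can
  be adjoined successively.  For a finite set of generators of \<open>I\<close> it describes \<open>\<Gamma>\<^sub>I\<close>; see
  \<open>torsion_complex_eq\<close> below.\<close>

definition torsion_part :: "('r, 'q) ring_scheme \<Rightarrow> 'r set \<Rightarrow> ('r, 'a) module \<Rightarrow> 'a set" where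
  "torsion_part R S A = {x \<in> carrier A. \<forall>a\<in>S. \<exists>k::nat. (a [^]\<^bsub>R\<^esub> k) \<odot>\<^bsub>A\<^esub> x = \<zero>\<^bsub>A\<^esub>}"

lemma pow_kill_mono:
  assumes A: "module R A" and a: "a \<in> carrier R" and x: "x \<in> carrier A"
    and z: "(a [^]\<^bsub>R\<^esub> (k::nat)) \<odot>\<^bsub>A\<^esub> x = \<zero>\<^bsub>A\<^esub>"
  shows "(a [^]\<^bsub>R\<^esub> (l + k)) \<odot>\<^bsub>A\<^esub> x = \<zero>\<^bsub>A\<^esub>"
proof -
  interpret module R A by fact
  have "(a [^]\<^bsub>R\<^esub> (l + k)) \<odot>\<^bsub>A\<^esub> x = (a [^]\<^bsub>R\<^esub> l) \<odot>\<^bsub>A\<^esub> ((a [^]\<^bsub>R\<^esub> k) \<odot>\<^bsub>A\<^esub> x)"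
    using R.nat_pow_mult[OF a, of l k] smult_assoc1[of "a [^]\<^bsub>R\<^esub> l" "a [^]\<^bsub>R\<^esub> k" x] a x by simp
  then show ?thesis using z a by simp
qed

lemma torsion_part_submodule:
  assumes A: "module R A" and S: "S \<subseteq> carrier R"
  shows "submodule (torsion_part R S A) R A"
proof -
  interpret module R A by fact
  show ?thesis
  proof (rule submodule_criterion[OF A])
    show "\<zero>\<^bsub>A\<^esub> \<in> torsion_part R S A" using S by (auto simp: torsion_part_def)
    fix x assume x: "x \<in> torsion_part R S A"
    {
      fix y assume y: "y \<in> torsion_part R S A"
      have "\<exists>k::nat. (a [^]\<^bsub>R\<^esub> k) \<odot>\<^bsub>A\<^esub> (x \<oplus>\<^bsub>A\<^esub> y) = \<zero>\<^bsub>A\<^esub>" if a: "a \<in> S" for a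
      proof -
        obtain k :: nat where k: "(a [^]\<^bsub>R\<^esub> k) \<odot>\<^bsub>A\<^esub> x = \<zero>\<^bsub>A\<^esub>"
          using x a by (auto simp: torsion_part_def)
        obtain l :: nat where l: "(a [^]\<^bsub>R\<^esub> l) \<odot>\<^bsub>A\<^esub> y = \<zero>\<^bsub>A\<^esub>"
          using y a by (auto simp: torsion_part_def)
        note kl = k l
        have aR: "a \<in> carrier R" using a S by blast
        have "(a [^]\<^bsub>R\<^esub> (k + l)) \<odot>\<^bsub>A\<^esub> x = \<zero>\<^bsub>A\<^esub>" "(a [^]\<^bsub>R\<^esub> (k + l)) \<odot>\<^bsub>A\<^esub> y = \<zero>\<^bsub>A\<^esub>"
          using pow_kill_mono[OF A aR _ kl(1), of l] pow_kill_mono[OF A aR _ kl(2), of k] x y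
          by (auto simp: torsion_part_def add.commute)
        then show ?thesis using x y aR
          by (intro exI[of _ "k + l"]) (simp add: smult_r_distr torsion_part_def)
      qed
      then show "x \<oplus>\<^bsub>A\<^esub> y \<in> torsion_part R S A" using x y by (auto simp: torsion_part_def)
    }
    fix r assume r: "r \<in> carrier R"
    have "\<exists>k::nat. (a [^]\<^bsub>R\<^esub> k) \<odot>\<^bsub>A\<^esub> (r \<odot>\<^bsub>A\<^esub> x) = \<zero>\<^bsub>A\<^esub>" if a: "a \<in> S" for a
    proof -
      obtain k :: nat where k: "(a [^]\<^bsub>R\<^esub> k) \<odot>\<^bsub>A\<^esub> x = \<zero>\<^bsub>A\<^esub>"
        using x a by (auto simp: torsion_part_def)
      have aR: "a [^]\<^bsub>R\<^esub> k \<in> carrier R" using a S by auto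
      have xA: "x \<in> carrier A" using x by (simp add: torsion_part_def)
      show ?thesis using smult_swap[OF A aR r xA] k r by auto
    qed
    then show "r \<odot>\<^bsub>A\<^esub> x \<in> torsion_part R S A" using x r by (auto simp: torsion_part_def)
  qed (auto simp: torsion_part_def)
qed

lemma torsion_part_hom:
  assumes f: "f \<in> mod_hom R A B" and A: "module R A" and B: "module R B" and S: "S \<subseteq> carrier R"
    and x: "x \<in> torsion_part R S A"
  shows "f x \<in> torsion_part R S B"
proof -
  interpret module R A by fact
  have xA: "x \<in> carrier A" using x by (simp add: torsion_part_def)
  have "\<exists>k::nat. (a [^]\<^bsub>R\<^esub> k) \<odot>\<^bsub>B\<^esub> f x = \<zero>\<^bsub>B\<^esub>" if a: "a \<in> S" for a
  proof -
    obtain k :: nat where k: "(a [^]\<^bsub>R\<^esub> k) \<odot>\<^bsub>A\<^esub> x = \<zero>\<^bsub>A\<^esub>" using x a by (auto simp: torsion_part_def)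
    have "a [^]\<^bsub>R\<^esub> k \<in> carrier R" using a S by auto
    from mod_homD(3)[OF f this xA] show ?thesis using k mod_hom_zero[OF f A B] by auto
  qed
  then show ?thesis using mod_homD(1)[OF f xA] by (simp add: torsion_part_def)
qed

abbreviation torsion_sub :: "('r, 'q) ring_scheme \<Rightarrow> 'r set \<Rightarrow> ('r, 'a) cpx \<Rightarrow> ('r, 'a) cpx" where
  "torsion_sub R S X \<equiv> subcomplex X (\<lambda>j. torsion_part R S (obj X j))"

lemma torsion_sub_cochain_complex:
  assumes X: "cochain_complex R X" and S: "S \<subseteq> carrier R"
  shows "cochain_complex R (torsion_sub R S X)"
  by (intro subcomplex_cochain_complex[OF X] torsion_part_submodule cochain_complexD(1)[OF X] S
      torsion_part_hom[OF cochain_complexD(2)[OF X] cochain_complexD(1)[OF X] cochain_complexD(1)[OF X] S])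

lemma quot_smult_bij:
  assumes A: "module R A" and K: "submodule K R A" and b: "b \<in> carrier R"
    and inj: "\<And>x. x \<in> carrier A \<Longrightarrow> b \<odot>\<^bsub>A\<^esub> x \<in> K \<Longrightarrow> x \<in> K"
    and surj: "\<And>x. x \<in> carrier A \<Longrightarrow> \<exists>y\<in>carrier A. b \<odot>\<^bsub>A\<^esub> y \<ominus>\<^bsub>A\<^esub> x \<in> K"
  shows "bij_betw (\<lambda>S. b \<odot>\<^bsub>quot_module A K\<^esub> S) (carrier (quot_module A K)) (carrier (quot_module A K))"
proof -
  interpret A: module R A by fact
  interpret Q: module R "quot_module A K" by (rule quot_module_module[OF A K])
  note car = quot_module_carrier[OF A K] and sm = quot_module_smult[OF A K b]
  note hom = smult_hom[OF Q.module_axioms b]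
  have "S = \<zero>\<^bsub>quot_module A K\<^esub>" if S: "S \<in> carrier (quot_module A K)" "b \<odot>\<^bsub>quot_module A K\<^esub> S = \<zero>\<^bsub>quot_module A K\<^esub>" for S
  proof -
    obtain x where x: "x \<in> carrier A" "S = K +>\<^bsub>A\<^esub> x" using S(1) by (auto simp: car)
    then have "b \<odot>\<^bsub>A\<^esub> x \<in> K"
      using S(2) sm[OF x(1)] coset_zero_iff[OF A K, of "b \<odot>\<^bsub>A\<^esub> x"] b by (simp add: quot_module_def)
    then show ?thesis using inj[OF x(1)] coset_zero_iff[OF A K x(1)] x(2) by (simp add: quot_module_def)
  qed
  then have i: "inj_on (\<lambda>S. b \<odot>\<^bsub>quot_module A K\<^esub> S) (carrier (quot_module A K))"
    unfolding mod_hom_inj_iff[OF hom Q.module_axioms Q.module_axioms] by blast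
  have s: "S \<in> (\<lambda>S. b \<odot>\<^bsub>quot_module A K\<^esub> S) ` carrier (quot_module A K)" if S: "S \<in> carrier (quot_module A K)" for S
  proof -
    obtain x where x: "x \<in> carrier A" "S = K +>\<^bsub>A\<^esub> x" using S by (auto simp: car)
    obtain y where y: "y \<in> carrier A" "b \<odot>\<^bsub>A\<^esub> y \<ominus>\<^bsub>A\<^esub> x \<in> K" using surj[OF x(1)] by blast
    have "S = b \<odot>\<^bsub>quot_module A K\<^esub> (K +>\<^bsub>A\<^esub> y)"
      using coset_eq_iff[OF A K _ x(1), of "b \<odot>\<^bsub>A\<^esub> y"] y x b sm[OF y(1)] by simp
    then show ?thesis using y(1) unfolding car by blast
  qed
  show ?thesis
    by (intro bij_betw_imageI i subset_antisym image_subsetI subsetI s Q.smult_closed b)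
qed

text \<open>Injectivity of \<open>b = a\<^sup>s\<close> on the quotient holds because an element that becomes \<open>a\<close>-torsion
  after multiplication by a power of \<open>a\<close> is \<open>a\<close>-torsion.  For surjectivity, dividing \<open>x\<close> by \<open>b\<close> in
  the injective module leaves a \<open>b\<close>-torsion error, which is zero in the quotient, and the result is
  still killed by powers of the elements of \<open>S\<close>, as it is killed by whatever kills \<open>x\<close>.\<close>

lemma torsion_quotient_bij:
  fixes R :: "('r, 'q) ring_scheme" and E :: "('r, 'e) cpx"
  assumes N: "noetherian_ring R" and E: "cochain_complex R E" and inj: "\<And>j. injective_module R (obj E j)"
    and S: "insert a S \<subseteq> carrier R" and bij_b: "b = a [^]\<^bsub>R\<^esub> (s::nat)"
  shows "bij_betw (\<lambda>x. b \<odot>\<^bsub>obj (coker_complex (torsion_sub R (insert a S) E) (torsion_sub R S E) incl_map) i\<^esub> x)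
    (carrier (obj (coker_complex (torsion_sub R (insert a S) E) (torsion_sub R S E) incl_map) i))
    (carrier (obj (coker_complex (torsion_sub R (insert a S) E) (torsion_sub R S E) incl_map) i))"
proof -
  let ?E = "obj E i"
  have Em: "module R ?E" by (rule cochain_complexD(1)[OF E])
  interpret module R ?E by (rule Em)
  let ?A = "sub_module ?E (torsion_part R S ?E)" and ?K = "torsion_part R (insert a S) ?E"
  have sub: "submodule (torsion_part R S ?E) R ?E" "submodule ?K R ?E"
    using torsion_part_submodule[OF Em] S by auto
  have KA: "?K \<subseteq> torsion_part R S ?E" by (auto simp: torsion_part_def)
  have A: "module R ?A" and K: "submodule ?K R ?A"
    by (rule sub_module_module[OF Em sub(1)], rule submodule_sub_module[OF Em sub KA])
  have aR: "a \<in> carrier R" and SR: "S \<subseteq> carrier R" using S by auto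
  then have b: "b \<in> carrier R" by (simp add: bij_b)
  have pow: "b [^]\<^bsub>R\<^esub> (k::nat) = a [^]\<^bsub>R\<^esub> (s * k)" for k using aR by (simp add: bij_b nat_pow_pow)
  have obj: "obj (coker_complex (torsion_sub R (insert a S) E) (torsion_sub R S E) incl_map) i = quot_module ?A ?K"
    by (simp add: coker_complex_def incl_map_def)
  have minus: "x \<ominus>\<^bsub>?A\<^esub> y = x \<ominus>\<^bsub>?E\<^esub> y" if "x \<in> torsion_part R S ?E" "y \<in> torsion_part R S ?E" for x y
  proof -
    have "(\<lambda>x. x) \<in> mod_hom R ?A ?E" using submoduleE(1)[OF sub(1)] by (intro mod_homI) auto
    from mod_hom_minus(2)[OF this A Em] show ?thesis using that by simp
  qed
  show ?thesis
    unfolding obj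
  proof (rule quot_smult_bij[OF A K b])
    fix x assume x: "x \<in> carrier ?A" and bx: "b \<odot>\<^bsub>?A\<^esub> x \<in> ?K"
    have xE: "x \<in> carrier ?E" using x submoduleE(1)[OF sub(1)] by auto
    obtain k :: nat where "(a [^]\<^bsub>R\<^esub> k) \<odot>\<^bsub>?E\<^esub> (b \<odot>\<^bsub>?E\<^esub> x) = \<zero>\<^bsub>?E\<^esub>"
      using bx by (auto simp: torsion_part_def)
    then have "(a [^]\<^bsub>R\<^esub> (k + s)) \<odot>\<^bsub>?E\<^esub> x = \<zero>\<^bsub>?E\<^esub>"
      using smult_assoc1[of "a [^]\<^bsub>R\<^esub> k" b x] nat_pow_mult[OF aR, of k s] aR b xE by (simp add: bij_b)
    then show "x \<in> ?K" using x by (auto simp: torsion_part_def)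
  next
    fix x assume x: "x \<in> carrier ?A"
    then have xT: "x \<in> torsion_part R S ?E" and xE: "x \<in> carrier ?E"
      using submoduleE(1)[OF sub(1)] by auto
    obtain y and k :: nat where y: "y \<in> carrier ?E" "(b [^]\<^bsub>R\<^esub> Suc k) \<odot>\<^bsub>?E\<^esub> y = (b [^]\<^bsub>R\<^esub> k) \<odot>\<^bsub>?E\<^esub> x"
      "\<And>r. r \<in> carrier R \<Longrightarrow> r \<odot>\<^bsub>?E\<^esub> x = \<zero>\<^bsub>?E\<^esub> \<Longrightarrow> r \<odot>\<^bsub>?E\<^esub> y = \<zero>\<^bsub>?E\<^esub>"
      using injective_divisible[OF N inj b xE] by blast
    have "\<exists>k::nat. (a' [^]\<^bsub>R\<^esub> k) \<odot>\<^bsub>?E\<^esub> y = \<zero>\<^bsub>?E\<^esub>" if a': "a' \<in> S" for a'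
    proof -
      obtain k :: nat where "(a' [^]\<^bsub>R\<^esub> k) \<odot>\<^bsub>?E\<^esub> x = \<zero>\<^bsub>?E\<^esub>" using xT a' by (auto simp: torsion_part_def)
      moreover have "a' [^]\<^bsub>R\<^esub> k \<in> carrier R" using a' SR by auto
      ultimately show ?thesis using y(3) by blast
    qed
    then have yT: "y \<in> torsion_part R S ?E" using y(1) by (simp add: torsion_part_def)
    have byT: "b \<odot>\<^bsub>?E\<^esub> y \<in> torsion_part R S ?E" by (rule submoduleE(4)[OF sub(1) b yT])
    have bk: "b [^]\<^bsub>R\<^esub> k \<in> carrier R" using b by simp
    have "(b [^]\<^bsub>R\<^esub> k) \<odot>\<^bsub>?E\<^esub> (b \<odot>\<^bsub>?E\<^esub> y \<ominus>\<^bsub>?E\<^esub> x) = (b [^]\<^bsub>R\<^esub> Suc k) \<odot>\<^bsub>?E\<^esub> y \<ominus>\<^bsub>?E\<^esub> (b [^]\<^bsub>R\<^esub> k) \<odot>\<^bsub>?E\<^esub> x"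
      using bk b y(1) xE smult_assoc1[OF bk b y(1)] by (simp add: a_minus_def smult_r_distr smult_r_minus)
    also have "\<dots> = \<zero>\<^bsub>?E\<^esub>" unfolding y(2) using bk xE by (simp add: a_minus_def M.r_neg)
    finally have "\<exists>k::nat. (a [^]\<^bsub>R\<^esub> k) \<odot>\<^bsub>?E\<^esub> (b \<odot>\<^bsub>?E\<^esub> y \<ominus>\<^bsub>?E\<^esub> x) = \<zero>\<^bsub>?E\<^esub>"
      unfolding pow by blast
    moreover have "b \<odot>\<^bsub>?E\<^esub> y \<ominus>\<^bsub>?E\<^esub> x \<in> torsion_part R S ?E"
      using submoduleE(3)[OF sub(1) xT] submoduleE(5)[OF sub(1) byT] by (simp add: a_minus_def)
    ultimately have "b \<odot>\<^bsub>?E\<^esub> y \<ominus>\<^bsub>?E\<^esub> x \<in> ?K" by (simp add: torsion_part_def)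
    then show "\<exists>y\<in>carrier ?A. b \<odot>\<^bsub>?A\<^esub> y \<ominus>\<^bsub>?A\<^esub> x \<in> ?K" using yT minus[OF byT xT]
      by (intro bexI[of _ y]) simp_all
  qed
qed

text \<open>Isomorphisms along two steps of a filtration compose to one along both; as functions, the maps
  of cochains may agree on the carrier only.\<close>

lemma cohomology_map_comp_iso:
  assumes X: "cochain_complex R X" and Y: "cochain_complex R Y" and Z: "cochain_complex R Z"
    and u: "chain_map R X Y u" and v: "chain_map R Y Z v" and w: "chain_map R X Z w"
    and eq: "\<And>x. x \<in> carrier (obj X i) \<Longrightarrow> w i x = v i (u i x)"
    and iu: "cohomology_map Y i (u i) \<in> mod_iso R (cohomology X i) (cohomology Y i)"
    and iv: "cohomology_map Z i (v i) \<in> mod_iso R (cohomology Y i) (cohomology Z i)"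
  shows "cohomology_map Z i (w i) \<in> mod_iso R (cohomology X i) (cohomology Z i)"
proof -
  have "cohomology_map Z i (w i) S = (cohomology_map Z i (v i) \<circ> cohomology_map Y i (u i)) S"
    if S: "S \<in> carrier (cohomology X i)" for S
  proof -
    obtain x where x: "x \<in> cocycles X i" "S = coh_class X i x" using S by (auto simp: cohomology_carrier[OF X])
    show ?thesis
      using x eq[OF cocyclesD(1)[OF x(1)]] chain_map_cocycles[OF X Y u x(1)]
      by (simp add: cohomology_map_class[OF X Y u] cohomology_map_class[OF Y Z v] cohomology_map_class[OF X Z w])
  qed
  then have "bij_betw (cohomology_map Z i (w i)) (carrier (cohomology X i)) (carrier (cohomology Z i)) \<longleftrightarrow>
      bij_betw (cohomology_map Z i (v i) \<circ> cohomology_map Y i (u i)) (carrier (cohomology X i)) (carrier (cohomology Z i))"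
    by (rule bij_betw_cong)
  then show ?thesis
    using mod_iso_comp[OF iu iv] cohomology_map_hom[OF X Z w] by (simp add: mod_iso_def)
qed

lemma cohomology_map_id_iso:
  assumes X: "cochain_complex R X" and u: "chain_map R X X u" and eq: "\<And>x. x \<in> carrier (obj X i) \<Longrightarrow> u i x = x"
  shows "cohomology_map X i (u i) \<in> mod_iso R (cohomology X i) (cohomology X i)"
proof -
  have "cohomology_map X i (u i) S = S" if S: "S \<in> carrier (cohomology X i)" for S
  proof -
    obtain x where x: "x \<in> cocycles X i" "S = coh_class X i x" using S by (auto simp: cohomology_carrier[OF X])
    then show ?thesis using eq[OF cocyclesD(1)[OF x(1)]] by (simp add: cohomology_map_class[OF X X u])
  qed
  then have "bij_betw (cohomology_map X i (u i)) (carrier (cohomology X i)) (carrier (cohomology X i)) \<longleftrightarrow>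
      bij_betw (\<lambda>x. x) (carrier (cohomology X i)) (carrier (cohomology X i))"
    by (intro bij_betw_cong) simp
  then show ?thesis using cohomology_map_hom[OF X X u] by (simp add: mod_iso_def bij_betw_def)
qed

abbreviation ext_cpx :: "('r, 'q) ring_scheme \<Rightarrow> ('r, 't) module \<Rightarrow> ('r, 'x) cpx \<Rightarrow> _" where
  "ext_cpx R T X \<equiv> Hom_complex R (std_res R T) X"

lemma Ext_map_alt: "Ext_map R T Y u i = cohomology_map (ext_cpx R T Y) i (hom_post (std_res R T) u i)"
  by (simp add: Ext_map_def hom_map_def[abs_def] compose_def)

context
  fixes R :: "('r, 'q) ring_scheme" and E :: "('r, 'e) cpx" and T :: "('r, 't) module" and s :: nat
  assumes N: "noetherian_ring R" and E: "cochain_complex R E" and inj: "\<And>j. injective_module R (obj E j)"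
    and T: "module R T"
begin

private lemma F: "cochain_complex R (std_res R T)"
  by (rule std_res_cochain_complex[OF T])

private lemma full: "torsion_sub R {} E = E"
proof -
  have "sub_module (obj E j) (torsion_part R {} (obj E j)) = obj E j" for j
    by (simp add: sub_module_def torsion_part_def)
  then show ?thesis by (simp add: subcomplex_def)
qed

private lemma step:
  assumes "insert a S \<subseteq> carrier R"
  shows "short_exact R (torsion_sub R (insert a S) E) (torsion_sub R S E)
    (coker_complex (torsion_sub R (insert a S) E) (torsion_sub R S E) incl_map) incl_map
    (\<lambda>j y. incl_map j ` carrier (obj (torsion_sub R (insert a S) E) j) +>\<^bsub>obj (torsion_sub R S E) j\<^esub> y)"
  using assms
  by (intro coker_short_exact torsion_sub_cochain_complex[OF E] incl_chain_map incl_inj) (auto simp: torsion_part_def)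

text \<open>Adjoining the generators of the ideal one at a time, Ext out of a module that is killed by a
  power of each of them does not see the difference between \<open>E\<close> and its torsion part, nor
  between their duals.\<close>

lemma Ext_torsion_iso:
  assumes "finite S" "S \<subseteq> carrier R" and kill: "\<And>a x. a \<in> S \<Longrightarrow> x \<in> carrier T \<Longrightarrow> (a [^]\<^bsub>R\<^esub> s) \<odot>\<^bsub>T\<^esub> x = \<zero>\<^bsub>T\<^esub>"
  shows "Ext_map R T E incl_map i \<in> mod_iso R (Ext R T (torsion_sub R S E) i) (Ext R T E i)"
  using assms
proof (induction S rule: finite_induct)
  case empty
  have c: "chain_map R E E incl_map" by (auto simp: chain_map_def incl_map_def mod_hom_def)
  have "hom_post (std_res R T) incl_map i f = f" if "f \<in> carrier (obj (ext_cpx R T E) i)" for f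
    using that by (intro ext) (auto simp: hom_map_def incl_map_def Hom_complex_carrier Hom_simps extensional_def)
  then show ?case
    unfolding full Ext_map_alt Ext_def
    by (intro cohomology_map_id_iso Hom_complex_cochain_complex[OF F E] hom_post_chain_map[OF F F E E c])
next
  interpret T: module R T by (rule T)
  case (insert a S)
  let ?X = "torsion_sub R (insert a S) E" and ?Y = "torsion_sub R S E"
  have SR: "S \<subseteq> carrier R" and aR: "a \<in> carrier R" using insert.prems by auto
  have IH: "Ext_map R T E incl_map i \<in> mod_iso R (Ext R T ?Y i) (Ext R T E i)"
    using insert.IH[OF SR] insert.prems(2) by blast
  note ex = step[OF insert.prems(1)]
  note D = short_exactD[OF ex]
  let ?b = "a [^]\<^bsub>R\<^esub> s"
  have "acyclic_cpx (ext_cpx R T (coker_complex ?X ?Y incl_map))"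
  proof (rule Hom_complex_acyclic_of_bij[OF T D(3)])
    show "?b \<in> carrier R" using aR by simp
  qed (use insert.prems torsion_quotient_bij[OF N E inj insert.prems(1) refl] in auto)
  from short_exact_iso_of_acyclic(1)[OF hom_post_short_exact[OF T ex] this]
  have u: "Ext_map R T ?Y incl_map i \<in> mod_iso R (Ext R T ?X i) (Ext R T ?Y i)"
    unfolding Ext_map_alt Ext_def .
  have c: "chain_map R ?Y E incl_map" "chain_map R ?X E incl_map"
    by (intro incl_chain_map_full, simp add: torsion_part_def)+
  show ?case
    using IH u unfolding Ext_map_alt Ext_def
    by (intro cohomology_map_comp_iso[OF Hom_complex_cochain_complex[OF F D(1)] Hom_complex_cochain_complex[OF F D(2)]
        Hom_complex_cochain_complex[OF F E] hom_post_chain_map[OF F F D(1,2,4)] hom_post_chain_map[OF F F D(2) E c(1)]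
        hom_post_chain_map[OF F F D(1) E c(2)]] hom_post_comp)
      (simp_all add: incl_map_def)
qed

lemma Ext_dual_torsion_iso:
  fixes K :: "('r, 'k) module"
  assumes K: "injective_module R K"
    and "finite S" "S \<subseteq> carrier R" and kill: "\<And>a x. a \<in> S \<Longrightarrow> x \<in> carrier T \<Longrightarrow> (a [^]\<^bsub>R\<^esub> s) \<odot>\<^bsub>T\<^esub> x = \<zero>\<^bsub>T\<^esub>"
  shows "Ext_map R T (dual_complex R K (torsion_sub R S E)) (dual_map (torsion_sub R S E) incl_map) i
    \<in> mod_iso R (Ext R T (dual_complex R K E) i) (Ext R T (dual_complex R K (torsion_sub R S E)) i)"
  using assms(2-)
proof (induction S rule: finite_induct)
  have Km: "module R K" using K by (simp add: injective_module_def)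
  note DE = dual_cochain_complex[OF E Km]
  case empty
  have "chain_map R E E incl_map" by (auto simp: chain_map_def incl_map_def mod_hom_def)
  from dual_chain_map[OF E E this, of K]
  have c: "chain_map R (dual_complex R K E) (dual_complex R K E) (dual_map E incl_map)" .
  have "dual_map E incl_map j f = f" if "f \<in> carrier (obj (dual_complex R K E) j)" for j f
    using that by (intro ext) (auto simp: dual_map_def dual_obj compose_def incl_map_def Hom_simps extensional_def)
  then have "hom_post (std_res R T) (dual_map E incl_map) i f = f"
    if "f \<in> carrier (obj (ext_cpx R T (dual_complex R K E)) i)" for f
    using mod_homD(1)[OF Hom_complex_hom[OF that refl]] that
    by (intro ext) (auto simp: hom_map_def Hom_complex_carrier Hom_simps extensional_def)
  then show ?case
    unfolding full Ext_map_alt Ext_def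
    by (intro cohomology_map_id_iso Hom_complex_cochain_complex[OF F DE] hom_post_chain_map[OF F F DE DE c])
next
  interpret T: module R T by (rule T)
  have Km: "module R K" using K by (simp add: injective_module_def)
  case (insert a S)
  let ?X = "torsion_sub R (insert a S) E" and ?Y = "torsion_sub R S E"
  let ?DX = "dual_complex R K ?X" and ?DY = "dual_complex R K ?Y" and ?DE = "dual_complex R K E"
  have SR: "S \<subseteq> carrier R" and aR: "a \<in> carrier R" using insert.prems by auto
  have IH: "Ext_map R T ?DY (dual_map ?Y incl_map) i \<in> mod_iso R (Ext R T ?DE i) (Ext R T ?DY i)"
    using insert.IH[OF SR] insert.prems(2) by blast
  note ex = step[OF insert.prems(1)]
  note D = short_exactD[OF ex]
  note dex = dual_short_exact_map[OF K ex]
  note dD = short_exactD[OF dex]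
  let ?b = "a [^]\<^bsub>R\<^esub> s"
  have b: "?b \<in> carrier R" using aR by simp
  have "acyclic_cpx (ext_cpx R T (dual_complex R K (coker_complex ?X ?Y incl_map)))"
  proof (rule Hom_complex_acyclic_of_bij[OF T dD(1) b])
    show "bij_betw (\<lambda>x. ?b \<odot>\<^bsub>obj (dual_complex R K (coker_complex ?X ?Y incl_map)) j\<^esub> x)
        (carrier (obj (dual_complex R K (coker_complex ?X ?Y incl_map)) j))
        (carrier (obj (dual_complex R K (coker_complex ?X ?Y incl_map)) j))" for j
      by (rule dual_bij[OF D(3) Km b torsion_quotient_bij[OF N E inj insert.prems(1) refl]])
  qed (use insert.prems in auto)
  from short_exact_iso_of_acyclic(2)[OF hom_post_short_exact[OF T dex] this]
  have u: "Ext_map R T ?DX (dual_map ?X incl_map) i \<in> mod_iso R (Ext R T ?DY i) (Ext R T ?DX i)"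
    unfolding Ext_map_alt Ext_def .
  have c: "chain_map R ?Y E incl_map" "chain_map R ?X E incl_map"
    by (intro incl_chain_map_full, simp add: torsion_part_def)+
  note DE = dual_cochain_complex[OF E Km]
  have sub: "torsion_part R (insert a S) A \<subseteq> torsion_part R S A" for A :: "('r, 'e) module"
    by (auto simp: torsion_part_def)
  have "dual_map ?X incl_map j f = dual_map ?X incl_map j (dual_map ?Y incl_map j f)" for j and f :: "'e \<Rightarrow> 'k"
    using sub[of "obj E (- j)"] by (intro ext) (auto simp: dual_map_def compose_def incl_map_def)
  then show ?case
    using IH u unfolding Ext_map_alt Ext_def
    by (intro cohomology_map_comp_iso[OF Hom_complex_cochain_complex[OF F DE] Hom_complex_cochain_complex[OF F dD(2)]
        Hom_complex_cochain_complex[OF F dD(3)] hom_post_chain_map[OF F F DE dD(2) dual_chain_map[OF D(2) E c(1)]]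
        hom_post_chain_map[OF F F dD(2,3,5)] hom_post_chain_map[OF F F DE dD(3) dual_chain_map[OF D(1) E c(2)]]] hom_post_comp)
qed

end

section \<open>Powers of an ideal\<close>

lemma ideal_power_simps:
  "ideal_power R I 0 = carrier R"
  "ideal_power R I (Suc n) = ideal_prod R (ideal_power R I n) I"
  by (simp_all add: nat_pow_def ideals_set_def)

context
  fixes R :: "('r, 'q) ring_scheme" and I :: "'r set"
  assumes R: "cring R" and I: "ideal I R"
begin

interpretation cring R by (rule R)

lemma ideal_power_ideal: "ideal (ideal_power R I n) R"
  by (induction n) (simp_all only: ideal_power_simps oneideal ideal_prod_is_ideal I)

lemma ideal_power_subset: "ideal_power R I (Suc n) \<subseteq> ideal_power R I n"
  unfolding ideal_power_simps using ideal_prod_inter[OF ideal_power_ideal I] by blast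

lemma pow_in_ideal_power: "a \<in> I \<Longrightarrow> a [^]\<^bsub>R\<^esub> (n::nat) \<in> ideal_power R I n"
proof (induction n)
  case 0
  then show ?case unfolding ideal_power_simps by simp
next
  case (Suc n)
  then show ?case unfolding ideal_power_simps by (simp add: ideal_prod.prod)
qed

text \<open>Induction on the sum of the exponents: multiplying \<open>x\<close> by a generator lowers it by one.  The
  exponent is one more than the sum because of the ideal generated by the empty set, which kills every
  \<open>x\<close>, while its power with exponent 0 is the whole ring.\<close>

lemma kill_ideal_power:
  assumes A: "module R A" and S: "finite S" "S \<subseteq> carrier R" "I = genideal R S"
    and x: "x \<in> carrier A" and k: "\<And>a. a \<in> S \<Longrightarrow> (a [^]\<^bsub>R\<^esub> (k a :: nat)) \<odot>\<^bsub>A\<^esub> x = \<zero>\<^bsub>A\<^esub>"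
    and n: "sum k S = n" and r: "r \<in> ideal_power R I (Suc n)"
  shows "r \<odot>\<^bsub>A\<^esub> x = \<zero>\<^bsub>A\<^esub>"
proof -
  interpret A: module R A by fact
  have carr: "r \<in> carrier R" if "r \<in> ideal_power R I n" for r n
    using ideal.Icarr[OF ideal_power_ideal that] .
  have IR: "I \<subseteq> carrier R" using ideal.Icarr[OF I] by blast
  let ?kill = "\<lambda>n. {y \<in> carrier A. \<forall>r\<in>ideal_power R I n. r \<odot>\<^bsub>A\<^esub> y = \<zero>\<^bsub>A\<^esub>}"
  have kill: "submodule (?kill n) R A" for n
  proof (rule submodule_criterion[OF A])
    fix r y assume r: "r \<in> carrier R" and y: "y \<in> ?kill n"
    have "q \<odot>\<^bsub>A\<^esub> (r \<odot>\<^bsub>A\<^esub> y) = \<zero>\<^bsub>A\<^esub>" if q: "q \<in> ideal_power R I n" for q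
      using smult_swap[OF A carr[OF q] r, of y] y q r by simp
    then show "r \<odot>\<^bsub>A\<^esub> y \<in> ?kill n" using r y by simp
  qed (auto simp: carr A.smult_r_distr)
  have "x \<in> ?kill (Suc n)"
    using x k n
  proof (induction n arbitrary: x k)
    case (0 x k)
    then have "k a = 0" if "a \<in> S" for a using that S(1) by simp
    then have x0: "S \<noteq> {} \<Longrightarrow> x = \<zero>\<^bsub>A\<^esub>" using 0 by fastforce
    have "r \<odot>\<^bsub>A\<^esub> x = \<zero>\<^bsub>A\<^esub>" if "r \<in> ideal_power R I (Suc 0)" for r
    proof (cases "S = {}")
      case True
      have "I \<subseteq> {\<zero>\<^bsub>R\<^esub>}" unfolding S(3) True by (rule genideal_minimal[OF zeroideal]) simp
      moreover have "r \<in> I" using that ideal_prod_inter[OF oneideal I] unfolding ideal_power_simps by blast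
      ultimately show ?thesis using 0 by auto
    next
      case False
      then show ?thesis using x0 carr[OF that] by simp
    qed
    then show ?case using 0 by simp
  next
    case (Suc n x k)
    have "a \<odot>\<^bsub>A\<^esub> x \<in> ?kill (Suc n)" if a: "a \<in> S" for a
    proof (cases "k a")
      case 0
      then have "x = \<zero>\<^bsub>A\<^esub>" using Suc.prems(2)[OF a] Suc.prems(1) by simp
      then have "a \<odot>\<^bsub>A\<^esub> x = \<zero>\<^bsub>A\<^esub>" using a S(2) by auto
      then show ?thesis using submodule_zero[OF kill, of "Suc n"] by metis
    next
      case (Suc m)
      have aR: "a \<in> carrier R" using a S(2) by blast
      define k' where "k' = k(a := m)"
      have "sum k' S = n"
        using Suc.prems(3) Suc sum.remove[OF S(1) a, of k] sum.remove[OF S(1) a, of k'] by (simp add: k'_def)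
      moreover have "(c [^]\<^bsub>R\<^esub> k' c) \<odot>\<^bsub>A\<^esub> (a \<odot>\<^bsub>A\<^esub> x) = \<zero>\<^bsub>A\<^esub>" if c: "c \<in> S" for c
      proof -
        have cR: "c \<in> carrier R" using c S(2) by blast
        then have ck: "c [^]\<^bsub>R\<^esub> k' c \<in> carrier R" by simp
        show ?thesis
        proof (cases "c = a")
          case True
          then show ?thesis
            using Suc.prems(2)[OF a] Suc A.smult_assoc1[OF ck[unfolded True] aR Suc.prems(1)] by (simp add: k'_def)
        next
          case False
          show ?thesis
            using smult_swap[OF A ck aR Suc.prems(1)] Suc.prems(2)[OF c] False aR by (simp add: k'_def)
        qed
      qed
      ultimately show ?thesis using Suc.IH[of "a \<odot>\<^bsub>A\<^esub> x" k'] aR Suc.prems(1) by blast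
    qed
    then have "S \<subseteq> {v \<in> carrier R. v \<odot>\<^bsub>A\<^esub> x \<in> ?kill (Suc n)}" using S(2) by blast
    then have "I \<subseteq> {v \<in> carrier R. v \<odot>\<^bsub>A\<^esub> x \<in> ?kill (Suc n)}"
      unfolding S(3) by (rule genideal_minimal[OF ideal_transporter[OF A kill Suc.prems(1), unfolded S(3)]])
    then have v: "q \<odot>\<^bsub>A\<^esub> (v \<odot>\<^bsub>A\<^esub> x) = \<zero>\<^bsub>A\<^esub>" if "v \<in> I" "q \<in> ideal_power R I (Suc n)" for v q
      using that by blast
    have "r \<odot>\<^bsub>A\<^esub> x = \<zero>\<^bsub>A\<^esub>" if "r \<in> ideal_prod R (ideal_power R I (Suc n)) I" for r
      using that
    proof (induction r rule: ideal_prod.induct)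
      case (prod q v)
      then show ?case using v A.smult_assoc1[OF carr[OF prod(1)] _ Suc.prems(1), of v] IR by auto
    next
      case (sum r r')
      have "r \<in> carrier R" "r' \<in> carrier R"
        using sum.hyps(1,2) ideal_prod_in_carrier[OF ideal_power_ideal I, of "Suc n"] by blast+
      then show ?case using sum.IH Suc.prems(1) by (simp add: A.smult_l_distr)
    qed
    then show ?case using Suc.prems(1) ideal_power_simps(2)[of R I "Suc n"] by simp
  qed
  then show ?thesis using r by blast
qed

lemma torsion_complex_eq:
  assumes E: "cochain_complex R E" and S: "finite S" "S \<subseteq> carrier R" "I = genideal R S"
  shows "torsion_complex R I E = torsion_sub R S E"
proof -
  have SI: "S \<subseteq> I" unfolding S(3) by (rule genideal_self[OF S(2)])
  have "{x \<in> carrier (obj E j). \<exists>s. \<forall>a\<in>ideal_power R I s. a \<odot>\<^bsub>obj E j\<^esub> x = \<zero>\<^bsub>obj E j\<^esub>} = torsion_part R S (obj E j)" for j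
  proof (intro subset_antisym subsetI)
    fix x assume "x \<in> {x \<in> carrier (obj E j). \<exists>s. \<forall>a\<in>ideal_power R I s. a \<odot>\<^bsub>obj E j\<^esub> x = \<zero>\<^bsub>obj E j\<^esub>}"
    then show "x \<in> torsion_part R S (obj E j)"
      using pow_in_ideal_power SI by (fastforce simp: torsion_part_def)
  next
    fix x assume x: "x \<in> torsion_part R S (obj E j)"
    then have "\<forall>a\<in>S. \<exists>k::nat. (a [^]\<^bsub>R\<^esub> k) \<odot>\<^bsub>obj E j\<^esub> x = \<zero>\<^bsub>obj E j\<^esub>" by (simp add: torsion_part_def)
    then obtain k :: "'r \<Rightarrow> nat" where k: "\<And>a. a \<in> S \<Longrightarrow> (a [^]\<^bsub>R\<^esub> k a) \<odot>\<^bsub>obj E j\<^esub> x = \<zero>\<^bsub>obj E j\<^esub>" by metis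
    have xE: "x \<in> carrier (obj E j)" using x by (simp add: torsion_part_def)
    show "x \<in> {x \<in> carrier (obj E j). \<exists>s. \<forall>a\<in>ideal_power R I s. a \<odot>\<^bsub>obj E j\<^esub> x = \<zero>\<^bsub>obj E j\<^esub>}"
      using kill_ideal_power[OF cochain_complexD(1)[OF E] S xE k refl] xE by blast
  qed
  then show ?thesis by (simp add: torsion_complex_def subcomplex_def)
qed

lemma ideal_smult_submodule:
  assumes A: "module R A" and J: "J \<subseteq> carrier R"
  shows "submodule (ideal_smult R J A) R A"
    and "a \<in> J \<Longrightarrow> x \<in> carrier A \<Longrightarrow> a \<odot>\<^bsub>A\<^esub> x \<in> ideal_smult R J A"
proof -
  interpret A: module R A by fact
  let ?C = "{K. submodule K R A \<and> (\<forall>a\<in>J. \<forall>x\<in>carrier A. a \<odot>\<^bsub>A\<^esub> x \<in> K)}"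
  have top: "carrier A \<in> ?C" using A.carrier_is_submodule J by auto
  show "submodule (ideal_smult R J A) R A"
    unfolding ideal_smult_def
  proof (rule submodule_criterion[OF A])
    show "\<Inter>?C \<subseteq> carrier A" using top by blast
    show "\<zero>\<^bsub>A\<^esub> \<in> \<Inter>?C" using submodule_zero by blast
    show "x \<oplus>\<^bsub>A\<^esub> y \<in> \<Inter>?C" if "x \<in> \<Inter>?C" "y \<in> \<Inter>?C" for x y
      using that A.submoduleE(5) by blast
    show "r \<odot>\<^bsub>A\<^esub> x \<in> \<Inter>?C" if "r \<in> carrier R" "x \<in> \<Inter>?C" for r x
      using that A.submoduleE(4) by blast
  qed
  show "a \<odot>\<^bsub>A\<^esub> x \<in> ideal_smult R J A" if "a \<in> J" "x \<in> carrier A"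
    unfolding ideal_smult_def using that by blast
qed

lemma ideal_smult_mono:
  assumes "J \<subseteq> J'"
  shows "ideal_smult R J A \<subseteq> ideal_smult R J' A"
  unfolding ideal_smult_def using assms by blast

context
  fixes N :: "('r, 'n) module"
  assumes N: "module R N"
begin

interpretation N: module R N by (rule N)

private lemma power_carrier: "ideal_power R I s \<subseteq> carrier R"
  using ideal.Icarr[OF ideal_power_ideal] by blast

private lemmas sub = ideal_smult_submodule(1)[OF N power_carrier]

lemma adic_quot_module: "module R (adic_quot R I N s)"
  unfolding adic_quot_def by (rule quot_module_module[OF N sub])

lemma adic_quot_kill:
  assumes a: "a \<in> I" and x: "x \<in> carrier (adic_quot R I N s)"
  shows "(a [^]\<^bsub>R\<^esub> s) \<odot>\<^bsub>adic_quot R I N s\<^esub> x = \<zero>\<^bsub>adic_quot R I N s\<^esub>"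
proof -
  obtain y where y: "y \<in> carrier N" "x = ideal_smult R (ideal_power R I s) N +>\<^bsub>N\<^esub> y"
    using x unfolding adic_quot_def quot_module_carrier[OF N sub] by blast
  have as: "a [^]\<^bsub>R\<^esub> s \<in> ideal_power R I s" by (rule pow_in_ideal_power[OF a])
  then have aR: "a [^]\<^bsub>R\<^esub> s \<in> carrier R" using power_carrier by blast
  have "(a [^]\<^bsub>R\<^esub> s) \<odot>\<^bsub>N\<^esub> y \<in> ideal_smult R (ideal_power R I s) N"
    by (rule ideal_smult_submodule(2)[OF N power_carrier as y(1)])
  then show ?thesis
    unfolding y(2) adic_quot_def quot_module_smult[OF N sub aR y(1)] quot_module_zero[OF N sub]
    using coset_zero_iff[OF N sub] aR y(1) by simp
qed

lemma adic_proj_hom: "adic_proj R I N s \<in> mod_hom R (adic_quot R I N (Suc s)) (adic_quot R I N s)"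
proof -
  let ?K = "\<lambda>s. ideal_smult R (ideal_power R I s) N"
  have sK: "?K (Suc s) \<subseteq> ?K s" by (rule ideal_smult_mono[OF ideal_power_subset])
  have app: "adic_proj R I N s (?K (Suc s) +>\<^bsub>N\<^esub> x) = ?K s +>\<^bsub>N\<^esub> x" if x: "x \<in> carrier N" for x
    unfolding adic_proj_def
    by (rule UN_coset[OF N sub x]) (use sK x coset_eq_iff[OF N sub, of _ x s] in blast)
  show ?thesis
  proof (rule mod_homI)
    fix S assume "S \<in> carrier (adic_quot R I N (Suc s))"
    then obtain x where x: "x \<in> carrier N" "S = ?K (Suc s) +>\<^bsub>N\<^esub> x"
      unfolding adic_quot_def quot_module_carrier[OF N sub] by blast
    show "adic_proj R I N s S \<in> carrier (adic_quot R I N s)"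
      unfolding x(2) app[OF x(1)] adic_quot_def quot_module_carrier[OF N sub] using x(1) by blast
    {
      fix S' assume "S' \<in> carrier (adic_quot R I N (Suc s))"
      then obtain y where y: "y \<in> carrier N" "S' = ?K (Suc s) +>\<^bsub>N\<^esub> y"
        unfolding adic_quot_def quot_module_carrier[OF N sub] by blast
      show "adic_proj R I N s (S \<oplus>\<^bsub>adic_quot R I N (Suc s)\<^esub> S') =
          adic_proj R I N s S \<oplus>\<^bsub>adic_quot R I N s\<^esub> adic_proj R I N s S'"
        unfolding x(2) y(2) app[OF x(1)] app[OF y(1)] adic_quot_def quot_module_add[OF N sub x(1) y(1)]
        by (rule app) (use x y in simp)
    }
    fix r assume r: "r \<in> carrier R"
    show "adic_proj R I N s (r \<odot>\<^bsub>adic_quot R I N (Suc s)\<^esub> S) = r \<odot>\<^bsub>adic_quot R I N s\<^esub> adic_proj R I N s S"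
      unfolding x(2) app[OF x(1)] adic_quot_def quot_module_smult[OF N sub r x(1)]
      by (rule app) (use r x in simp)
  qed
qed

end

end

section \<open>Generalized local cohomology\<close>

context
  fixes R :: "('r, 'q) ring_scheme" and I :: "'r set" and N :: "('r, 'n) module"
  assumes R: "cring R" and I: "ideal I R" and N: "module R N"
begin

private abbreviation (input) "Q \<equiv> adic_quot R I N"
private abbreviation (input) "tr \<equiv> \<lambda>s. hom_pre (std_res R (Q (Suc s))) (\<lambda>p. std_map R (adic_proj R I N s))"

private lemmas Q = adic_quot_module[OF R I N]
private lemmas res_cpx = std_res_cochain_complex[OF Q]

private lemma ext_system:
  assumes "cochain_complex R X"
  shows "cpx_system R (\<lambda>s. ext_cpx R (Q s) X) tr"
  unfolding cpx_system_def
  by (intro conjI allI Hom_complex_cochain_complex res_cpx assms hom_pre_chain_map std_map_chain_map Q adic_proj_hom R I N)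

private lemma ext_system_map:
  assumes X: "cochain_complex R X" and Y: "cochain_complex R Y" and u: "chain_map R X Y u"
  shows "cpx_system_map R (\<lambda>s. ext_cpx R (Q s) X) tr (\<lambda>s. ext_cpx R (Q s) Y) tr
    (\<lambda>s. hom_post (std_res R (Q s)) u)"
  unfolding cpx_system_map_def
  by (intro conjI allI ballI hom_post_chain_map res_cpx X Y u
      hom_post_pre[OF std_map_chain_map[OF Q Q adic_proj_hom[OF R I N]]])

private lemma ext_alt:
  "(\<lambda>s. Ext R (Q s) X i) = coh_sys (\<lambda>s. ext_cpx R (Q s) X) i"
  "gen_lc_transition R I N X i = coh_trans (\<lambda>s. ext_cpx R (Q s) X) tr i"
  "(\<lambda>s. Ext_map R (Q s) X u i) = (\<lambda>s. cohomology_map (ext_cpx R (Q s) X) i (hom_post (std_res R (Q s)) u i))"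
  by (simp_all add: Ext_def Ext_map_alt gen_lc_transition_def[abs_def] Ext_comap_def[abs_def] hom_map_def[abs_def] compose_def)

lemma gen_lc_mod_system:
  assumes "cochain_complex R X"
  shows "mod_system R (\<lambda>s. Ext R (adic_quot R I N s) X i) (gen_lc_transition R I N X i)"
  unfolding ext_alt by (rule coh_sys[OF ext_system[OF assms]])

lemma gen_lc_system_map:
  assumes X: "cochain_complex R X" and Y: "cochain_complex R Y" and u: "chain_map R X Y u"
  shows "system_map R (\<lambda>s. Ext R (adic_quot R I N s) X i) (gen_lc_transition R I N X i)
    (\<lambda>s. Ext R (adic_quot R I N s) Y i) (gen_lc_transition R I N Y i) (\<lambda>s. Ext_map R (adic_quot R I N s) Y u i)"
  unfolding ext_alt by (rule coh_sys_map[OF ext_system[OF X] ext_system[OF Y] ext_system_map[OF X Y u]])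

text \<open>The Hom complexes out of the resolutions of \<open>N/I\<^sup>sN\<close> form systems of complexes, and the given
  sequence induces a short exact sequence at each stage \<open>s\<close>, so the limit of the long exact
  sequences applies.\<close>

lemma gen_lc_short_exact:
  assumes ex: "short_exact R X Y Z u v"
  shows "(\<forall>i. gen_lc_map R I N Y i (\<lambda>s. Ext_map R (adic_quot R I N s) Y u i)
        \<in> mod_iso R (gen_lc R I N X i) (gen_lc R I N Y i)) \<longleftrightarrow> (\<forall>i. zero_module (gen_lc R I N Z i))"
    and "(\<forall>i. gen_lc_map R I N Z i (\<lambda>s. Ext_map R (adic_quot R I N s) Z v i)
        \<in> mod_iso R (gen_lc R I N Y i) (gen_lc R I N Z i)) \<longleftrightarrow> (\<forall>i. zero_module (gen_lc R I N X i))"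
proof -
  note D = short_exactD[OF ex]
  note sys = ext_system[OF D(1)] ext_system[OF D(2)] ext_system[OF D(3)]
  note u = ext_system_map[OF D(1,2,4)] and v = ext_system_map[OF D(2,3,5)]
  note seq = sys u v hom_post_short_exact[OF Q ex]
  show "(\<forall>i. gen_lc_map R I N Y i (\<lambda>s. Ext_map R (Q s) Y u i)
      \<in> mod_iso R (gen_lc R I N X i) (gen_lc R I N Y i)) \<longleftrightarrow> (\<forall>i. zero_module (gen_lc R I N Z i))"
    unfolding gen_lc_map_def gen_lc_def ext_alt lim_iso_iff[OF sys(1,2) u] lim_acyclic_iff[OF sys(3)]
    by (rule lim_iso_iff_coker_acyclic[OF seq])
  show "(\<forall>i. gen_lc_map R I N Z i (\<lambda>s. Ext_map R (Q s) Z v i)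
      \<in> mod_iso R (gen_lc R I N Y i) (gen_lc R I N Z i)) \<longleftrightarrow> (\<forall>i. zero_module (gen_lc R I N X i))"
    unfolding gen_lc_map_def gen_lc_def ext_alt lim_iso_iff[OF sys(2,3) v] lim_acyclic_iff[OF sys(1)]
    by (rule lim_iso_iff_ker_acyclic[OF seq])
qed

lemma gen_lc_transition_single_shift:
  assumes A: "module R A"
  shows "gen_lc_transition R I N (single c A) (i + c) = gen_lc_transition R I N (single 0 A) i"
proof (rule ext)
  fix s
  let ?F = "std_res R (Q (Suc s))"
  have obj: "obj (single c A) (p + (i + c)) = obj (single 0 A) (p + i)" for p
    by (simp add: single_obj)
  have "obj (Hom_complex R ?F (single c A)) (i + c) = obj (Hom_complex R ?F (single 0 A)) i"
    by (simp add: Hom_complex_def obj)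
  moreover have "coboundaries (Hom_complex R ?F (single c A)) (i + c) = coboundaries (Hom_complex R ?F (single 0 A)) i"
    using arg_cong[OF Ext_single_shift[OF Q A, of "Suc s" c i], of zero] by (simp add: Ext_def cohomology_def quot_module_def)
  ultimately show "gen_lc_transition R I N (single c A) (i + c) s = gen_lc_transition R I N (single 0 A) i s"
    by (simp add: gen_lc_transition_def Ext_comap_def cohomology_map_def[abs_def])
qed

text \<open>The two Hom complexes differ only by the shift and by the sign of the differential, so
  cocycles and coboundaries coincide and the identifications are equalities, not just isomorphisms.\<close>

lemma gen_lc_single_shift:
  assumes A: "module R A"
  shows "gen_lc R I N (single c A) (i + c) = gen_lc R I N (single 0 A) i"
    and "gen_lc_map R I N (single c A) (i + c) \<phi> = gen_lc_map R I N (single 0 A) i \<phi>"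
  by (simp_all add: gen_lc_def gen_lc_map_def gen_lc_transition_single_shift[OF A] Ext_single_shift[OF Q A])

end

section \<open>The embedding of the first local cohomology module\<close>

context
  fixes R :: "('r, 'q) ring_scheme" and I :: "'r set" and M :: "('r, 'm) module"
    and E :: "('r, 'e) cpx" and \<epsilon> :: "'m \<Rightarrow> 'e" and c :: int
  assumes R: "cring R" and noeth: "noetherian_ring R" and M: "module R M" and I: "ideal I R"
    and res: "minimal_injective_resolution R M \<epsilon> E"
    and grade: "grade R I E = ereal (real_of_int c)"
begin

private lemma resD:
  shows "cochain_complex R E" "injective_module R (obj E j)" "j < 0 \<Longrightarrow> zero_module (obj E j)"
    and "\<epsilon> \<in> mod_hom R M (obj E 0)" "inj_on \<epsilon> (carrier M)" "cocycles E 0 = \<epsilon> ` carrier M"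
    and "j > 0 \<Longrightarrow> cocycles E j = coboundaries E j" "essential R (cocycles E j) (obj E j)"
  using res by (auto simp: minimal_injective_resolution_def injective_resolution_def)

private lemma generators: "\<exists>S. finite S \<and> S \<subseteq> carrier R \<and> I = genideal R S"
  using noetherian_ring.finetely_gen[OF noeth I] by blast

private abbreviation (input) "\<Gamma> \<equiv> torsion_complex R I E"
private abbreviation (input) "H \<equiv> local_cohomology R I E c"
private abbreviation (input) "C \<equiv> truncation_complex R I E c"

private lemma torsion_cpx: "cochain_complex R \<Gamma>"
  using generators torsion_complex_eq[OF R I resD(1)] torsion_sub_cochain_complex[OF resD(1)] by metis

private lemma torsion_simps:
  "carrier (obj \<Gamma> j) \<subseteq> carrier (obj E j)" "\<zero>\<^bsub>obj \<Gamma> j\<^esub> = \<zero>\<^bsub>obj E j\<^esub>" "dif \<Gamma> = dif E"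
  by (auto simp: torsion_complex_def)

private lemma torsion_submodule: "submodule (carrier (obj \<Gamma> j)) R (obj E j)"
proof -
  obtain S where S: "finite S" "S \<subseteq> carrier R" "I = genideal R S" using generators by blast
  show ?thesis
    unfolding torsion_complex_eq[OF R I resD(1) S]
    using torsion_part_submodule[OF cochain_complexD(1)[OF resD(1)] S(2)] by simp
qed

text \<open>Induction on the degree: once the torsion complex is zero in one degree, its cohomology in the
  next degree is the submodule of cocycles; below the grade this is zero, and by minimality it is
  essential.\<close>

lemma torsion_complex_below_grade:
  assumes "j < c"
  shows "carrier (obj \<Gamma> j) = {\<zero>\<^bsub>obj E j\<^esub>}"
proof -
  have z: "\<zero>\<^bsub>obj E j\<^esub> \<in> carrier (obj \<Gamma> j)" for j by (rule submodule_zero[OF torsion_submodule])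
  have neg: "carrier (obj \<Gamma> j) = {\<zero>\<^bsub>obj E j\<^esub>}" if "j < 0" for j
    using resD(3)[OF that] torsion_simps(1)[of j] z[of j] unfolding zero_module_def by blast
  have "int n - 1 < c \<longrightarrow> carrier (obj \<Gamma> (int n - 1)) = {\<zero>\<^bsub>obj E (int n - 1)\<^esub>}" for n
  proof (induction n)
    case 0
    then show ?case using neg by simp
  next
    case (Suc n)
    let ?j = "int n"
    show ?case
    proof
      assume "int (Suc n) - 1 < c"
      then have j: "?j < c" by simp
      have prev: "carrier (obj \<Gamma> (?j - 1)) = {\<zero>\<^bsub>obj E (?j - 1)\<^esub>}" using Suc j by simp
      have "zero_module (local_cohomology R I E ?j)"
      proof (rule ccontr)
        assume "\<not> zero_module (local_cohomology R I E ?j)"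
        then have "grade R I E \<le> ereal (real_of_int ?j)"
          unfolding grade_def by (intro Inf_lower) blast
        then show False using grade j by simp
      qed
      then have "coh_class \<Gamma> ?j x = \<zero>\<^bsub>cohomology \<Gamma> ?j\<^esub>" if "x \<in> cocycles \<Gamma> ?j" for x
        using that unfolding zero_module_def local_cohomology_def cohomology_carrier[OF torsion_cpx] by blast
      then have "cocycles \<Gamma> ?j \<subseteq> coboundaries \<Gamma> ?j"
        using coh_class_zero_iff[OF torsion_cpx] by blast
      moreover have "coboundaries \<Gamma> ?j = {\<zero>\<^bsub>obj E ?j\<^esub>}"
        using prev mod_hom_zero[OF cochain_complexD(2)[OF torsion_cpx, of "?j - 1"]
            cochain_complexD(1)[OF torsion_cpx] cochain_complexD(1)[OF torsion_cpx]]
        by (simp add: coboundaries_def torsion_simps)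
      moreover have "carrier (obj \<Gamma> ?j) \<inter> cocycles E ?j \<subseteq> cocycles \<Gamma> ?j"
        by (auto simp: cocycles_def torsion_simps)
      moreover have "\<zero>\<^bsub>obj E ?j\<^esub> \<in> cocycles E ?j"
        by (rule submodule_zero[OF cocycles_submodule[OF resD(1)]])
      ultimately have "carrier (obj \<Gamma> ?j) \<inter> cocycles E ?j = {\<zero>\<^bsub>obj E ?j\<^esub>}" using z[of ?j] by blast
      then show "carrier (obj \<Gamma> (int (Suc n) - 1)) = {\<zero>\<^bsub>obj E (int (Suc n) - 1)\<^esub>}"
        using resD(8)[of ?j] torsion_submodule[of ?j] unfolding essential_def by auto
    qed
  qed
  from this[of "nat (j + 1)"] show ?thesis
    using assms neg[of j] by (cases "j < 0") auto
qed

private lemma H_module: "module R H"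
  unfolding local_cohomology_def by (rule cohomology_module[OF torsion_cpx])

text \<open>There are no nonzero cochains of \<open>\<Gamma>\<close> in degree \<open>c - 1\<close>, hence no nonzero coboundaries in
  degree \<open>c\<close>.  So a class consists of a single cocycle, and \<open>the_elem\<close> returns it.\<close>

private lemma coh_class_singleton:
  assumes "x \<in> carrier (obj \<Gamma> c)"
  shows "coh_class \<Gamma> c x = {x}"
proof -
  interpret G: module R "obj \<Gamma> j" for j by (rule cochain_complexD(1)[OF torsion_cpx])
  have "coboundaries \<Gamma> c = {\<zero>\<^bsub>obj \<Gamma> c\<^esub>}"
    using torsion_complex_below_grade[of "c - 1"] mod_hom_zero[OF cochain_complexD(2)[OF torsion_cpx, of "c - 1"]
        G.module_axioms G.module_axioms] by (simp add: coboundaries_def torsion_simps)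
  then show ?thesis using assms by (simp add: coh_class_def a_r_coset_def')
qed

private lemma H_cases:
  assumes "h \<in> carrier H"
  obtains x where "x \<in> cocycles \<Gamma> c" "h = coh_class \<Gamma> c x" "h = {x}"
  using assms coh_class_singleton[OF cocyclesD(1)]
  unfolding local_cohomology_def cohomology_carrier[OF torsion_cpx] by blast

private lemma embedding_hom: "the_elem \<in> mod_hom R H (obj \<Gamma> c)"
proof (rule mod_homI)
  interpret G: module R "obj \<Gamma> j" for j by (rule cochain_complexD(1)[OF torsion_cpx])
  note hom = mod_homD[OF coh_class_hom[OF torsion_cpx, of c], simplified, folded local_cohomology_def]
  note sub = G.submoduleE[OF cocycles_submodule[OF torsion_cpx, of c]]
  fix h assume "h \<in> carrier H"
  then obtain x where x: "x \<in> cocycles \<Gamma> c" "h = coh_class \<Gamma> c x" "h = {x}" by (rule H_cases)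
  show "the_elem h \<in> carrier (obj \<Gamma> c)" using x(3) cocyclesD(1)[OF x(1)] by simp
  {
    fix h' assume "h' \<in> carrier H"
    then obtain y where y: "y \<in> cocycles \<Gamma> c" "h' = coh_class \<Gamma> c y" "h' = {y}" by (rule H_cases)
    have "h \<oplus>\<^bsub>H\<^esub> h' = coh_class \<Gamma> c (x \<oplus>\<^bsub>obj \<Gamma> c\<^esub> y)"
      unfolding x(2) y(2) using hom(2)[OF x(1) y(1)] by simp
    also have "\<dots> = {x \<oplus>\<^bsub>obj \<Gamma> c\<^esub> y}"
      using cocyclesD(1)[OF x(1)] cocyclesD(1)[OF y(1)] by (intro coh_class_singleton) simp
    finally show "the_elem (h \<oplus>\<^bsub>H\<^esub> h') = the_elem h \<oplus>\<^bsub>obj \<Gamma> c\<^esub> the_elem h'" by (simp add: x(3) y(3))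
  }
  fix r assume r: "r \<in> carrier R"
  have "r \<odot>\<^bsub>H\<^esub> h = coh_class \<Gamma> c (r \<odot>\<^bsub>obj \<Gamma> c\<^esub> x)"
    unfolding x(2) using hom(3)[OF r x(1)] by simp
  also have "\<dots> = {r \<odot>\<^bsub>obj \<Gamma> c\<^esub> x}"
    using cocyclesD(1)[OF x(1)] r by (intro coh_class_singleton) simp
  finally show "the_elem (r \<odot>\<^bsub>H\<^esub> h) = r \<odot>\<^bsub>obj \<Gamma> c\<^esub> the_elem h" by (simp add: x(3))
qed

private lemma truncation_exact:
  obtains v where "short_exact R (single c H) \<Gamma> C (lc_embedding R I E c) v"
proof -
  have "dif \<Gamma> c (the_elem h) = \<zero>\<^bsub>obj \<Gamma> (c + 1)\<^esub>" if "h \<in> carrier H" for h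
    using that by (rule H_cases) (metis the_elem_eq cocyclesD(2))
  then have map: "chain_map R (single c H) \<Gamma> (lc_embedding R I E c)"
    unfolding lc_embedding_def by (intro single_map_chain_map[OF H_module torsion_cpx embedding_hom])
  have "inj_on the_elem (carrier H)"
    by (rule inj_onI) (metis H_cases the_elem_eq)
  then have "inj_on (lc_embedding R I E c j) (carrier (obj (single c H) j))" for j
    unfolding lc_embedding_def by (rule single_map_inj)
  from coker_short_exact[OF single_cochain_complex[OF H_module] torsion_cpx map this]
  show thesis unfolding truncation_complex_def[symmetric] by (rule that)
qed

text \<open>The cokernel of \<open>M[0] \<rightarrow> E\<close> is zero in negative degrees, is \<open>E\<^sup>0/M\<close> in degree 0, where \<open>M\<close> is
  the module of cocycles, and agrees with \<open>E\<close> in positive degrees, where \<open>E\<close> is exact.\<close>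

private lemma resolution_exact:
  obtains v where
    "short_exact R (single 0 M) E (coker_complex (single 0 M) E (res_map \<epsilon> E)) (res_map \<epsilon> E) v"
    "acyclic_cpx (coker_complex (single 0 M) E (res_map \<epsilon> E))"
proof -
  interpret E: module R "obj E j" for j by (rule cochain_complexD(1)[OF resD(1)])
  have "dif E 0 (\<epsilon> x) = \<zero>\<^bsub>obj E (0 + 1)\<^esub>" if "x \<in> carrier M" for x
    using resD(6) that by (auto simp: cocycles_def)
  then have map: "chain_map R (single 0 M) E (res_map \<epsilon> E)"
    unfolding res_map_def by (intro single_map_chain_map[OF M resD(1,4)])
  have inj: "inj_on (res_map \<epsilon> E j) (carrier (obj (single 0 M) j))" for j
    unfolding res_map_def by (rule single_map_inj[OF resD(5)])
  let ?Z = "coker_complex (single 0 M) E (res_map \<epsilon> E)"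
  obtain v where ex: "short_exact R (single 0 M) E ?Z (res_map \<epsilon> E) v"
    using coker_short_exact[OF single_cochain_complex[OF M] resD(1) map inj] by blast
  note D = short_exactD[OF ex]
  have im0: "res_map \<epsilon> E 0 ` carrier (obj (single 0 M) 0) = cocycles E 0"
    by (simp add: res_map_def single_map_def single_obj resD(6))
  have im: "res_map \<epsilon> E j ` carrier (obj (single 0 M) j) = {\<zero>\<^bsub>obj E j\<^esub>}" if "j \<noteq> 0" for j
    using that by (simp add: res_map_def single_map_def single_obj)
  have "acyclic_cpx ?Z"
    unfolding acyclic_cpx_def
  proof (intro allI subsetI)
    fix j z assume z: "z \<in> cocycles ?Z j"
    obtain y where y: "y \<in> carrier (obj E j)" "v j y = z"
      using D(8)[of j] cocyclesD(1)[OF z] by (metis imageE)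
    have zero: "\<zero>\<^bsub>obj ?Z j\<^esub> \<in> coboundaries ?Z j"
      by (rule submodule_zero[OF coboundaries_submodule[OF D(3)]])
    have dy: "dif E j y \<in> res_map \<epsilon> E (j + 1) ` carrier (obj (single 0 M) (j + 1))"
      using D(7)[of "j + 1"] chain_mapD(2)[OF D(5) y(1)] y(2) cocyclesD(2)[OF z]
        mod_homD(1)[OF cochain_complexD(2)[OF resD(1)] y(1)] by simp
    consider "j < 0" | "j = 0" | "j > 0" by linarith
    then show "z \<in> coboundaries ?Z j"
    proof cases
      case 1
      then have "y = \<zero>\<^bsub>obj E j\<^esub>" using resD(3)[of j] y(1) by (simp add: zero_module_def)
      then show ?thesis
        using mod_hom_zero[OF chain_mapD(1)[OF D(5)] E.module_axioms cochain_complexD(1)[OF D(3)], of j] zero y(2) by simp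
    next
      case 2
      then have "dif E 0 y = \<zero>\<^bsub>obj E (0 + 1)\<^esub>" using dy im[of 1] by simp
      then have "y \<in> cocycles E 0" using y(1) 2 by (simp add: cocycles_def)
      then have "v j y = \<zero>\<^bsub>obj ?Z j\<^esub>" using D(7)[of 0] im0 2 by blast
      then show ?thesis using zero y(2) by simp
    next
      case 3
      then have "y \<in> cocycles E j" using dy im[of "j + 1"] y(1) by (simp add: cocycles_def)
      then have "y \<in> coboundaries E j" using resD(7)[OF 3] by simp
      then show ?thesis using chain_map_coboundaries[OF resD(1) D(3,5)] y(2) by blast
    qed
  qed
  then show thesis using that ex by blast
qed

private lemma dual_incl_map_alt: "dual_incl_map R I E = (dual_map \<Gamma> incl_map :: int \<Rightarrow> ('e \<Rightarrow> 'k) \<Rightarrow> _)"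
  by (intro ext) (simp add: dual_incl_map_def dual_map_def compose_def incl_map_def)

section \<open>The comparison isomorphisms\<close>

context
  fixes N :: "('r, 'n) module"
  assumes N: "module R N"
begin

private abbreviation (input) "T \<equiv> adic_quot R I N"
private lemmas T = adic_quot_module[OF R I N]

lemma Ext_resolution_iso:
  "Ext_map R (T s) E (res_map \<epsilon> E) i \<in> mod_iso R (Ext R (T s) (single 0 M) i) (Ext R (T s) E i)"
proof -
  obtain v where ex: "short_exact R (single 0 M) E (coker_complex (single 0 M) E (res_map \<epsilon> E)) (res_map \<epsilon> E) v"
    and ac: "acyclic_cpx (coker_complex (single 0 M) E (res_map \<epsilon> E))"
    by (rule resolution_exact)
  show ?thesis
    unfolding Ext_map_alt Ext_def
    by (rule short_exact_iso_of_acyclic(1)[OF hom_post_short_exact[OF T ex]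
          Hom_complex_acyclic[OF T short_exactD(3)[OF ex] ac]])
qed

lemma Ext_inclusion_iso:
  "Ext_map R (T s) E incl_map i \<in> mod_iso R (Ext R (T s) \<Gamma> i) (Ext R (T s) E i)"
proof -
  obtain S where S: "finite S" "S \<subseteq> carrier R" "I = genideal R S" using generators by blast
  have "S \<subseteq> I" unfolding S(3) using ring.genideal_self[OF cring.axioms(1)[OF R] S(2)] .
  then show ?thesis
    unfolding torsion_complex_eq[OF R I resD(1) S]
    using adic_quot_kill[OF R I N] by (intro Ext_torsion_iso[OF noeth resD(1,2) T S(1,2), where s = s]) blast
qed

context
  fixes K :: "('r, 'k) module"
  assumes K: "injective_module R K"
begin

private abbreviation (input) "D \<equiv> dual_complex R K"

lemma Ext_dual_resolution_iso:
  "Ext_map R (T s) (single 0 (Hom R M K)) (dual_res_map R K M \<epsilon>) i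
    \<in> mod_iso R (Ext R (T s) (D E) i) (Ext R (T s) (single 0 (Hom R M K)) i)"
proof -
  obtain v where ex: "short_exact R (single 0 M) E (coker_complex (single 0 M) E (res_map \<epsilon> E)) (res_map \<epsilon> E) v"
    and ac: "acyclic_cpx (coker_complex (single 0 M) E (res_map \<epsilon> E))"
    by (rule resolution_exact)
  have dex: "short_exact R (D (coker_complex (single 0 M) E (res_map \<epsilon> E))) (D E) (single 0 (Hom R M K))
      (dual_map E v) (dual_res_map R K M \<epsilon>)"
    using dual_single_short_exact[OF K M ex[unfolded res_map_def], folded res_map_def] by (simp add: dual_res_map_def)
  show ?thesis
    unfolding Ext_map_alt Ext_def
    by (rule short_exact_iso_of_acyclic(2)[OF hom_post_short_exact[OF T dex]
          Hom_complex_acyclic[OF T short_exactD(1)[OF dex] dual_acyclic[OF K short_exactD(3)[OF ex] ac]]])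
qed

lemma Ext_dual_inclusion_iso:
  "Ext_map R (T s) (D \<Gamma>) (dual_incl_map R I E) i \<in> mod_iso R (Ext R (T s) (D E) i) (Ext R (T s) (D \<Gamma>) i)"
proof -
  obtain S where S: "finite S" "S \<subseteq> carrier R" "I = genideal R S" using generators by blast
  have "S \<subseteq> I" unfolding S(3) using ring.genideal_self[OF cring.axioms(1)[OF R] S(2)] .
  then show ?thesis
    unfolding dual_incl_map_alt torsion_complex_eq[OF R I resD(1) S]
    using adic_quot_kill[OF R I N] by (intro Ext_dual_torsion_iso[OF noeth resD(1,2) T K S(1,2), where s = s]) blast
qed

end

section \<open>The natural homomorphisms\<close>

private lemma incl_chain: "chain_map R \<Gamma> E incl_map"
proof -
  obtain S where S: "finite S" "S \<subseteq> carrier R" "I = genideal R S" using generators by blast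
  show ?thesis
    unfolding torsion_complex_eq[OF R I resD(1) S] by (rule incl_chain_map_full) (simp add: torsion_part_def)
qed

text \<open>At each stage \<open>s\<close> the natural map is that of the embedding \<open>H[-c] \<rightarrow> \<Gamma>\<close> followed by the
  comparison isomorphisms.  The latter form an isomorphism of systems, so only the embedding
  matters, and for it the cokernel decides.\<close>

lemma nat_map_properties:
  "nat_map R I M \<epsilon> E c N i \<in> mod_hom R (gen_lc R I N (single 0 H) i) (gen_lc R I N (single 0 M) (i + c))"
  "(\<forall>i. nat_map R I M \<epsilon> E c N i \<in> mod_iso R (gen_lc R I N (single 0 H) i) (gen_lc R I N (single 0 M) (i + c))) \<longleftrightarrow>
    (\<forall>i. zero_module (gen_lc R I N C i))"
proof -
  obtain v where ex: "short_exact R (single c H) \<Gamma> C (lc_embedding R I E c) v" by (rule truncation_exact)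
  obtain v' where rx: "short_exact R (single 0 M) E (coker_complex (single 0 M) E (res_map \<epsilon> E)) (res_map \<epsilon> E) v'"
    by (rule resolution_exact)
  note D = short_exactD[OF ex] and rD = short_exactD[OF rx]
  note sys = gen_lc_mod_system[OF R I N]
  define \<phi> where "\<phi> i s = Ext_map R (T s) \<Gamma> (lc_embedding R I E c) i" for i s
  define \<psi> where "\<psi> i s = inv_into (carrier (Ext R (T s) (single 0 M) i)) (Ext_map R (T s) E (res_map \<epsilon> E) i) \<circ>
    Ext_map R (T s) E incl_map i" for i s
  have \<phi>: "system_map R (\<lambda>s. Ext R (T s) (single c H) i) (gen_lc_transition R I N (single c H) i)
      (\<lambda>s. Ext R (T s) \<Gamma> i) (gen_lc_transition R I N \<Gamma> i) (\<phi> i)" for i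
    unfolding \<phi>_def by (rule gen_lc_system_map[OF R I N D(1,2,4)])
  have inv: "system_map R (\<lambda>s. Ext R (T s) E i) (gen_lc_transition R I N E i)
      (\<lambda>s. Ext R (T s) (single 0 M) i) (gen_lc_transition R I N (single 0 M) i)
      (\<lambda>s. inv_into (carrier (Ext R (T s) (single 0 M) i)) (Ext_map R (T s) E (res_map \<epsilon> E) i))" for i
    by (rule system_map_inv[OF sys[OF rD(1)] gen_lc_system_map[OF R I N rD(1,2,4)] Ext_resolution_iso])
  have \<psi>: "system_map R (\<lambda>s. Ext R (T s) \<Gamma> i) (gen_lc_transition R I N \<Gamma> i)
      (\<lambda>s. Ext R (T s) (single 0 M) i) (gen_lc_transition R I N (single 0 M) i) (\<psi> i)" for i
    unfolding \<psi>_def by (rule system_map_comp[OF gen_lc_system_map[OF R I N D(2) rD(2) incl_chain] inv])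
  have iso: "\<psi> i s \<in> mod_iso R (Ext R (T s) \<Gamma> i) (Ext R (T s) (single 0 M) i)" for i s
    unfolding \<psi>_def
    by (rule mod_iso_comp[OF Ext_inclusion_iso mod_iso_inv_into[OF Ext_resolution_iso mod_systemD(1)[OF sys[OF rD(1)]]]])
  have nat: "nat_map R I M \<epsilon> E c N i = gen_lc_map R I N (single 0 M) (i + c) (\<lambda>s. \<psi> (i + c) s \<circ> \<phi> (i + c) s)" for i
    by (simp add: nat_map_def nat_level_def \<psi>_def \<phi>_def)
  note shift = gen_lc_single_shift(1)[OF R I N H_module, of c, symmetric]
  show "nat_map R I M \<epsilon> E c N i \<in> mod_hom R (gen_lc R I N (single 0 H) i) (gen_lc R I N (single 0 M) (i + c))"
    unfolding nat shift unfolding gen_lc_map_def gen_lc_def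
    by (rule dirlim_map_hom[OF sys[OF D(1)] sys[OF rD(1)] system_map_comp[OF \<phi> \<psi>]])
  have "nat_map R I M \<epsilon> E c N i \<in> mod_iso R (gen_lc R I N (single 0 H) i) (gen_lc R I N (single 0 M) (i + c)) \<longleftrightarrow>
      gen_lc_map R I N \<Gamma> (i + c) (\<phi> (i + c)) \<in> mod_iso R (gen_lc R I N (single c H) (i + c)) (gen_lc R I N \<Gamma> (i + c))" for i
    unfolding nat shift unfolding gen_lc_map_def gen_lc_def
    by (rule dirlim_map_comp_iso_left_iff[OF sys[OF D(1)] sys[OF D(2)] sys[OF rD(1)] \<phi> \<psi> iso])
  then have "(\<forall>i. nat_map R I M \<epsilon> E c N i \<in> mod_iso R (gen_lc R I N (single 0 H) i) (gen_lc R I N (single 0 M) (i + c))) \<longleftrightarrow>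
      (\<forall>i. gen_lc_map R I N \<Gamma> i (\<phi> i) \<in> mod_iso R (gen_lc R I N (single c H) i) (gen_lc R I N \<Gamma> i))"
    by (metis diff_add_cancel)
  also have "\<dots> \<longleftrightarrow> (\<forall>i. zero_module (gen_lc R I N C i))"
    using gen_lc_short_exact(1)[OF R I N ex] by (simp add: \<phi>_def[abs_def])
  finally show "(\<forall>i. nat_map R I M \<epsilon> E c N i \<in> mod_iso R (gen_lc R I N (single 0 H) i) (gen_lc R I N (single 0 M) (i + c))) \<longleftrightarrow>
    (\<forall>i. zero_module (gen_lc R I N C i))" .
qed

text \<open>Here the comparison isomorphisms come first, and the dual of the embedding is a surjection, with
  kernel \<open>D(C)\<close>.\<close>

lemma dual_nat_map_properties:
  fixes K :: "('r, 'k) module"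
  assumes K: "injective_module R K"
  shows "dual_nat_map R I K M \<epsilon> E c N i
      \<in> mod_hom R (gen_lc R I N (single 0 (Hom R M K)) i) (gen_lc R I N (single 0 (Hom R H K)) (i + c))"
    and "(\<forall>i. dual_nat_map R I K M \<epsilon> E c N i
      \<in> mod_iso R (gen_lc R I N (single 0 (Hom R M K)) i) (gen_lc R I N (single 0 (Hom R H K)) (i + c))) \<longleftrightarrow>
    (\<forall>i. zero_module (gen_lc R I N (dual_complex R K C) i))"
proof -
  have Km: "module R K" using K by (simp add: injective_module_def)
  let ?D = "dual_complex R K" and ?DM = "single 0 (Hom R M K)" and ?DH = "single (- c) (Hom R H K)"
  obtain v where ex: "short_exact R (single c H) \<Gamma> C (lc_embedding R I E c) v" by (rule truncation_exact)
  have "lc_embedding R I E c c = the_elem" by (intro ext) (simp add: lc_embedding_def single_map_def)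
  then have dex: "short_exact R (?D C) (?D \<Gamma>) ?DH (dual_map \<Gamma> v) (dual_lc_embedding R I K E c)"
    using dual_single_short_exact[OF K H_module ex[unfolded lc_embedding_def]]
    by (simp add: dual_lc_embedding_def Let_def)
  note D = short_exactD[OF dex]
  note sys = gen_lc_mod_system[OF R I N]
  note DE = dual_cochain_complex[OF resD(1) Km]
  have HM: "module R (Hom R M K)" and HH: "module R (Hom R H K)"
    by (rule Hom_module[OF M Km], rule Hom_module[OF H_module Km])
  note DM = single_cochain_complex[OF HM, of 0]
  have resc: "chain_map R (?D E) ?DM (dual_res_map R K M \<epsilon>)"
  proof -
    obtain w where rx: "short_exact R (single 0 M) E (coker_complex (single 0 M) E (res_map \<epsilon> E)) (res_map \<epsilon> E) w"
      by (rule resolution_exact)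
    show ?thesis
      using short_exactD(5)[OF dual_single_short_exact[OF K M rx[unfolded res_map_def]]] by (simp add: dual_res_map_def)
  qed
  have incc: "chain_map R (?D E) (?D \<Gamma>) (dual_incl_map R I E)"
    unfolding dual_incl_map_alt by (rule dual_chain_map[OF torsion_cpx resD(1) incl_chain])
  define \<phi> where "\<phi> i s = Ext_map R (T s) (?D \<Gamma>) (dual_incl_map R I E) i \<circ>
    inv_into (carrier (Ext R (T s) (?D E) i)) (Ext_map R (T s) ?DM (dual_res_map R K M \<epsilon>) i)" for i s
  define \<psi> where "\<psi> i s = Ext_map R (T s) ?DH (dual_lc_embedding R I K E c) i" for i s
  have inv: "system_map R (\<lambda>s. Ext R (T s) ?DM i) (gen_lc_transition R I N ?DM i)
      (\<lambda>s. Ext R (T s) (?D E) i) (gen_lc_transition R I N (?D E) i)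
      (\<lambda>s. inv_into (carrier (Ext R (T s) (?D E) i)) (Ext_map R (T s) ?DM (dual_res_map R K M \<epsilon>) i))" for i
    by (rule system_map_inv[OF sys[OF DE] gen_lc_system_map[OF R I N DE DM resc] Ext_dual_resolution_iso[OF K]])
  have \<phi>: "system_map R (\<lambda>s. Ext R (T s) ?DM i) (gen_lc_transition R I N ?DM i)
      (\<lambda>s. Ext R (T s) (?D \<Gamma>) i) (gen_lc_transition R I N (?D \<Gamma>) i) (\<phi> i)" for i
    unfolding \<phi>_def by (rule system_map_comp[OF inv gen_lc_system_map[OF R I N DE D(2) incc]])
  have \<psi>: "system_map R (\<lambda>s. Ext R (T s) (?D \<Gamma>) i) (gen_lc_transition R I N (?D \<Gamma>) i)
      (\<lambda>s. Ext R (T s) ?DH i) (gen_lc_transition R I N ?DH i) (\<psi> i)" for i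
    unfolding \<psi>_def by (rule gen_lc_system_map[OF R I N D(2,3,5)])
  have iso: "\<phi> i s \<in> mod_iso R (Ext R (T s) ?DM i) (Ext R (T s) (?D \<Gamma>) i)" for i s
    unfolding \<phi>_def
    by (rule mod_iso_comp[OF mod_iso_inv_into[OF Ext_dual_resolution_iso[OF K] mod_systemD(1)[OF sys[OF DE]]]
          Ext_dual_inclusion_iso[OF K]])
  have shift: "gen_lc R I N (single 0 (Hom R H K)) (i + c) = gen_lc R I N ?DH i" for i
    using gen_lc_single_shift(1)[OF R I N HH, of "- c" "i + c"] by simp
  have nat: "dual_nat_map R I K M \<epsilon> E c N i = gen_lc_map R I N ?DH i (\<lambda>s. \<psi> i s \<circ> \<phi> i s)" for i
    by (simp add: dual_nat_map_def dual_nat_level_def \<psi>_def \<phi>_def comp_assoc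
        gen_lc_single_shift(2)[OF R I N HH, of "- c" "i + c", simplified])
  show "dual_nat_map R I K M \<epsilon> E c N i \<in> mod_hom R (gen_lc R I N ?DM i) (gen_lc R I N (single 0 (Hom R H K)) (i + c))"
    unfolding nat shift unfolding gen_lc_map_def gen_lc_def
    by (rule dirlim_map_hom[OF sys[OF DM] sys[OF D(3)] system_map_comp[OF \<phi> \<psi>]])
  have "dual_nat_map R I K M \<epsilon> E c N i \<in> mod_iso R (gen_lc R I N ?DM i) (gen_lc R I N (single 0 (Hom R H K)) (i + c)) \<longleftrightarrow>
      gen_lc_map R I N ?DH i (\<psi> i) \<in> mod_iso R (gen_lc R I N (?D \<Gamma>) i) (gen_lc R I N ?DH i)" for i
    unfolding nat shift unfolding gen_lc_map_def gen_lc_def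
    by (rule dirlim_map_comp_iso_right_iff[OF sys[OF DM] sys[OF D(2)] sys[OF D(3)] \<phi> \<psi> iso])
  then show "(\<forall>i. dual_nat_map R I K M \<epsilon> E c N i \<in> mod_iso R (gen_lc R I N ?DM i) (gen_lc R I N (single 0 (Hom R H K)) (i + c))) \<longleftrightarrow>
    (\<forall>i. zero_module (gen_lc R I N (?D C) i))"
    using gen_lc_short_exact(2)[OF R I N dex] by (simp add: \<psi>_def[abs_def])
qed

end

end

theorem theorem2p9:
  fixes R :: "('r, 'q) ring_scheme" and I :: "'r set"
    and M :: "('r, 'm) module" and N :: "('r, 'n) module"
    and E :: "('r, 'e) cpx" and \<epsilon> :: "'m \<Rightarrow> 'e" and c :: int
  assumes "cring R" and "noetherian_ring R"
    and "module R M" and "ideal I R" and "ideal_smult R I M \<noteq> carrier M"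
    and "minimal_injective_resolution R M \<epsilon> E"
    and "grade R I E = ereal (real_of_int c)"
    and "module R N"
  shows
    "((\<forall>i s. let T = adic_quot R I N s in
          Ext_map R T E (res_map \<epsilon> E) i \<in> mod_iso R (Ext R T (single 0 M) i) (Ext R T E i) \<and>
          Ext_map R T E incl_map i
            \<in> mod_iso R (Ext R T (torsion_complex R I E) i) (Ext R T E i)) \<and>
      (\<forall>i. nat_map R I M \<epsilon> E c N i
        \<in> mod_hom R (gen_lc R I N (single 0 (local_cohomology R I E c)) i)
            (gen_lc R I N (single 0 M) (i + c))) \<and>
      ((\<forall>i. nat_map R I M \<epsilon> E c N i
          \<in> mod_iso R (gen_lc R I N (single 0 (local_cohomology R I E c)) i)
              (gen_lc R I N (single 0 M) (i + c))) \<longleftrightarrow>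
       (\<forall>i. zero_module (gen_lc R I N (truncation_complex R I E c) i))))
   \<and>
     (\<forall>(K :: ('r, 'k) module) \<iota>.
      local_ring R \<and> injective_hull R (residue_field R) \<iota> K \<longrightarrow>
      (\<forall>i s. let T = adic_quot R I N s in
          Ext_map R T (single 0 (Hom R M K)) (dual_res_map R K M \<epsilon>) i
            \<in> mod_iso R (Ext R T (dual_complex R K E) i) (Ext R T (single 0 (Hom R M K)) i) \<and>
          Ext_map R T (dual_complex R K (torsion_complex R I E)) (dual_incl_map R I E) i
            \<in> mod_iso R (Ext R T (dual_complex R K E) i)
                (Ext R T (dual_complex R K (torsion_complex R I E)) i)) \<and>
      (\<forall>i. dual_nat_map R I K M \<epsilon> E c N i
        \<in> mod_hom R (gen_lc R I N (single 0 (Hom R M K)) i)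
            (gen_lc R I N (single 0 (Hom R (local_cohomology R I E c) K)) (i + c))) \<and>
      ((\<forall>i. dual_nat_map R I K M \<epsilon> E c N i
          \<in> mod_iso R (gen_lc R I N (single 0 (Hom R M K)) i)
              (gen_lc R I N (single 0 (Hom R (local_cohomology R I E c) K)) (i + c))) \<longleftrightarrow>
       (\<forall>i. zero_module (gen_lc R I N (dual_complex R K (truncation_complex R I E c)) i))))"
proof -
  note hyps = assms(1,2,3,4,6,7,8)
  show ?thesis
    by (auto simp: Let_def injective_hull_def Ext_resolution_iso[OF hyps] Ext_inclusion_iso[OF hyps]
        nat_map_properties[OF hyps] Ext_dual_resolution_iso[OF hyps] Ext_dual_inclusion_iso[OF hyps]
        dual_nat_map_properties[OF hyps])
qed

end
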